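(* (Type Preservation for projection and extraction.) Let $\Sigma$ be a session environment, $\Psi$ a hypersequent, $P,Q$ terms and $\tilde x$ a vector of endpoints. (1) If $P\stackrel{\tilde x}{\longrightarrow}_{\mathsf{extr}}Q$ and $\Sigma\Vdash P::\Psi$ is derivable, then $\Sigma\Vdash Q::\Psi$ is derivable. (2) If $Q\stackrel{\tilde x}{\longrightarrow}_{\mathsf{proj}}P$ and $\Sigma\Vdash Q::\Psi$ is derivable, then $\Sigma\Vdash P::\Psi$ is derivable.
   Context: **Notation.** $\tilde x$ or $(x_i)_i$ denotes a finite vector of endpoints (names); the same notation is used for families of other objects; $\tilde P=(P_i)_i$ as a term means $P_1\mid\dots\mid P_n$. $\mathrm{fv}$ = free endpoints, $\mathrm{vars}$ = endpoints occurring. $Q'$ denotes $Q$ with every free endpoint $u$ renamed to a fresh $u'$. **Local types** $A ::= A\otimes B\mid A\wp B\mid A\oplus B\mid A\& B\mid {!}A\mid {?}A\mid \mathbf 1\mid\bot\mid 0\mid\top\mid X\mid X^\bot$ ($\wp$ is "par"). The dual $A^\bot$ recursively exchanges $\otimes/\wp$, $\oplus/\&$, $!/?$, $\mathbf 1/\bot$, $0/\top$, $X/X^\bot$. **Global types** $G ::= \tilde x\to y(G);H\mid x\to\tilde y.\mathsf{case}(G,H)\mid {!}x\to\tilde y(G)\mid \tilde x\to y\mid x\to\tilde y.\mathsf{case}()\mid x^A\to y$. **Coherence** $G\vDash\Gamma$ ($\Gamma$ a set of typings $x:A$), least relation with: - $G\vDash (x_i:A_i)_i,y:C$ and $H\vDash\Gamma,(x_i:B_i)_i,y:D$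 imply $\tilde x\to y(G);H\vDash \Gamma,(x_i:A_i\otimes B_i)_i,y:C\wp D$; - $\tilde x\to y\vDash (x_i:\mathbf 1)_i,y:\bot$; - $G_1\vDash\Gamma,x:A,(y_i:C_i)_i$ and $G_2\vDash\Gamma,x:B,(y_i:D_i)_i$ imply $x\to\tilde y.\mathsf{case}(G_1,G_2)\vDash\Gamma,x:A\oplus B,(y_i:C_i\& D_i)_i$; - $G\vDash x:A,(y_i:B_i)_i$ implies ${!}x\to\tilde y(G)\vDash x:{?}A,(y_i:{!}B_i)_i$; - $x\to\tilde y.\mathsf{case}()\vDash\Gamma,x:0,(y_i:\top)_i$; - $x^A\to y\vDash x:A,y:A^\bot$ if $A=X$ or $A=X^\bot$. **Terms.** Action fragment: link $x^A\to y$; parallel $P\mid Q$; restriction $(\nu\tilde x:G)P$; send $\overline x(x');(P\mid Q)$; receive $y(y');P$; $\mathsf{close}[x]$; $\mathsf{wait}[y];P$; $x.\mathsf{inl};P$; $x.\mathsf{inr};P$; general selection $x.(\mathsf{inl}:P,\mathsf{inr}:Q)$; branching $y.\mathsf{case}(P,Q)$; empty choice $x^{\tilde u}.\mathsf{case}()$; client $\mathsf{use}\,x;P$; server $\mathsf{srv}\,y;P$; $\mathsf{kill}\,x\mid P$; $\mathsf{clone}\,x(x');P$. Interaction fragment (choreographies): link $w\leftarrow y^B\to x;P$; communication $\tilde x(\tilde x')\to y(y');P$; $\tilde x\ \mathsf{closes}\ y;P$; left selection $x\to\tilde y.\mathsf{inl}(P;Q_1,\dots,Q_n)$; right selection $x\to\tilde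 y.\mathsf{inr}(P_1,\dots,P_n;Q)$; general selection $x\to\tilde y.(\mathsf{inl}:P,\mathsf{inr}:Q)$; $x\ \mathsf{starts}\ \tilde y;P$; $x\ \mathsf{kills}\ \widetilde{y(Q)};P$ (with one $Q_i$ per $y_i$); $x\ \mathsf{clones}\ \tilde y(x',\tilde y');P$. **Judgements** $\Sigma\Vdash P::\Psi$: $\Sigma$ is a set of session typings $(x_i)_i:G$ (each endpoint occurs in at most one session), $\Psi$ is a hypersequent, i.e. a set of sequents $\vdash\Gamma$ separated by $\mid$. Environments and hypersequents are joined only if their domains are disjoint. In the action rules other than Conn and Scope the endpoints mentioned explicitly in the rule do not occur in the domain of $\Sigma$. "$\cdot$" is the empty $\Sigma$; ${?}\Gamma$ is a context all of whose types have the form ${?}A$. *Structural rules.* - Conn: from $(\Sigma_i\Vdash P_i::\Psi_i\mid\ \vdash\Gamma_i,x_i:A_i)_i$ and $G\vDash(x_i:A_i)_i$ infer $(\Sigma_i)_i,(x_i)_i:G\Vdash (P_i)_i::(\Psi_i\mid\ \vdash\Gamma_i,x_i:A_i)_i$. - Scope: from $\Sigma,(x_i)_i:G\Vdash P::\Psi\mid(\vdash\Gamma_i,x_i:A_i)_i$ infer $\Sigma\Vdash(\nu\tilde x:G)P::\Psi\mid\ \vdash(\Gamma_i)_i$. *Action rules.* - Ax: $\cdot\Vdash x^A\to y::\ \vdash x:A,y:A^\bot$ if $A=X$ or $A=X^\bot$. - $\otimes$: from $\Sigma_1\Vdash P::\Psi_1\mid\ \vdash\Gamma_1,x':A$ and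 $\Sigma_2\Vdash Q::\Psi_2\mid\ \vdash\Gamma_2,x:B$ infer $\Sigma_1,\Sigma_2\Vdash\overline x(x');(P\mid Q)::\Psi_1\mid\Psi_2\mid\ \vdash\Gamma_1,\Gamma_2,x:A\otimes B$. - $\wp$: from $\Sigma\Vdash P::\Psi\mid\ \vdash\Gamma,y':A,y:B$ infer $\Sigma\Vdash y(y');P::\Psi\mid\ \vdash\Gamma,y:A\wp B$. - $\mathbf 1$: $\cdot\Vdash\mathsf{close}[x]::\ \vdash x:\mathbf 1$. $\bot$: from $\Sigma\Vdash P::\Psi\mid\ \vdash\Gamma$ infer $\Sigma\Vdash\mathsf{wait}[y];P::\Psi\mid\ \vdash\Gamma,y:\bot$. - $\top$: $\cdot\Vdash x^{\tilde u}.\mathsf{case}()::\ \vdash\Gamma,x:\top$ if $\mathrm{vars}(\Gamma)=\tilde u$. No rule for $0$. - $\oplus_1$ / $\oplus_2$: from $\Sigma\Vdash P::\Psi\mid\ \vdash\Gamma,x:A$ (resp. $x:B$) infer $\Sigma\Vdash x.\mathsf{inl};P$ (resp. $x.\mathsf{inr};P$) $::\Psi\mid\ \vdash\Gamma,x:A\oplus B$. - $\oplus$: from $\Sigma\Vdash P::\Psi\mid\ \vdash\Gamma,x:A$ and $\Sigma\Vdash Q::\Psi\mid\ \vdash\Gamma,x:B$ infer $\Sigma\Vdash x.(\mathsf{inl}:P,\mathsf{inr}:Q)::\Psi\mid\ \vdash\Gamma,x:A\oplus B$. - $\&$: from $\Sigma\Vdash P::\Psi\mid\ \vdash\Gamma,y:A$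 and $\Sigma\Vdash Q::\Psi\mid\ \vdash\Gamma,y:B$ infer $\Sigma\Vdash y.\mathsf{case}(P,Q)::\Psi\mid\ \vdash\Gamma,y:A\& B$. - $!$: from $\cdot\Vdash P::\ \vdash{?}\Gamma,y:A$ infer $\cdot\Vdash\mathsf{srv}\,y;P::\ \vdash{?}\Gamma,y:{!}A$. $?$: from $\Sigma\Vdash P::\Psi\mid\ \vdash\Gamma,x:A$ infer $\Sigma\Vdash\mathsf{use}\,x;P::\Psi\mid\ \vdash\Gamma,x:{?}A$. - Weaken: from $\Sigma\Vdash P::\Psi\mid\ \vdash\Gamma$ infer $\Sigma\Vdash\mathsf{kill}\,x\mid P::\Psi\mid\ \vdash\Gamma,x:{?}A$. Contract: from $\Sigma\Vdash P::\Psi\mid\ \vdash\Gamma,x:{?}A,x':{?}A$ infer $\Sigma\Vdash\mathsf{clone}\,x(x');P::\Psi\mid\ \vdash\Gamma,x:{?}A$. *Interaction rules (C-rules).* - $C_{\mathrm{Ax}}$: from $\Sigma\Vdash P\{w/x\}::\Psi\mid\ \vdash\Gamma,w:A$, with $w\notin\mathrm{vars}(\Sigma)$, $A^\bot=B$, and $A=X$ or $A=X^\bot$, infer $\Sigma,(x,y):x^A\to y\Vdash w\leftarrow y^B\to x;P::\Psi\mid\ \vdash\Gamma,x:A\mid\ \vdash w:A,y:B$. - $C_{\otimes\wp}$: from $\Sigma,(\tilde x,y,\tilde u):H,(\tilde x',y'):G\{\tilde x'/\tilde x,y'/y\}\Vdash P::\Psi\mid(\vdash\Gamma_{i1},x_i':A_i)_i\mid(\vdash\Gamma_{i2},x_i:B_i)_i\mid\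 \vdash\Gamma,y':C,y:D$ infer $\Sigma,(\tilde x,y,\tilde u):\tilde x\to y(G);H\Vdash\tilde x(\tilde x')\to y(y');P::\Psi\mid(\vdash\Gamma_{i1},\Gamma_{i2},x_i:A_i\otimes B_i)_i\mid\ \vdash\Gamma,y:C\wp D$. - $C_{\mathbf 1\bot}$: from $\Sigma\Vdash P::\Psi\mid\ \vdash\Gamma$ infer $\Sigma,(\tilde x,y):\tilde x\to y\Vdash\tilde x\ \mathsf{closes}\ y;P::\Psi\mid(\vdash x_i:\mathbf 1)_i\mid\ \vdash\Gamma,y:\bot$. - $C^1_{\oplus\&}$: from $\Sigma,(\Sigma_i)_i,(x,\tilde y,\tilde u):G\Vdash P::\Psi\mid(\Psi_i)_i\mid\ \vdash\Gamma,x:A\mid(\vdash\Gamma_i,y_i:C_i)_i\mid(\vdash\Delta_j,u_j:E_j)_j$, $(\Sigma_i\Vdash Q_i::\Psi_i\mid\ \vdash\Gamma_i,y_i:D_i)_i$ and $H\vDash x:B,(y_i:D_i)_i,(u_j:E_j)_j$ infer $\Sigma,(\Sigma_i)_i,(x,\tilde y,\tilde u):x\to\tilde y.\mathsf{case}(G,H)\Vdash x\to\tilde y.\mathsf{inl}(P;Q_1,\dots,Q_n)::\Psi\mid(\Psi_i)_i\mid\ \vdash\Gamma,x:A\oplus B\mid(\vdash\Gamma_i,y_i:C_i\& D_i)_i\mid(\vdash\Delta_j,u_j:E_j)_j$. - $C^2_{\oplus\&}$: symmetric, for $x\to\tilde y.\mathsf{inr}(P_1,\dots,P_n;Q)$: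 premises $(\Sigma_i\Vdash P_i::\Psi_i\mid\ \vdash\Gamma_i,y_i:C_i)_i$, $G\vDash x:A,(y_i:C_i)_i,(u_j:E_j)_j$, and $\Sigma,(\Sigma_i)_i,(x,\tilde y,\tilde u):H\Vdash Q::\Psi\mid(\Psi_i)_i\mid\ \vdash\Gamma,x:B\mid(\vdash\Gamma_i,y_i:D_i)_i\mid(\vdash\Delta_j,u_j:E_j)_j$; same environment and hypersequent in the conclusion. - $C_{\oplus\&}$: from $\Sigma,(x,\tilde y,\tilde u):G\Vdash P::\Psi\mid\ \vdash\Gamma,x:A\mid(\vdash\Gamma_i,y_i:C_i)_i$ and $\Sigma,(x,\tilde y,\tilde u):H\Vdash Q::\Psi\mid\ \vdash\Gamma,x:B\mid(\vdash\Gamma_i,y_i:D_i)_i$ infer $\Sigma,(x,\tilde y,\tilde u):x\to\tilde y.\mathsf{case}(G,H)\Vdash x\to\tilde y.(\mathsf{inl}:P,\mathsf{inr}:Q)::\Psi\mid\ \vdash\Gamma,x:A\oplus B\mid(\vdash\Gamma_i,y_i:C_i\& D_i)_i$. - $C_{!?}$: from $\Sigma,(x,\tilde y):G\Vdash P::\Psi\mid\ \vdash\Gamma,x:A\mid(\vdash{?}\Gamma_i,y_i:B_i)_i$ with $\mathrm{vars}({?}\Gamma_i)\cap\mathrm{vars}(\Sigma)=\emptyset$ for all $i$, infer $\Sigma,(x,\tilde y):{!}x\to\tilde y(G)\Vdash x\ \mathsf{starts}\ \tilde y;P::\Psi\mid\ \vdash\Gamma,x:{?}A\mid(\vdash{?}\Gamma_i,y_i:{!}B_i)_i$.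 - $C_{!w}$: from $\Sigma\Vdash P::\Psi\mid\ \vdash\Gamma$, $(\cdot\Vdash Q_i::\ \vdash{?}\Gamma_i,y_i:B_i)_i$ and $G\vDash x:A,(y_i:B_i)_i$ infer $\Sigma,(x,\tilde y):{!}x\to\tilde y(G)\Vdash x\ \mathsf{kills}\ \widetilde{y(Q)};P::\Psi\mid\ \vdash\Gamma,x:{?}A\mid(\vdash{?}\Gamma_i,y_i:{!}B_i)_i$. - $C_{!C}$: from $\Sigma,(x,\tilde y):{!}x\to\tilde y(G),(x',\tilde y'):{!}x'\to\tilde y'(G\{x'/x,\tilde y'/\tilde y\})\Vdash P::\Psi\mid\ \vdash\Gamma,x:{?}A,x':{?}A\mid(\vdash{?}\Gamma_i,y_i:{!}B_i\mid\ \vdash{?}\Gamma_i',y_i':{!}B_i)_i$, with $\mathrm{vars}({?}\Gamma_i)$ and $\mathrm{vars}({?}\Gamma_i')$ disjoint from $\mathrm{vars}(\Sigma)$, infer $\Sigma,(x,\tilde y):{!}x\to\tilde y(G)\Vdash x\ \mathsf{clones}\ \tilde y(x',\tilde y');P::\Psi\mid\ \vdash\Gamma,x:{?}A\mid(\vdash{?}\Gamma_i,y_i:{!}B_i)_i$ (here ${?}\Gamma_i'$ is ${?}\Gamma_i$ with fresh names). **Structural equivalence** $\equiv$ is the congruence generated by the equations below; every equation is used only when both sides are typable with the same $\Sigma$ and $\Psi$ (which instance applies may depend on the typing derivation). The equations are the type-preserving permutations of an application of Conn, of Scope, or of Conn immediately followed by Scope, past an adjacent application of another rule (copying the other parallel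 components, with fresh names where needed, into every premise that needs them); this general reading defines $\equiv$. Explicitly: - $(\tilde P\mid Q)\mid\tilde S\equiv\tilde P\mid(Q\mid\tilde S)$; $(\nu\tilde x:G)(P\mid\tilde Q)\equiv(\nu\tilde x:G)P\mid\tilde Q$; $(\nu\tilde x:G)(\nu\tilde y:H)P\equiv(\nu\tilde y:H)(\nu\tilde x:G)P$. - For $\pi$ any of the prefixes $y(y');$, $\mathsf{wait}[y];$, $x.\mathsf{inl};$, $x.\mathsf{inr};$, $\mathsf{use}\,x;$, $\mathsf{kill}\,x\mid$, $\mathsf{clone}\,x(x');$, $w\leftarrow y^B\to x;$, $\tilde x(\tilde x')\to y(y');$, $\tilde x\ \mathsf{closes}\ y;$, $x\ \mathsf{starts}\ \tilde y;$, $x\ \mathsf{kills}\ \widetilde{y(Q)};$, $x\ \mathsf{clones}\ \tilde y(x',\tilde y');$ : $(\pi P)\mid\tilde S\equiv\pi(P\mid\tilde S)$ and $(\nu\tilde w:G)(\pi P)\equiv\pi((\nu\tilde w:G)P)$. - $(\overline x(x');(P\mid Q))\mid\tilde S$ is equivalent to $\overline x(x');((P\mid\tilde S)\mid Q)$ and to $\overline x(x');(P\mid(Q\mid\tilde S))$; $(\nu\tilde w:G)(\overline x(x');(P\mid Q))$ is equivalent to $\overline x(x');((\nu\tilde w:G)P\mid Q)$ if some $w_i\in\mathrm{fv}(P)$, and to $\overline x(x');(P\mid(\nu\tilde w:G)Q)$ if some $w_i\in\mathrm{fv}(Q)$. - Parallel composition with $\tilde S$, and restriction, distribute over both branches of $x.(\mathsf{inl}:P,\mathsf{inr}:Q)$,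 $y.\mathsf{case}(P,Q)$ and $x\to\tilde y.(\mathsf{inl}:P,\mathsf{inr}:Q)$. - Parallel composition with $\tilde S$, and restriction, are pushed into $P$ alone, or into $P$ and one $Q_i$, in $x\to\tilde y.\mathsf{inl}(P;Q_1,\dots,Q_n)$; and into $Q$ alone, or into $Q$ and one $P_i$, in $x\to\tilde y.\mathsf{inr}(P_1,\dots,P_n;Q)$. - $(\nu\tilde x:G)(\mathsf{srv}\,y;P\mid\tilde Q)\equiv\mathsf{srv}\,y;(\nu\tilde x:G)(P\mid\tilde Q)$; $(\nu\tilde z:G)((x\ \mathsf{clones}\ \tilde y(x',\tilde y');P)\mid\tilde Q)\equiv x\ \mathsf{clones}\ \tilde y(x',\tilde y');(\nu\tilde z:G)(P\mid\tilde Q)$. - $(\nu\tilde z,z:G)(x^{\tilde u,z}.\mathsf{case}()\mid\tilde Q)\equiv x^{\tilde u,\tilde v}.\mathsf{case}()$ with $\tilde v=\mathrm{vars}(\tilde Q)\setminus\tilde z$. - $x^A\to y\equiv y^{A^\bot}\to x$; $(\nu\tilde w,y,x,\tilde z:G)(\tilde P\mid R\mid Q\mid\tilde S)\equiv(\nu\tilde w,x,y,\tilde z:G)(\tilde P\mid Q\mid R\mid\tilde S)$; $(\nu z,\tilde w:H)((\nu x,\tilde y:G)(P\mid\tilde R)\mid\tilde Q)\equiv(\nu x,\tilde y:G)((\nu z,\tilde w:H)(P\mid\tilde Q)\mid\tilde R)$. **Extraction and projection.** The following transformations $L\rightleftharpoons R$ are considered on typable terms; $\Sigma$ is the session environment of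 the transformed (sub)term, and the endpoints of the displayed parallel components (those of $\tilde S$, $\tilde T$ included) must be all the endpoints of one session of $\Sigma$: - $P\mid x^X\to y\ \rightleftharpoons\ x\leftarrow y^{X^\bot}\to w;P$ and $P\mid y^X\to x\ \rightleftharpoons\ x\leftarrow y^X\to w;P$, where $(w,y)\in\mathrm{dom}(\Sigma)$; - $(\overline{x_i}(x_i');(P_i\mid Q_i))_i\mid y(y');R\mid\tilde S\ \rightleftharpoons\ \tilde x(\tilde x')\to y(y');(\tilde P\mid\tilde Q\mid R\mid\tilde S)$; - $(\mathsf{close}[x_i])_i\mid\mathsf{wait}[y];P\ \rightleftharpoons\ \tilde x\ \mathsf{closes}\ y;P$; - $x.\mathsf{inl};P\mid(y_i.\mathsf{case}(Q_i,R_i))_i\mid\tilde S\ \rightleftharpoons\ x\to\tilde y.\mathsf{inl}(P\mid\tilde Q\mid\tilde S;R_1,\dots,R_n)$; - $x.\mathsf{inr};P\mid(y_i.\mathsf{case}(Q_i,R_i))_i\mid\tilde S\ \rightleftharpoons\ x\to\tilde y.\mathsf{inr}(Q_1,\dots,Q_n;P\mid\tilde R\mid\tilde S)$; - $x.(\mathsf{inl}:P,\mathsf{inr}:Q)\mid(y_i.\mathsf{case}(R_i,S_i))_i\mid\tilde T\ \rightleftharpoons\ x\to\tilde y.(\mathsf{inl}:P\mid\tilde R\mid\tilde T,\ \mathsf{inr}:Q\mid\tilde S\mid\tilde T)$; - $\mathsf{use}\,x;P\mid(\mathsf{srv}\,y_i;Q_i)_i\ \rightleftharpoons\ x\ \mathsf{starts}\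 \tilde y;(P\mid\tilde Q)$; - $(\mathsf{kill}\,x\mid P)\mid(\mathsf{srv}\,y_i;Q_i)_i\ \rightleftharpoons\ x\ \mathsf{kills}\ \widetilde{y(Q)};P$; - $\mathsf{clone}\,x(x');P\mid(\mathsf{srv}\,y_i;Q_i)_i\ \rightleftharpoons\ x\ \mathsf{clones}\ \tilde y(x',\tilde y');(P\mid(\mathsf{srv}\,y_i;Q_i)_i\mid(\mathsf{srv}\,y_i';Q_i')_i)$. $P\stackrel{\tilde x}{\longrightarrow}_{\mathsf{extr}}P'$ (resp. $P\stackrel{\tilde x}{\longrightarrow}_{\mathsf{proj}}P'$) means that $P'$ is obtained by applying one of these transformations from left to right (resp. from right to left) in a term equivalent ($\equiv$) to $P$, possibly at a subterm, where $\tilde x$ are the endpoints involved in the transformation.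
   Formalization: A transformation also requires that the global type of the session joining the components begins with the displayed interaction (else Σ is not preserved); compositions of a single component and communications without a sender are excluded. *)

theory Defs
  imports "HOL-Library.Multiset"
begin

section \<open>Local and global types\<close>

type_synonym ep = nat

datatype ltype =
    Tensor ltype ltype
  | Parr ltype ltype
  | Oplus ltype ltype
  | With ltype ltype
  | Bang ltype
  | Quest ltype
  | TOne
  | TBot
  | TZero
  | TTop
  | TVar nat
  | TCoVar nat

primrec dual :: "ltype \<Rightarrow> ltype" where
  "dual (Tensor A B) = Parr (dual A) (dual B)"
| "dual (Parr A B) = Tensor (dual A) (dual B)"
| "dual (Oplus A B) = With (dual A) (dual B)"
| "dual (With A B) = Oplus (dual A) (dual B)"
| "dual (Bang A) = Quest (dual A)"
| "dual (Quest A) = Bang (dual A)"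
| "dual TOne = TBot"
| "dual TBot = TOne"
| "dual TZero = TTop"
| "dual TTop = TZero"
| "dual (TVar X) = TCoVar X"
| "dual (TCoVar X) = TVar X"

definition atomic :: "ltype \<Rightarrow> bool" where
  "atomic A \<longleftrightarrow> (\<exists>X. A = TVar X \<or> A = TCoVar X)"

datatype 'e gtype =
    GComm "'e list" 'e "'e gtype" "'e gtype"  \<comment> \<open>\<open>xs \<rightarrow> y (G); H\<close>\<close>
  | GCase 'e "'e list" "'e gtype" "'e gtype"  \<comment> \<open>\<open>x \<rightarrow> ys.case (G, H)\<close>\<close>
  | GBang 'e "'e list" "'e gtype"             \<comment> \<open>\<open>!x \<rightarrow> ys (G)\<close>\<close>
  | GClose "'e list" 'e                       \<comment> \<open>\<open>xs \<rightarrow> y\<close>\<close>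
  | GEmpty 'e "'e list"                       \<comment> \<open>\<open>x \<rightarrow> ys.case ()\<close>\<close>
  | GLink 'e ltype 'e                         \<comment> \<open>\<open>x\<^sup>A \<rightarrow> y\<close>\<close>


section \<open>Environments\<close>

text \<open>
  Contexts, hypersequents and session environments are multisets, so that \<open>+\<close> is
  the comma (or the bar) of the calculus; that no endpoint is declared twice is imposed on
  every judgement by \<open>wf\<close> below. The endpoints \<open>(x\<^sub>i)\<^sub>i\<close> of a session form a multiset as well:
  their order in \<open>(x\<^sub>i)\<^sub>i : G\<close> is immaterial (a session typed \<open>(x, y) : G\<close> may next be
  driven by \<open>y\<close>). A family \<open>(a\<^sub>i)\<^sub>i\<close> is a function on the indices \<open>i < length xs\<close>.
\<close>

type_synonym ctx = "(ep \<times> ltype) multiset"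
type_synonym hyp = "ctx multiset"
type_synonym env = "(ep multiset \<times> ep gtype) multiset"

definition nodup :: "'a multiset \<Rightarrow> bool" where
  "nodup M \<longleftrightarrow> (\<forall>a. count M a \<le> 1)"

definition names :: "ctx \<Rightarrow> ep multiset" where
  "names \<Gamma> = image_mset fst \<Gamma>"

definition hdom :: "hyp \<Rightarrow> ep multiset" where
  "hdom \<Psi> = \<Sum>\<^sub># (image_mset names \<Psi>)"

definition edom :: "env \<Rightarrow> ep multiset" where
  "edom \<Sigma> = \<Sum>\<^sub># (image_mset fst \<Sigma>)"

definition evars :: "env \<Rightarrow> ep set" where
  "evars \<Sigma> = (\<Union>(M, G) \<in> set_mset \<Sigma>. set_mset M \<union> set_gtype G)"

definition wf :: "env \<Rightarrow> hyp \<Rightarrow> bool" where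
  "wf \<Sigma> \<Psi> \<longleftrightarrow> nodup (edom \<Sigma>) \<and> nodup (hdom \<Psi>)"

definition quest_ctx :: "ctx \<Rightarrow> bool" where
  "quest_ctx \<Gamma> \<longleftrightarrow> (\<forall>(x, A) \<in># \<Gamma>. \<exists>B. A = Quest B)"

text \<open>\<open>(x\<^sub>i : A\<^sub>i)\<^sub>i\<close> and \<open>(\<turnstile> \<Gamma>\<^sub>i, x\<^sub>i : A\<^sub>i)\<^sub>i\<close>\<close>

definition fam :: "ep list \<Rightarrow> (nat \<Rightarrow> ltype) \<Rightarrow> ctx" where
  "fam xs A = (\<Sum>i<length xs. {#(xs ! i, A i)#})"

definition seqs :: "ep list \<Rightarrow> (nat \<Rightarrow> ctx) \<Rightarrow> (nat \<Rightarrow> ltype) \<Rightarrow> hyp" where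
  "seqs xs \<Gamma> A = (\<Sum>i<length xs. {#add_mset (xs ! i, A i) (\<Gamma> i)#})"

text \<open>
  A renaming \<open>{ys/xs}\<close> is rendered by the exchange of \<open>xs\<close> and \<open>ys\<close>, for distinct and
  mutually disjoint \<open>xs\<close>, \<open>ys\<close>. On objects in which no \<open>y \<in> set ys\<close> is free it is, up to
  renaming of bound endpoints, the capture-avoiding substitution.
\<close>

definition exch :: "ep list \<Rightarrow> ep list \<Rightarrow> ep \<Rightarrow> ep" where
  "exch xs ys z = (case map_of (zip xs ys @ zip ys xs) z of None \<Rightarrow> z | Some z' \<Rightarrow> z')"


section \<open>Coherence\<close>

inductive coherent :: "ep gtype \<Rightarrow> ctx \<Rightarrow> bool"  (infix \<open>\<Turnstile>\<close> 50) where
  coh_comm: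
    "G \<Turnstile> fam xs A + {#(y, C)#} \<Longrightarrow>
     H \<Turnstile> \<Gamma> + fam xs B + {#(y, D)#} \<Longrightarrow>
     GComm xs y G H \<Turnstile> \<Gamma> + fam xs (\<lambda>i. Tensor (A i) (B i)) + {#(y, Parr C D)#}"
| coh_close:
    "nodup (mset xs + {#y#}) \<Longrightarrow>
     GClose xs y \<Turnstile> fam xs (\<lambda>i. TOne) + {#(y, TBot)#}"
| coh_case:
    "G1 \<Turnstile> \<Gamma> + {#(x, A)#} + fam ys C \<Longrightarrow>
     G2 \<Turnstile> \<Gamma> + {#(x, B)#} + fam ys D \<Longrightarrow>
     GCase x ys G1 G2 \<Turnstile> \<Gamma> + {#(x, Oplus A B)#} + fam ys (\<lambda>i. With (C i) (D i))"
| coh_bang: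
    "G \<Turnstile> {#(x, A)#} + fam ys B \<Longrightarrow>
     GBang x ys G \<Turnstile> {#(x, Quest A)#} + fam ys (\<lambda>i. Bang (B i))"
| coh_empty:
    "nodup (names \<Gamma> + {#x#} + mset ys) \<Longrightarrow>
     GEmpty x ys \<Turnstile> \<Gamma> + {#(x, TZero)#} + fam ys (\<lambda>i. TTop)"
| coh_link:
    "x \<noteq> y \<Longrightarrow> atomic A \<Longrightarrow>
     GLink x A y \<Turnstile> {#(x, A), (y, dual A)#}"


section \<open>Terms\<close>

text \<open>
  In \<open>x clones ys(x',ys'); P\<close> the premise of the typing rule contains copies, under fresh
  names, of the contexts of the servers \<open>ys\<close>. These names do not occur in the conclusion, so
  they are bound in \<open>P\<close>, although the notation does not show them. \<open>Clones\<close> records them: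
  \<open>zs'\<close> are the copies of the endpoints \<open>zs\<close>.
\<close>

datatype 'e trm =
    Link 'e ltype 'e                               \<comment> \<open>\<open>x\<^sup>A \<rightarrow> y\<close>\<close>
  | Par "'e trm" "'e trm"
  | Res "'e list" "'e gtype" "'e trm"
  | Send 'e 'e "'e trm" "'e trm"                   \<comment> \<open>output of \<open>x'\<close> on \<open>x\<close>, \<open>x'\<close> bound in the first term\<close>
  | Recv 'e 'e "'e trm"                            \<comment> \<open>\<open>y(y'); P\<close>\<close>
  | Close 'e
  | Wait 'e "'e trm"
  | Inl 'e "'e trm"
  | Inr 'e "'e trm"
  | Sel 'e "'e trm" "'e trm"                       \<comment> \<open>\<open>x.(inl: P, inr: Q)\<close>\<close>
  | Case 'e "'e trm" "'e trm"
  | Empty 'e "'e list"                             \<comment> \<open>\<open>x.case ()\<close>, annotated with \<open>us\<close>\<close>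
  | Use 'e "'e trm"
  | Srv 'e "'e trm"
  | Kill 'e "'e trm"
  | Clone 'e 'e "'e trm"                           \<comment> \<open>\<open>clone x(x'); P\<close>\<close>
  | CLink 'e 'e ltype 'e "'e trm"                  \<comment> \<open>\<open>w \<leftarrow> y\<^sup>B \<rightarrow> x; P\<close>\<close>
  | Comm "'e list" "'e list" 'e 'e "'e trm"        \<comment> \<open>\<open>xs(xs') \<rightarrow> y(y'); P\<close>\<close>
  | Closes "'e list" 'e "'e trm"
  | CInl 'e "'e list" "'e trm" "'e trm list"       \<comment> \<open>\<open>x \<rightarrow> ys.inl(P; Qs)\<close>\<close>
  | CInr 'e "'e list" "'e trm list" "'e trm"       \<comment> \<open>\<open>x \<rightarrow> ys.inr(Ps; Q)\<close>\<close>
  | CSel 'e "'e list" "'e trm" "'e trm"            \<comment> \<open>\<open>x \<rightarrow> ys.(inl: P, inr: Q)\<close>\<close>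
  | Starts 'e "'e list" "'e trm"
  | Kills 'e "'e list" "'e trm list" "'e trm"      \<comment> \<open>\<open>x kills ys(Qs); P\<close>\<close>
  | Clones 'e "'e list" 'e "'e list" "'e list" "'e list" "'e trm"
      \<comment> \<open>\<open>x clones ys(x', ys'); P\<close>, recording \<open>zs\<close> and \<open>zs'\<close>\<close>

primrec fv :: "'e trm \<Rightarrow> 'e set" where
  "fv (Link x A y) = {x, y}"
| "fv (Par P Q) = fv P \<union> fv Q"
| "fv (Res xs G P) = (set_gtype G \<union> fv P) - set xs"
| "fv (Send x x' P Q) = {x} \<union> (fv P - {x'}) \<union> fv Q"
| "fv (Recv y y' P) = {y} \<union> (fv P - {y'})"
| "fv (Close x) = {x}"
| "fv (Wait y P) = {y} \<union> fv P"
| "fv (Inl x P) = {x} \<union> fv P"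
| "fv (Inr x P) = {x} \<union> fv P"
| "fv (Sel x P Q) = {x} \<union> fv P \<union> fv Q"
| "fv (Case y P Q) = {y} \<union> fv P \<union> fv Q"
| "fv (Empty x us) = {x} \<union> set us"
| "fv (Use x P) = {x} \<union> fv P"
| "fv (Srv y P) = {y} \<union> fv P"
| "fv (Kill x P) = {x} \<union> fv P"
| "fv (Clone x x' P) = {x} \<union> (fv P - {x'})"
| "fv (CLink w y B x P) = {w, y, x} \<union> fv P"
| "fv (Comm xs xs' y y' P) = set xs \<union> {y} \<union> (fv P - set xs' - {y'})"
| "fv (Closes xs y P) = set xs \<union> {y} \<union> fv P"
| "fv (CInl x ys P Qs) = {x} \<union> set ys \<union> fv P \<union> \<Union> (set (map fv Qs))"
| "fv (CInr x ys Ps Q) = {x} \<union> set ys \<union> \<Union> (set (map fv Ps)) \<union> fv Q"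
| "fv (CSel x ys P Q) = {x} \<union> set ys \<union> fv P \<union> fv Q"
| "fv (Starts x ys P) = {x} \<union> set ys \<union> fv P"
| "fv (Kills x ys Qs P) = {x} \<union> set ys \<union> \<Union> (set (map fv Qs)) \<union> fv P"
| "fv (Clones x ys x' ys' zs zs' P) =
     {x} \<union> set ys \<union> set zs \<union> (fv P - {x'} - set ys' - set zs')"

text \<open>\<open>P\<^sub>1 | \<dots> | P\<^sub>n\<close> for \<open>n \<ge> 1\<close>; the bar associates to the right.\<close>

fun par :: "'e trm list \<Rightarrow> 'e trm" where
  "par [P] = P"
| "par (P # Q # Ps) = Par P (par (Q # Ps))"


section \<open>Typing\<close>

text \<open>
  \<open>rule F J \<Sigma> \<Psi>\<close> is an instance of an inference rule: from judgements for terms \<open>Ps\<close>, with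
  environments and hypersequents listed in \<open>J\<close>, it infers the judgement for \<open>F Ps\<close> with
  \<open>\<Sigma>\<close> and \<open>\<Psi>\<close>. Keeping the term former \<open>F\<close> apart makes it possible to rewrite one
  premise of a derivation, which is how equivalence and the transformations act on subterms.
\<close>

definition un :: "('t \<Rightarrow> 't) \<Rightarrow> 't list \<Rightarrow> 't" where
  "un f Ps = f (Ps ! 0)"

definition bin :: "('t \<Rightarrow> 't \<Rightarrow> 't) \<Rightarrow> 't list \<Rightarrow> 't" where
  "bin f Ps = f (Ps ! 0) (Ps ! 1)"

inductive rule :: "(ep trm list \<Rightarrow> ep trm) \<Rightarrow> (env \<times> hyp) list \<Rightarrow> env \<Rightarrow> hyp \<Rightarrow> bool" where
  Conn:
    "G \<Turnstile> fam xs A \<Longrightarrow>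
     rule par
       (map (\<lambda>i. (\<Sigma>i i, \<Psi>i i + {#\<Gamma>i i + {#(xs ! i, A i)#}#})) [0..<length xs])
       ((\<Sum>i<length xs. \<Sigma>i i) + {#(mset xs, G)#})
       (\<Sum>i<length xs. \<Psi>i i + {#\<Gamma>i i + {#(xs ! i, A i)#}#})"
| Scope:
    "rule (un (Res xs G))
       [(\<Sigma> + {#(mset xs, G)#}, \<Psi> + seqs xs \<Gamma>i A)]
       \<Sigma> (\<Psi> + {#\<Sum>i<length xs. \<Gamma>i i#})"
| Ax:
    "atomic A \<Longrightarrow>
     rule (\<lambda>_. Link x A y) [] {#} {#{#(x, A), (y, dual A)#}#}"
| Tensor:
    "x \<notin># edom (\<Sigma>1 + \<Sigma>2) \<Longrightarrow> x' \<notin># edom (\<Sigma>1 + \<Sigma>2) \<Longrightarrow>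
     rule (bin (Send x x'))
       [(\<Sigma>1, \<Psi>1 + {#\<Gamma>1 + {#(x', A)#}#}),
        (\<Sigma>2, \<Psi>2 + {#\<Gamma>2 + {#(x, B)#}#})]
       (\<Sigma>1 + \<Sigma>2) (\<Psi>1 + \<Psi>2 + {#\<Gamma>1 + \<Gamma>2 + {#(x, Tensor A B)#}#})"
| Parr:
    "y \<notin># edom \<Sigma> \<Longrightarrow> y' \<notin># edom \<Sigma> \<Longrightarrow>
     rule (un (Recv y y'))
       [(\<Sigma>, \<Psi> + {#\<Gamma> + {#(y', A), (y, B)#}#})]
       \<Sigma> (\<Psi> + {#\<Gamma> + {#(y, Parr A B)#}#})"
| One:
    "rule (\<lambda>_. Close x) [] {#} {#{#(x, TOne)#}#}"
| Bot:
    "y \<notin># edom \<Sigma> \<Longrightarrow>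
     rule (un (Wait y)) [(\<Sigma>, \<Psi> + {#\<Gamma>#})] \<Sigma> (\<Psi> + {#\<Gamma> + {#(y, TBot)#}#})"
| Top:
    "names \<Gamma> = mset us \<Longrightarrow>
     rule (\<lambda>_. Empty x us) [] {#} {#\<Gamma> + {#(x, TTop)#}#}"
| Oplus1:
    "x \<notin># edom \<Sigma> \<Longrightarrow>
     rule (un (Inl x))
       [(\<Sigma>, \<Psi> + {#\<Gamma> + {#(x, A)#}#})]
       \<Sigma> (\<Psi> + {#\<Gamma> + {#(x, Oplus A B)#}#})"
| Oplus2:
    "x \<notin># edom \<Sigma> \<Longrightarrow>
     rule (un (Inr x))
       [(\<Sigma>, \<Psi> + {#\<Gamma> + {#(x, B)#}#})]
       \<Sigma> (\<Psi> + {#\<Gamma> + {#(x, Oplus A B)#}#})"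
| Oplus:
    "x \<notin># edom \<Sigma> \<Longrightarrow>
     rule (bin (Sel x))
       [(\<Sigma>, \<Psi> + {#\<Gamma> + {#(x, A)#}#}), (\<Sigma>, \<Psi> + {#\<Gamma> + {#(x, B)#}#})]
       \<Sigma> (\<Psi> + {#\<Gamma> + {#(x, Oplus A B)#}#})"
| With:
    "y \<notin># edom \<Sigma> \<Longrightarrow>
     rule (bin (Case y))
       [(\<Sigma>, \<Psi> + {#\<Gamma> + {#(y, A)#}#}), (\<Sigma>, \<Psi> + {#\<Gamma> + {#(y, B)#}#})]
       \<Sigma> (\<Psi> + {#\<Gamma> + {#(y, With A B)#}#})"
| Bang:
    "quest_ctx \<Gamma> \<Longrightarrow>
     rule (un (Srv y))
       [({#}, {#\<Gamma> + {#(y, A)#}#})]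
       {#} {#\<Gamma> + {#(y, Bang A)#}#}"
| Quest:
    "x \<notin># edom \<Sigma> \<Longrightarrow>
     rule (un (Use x))
       [(\<Sigma>, \<Psi> + {#\<Gamma> + {#(x, A)#}#})]
       \<Sigma> (\<Psi> + {#\<Gamma> + {#(x, Quest A)#}#})"
| Weaken:
    "x \<notin># edom \<Sigma> \<Longrightarrow>
     rule (un (Kill x))
       [(\<Sigma>, \<Psi> + {#\<Gamma>#})]
       \<Sigma> (\<Psi> + {#\<Gamma> + {#(x, Quest A)#}#})"
| Contract:
    "x \<notin># edom \<Sigma> \<Longrightarrow> x' \<notin># edom \<Sigma> \<Longrightarrow>
     rule (un (Clone x x'))
       [(\<Sigma>, \<Psi> + {#\<Gamma> + {#(x, Quest A), (x', Quest A)#}#})]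
       \<Sigma> (\<Psi> + {#\<Gamma> + {#(x, Quest A)#}#})"
| CAx:
    \<comment> \<open>The premise is typed for \<open>P{w/x}\<close>; the exchange, an involution, recovers \<open>P\<close>.\<close>
    "w \<notin> evars \<Sigma> \<Longrightarrow> dual A = B \<Longrightarrow> atomic A \<Longrightarrow>
     rule (un (\<lambda>P. CLink w y B x (map_trm (exch [x] [w]) P)))
       [(\<Sigma>, \<Psi> + {#\<Gamma> + {#(w, A)#}#})]
       (\<Sigma> + {#({#x, y#}, GLink x A y)#})
       (\<Psi> + {#\<Gamma> + {#(x, A)#}, {#(w, A), (y, B)#}#})"
| CTensorParr:
    "length xs' = length xs \<Longrightarrow>
     rule (un (Comm xs xs' y y'))
       [(\<Sigma> + {#(mset xs + {#y#} + mset us, H),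
               (mset xs' + {#y'#}, map_gtype (exch (xs @ [y]) (xs' @ [y'])) G)#},
         \<Psi> + seqs xs' \<Gamma>1 A + seqs xs \<Gamma>2 B + {#\<Gamma> + {#(y', C), (y, D)#}#})]
       (\<Sigma> + {#(mset xs + {#y#} + mset us, GComm xs y G H)#})
       (\<Psi> + seqs xs (\<lambda>i. \<Gamma>1 i + \<Gamma>2 i) (\<lambda>i. Tensor (A i) (B i)) + {#\<Gamma> + {#(y, Parr C D)#}#})"
| COneBot:
    "rule (un (Closes xs y))
       [(\<Sigma>, \<Psi> + {#\<Gamma>#})]
       (\<Sigma> + {#(mset xs + {#y#}, GClose xs y)#})
       (\<Psi> + seqs xs (\<lambda>i. {#}) (\<lambda>i. TOne) + {#\<Gamma> + {#(y, TBot)#}#})"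
| COplusWith1:
    "H \<Turnstile> {#(x, B)#} + fam ys D + fam us E \<Longrightarrow>
     rule (\<lambda>Ps. CInl x ys (hd Ps) (tl Ps))
       ((\<Sigma> + (\<Sum>i<length ys. \<Sigma>i i) + {#({#x#} + mset ys + mset us, G)#},
         \<Psi> + (\<Sum>i<length ys. \<Psi>i i) + {#\<Gamma> + {#(x, A)#}#} + seqs ys \<Gamma>i C + seqs us \<Delta> E)
        # map (\<lambda>i. (\<Sigma>i i, \<Psi>i i + {#\<Gamma>i i + {#(ys ! i, D i)#}#})) [0..<length ys])
       (\<Sigma> + (\<Sum>i<length ys. \<Sigma>i i) + {#({#x#} + mset ys + mset us, GCase x ys G H)#})
       (\<Psi> + (\<Sum>i<length ys. \<Psi>i i) + {#\<Gamma> + {#(x, Oplus A B)#}#}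
          + seqs ys \<Gamma>i (\<lambda>i. With (C i) (D i)) + seqs us \<Delta> E)"
| COplusWith2:
    "G \<Turnstile> {#(x, A)#} + fam ys C + fam us E \<Longrightarrow>
     rule (\<lambda>Ps. CInr x ys (tl Ps) (hd Ps))
       ((\<Sigma> + (\<Sum>i<length ys. \<Sigma>i i) + {#({#x#} + mset ys + mset us, H)#},
         \<Psi> + (\<Sum>i<length ys. \<Psi>i i) + {#\<Gamma> + {#(x, B)#}#} + seqs ys \<Gamma>i D + seqs us \<Delta> E)
        # map (\<lambda>i. (\<Sigma>i i, \<Psi>i i + {#\<Gamma>i i + {#(ys ! i, C i)#}#})) [0..<length ys])
       (\<Sigma> + (\<Sum>i<length ys. \<Sigma>i i) + {#({#x#} + mset ys + mset us, GCase x ys G H)#})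
       (\<Psi> + (\<Sum>i<length ys. \<Psi>i i) + {#\<Gamma> + {#(x, Oplus A B)#}#}
          + seqs ys \<Gamma>i (\<lambda>i. With (C i) (D i)) + seqs us \<Delta> E)"
| COplusWith:
    "rule (bin (CSel x ys))
       [(\<Sigma> + {#({#x#} + mset ys + mset us, G)#}, \<Psi> + {#\<Gamma> + {#(x, A)#}#} + seqs ys \<Gamma>i C),
        (\<Sigma> + {#({#x#} + mset ys + mset us, H)#}, \<Psi> + {#\<Gamma> + {#(x, B)#}#} + seqs ys \<Gamma>i D)]
       (\<Sigma> + {#({#x#} + mset ys + mset us, GCase x ys G H)#})
       (\<Psi> + {#\<Gamma> + {#(x, Oplus A B)#}#} + seqs ys \<Gamma>i (\<lambda>i. With (C i) (D i)))"
| CBangQuest: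
    "\<forall>i<length ys. quest_ctx (\<Gamma>i i) \<and> set_mset (names (\<Gamma>i i)) \<inter> evars \<Sigma> = {} \<Longrightarrow>
     rule (un (Starts x ys))
       [(\<Sigma> + {#({#x#} + mset ys, G)#}, \<Psi> + {#\<Gamma> + {#(x, A)#}#} + seqs ys \<Gamma>i B)]
       (\<Sigma> + {#({#x#} + mset ys, GBang x ys G)#})
       (\<Psi> + {#\<Gamma> + {#(x, Quest A)#}#} + seqs ys \<Gamma>i (\<lambda>i. Bang (B i)))"
| CBangWeaken:
    "G \<Turnstile> {#(x, A)#} + fam ys B \<Longrightarrow>
     \<forall>i<length ys. quest_ctx (\<Gamma>i i) \<Longrightarrow>
     rule (\<lambda>Ps. Kills x ys (tl Ps) (hd Ps))
       ((\<Sigma>, \<Psi> + {#\<Gamma>#}) # map (\<lambda>i. ({#}, {#\<Gamma>i i + {#(ys ! i, B i)#}#})) [0..<length ys])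
       (\<Sigma> + {#({#x#} + mset ys, GBang x ys G)#})
       (\<Psi> + {#\<Gamma> + {#(x, Quest A)#}#} + seqs ys \<Gamma>i (\<lambda>i. Bang (B i)))"
| CBangContract:
    "length ys' = length ys \<Longrightarrow> length zs' = length zs \<Longrightarrow>
     mset zs = (\<Sum>i<length ys. names (\<Gamma>i i)) \<Longrightarrow>
     \<Gamma>i' = (\<lambda>i. image_mset (map_prod (exch zs zs') id) (\<Gamma>i i)) \<Longrightarrow>
     \<forall>i<length ys. quest_ctx (\<Gamma>i i)
        \<and> (set_mset (names (\<Gamma>i i)) \<union> set_mset (names (\<Gamma>i' i))) \<inter> evars \<Sigma> = {} \<Longrightarrow>
     rule (un (Clones x ys x' ys' zs zs'))
       [(\<Sigma> + {#({#x#} + mset ys, GBang x ys G),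
               ({#x'#} + mset ys', GBang x' ys' (map_gtype (exch (x # ys) (x' # ys')) G))#},
         \<Psi> + {#\<Gamma> + {#(x, Quest A), (x', Quest A)#}#}
           + seqs ys \<Gamma>i (\<lambda>i. Bang (B i)) + seqs ys' \<Gamma>i' (\<lambda>i. Bang (B i)))]
       (\<Sigma> + {#({#x#} + mset ys, GBang x ys G)#})
       (\<Psi> + {#\<Gamma> + {#(x, Quest A)#}#} + seqs ys \<Gamma>i (\<lambda>i. Bang (B i)))"

inductive typed :: "env \<Rightarrow> ep trm \<Rightarrow> hyp \<Rightarrow> bool"  (\<open>_ \<tturnstile> _ \<Colon> _\<close> [51, 51, 51] 50) where
  "rule F J \<Sigma> \<Psi> \<Longrightarrow> wf \<Sigma> \<Psi> \<Longrightarrow> length Ps = length J \<Longrightarrow>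
   (\<And>i. i < length J \<Longrightarrow> fst (J ! i) \<tturnstile> Ps ! i \<Colon> snd (J ! i)) \<Longrightarrow>
   \<Sigma> \<tturnstile> F Ps \<Colon> \<Psi>"

text \<open>A derivable instance of a rule, with its premises.\<close>

definition infers ::
    "(ep trm list \<Rightarrow> ep trm) \<Rightarrow> (env \<times> hyp) list \<Rightarrow> ep trm list \<Rightarrow> env \<Rightarrow> hyp \<Rightarrow> bool" where
  "infers F J Ps \<Sigma> \<Psi> \<longleftrightarrow> rule F J \<Sigma> \<Psi> \<and> wf \<Sigma> \<Psi> \<and> length Ps = length J
     \<and> (\<forall>i<length J. fst (J ! i) \<tturnstile> Ps ! i \<Colon> snd (J ! i))"

definition typable :: "ep trm \<Rightarrow> bool" where
  "typable P \<longleftrightarrow> (\<exists>\<Sigma> \<Psi>. \<Sigma> \<tturnstile> P \<Colon> \<Psi>)"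


section \<open>Structural equivalence\<close>

text \<open>
  The equations themselves are untyped; they are only ever used between two terms that are typable
  with the same \<open>\<Sigma>\<close> and \<open>\<Psi>\<close> (see \<open>eqv\<close>), which is what excludes capture and ill-scoped
  instances. The component past which a rule is permuted may stand anywhere in its parallel
  composition.
\<close>

inductive prefix :: "(ep trm \<Rightarrow> ep trm) \<Rightarrow> bool" where
  "prefix (Recv y y')"
| "prefix (Wait y)"
| "prefix (Inl x)"
| "prefix (Inr x)"
| "prefix (Use x)"
| "prefix (Kill x)"
| "prefix (Clone x x')"
| "prefix (CLink w y B x)"
| "prefix (Comm xs xs' y y')"
| "prefix (Closes xs y)"
| "prefix (Starts x ys)"
| "prefix (Kills x ys Qs)"
| "prefix (Clones x ys x' ys' zs zs')"

inductive branching :: "(ep trm \<Rightarrow> ep trm \<Rightarrow> ep trm) \<Rightarrow> bool" where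
  "branching (Sel x)"
| "branching (Case y)"
| "branching (CSel x ys)"

inductive equation :: "ep trm \<Rightarrow> ep trm \<Rightarrow> bool" where
  \<comment> \<open>Renaming of bound endpoints: a transposition of two non-free endpoints yields an
     alpha-variant. The output prefix binds in one of its two subterms only.\<close>
  alpha: "a \<notin> fv P \<Longrightarrow> b \<notin> fv P \<Longrightarrow> equation P (map_trm (exch [a] [b]) P)"
| alpha_send:
    "b \<notin> fv P \<Longrightarrow> equation (Send x a P Q) (Send x b (map_trm (exch [a] [b]) P) Q)"

| conn_conn:
    "equation (par (As @ par (Bs @ Q # Cs) # Ds)) (par (Bs @ par (As @ Q # Ds) # Cs))"
| scope_conn:
    "equation (Res xs G (par (As @ P # Bs))) (par (As @ Res xs G P # Bs))"
| scope_scope: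
    "equation (Res xs G (Res ys H P)) (Res ys H (Res xs G P))"

| conn_prefix:
    "prefix \<pi> \<Longrightarrow> equation (par (As @ \<pi> P # Bs)) (\<pi> (par (As @ P # Bs)))"
| scope_prefix:
    "prefix \<pi> \<Longrightarrow> equation (Res ws G (\<pi> P)) (\<pi> (Res ws G P))"
| conn_scope_prefix:
    \<comment> \<open>For \<open>Starts\<close> and \<open>Clones\<close> not a composition of the previous two: their side
       conditions may fail as long as the session is not restricted.\<close>
    "prefix \<pi> \<Longrightarrow>
     equation (Res ws G (par (As @ \<pi> P # Bs))) (\<pi> (Res ws G (par (As @ P # Bs))))"

| conn_send1:
    "equation (par (As @ Send x x' P Q # Bs)) (Send x x' (par (As @ P # Bs)) Q)"
| conn_send2:
    "equation (par (As @ Send x x' P Q # Bs)) (Send x x' P (par (As @ Q # Bs)))"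
| scope_send1:
    "w \<in> set ws \<Longrightarrow> w \<in> fv P \<Longrightarrow>
     equation (Res ws G (Send x x' P Q)) (Send x x' (Res ws G P) Q)"
| scope_send2:
    "w \<in> set ws \<Longrightarrow> w \<in> fv Q \<Longrightarrow>
     equation (Res ws G (Send x x' P Q)) (Send x x' P (Res ws G Q))"

| conn_branching:
    "branching \<beta> \<Longrightarrow>
     equation (par (As @ \<beta> P Q # Bs)) (\<beta> (par (As @ P # Bs)) (par (As @ Q # Bs)))"
| scope_branching:
    "branching \<beta> \<Longrightarrow> equation (Res ws G (\<beta> P Q)) (\<beta> (Res ws G P) (Res ws G Q))"

| conn_inl:
    "equation (par (As @ CInl x ys P Qs # Bs)) (CInl x ys (par (As @ P # Bs)) Qs)"
| conn_inl':
    "i < length Qs \<Longrightarrow>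
     equation (par (As @ CInl x ys P Qs # Bs))
       (CInl x ys (par (As @ P # Bs)) (Qs[i := par (As @ Qs ! i # Bs)]))"
| scope_inl:
    "equation (Res ws G (CInl x ys P Qs)) (CInl x ys (Res ws G P) Qs)"
| scope_inl':
    "i < length Qs \<Longrightarrow>
     equation (Res ws G (CInl x ys P Qs)) (CInl x ys (Res ws G P) (Qs[i := Res ws G (Qs ! i)]))"
| conn_inr:
    "equation (par (As @ CInr x ys Ps Q # Bs)) (CInr x ys Ps (par (As @ Q # Bs)))"
| conn_inr':
    "i < length Ps \<Longrightarrow>
     equation (par (As @ CInr x ys Ps Q # Bs))
       (CInr x ys (Ps[i := par (As @ Ps ! i # Bs)]) (par (As @ Q # Bs)))"
| scope_inr:
    "equation (Res ws G (CInr x ys Ps Q)) (CInr x ys Ps (Res ws G Q))"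
| scope_inr':
    "i < length Ps \<Longrightarrow>
     equation (Res ws G (CInr x ys Ps Q)) (CInr x ys (Ps[i := Res ws G (Ps ! i)]) (Res ws G Q))"

| conn_scope_srv:
    "equation (Res xs G (par (As @ Srv y P # Bs))) (Srv y (Res xs G (par (As @ P # Bs))))"
| conn_scope_kills:
    "i < length Qs \<Longrightarrow>
     equation (Res zs G (par (As @ Kills x ys Qs P # Bs)))
       (Kills x ys (Qs[i := Res zs G (par (As @ Qs ! i # Bs))]) P)"
| conn_scope_clones:
    \<comment> \<open>The server contexts, hence the recorded endpoints, change from \<open>us\<close> to \<open>vs\<close>.\<close>
    "equation (Res zs G (par (As @ Clones x ys x' ys' us us' P # Bs)))
       (Clones x ys x' ys' vs vs' (Res zs G (par (As @ P # Bs))))"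
| conn_scope_clones_copy:
    \<comment> \<open>If the restricted session involves a server context, then \<open>P\<close> contains a copy of its
       endpoint, to be connected to copies of the other components.\<close>
    "distinct ws \<Longrightarrow> distinct ws' \<Longrightarrow> length ws' = length ws \<Longrightarrow> set ws \<inter> set ws' = {} \<Longrightarrow>
     \<rho> = exch ws ws' \<Longrightarrow>
     equation (Res zs G (par (As @ Clones x ys x' ys' us us' P # Bs)))
       (Clones x ys x' ys' vs vs'
         (Res zs G (Res (map \<rho> zs) (map_gtype \<rho> G)
           (par (map (map_trm \<rho>) As @ par (As @ P # Bs) # map (map_trm \<rho>) Bs)))))"
| conn_scope_empty:
    "set vs = (\<Union>Q \<in> set As \<union> set Bs. fv Q) - set zs \<Longrightarrow>
     equation (Res (zs @ [z]) G (par (As @ Empty x (us @ [z]) # Bs))) (Empty x (us @ vs))"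

| link_sym:
    "equation (Link x A y) (Link y (dual A) x)"
| comm_scope:
    "equation (Res (ws @ y # x # zs) G (par (Ps @ R # Q # Ss)))
       (Res (ws @ x # y # zs) G (par (Ps @ Q # R # Ss)))"
| conn_scope_conn_scope:
    "equation (Res zs H (par (As @ Res xs G (par (Bs @ P # Cs)) # Ds)))
       (Res xs G (par (Bs @ Res zs H (par (As @ P # Ds)) # Cs)))"

inductive eqv :: "env \<Rightarrow> hyp \<Rightarrow> ep trm \<Rightarrow> ep trm \<Rightarrow> bool" where
  eqv_equation: "equation P Q \<Longrightarrow> \<Sigma> \<tturnstile> P \<Colon> \<Psi> \<Longrightarrow> \<Sigma> \<tturnstile> Q \<Colon> \<Psi> \<Longrightarrow> eqv \<Sigma> \<Psi> P Q"
| eqv_refl: "\<Sigma> \<tturnstile> P \<Colon> \<Psi> \<Longrightarrow> eqv \<Sigma> \<Psi> P P"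
| eqv_sym: "eqv \<Sigma> \<Psi> P Q \<Longrightarrow> eqv \<Sigma> \<Psi> Q P"
| eqv_trans: "eqv \<Sigma> \<Psi> P Q \<Longrightarrow> eqv \<Sigma> \<Psi> Q R \<Longrightarrow> eqv \<Sigma> \<Psi> P R"
| eqv_cong:
    "infers F J Ps \<Sigma> \<Psi> \<Longrightarrow> k < length J \<Longrightarrow>
     eqv (fst (J ! k)) (snd (J ! k)) (Ps ! k) Q \<Longrightarrow>
     eqv \<Sigma> \<Psi> (F Ps) (F (Ps[k := Q]))"


section \<open>Extraction and projection\<close>

text \<open>
  \<open>joined \<Sigma> G es Ks\<close>: the endpoints \<open>es\<close> of the parallel components \<open>Ks\<close> are all the
  endpoints of a session of \<open>\<Sigma>\<close>, of global type \<open>G\<close>.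
\<close>

definition joined :: "env \<Rightarrow> ep gtype \<Rightarrow> ep list \<Rightarrow> ep trm list \<Rightarrow> bool" where
  "joined \<Sigma> G es Ks \<longleftrightarrow> 2 \<le> length Ks \<and> length es = length Ks
     \<and> (\<forall>i<length Ks. es ! i \<in> fv (Ks ! i)) \<and> (mset es, G) \<in># \<Sigma>"

text \<open>
  \<open>transf \<Sigma> as L R\<close>: the transformation between \<open>L\<close> and \<open>R\<close>, where \<open>as\<close> are the endpoints
  displayed by the interaction. The global type must prescribe that very interaction:
  the session of the components may well start with another one, and then \<open>R\<close> cannot be
  typed with \<open>\<Sigma>\<close>. The bound endpoints of \<open>R\<close> scope over more components than in \<open>L\<close>,
  whence the freshness conditions.
\<close>

inductive transf :: "env \<Rightarrow> ep list \<Rightarrow> ep trm \<Rightarrow> ep trm \<Rightarrow> bool" where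
  tr_link1:
    "joined \<Sigma> (GLink w (TVar X) y) [w, y] [P, Link x (TVar X) y] \<Longrightarrow>
     transf \<Sigma> [x, y, w]
       (Par P (Link x (TVar X) y))
       (CLink x y (TCoVar X) w P)"
| tr_link2:
    "joined \<Sigma> (GLink w (TCoVar X) y) [w, y] [P, Link y (TVar X) x] \<Longrightarrow>
     transf \<Sigma> [x, y, w]
       (Par P (Link y (TVar X) x))
       (CLink x y (TVar X) w P)"
| tr_comm:
    "xs \<noteq> [] \<Longrightarrow> length xs' = length xs \<Longrightarrow> length Ps = length xs \<Longrightarrow> length Qs = length xs \<Longrightarrow>
     Ks = map (\<lambda>i. Send (xs ! i) (xs' ! i) (Ps ! i) (Qs ! i)) [0..<length xs] @ Recv y y' R # Ss \<Longrightarrow>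
     distinct (xs' @ [y']) \<Longrightarrow> (set xs' \<union> {y'}) \<inter> fv (par Ks) = {} \<Longrightarrow>
     joined \<Sigma> (GComm xs y G H) (xs @ y # us) Ks \<Longrightarrow>
     transf \<Sigma> (xs @ [y])
       (par Ks)
       (Comm xs xs' y y' (par (Ps @ Qs @ R # Ss)))"
| tr_close:
    "joined \<Sigma> (GClose xs y) (xs @ [y]) (map Close xs @ [Wait y P]) \<Longrightarrow>
     transf \<Sigma> (xs @ [y])
       (par (map Close xs @ [Wait y P]))
       (Closes xs y P)"
| tr_inl:
    "length Qs = length ys \<Longrightarrow> length Rs = length ys \<Longrightarrow>
     Ks = Inl x P # map (\<lambda>i. Case (ys ! i) (Qs ! i) (Rs ! i)) [0..<length ys] @ Ss \<Longrightarrow>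
     joined \<Sigma> (GCase x ys G H) (x # ys @ us) Ks \<Longrightarrow>
     transf \<Sigma> (x # ys)
       (par Ks)
       (CInl x ys (par (P # Qs @ Ss)) Rs)"
| tr_inr:
    "length Qs = length ys \<Longrightarrow> length Rs = length ys \<Longrightarrow>
     Ks = Inr x P # map (\<lambda>i. Case (ys ! i) (Qs ! i) (Rs ! i)) [0..<length ys] @ Ss \<Longrightarrow>
     joined \<Sigma> (GCase x ys G H) (x # ys @ us) Ks \<Longrightarrow>
     transf \<Sigma> (x # ys)
       (par Ks)
       (CInr x ys Qs (par (P # Rs @ Ss)))"
| tr_sel:
    "length Rs = length ys \<Longrightarrow> length Ss = length ys \<Longrightarrow>
     Ks = Sel x P Q # map (\<lambda>i. Case (ys ! i) (Rs ! i) (Ss ! i)) [0..<length ys] @ Ts \<Longrightarrow>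
     joined \<Sigma> (GCase x ys G H) (x # ys @ us) Ks \<Longrightarrow>
     transf \<Sigma> (x # ys)
       (par Ks)
       (CSel x ys (par (P # Rs @ Ts)) (par (Q # Ss @ Ts)))"
| tr_starts:
    "length Qs = length ys \<Longrightarrow>
     joined \<Sigma> (GBang x ys G) (x # ys) (Use x P # map2 Srv ys Qs) \<Longrightarrow>
     transf \<Sigma> (x # ys)
       (par (Use x P # map2 Srv ys Qs))
       (Starts x ys (par (P # Qs)))"
| tr_kills:
    "length Qs = length ys \<Longrightarrow>
     joined \<Sigma> (GBang x ys G) (x # ys) (Kill x P # map2 Srv ys Qs) \<Longrightarrow>
     transf \<Sigma> (x # ys)
       (par (Kill x P # map2 Srv ys Qs))
       (Kills x ys Qs P)"
| tr_clones:
    \<comment> \<open>The components \<open>ys\<close> and their copies are joined to \<open>P\<close> by two different sessions.\<close>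
    "length Qs = length ys \<Longrightarrow> length ys' = length ys \<Longrightarrow> length zs' = length zs \<Longrightarrow>
     Ks = Clone x x' P # map2 Srv ys Qs \<Longrightarrow>
     set zs = (\<Union>Q \<in> set Qs. fv Q) - set ys \<Longrightarrow> distinct zs \<Longrightarrow>
     distinct (x' # ys' @ zs') \<Longrightarrow> ({x'} \<union> set ys' \<union> set zs') \<inter> fv (par Ks) = {} \<Longrightarrow>
     joined \<Sigma> (GBang x ys G) (x # ys) Ks \<Longrightarrow>
     transf \<Sigma> (x # ys)
       (par Ks)
       (Clones x ys x' ys' zs zs'
         (par (par (P # map2 Srv ys Qs)
            # map2 Srv ys' (map (map_trm (exch (ys @ zs) (ys' @ zs'))) Qs))))"

text \<open>
  Application of a typed relation at a subterm: the relation is applied to one judgement of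
  a derivation, so that \<open>\<Sigma>\<close> is always the session environment of the rewritten subterm.
\<close>

inductive at_subterm ::
    "(env \<Rightarrow> ep trm \<Rightarrow> ep trm \<Rightarrow> bool) \<Rightarrow> env \<Rightarrow> hyp \<Rightarrow> ep trm \<Rightarrow> ep trm \<Rightarrow> bool" for T where
  here: "\<Sigma> \<tturnstile> P \<Colon> \<Psi> \<Longrightarrow> T \<Sigma> P Q \<Longrightarrow> at_subterm T \<Sigma> \<Psi> P Q"
| inside:
    "infers F J Ps \<Sigma> \<Psi> \<Longrightarrow> k < length J \<Longrightarrow>
     at_subterm T (fst (J ! k)) (snd (J ! k)) (Ps ! k) Q \<Longrightarrow>
     at_subterm T \<Sigma> \<Psi> (F Ps) (F (Ps[k := Q]))"

text \<open>
  Like \<open>eqv\<close>, extraction and projection depend on the typing of the source term. The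
  transformations relate typable terms: a typed \<open>R\<close> is projected only to an \<open>L\<close> that is
  typable, with whatever environment and hypersequent.
\<close>

definition extr :: "env \<Rightarrow> hyp \<Rightarrow> ep list \<Rightarrow> ep trm \<Rightarrow> ep trm \<Rightarrow> bool" where
  "extr \<Sigma> \<Psi> as P P' \<longleftrightarrow>
     (\<exists>P0. eqv \<Sigma> \<Psi> P P0 \<and> at_subterm (\<lambda>\<Sigma> L R. transf \<Sigma> as L R) \<Sigma> \<Psi> P0 P')"

definition proj :: "env \<Rightarrow> hyp \<Rightarrow> ep list \<Rightarrow> ep trm \<Rightarrow> ep trm \<Rightarrow> bool" where
  "proj \<Sigma> \<Psi> as P P' \<longleftrightarrow>
     (\<exists>P0. eqv \<Sigma> \<Psi> P P0 \<and> at_subterm (\<lambda>\<Sigma> R L. transf \<Sigma> as L R \<and> typable L) \<Sigma> \<Psi> P0 P')"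

end

theory Submission
  imports Defs
begin

text \<open>
  Extraction: the given derivation of the parallel composition ends with the Conn that introduces
  the session of the displayed components, up to Conn steps on a single component, which do not
  show in the term. These steps are stripped off, each component is inverted, its continuation is
  put into the remaining session, and the stripped sessions are added back by Conn steps at the end.

  Projection runs backwards, and is delicate only where a branch of the choreography sits in one
  component of the projected term: the two premises of that component must have the same sessions
  and sequents. As the projected term is typable in some way, both branches have the same free
  endpoints, which are the endpoints of their sequents; hence they have the same sequents. Since
  sequents and sessions form a tree, one branch can then have more sessions than the other only by
  sessions with a single endpoint, and these can be added.
\<close>

section \<open>Multisets\<close>

text \<open>The obstacle to connectedness is the empty sequent. It contains no endpoint, so no set
  of endpoints can detect it, and \<open>Bot\<close> or \<open>Weaken\<close> may put an endpoint
  into it, creating a piece that is cut off from the other sequents. Hence a further invariant says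
  that an empty sequent stands alone (\<open>solo\<close>). Conversely, \<open>Scope\<close> can
  produce an empty sequent beside others unless the premise is connected. The invariants therefore
  depend on each other and are proved in one induction, \<open>typed_good\<close>. The tree count
  itself concerns the bipartite graph whose vertices are the sequents and the sessions and whose
  edges are the session endpoints: a tree has one vertex more than edges. Connectedness has a second
  use. The side conditions of \<open>CBangQuest\<close> and \<open>CBangContract\<close> keep the
  server contexts away from all sessions, while \<open>Bang\<close> demands a server with no session
  and no further sequent. That the components found in the premise have this form is exactly
  connectedness (\<open>isolated\<close>).\<close>

lemma nodup_simps [simp]:
  "nodup {#}"
  "nodup (add_mset a M) \<longleftrightarrow> a \<notin># M \<and> nodup M"
  by (auto simp: nodup_def not_in_iff le_Suc_eq)

lemma nodup_union [simp]:
  "nodup (M + N) \<longleftrightarrow> nodup M \<and> nodup N \<and> set_mset M \<inter> set_mset N = {}"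
  by (induction M) auto

lemma nodup_mset [simp]: "nodup (mset xs) \<longleftrightarrow> distinct xs"
  by (induction xs) auto

lemma nodup_image: "nodup M \<Longrightarrow> inj f \<Longrightarrow> nodup (image_mset f M)"
  by (induction M) (auto dest: injD)

lemma nodup_sum:
  fixes f :: "nat \<Rightarrow> 'a multiset"
  shows "nodup (\<Sum>i<n. f i) \<longleftrightarrow>
    (\<forall>i<n. nodup (f i)) \<and> (\<forall>i<n. \<forall>j<n. i \<noteq> j \<longrightarrow> set_mset (f i) \<inter> set_mset (f j) = {})"
proof (induction n)
  case (Suc n)
  have "nodup (\<Sum>i<Suc n. f i) \<longleftrightarrow> nodup (\<Sum>i<n. f i) \<and> nodup (f n)
      \<and> (\<forall>i<n. set_mset (f i) \<inter> set_mset (f n) = {})"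
    by (auto simp: set_mset_sum)
  then show ?case unfolding Suc less_Suc_eq by blast
qed simp

lemma image_mset_sum: "image_mset g (\<Sum>i<(n::nat). f i) = (\<Sum>i<n. image_mset g (f i))"
  by (induction n) auto

lemma filter_mset_sum: "filter_mset P (\<Sum>i<(n::nat). f i) = (\<Sum>i<n. filter_mset P (f i))"
  by (induction n) auto

lemma sum_list_upt [simp]: "sum_list (map f [0..<n]) = (\<Sum>i<n. f i)"
  by (simp add: interv_sum_list_conv_sum_set_nat atLeast0LessThan)

lemma sum_length_nth: "(\<Sum>i<length xs. f (xs ! i)) = sum_list (map f xs)"
  by (simp add: sum_list_sum_nth atLeast0LessThan)

lemma member_sum [simp]: "a \<in># (\<Sum>i<(n::nat). f i) \<longleftrightarrow> (\<exists>i<n. a \<in># f i)"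
  by (auto simp: set_mset_sum)

lemma Union_mset_sum: "\<Sum>\<^sub># (\<Sum>i<(n::nat). f i) = (\<Sum>i<n. \<Sum>\<^sub># (f i))"
  by (induction n) auto

lemma mset_subset_sum: "i < (n::nat) \<Longrightarrow> f i \<subseteq># (\<Sum>i<n. f i)"
  by (metis finite_lessThan lessThan_iff mset_subset_eq_add_left sum.remove)

lemma names_simps [simp]:
  "names {#} = {#}"
  "names (add_mset (x, A) \<Gamma>) = add_mset x (names \<Gamma>)"
  "names (\<Gamma> + \<Delta>) = names \<Gamma> + names \<Delta>"
  "names (\<Sum>i<(n::nat). f i) = (\<Sum>i<n. names (f i))"
  by (auto simp: names_def image_mset_sum)

lemma hdom_simps [simp]:
  "hdom {#} = {#}"
  "hdom (add_mset \<Gamma> \<Psi>) = names \<Gamma> + hdom \<Psi>"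
  "hdom (\<Psi> + \<Phi>) = hdom \<Psi> + hdom \<Phi>"
  "hdom (\<Sum>i<(n::nat). f i) = (\<Sum>i<n. hdom (f i))"
  by (auto simp: hdom_def image_mset_sum Union_mset_sum)

lemma edom_simps [simp]:
  "edom {#} = {#}"
  "edom (add_mset (M, G) \<Sigma>) = M + edom \<Sigma>"
  "edom (\<Sigma> + \<Sigma>') = edom \<Sigma> + edom \<Sigma>'"
  "edom (\<Sum>i<(n::nat). e i) = (\<Sum>i<n. edom (e i))"
  by (auto simp: edom_def image_mset_sum Union_mset_sum)

lemma in_names: "x \<in># names \<Gamma> \<longleftrightarrow> (\<exists>A. (x, A) \<in># \<Gamma>)"
  by (force simp: names_def)

lemma in_hdom: "x \<in># hdom \<Psi> \<longleftrightarrow> (\<exists>\<Gamma>. \<Gamma> \<in># \<Psi> \<and> x \<in># names \<Gamma>)"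
  by (auto simp: hdom_def)

lemma in_edom: "x \<in># edom \<Sigma> \<longleftrightarrow> (\<exists>M G. (M, G) \<in># \<Sigma> \<and> x \<in># M)"
  by (force simp: edom_def)

lemma wf_subset: "wf \<Sigma> \<Psi> \<Longrightarrow> \<Sigma>' \<subseteq># \<Sigma> \<Longrightarrow> wf \<Sigma>' \<Psi>"
  by (auto simp: wf_def elim!: subset_mset.less_eqE)

lemma names_fam [simp]: "names (fam xs A) = mset xs"
proof -
  have "names (fam xs A) = (\<Sum>i<length xs. {#xs ! i#})"
    by (simp add: fam_def)
  also have "\<dots> = mset xs"
    by (simp only: sum_length_nth[of "\<lambda>x. {#x#}"]) simp
  finally show ?thesis .
qed

lemma hdom_seqs [simp]: "hdom (seqs xs \<Gamma> A) = (\<Sum>i<length xs. names (\<Gamma> i)) + mset xs"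
proof -
  have "hdom (seqs xs \<Gamma> A) = (\<Sum>i<length xs. names (\<Gamma> i)) + (\<Sum>i<length xs. {#xs ! i#})"
    by (simp add: seqs_def sum.distrib [symmetric])
  also have "(\<Sum>i<length xs. {#xs ! i#}) = mset xs"
    by (simp only: sum_length_nth[of "\<lambda>x. {#x#}"]) simp
  finally show ?thesis .
qed

lemma size_seqs [simp]: "size (seqs xs \<Gamma> A) = length xs"
  by (simp add: seqs_def)

lemma in_seqs: "\<Delta> \<in># seqs xs \<Gamma> A \<longleftrightarrow> (\<exists>i<length xs. \<Delta> = add_mset (xs ! i, A i) (\<Gamma> i))"
  by (auto simp: seqs_def)

lemma in_fam: "p \<in># fam xs A \<longleftrightarrow> (\<exists>i<length xs. p = (xs ! i, A i))"
  by (auto simp: fam_def)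

lemma fam_Cons: "fam (x # xs) A = add_mset (x, A 0) (fam xs (\<lambda>i. A (Suc i)))"
  unfolding fam_def by (simp add: sum.lessThan_Suc_shift del: sum.lessThan_Suc)

lemma fam_cong: "(\<And>i. i < length xs \<Longrightarrow> A i = B i) \<Longrightarrow> fam xs A = fam xs B"
  by (auto simp: fam_def intro!: sum.cong)

lemma seqs_cong:
  "(\<And>i. i < length xs \<Longrightarrow> A i = B i) \<Longrightarrow> (\<And>i. i < length xs \<Longrightarrow> \<Gamma> i = \<Delta> i) \<Longrightarrow>
   seqs xs \<Gamma> A = seqs xs \<Delta> B"
  by (auto simp: seqs_def intro!: sum.cong)

text \<open>Coherence of a session depends on the types of its endpoints, but not on how these are
  grouped into sequents.\<close>

definition flat :: "hyp \<Rightarrow> ctx" where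
  "flat \<Psi> = \<Sum>\<^sub># \<Psi>"

lemma flat_simps [simp]:
  "flat {#} = {#}"
  "flat (add_mset \<Gamma> \<Psi>) = \<Gamma> + flat \<Psi>"
  "flat (\<Psi> + \<Phi>) = flat \<Psi> + flat \<Phi>"
  "flat (\<Sum>i<(n::nat). f i) = (\<Sum>i<n. flat (f i))"
  by (auto simp: flat_def Union_mset_sum)

lemma names_flat [simp]: "names (flat \<Psi>) = hdom \<Psi>"
  by (induction \<Psi>) auto

lemma flat_seqs [simp]: "flat (seqs xs \<Gamma> A) = (\<Sum>i<length xs. \<Gamma> i) + fam xs A"
  by (simp add: seqs_def fam_def sum.distrib [symmetric])

lemma typing_unique:
  "nodup (names \<Delta>) \<Longrightarrow> (x, A) \<in># \<Delta> \<Longrightarrow> (x, B) \<in># \<Delta> \<Longrightarrow> A = B"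
  by (drule multi_member_split[of "(x, A)"]) (auto simp: in_names)

lemma sequent_unique:
  "nodup (hdom \<Psi>) \<Longrightarrow> \<Gamma> \<in># \<Psi> \<Longrightarrow> \<Delta> \<in># \<Psi> \<Longrightarrow> x \<in># names \<Gamma> \<Longrightarrow> x \<in># names \<Delta> \<Longrightarrow> \<Gamma> = \<Delta>"
  by (drule multi_member_split[of \<Gamma>]) (fastforce simp: in_hdom)

text \<open>Used to match two decompositions of one hypersequent, typically the one shown by an
  inverted rule and the one found by splitting a composition: sharing a declared endpoint is
  enough.\<close>

lemma focus_unique:
  assumes "nodup (hdom \<Psi>)" "add_mset (x, A) \<Gamma> \<in># \<Psi>" "add_mset (x, B) \<Delta> \<in># \<Psi>"
  shows "A = B \<and> \<Gamma> = \<Delta>"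
proof -
  have eq: "add_mset (x, A) \<Gamma> = add_mset (x, B) \<Delta>"
    using sequent_unique[OF assms, of x] by simp
  have nd: "nodup (names (add_mset (x, A) \<Gamma>))"
    using assms(1,2) by (auto dest!: multi_member_split)
  have "(x, B) \<in># add_mset (x, A) \<Gamma>" by (simp add: eq)
  then have "A = B" using typing_unique[OF nd, of x A B] by simp
  then show ?thesis using eq by simp
qed

lemma session_unique:
  "nodup (edom \<Sigma>) \<Longrightarrow> (M, G) \<in># \<Sigma> \<Longrightarrow> (N, H) \<in># \<Sigma> \<Longrightarrow> x \<in># M \<Longrightarrow> x \<in># N \<Longrightarrow> M = N \<and> G = H"
  by (drule multi_member_split[of "(M, G)"]) (fastforce simp: in_edom)

section \<open>Parallel composition\<close>

lemma par_Cons: "Ks \<noteq> [] \<Longrightarrow> par (K # Ks) = Par K (par Ks)"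
  by (cases Ks) auto

text \<open>The bar associates to the right, so a Conn whose last component is itself a Conn builds
  the same term as a single flat composition. This is how a term with two nested sessions, as under
  a communication, is built and read back.\<close>

lemma par_append_par: "Bs \<noteq> [] \<Longrightarrow> par (As @ [par Bs]) = par (As @ Bs)"
  by (induction As) (auto simp: par_Cons)

text \<open>The number of components must be fixed, since \<open>par [Par P Q]\<close> and
  \<open>par [P, Q]\<close> are the same term.\<close>

lemma par_inj: "length Ks = length Ls \<Longrightarrow> Ks \<noteq> [] \<Longrightarrow> par Ks = par Ls \<Longrightarrow> Ks = Ls"
proof (induction Ks Ls rule: list_induct2)
  case (Cons K Ks L Ls)
  then show ?case by (cases Ks; cases Ls) auto
qed simp

lemma fv_par: "Ks \<noteq> [] \<Longrightarrow> fv (par Ks) = (\<Union>K\<in>set Ks. fv K)"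
  by (induction Ks rule: par.induct) auto

lemma map_par: "Ks \<noteq> [] \<Longrightarrow> map_trm f (par Ks) = par (map (map_trm f) Ks)"
  by (induction Ks rule: par.induct) auto

section \<open>Coherence\<close>

lemma coherent_nodup: "G \<Turnstile> \<Gamma> \<Longrightarrow> nodup (names \<Gamma>)"
  by (induction rule: coherent.induct) auto

text \<open>Every global type constrains at least one endpoint. Consequently a Conn has at least one
  component, and \<open>par\<close> is never applied to the empty list in a derivation.\<close>

lemma coherent_nonempty: "G \<Turnstile> \<Gamma> \<Longrightarrow> \<Gamma> \<noteq> {#}"
  by (induction rule: coherent.induct) auto

text \<open>This makes the side conditions on \<open>evars\<close> conditions on session endpoints
  alone, as soon as all sessions are coherent.\<close>

lemma coherent_vars: "G \<Turnstile> \<Gamma> \<Longrightarrow> set_gtype G \<subseteq> set_mset (names \<Gamma>)"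
  by (induction rule: coherent.induct) auto

inductive_cases coherent_commE: "GComm xs y G H \<Turnstile> \<Gamma>"
inductive_cases coherent_caseE: "GCase x ys G H \<Turnstile> \<Gamma>"
inductive_cases coherent_bangE: "GBang x ys G \<Turnstile> \<Gamma>"
inductive_cases coherent_linkE: "GLink x A y \<Turnstile> \<Gamma>"

section \<open>Renaming\<close>

definition rC :: "(ep \<Rightarrow> ep) \<Rightarrow> ctx \<Rightarrow> ctx" where
  "rC f \<Gamma> = image_mset (map_prod f id) \<Gamma>"

definition rH :: "(ep \<Rightarrow> ep) \<Rightarrow> hyp \<Rightarrow> hyp" where
  "rH f \<Psi> = image_mset (rC f) \<Psi>"

definition rE :: "(ep \<Rightarrow> ep) \<Rightarrow> env \<Rightarrow> env" where
  "rE f \<Sigma> = image_mset (map_prod (image_mset f) (map_gtype f)) \<Sigma>"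

lemma rC_simps [simp]:
  "rC f {#} = {#}"
  "rC f (add_mset (x, A) \<Gamma>) = add_mset (f x, A) (rC f \<Gamma>)"
  "rC f (\<Gamma> + \<Delta>) = rC f \<Gamma> + rC f \<Delta>"
  "rC f (\<Sum>i<(n::nat). g i) = (\<Sum>i<n. rC f (g i))"
  by (auto simp: rC_def image_mset_sum)

lemma rH_simps [simp]:
  "rH f {#} = {#}"
  "rH f (add_mset \<Gamma> \<Psi>) = add_mset (rC f \<Gamma>) (rH f \<Psi>)"
  "rH f (\<Psi> + \<Phi>) = rH f \<Psi> + rH f \<Phi>"
  "rH f (\<Sum>i<(n::nat). h i) = (\<Sum>i<n. rH f (h i))"
  by (auto simp: rH_def image_mset_sum)

lemma rE_simps [simp]:
  "rE f {#} = {#}"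
  "rE f (add_mset (M, G) \<Sigma>) = add_mset (image_mset f M, map_gtype f G) (rE f \<Sigma>)"
  "rE f (\<Sigma> + \<Sigma>') = rE f \<Sigma> + rE f \<Sigma>'"
  "rE f (\<Sum>i<(n::nat). e i) = (\<Sum>i<n. rE f (e i))"
  by (auto simp: rE_def image_mset_sum)

lemma rC_fam [simp]: "rC f (fam xs A) = fam (map f xs) A"
  by (simp add: fam_def)

lemma rH_seqs [simp]: "rH f (seqs xs \<Gamma> A) = seqs (map f xs) (\<lambda>i. rC f (\<Gamma> i)) A"
  by (simp add: seqs_def)

lemma names_rC [simp]: "names (rC f \<Gamma>) = image_mset f (names \<Gamma>)"
  by (simp add: names_def rC_def image_mset.compositionality comp_def)

lemma hdom_rH [simp]: "hdom (rH f \<Psi>) = image_mset f (hdom \<Psi>)"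
  by (induction \<Psi>) auto

lemma edom_rE [simp]: "edom (rE f \<Sigma>) = image_mset f (edom \<Sigma>)"
  by (induction \<Sigma>) auto

lemma evars_rE [simp]: "evars (rE f \<Sigma>) = f ` evars \<Sigma>"
  by (force simp: evars_def rE_def gtype.set_map)

lemma quest_rC [simp]: "quest_ctx (rC f \<Gamma>) \<longleftrightarrow> quest_ctx \<Gamma>"
  by (auto simp: quest_ctx_def rC_def)

lemma rC_comp: "rC f (rC g \<Gamma>) = rC (f \<circ> g) \<Gamma>"
  by (auto simp: rC_def multiset.map_comp intro!: image_mset_cong)

lemma rC_cong: "(\<And>x. x \<in># names \<Gamma> \<Longrightarrow> f x = g x) \<Longrightarrow> rC f \<Gamma> = rC g \<Gamma>"
  by (force simp: rC_def in_names intro!: image_mset_cong)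

lemma rC_id: "rC id \<Gamma> = \<Gamma>"
  by (simp add: rC_def prod.map_id0)

lemma rC_ident: "(\<And>x. x \<in># names \<Gamma> \<Longrightarrow> f x = x) \<Longrightarrow> rC f \<Gamma> = \<Gamma>"
  using rC_cong[of \<Gamma> f id] by (simp add: rC_id)

lemma rH_ident: "(\<And>x. x \<in># hdom \<Psi> \<Longrightarrow> f x = x) \<Longrightarrow> rH f \<Psi> = \<Psi>"
  by (induction \<Psi>) (auto intro: rC_ident)

lemma rE_ident:
  assumes "\<And>x. x \<in> evars \<Sigma> \<Longrightarrow> f x = x"
  shows "rE f \<Sigma> = \<Sigma>"
proof -
  have "map_prod (image_mset f) (map_gtype f) s = s" if "s \<in># \<Sigma>" for s
  proof (cases s)
    case (Pair M G)
    then have "set_mset M \<union> set_gtype G \<subseteq> evars \<Sigma>"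
      using that by (auto simp: evars_def)
    then have "image_mset f M = image_mset id M" "map_gtype f G = map_gtype id G"
      using assms by (intro image_mset_cong gtype.map_cong0; auto)+
    then show ?thesis using Pair by (simp add: gtype.map_id)
  qed
  then show ?thesis unfolding rE_def by (metis image_mset_cong multiset.map_ident)
qed

lemma coherent_rename: "G \<Turnstile> \<Gamma> \<Longrightarrow> inj f \<Longrightarrow> map_gtype f G \<Turnstile> rC f \<Gamma>"
proof (induction rule: coherent.induct)
  case (coh_comm G xs A y C H \<Gamma> B D)
  then show ?case using coherent.coh_comm[of _ "map f xs" A "f y" C _ "rC f \<Gamma>" B D] by simp
next
  case (coh_close xs y)
  have "nodup (image_mset f (mset xs + {#y#}))"
    using coh_close nodup_image by blast
  then have "nodup (mset (map f xs) + {#f y#})"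
    by simp
  from coherent.coh_close[OF this] show ?case by simp
next
  case (coh_case G1 \<Gamma> x A ys C G2 B D)
  then show ?case using coherent.coh_case[of _ "rC f \<Gamma>" "f x" A "map f ys" C _ B D] by simp
next
  case (coh_bang G x A ys B)
  then show ?case using coherent.coh_bang[of _ "f x" A "map f ys" B] by simp
next
  case (coh_empty \<Gamma> x ys)
  have "nodup (image_mset f (names \<Gamma> + {#x#} + mset ys))"
    using coh_empty nodup_image by blast
  then have "nodup (names (rC f \<Gamma>) + {#f x#} + mset (map f ys))"
    by simp
  from coherent.coh_empty[OF this] show ?case by simp
next
  case (coh_link x y A)
  then show ?case using coherent.coh_link[of "f x" "f y" A] by (auto dest: injD)
qed

section \<open>The exchange of two lists of endpoints\<close>

lemma exch_nil [simp]: "exch [] [] = id"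
  by (auto simp: exch_def)

lemma exch_fst:
  assumes "distinct xs" "length ys = length xs" "i < length xs"
  shows "exch xs ys (xs ! i) = ys ! i"
  using assms by (simp add: exch_def map_of_zip_nth map_add_def)

lemma exch_snd:
  assumes "distinct ys" "length ys = length xs" "i < length xs" "set xs \<inter> set ys = {}"
  shows "exch xs ys (ys ! i) = xs ! i"
proof -
  have "map_of (zip xs ys) (ys ! i) = None"
    using assms nth_mem by (fastforce simp: map_of_zip_is_None)
  moreover have "map_of (zip ys xs) (ys ! i) = Some (xs ! i)"
    using assms by (simp add: map_of_zip_nth)
  ultimately show ?thesis
    by (simp add: exch_def map_add_def)
qed

lemma exch_other:
  assumes "length ys = length xs" "z \<notin> set xs" "z \<notin> set ys"
  shows "exch xs ys z = z"
proof -
  have "map_of (zip xs ys) z = None" "map_of (zip ys xs) z = None"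
    using assms by (auto simp: map_of_zip_is_None)
  then show ?thesis by (simp add: exch_def map_add_def)
qed

lemma exch_involutive:
  assumes "distinct xs" "distinct ys" "length ys = length xs" "set xs \<inter> set ys = {}"
  shows "exch xs ys (exch xs ys z) = z"
proof -
  consider i where "i < length xs" "z = xs ! i" | i where "i < length xs" "z = ys ! i"
    | "z \<notin> set xs" "z \<notin> set ys"
    using assms(3) by (metis in_set_conv_nth)
  then show ?thesis
    by cases (use assms in \<open>auto simp: exch_fst exch_snd exch_other\<close>)
qed

lemma exch_inj:
  assumes "distinct xs" "distinct ys" "length ys = length xs" "set xs \<inter> set ys = {}"
  shows "inj (exch xs ys)"
  by (metis assms exch_involutive injI)

lemma map_exch:
  assumes "distinct xs" "length ys = length xs"
  shows "map (exch xs ys) xs = ys"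
  using assms by (auto intro!: nth_equalityI simp: exch_fst)

lemma exch_single [simp]: "exch [a] [b] z = (if z = a then b else if z = b then a else z)"
  by (auto simp: exch_def)

lemma inj_exch_single: "inj (exch [a] [b])"
  by (auto simp: inj_def)

lemma map_of_map_inj:
  "inj f \<Longrightarrow> map_of (map (map_prod f f) ps) (f z) = map_option f (map_of ps z)"
  by (induction ps) (auto dest: injD)

text \<open>Conjugating an exchange by an injective renaming gives the exchange of the renamed
  lists. With this, the rules that contain an exchange (\<open>CAx\<close>,
  \<open>CTensorParr\<close>, \<open>CBangContract\<close>) are invariant under renaming like the
  others.\<close>

lemma exch_natural: "inj f \<Longrightarrow> exch (map f xs) (map f ys) (f z) = f (exch xs ys z)"
proof -
  assume "inj f"
  moreover have "zip (map f xs) (map f ys) @ zip (map f ys) (map f xs)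
    = map (map_prod f f) (zip xs ys @ zip ys xs)"
    by (simp add: zip_map_map map_prod_def)
  ultimately have "map_of (zip (map f xs) (map f ys) @ zip (map f ys) (map f xs)) (f z)
    = map_option f (map_of (zip xs ys @ zip ys xs) z)"
    by (metis map_of_map_inj)
  then show ?thesis
    unfolding exch_def by (cases "map_of (zip xs ys @ zip ys xs) z") (simp_all del: map_of_append)
qed

lemma exch_natural': "inj f \<Longrightarrow> exch (map f xs) (map f ys) \<circ> f = f \<circ> exch xs ys"
  by (rule ext) (simp only: comp_apply, rule exch_natural)

text \<open>The environments and hypersequents of a rule usually agree with those at hand only up to
  rearrangement of multisets; this turns the mismatch into separate equations.\<close>

lemma rule_eqI: "rule F J S H \<Longrightarrow> J = J' \<Longrightarrow> S = S' \<Longrightarrow> H = H' \<Longrightarrow> rule F J' S' H'"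
  by simp

lemma hd_map_Suc: "length Ps = Suc n \<Longrightarrow> hd (map f Ps) = f (hd Ps)"
  by (cases Ps) auto

text \<open>The term former contains endpoints as well and has to be renamed, hence the existential
  \<open>F'\<close>. It is compared with \<open>F\<close> only on lists of the right length, because
  selecting premises from a shorter list, or composing the empty list, is unspecified.\<close>

lemma rule_rename:
  assumes "rule F J \<Sigma> \<Psi>" "inj f"
  shows "\<exists>F'. rule F' (map (map_prod (rE f) (rH f)) J) (rE f \<Sigma>) (rH f \<Psi>) \<and>
    (\<forall>Ps. length Ps = length J \<longrightarrow> F' (map (map_trm f) Ps) = map_trm f (F Ps))"
  using assms
proof (induction rule: rule.induct)
  case (Conn G xs A \<Sigma>i \<Psi>i \<Gamma>i)
  have c: "map_gtype f G \<Turnstile> fam (map f xs) A"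
    using coherent_rename[OF Conn] by simp
  have ne: "xs \<noteq> []"
    using coherent_nonempty[OF Conn(1)] by (auto simp: fam_def)
  have p: "par (map (map_trm f) Ps) = map_trm f (par Ps)" if "length Ps = length xs" for Ps
    using that ne by (intro map_par[symmetric]) auto
  show ?case
    by (intro exI[of _ par] conjI,
        rule rule_eqI[OF rule.Conn[OF c, of "\<lambda>i. rE f (\<Sigma>i i)" "\<lambda>i. rH f (\<Psi>i i)" "\<lambda>i. rC f (\<Gamma>i i)"]])
      (auto simp: p intro!: sum.cong)
next
  case (Scope xs G \<Sigma> \<Psi> \<Gamma>i A)
  show ?case
    by (intro exI[of _ "un (Res (map f xs) (map_gtype f G))"] conjI,
        rule rule_eqI[OF rule.Scope[of "map f xs" _ "rE f \<Sigma>" "rH f \<Psi>" "\<lambda>i. rC f (\<Gamma>i i)" A]])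
      (auto simp: un_def)
next
  case (Ax A x y)
  show ?case
    by (intro exI[of _ "\<lambda>_. Link (f x) A (f y)"] conjI, rule rule_eqI[OF rule.Ax[OF Ax(1)]]) auto
next
  case (Tensor x \<Sigma>1 \<Sigma>2 x' \<Psi>1 \<Gamma>1 A \<Psi>2 \<Gamma>2 B)
  have "f x \<notin># edom (rE f \<Sigma>1 + rE f \<Sigma>2)" "f x' \<notin># edom (rE f \<Sigma>1 + rE f \<Sigma>2)"
    using Tensor by (auto dest: injD)
  note r = rule.Tensor[OF this, of "rH f \<Psi>1" "rC f \<Gamma>1" A "rH f \<Psi>2" "rC f \<Gamma>2" B]
  show ?case
    by (intro exI[of _ "bin (Send (f x) (f x'))"] conjI, rule rule_eqI[OF r]) (auto simp: bin_def)
next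
  case (Parr y \<Sigma> y' \<Psi> \<Gamma> A B)
  have "f y \<notin># edom (rE f \<Sigma>)" "f y' \<notin># edom (rE f \<Sigma>)"
    using Parr by (auto dest: injD)
  note r = rule.Parr[OF this, of "rH f \<Psi>" "rC f \<Gamma>" A B]
  show ?case
    by (intro exI[of _ "un (Recv (f y) (f y'))"] conjI, rule rule_eqI[OF r]) (auto simp: un_def)
next
  case (One x)
  show ?case
    by (intro exI[of _ "\<lambda>_. Close (f x)"] conjI, rule rule_eqI[OF rule.One]) auto
next
  case (Bot y \<Sigma> \<Psi> \<Gamma>)
  have "f y \<notin># edom (rE f \<Sigma>)"
    using Bot by (auto dest: injD)
  note r = rule.Bot[OF this, of "rH f \<Psi>" "rC f \<Gamma>"]
  show ?case
    by (intro exI[of _ "un (Wait (f y))"] conjI, rule rule_eqI[OF r]) (auto simp: un_def)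
next
  case (Top \<Gamma> us x)
  have "names (rC f \<Gamma>) = mset (map f us)"
    using Top by simp
  note r = rule.Top[OF this, of "f x"]
  show ?case
    by (intro exI[of _ "\<lambda>_. Empty (f x) (map f us)"] conjI, rule rule_eqI[OF r]) auto
next
  case (Oplus1 x \<Sigma> \<Psi> \<Gamma> A B)
  have "f x \<notin># edom (rE f \<Sigma>)"
    using Oplus1 by (auto dest: injD)
  note r = rule.Oplus1[OF this, of "rH f \<Psi>" "rC f \<Gamma>" A B]
  show ?case
    by (intro exI[of _ "un (Inl (f x))"] conjI, rule rule_eqI[OF r]) (auto simp: un_def)
next
  case (Oplus2 x \<Sigma> \<Psi> \<Gamma> B A)
  have "f x \<notin># edom (rE f \<Sigma>)"
    using Oplus2 by (auto dest: injD)
  note r = rule.Oplus2[OF this, of "rH f \<Psi>" "rC f \<Gamma>" B A]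
  show ?case
    by (intro exI[of _ "un (Inr (f x))"] conjI, rule rule_eqI[OF r]) (auto simp: un_def)
next
  case (Oplus x \<Sigma> \<Psi> \<Gamma> A B)
  have "f x \<notin># edom (rE f \<Sigma>)"
    using Oplus by (auto dest: injD)
  note r = rule.Oplus[OF this, of "rH f \<Psi>" "rC f \<Gamma>" A B]
  show ?case
    by (intro exI[of _ "bin (Sel (f x))"] conjI, rule rule_eqI[OF r]) (auto simp: bin_def)
next
  case (With y \<Sigma> \<Psi> \<Gamma> A B)
  have "f y \<notin># edom (rE f \<Sigma>)"
    using With by (auto dest: injD)
  note r = rule.With[OF this, of "rH f \<Psi>" "rC f \<Gamma>" A B]
  show ?case
    by (intro exI[of _ "bin (Case (f y))"] conjI, rule rule_eqI[OF r]) (auto simp: bin_def)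
next
  case (Bang \<Gamma> y A)
  then have "quest_ctx (rC f \<Gamma>)" by simp
  note r = rule.Bang[OF this, of "f y" A]
  show ?case
    by (intro exI[of _ "un (Srv (f y))"] conjI, rule rule_eqI[OF r]) (auto simp: un_def)
next
  case (Quest x \<Sigma> \<Psi> \<Gamma> A)
  have "f x \<notin># edom (rE f \<Sigma>)"
    using Quest by (auto dest: injD)
  note r = rule.Quest[OF this, of "rH f \<Psi>" "rC f \<Gamma>" A]
  show ?case
    by (intro exI[of _ "un (Use (f x))"] conjI, rule rule_eqI[OF r]) (auto simp: un_def)
next
  case (Weaken x \<Sigma> \<Psi> \<Gamma> A)
  have "f x \<notin># edom (rE f \<Sigma>)"
    using Weaken by (auto dest: injD)
  note r = rule.Weaken[OF this, of "rH f \<Psi>" "rC f \<Gamma>" A]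
  show ?case
    by (intro exI[of _ "un (Kill (f x))"] conjI, rule rule_eqI[OF r]) (auto simp: un_def)
next
  case (Contract x \<Sigma> x' \<Psi> \<Gamma> A)
  have "f x \<notin># edom (rE f \<Sigma>)" "f x' \<notin># edom (rE f \<Sigma>)"
    using Contract by (auto dest: injD)
  note r = rule.Contract[OF this, of "rH f \<Psi>" "rC f \<Gamma>" A]
  show ?case
    by (intro exI[of _ "un (Clone (f x) (f x'))"] conjI, rule rule_eqI[OF r]) (auto simp: un_def)
next
  case (CAx w \<Sigma> A B y x \<Psi> \<Gamma>)
  have "f w \<notin> evars (rE f \<Sigma>)"
    using CAx by (auto dest: injD)
  note r = rule.CAx[OF this CAx(2,3), of "f y" "f x" "rH f \<Psi>" "rC f \<Gamma>"]
  show ?case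
    by (intro exI[of _ "un (\<lambda>P. CLink (f w) (f y) B (f x) (map_trm (exch [f x] [f w]) P))"] conjI, rule rule_eqI[OF r])
      (use exch_natural'[OF CAx(4), of "[x]" "[w]"] in \<open>auto simp: un_def trm.map_comp\<close>)
next
  case (CTensorParr xs' xs y y' \<Sigma> us H G \<Psi> \<Gamma>1 A \<Gamma>2 B \<Gamma> C D)
  have l: "length (map f xs') = length (map f xs)" using CTensorParr by simp
  have e: "map_gtype (exch (map f xs @ [f y]) (map f xs' @ [f y'])) (map_gtype f G) =
      map_gtype f (map_gtype (exch (xs @ [y]) (xs' @ [y'])) G)"
    using exch_natural'[OF CTensorParr(2), of "xs @ [y]" "xs' @ [y']"] by (simp add: gtype.map_comp)
  show ?case
    by (intro exI[of _ "un (Comm (map f xs) (map f xs') (f y) (f y'))"] conjI,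
        rule rule_eqI[OF rule.CTensorParr[OF l, of "f y" "f y'" "rE f \<Sigma>" "map f us" "map_gtype f H"
        "map_gtype f G" "rH f \<Psi>" "\<lambda>i. rC f (\<Gamma>1 i)" A "\<lambda>i. rC f (\<Gamma>2 i)" B "rC f \<Gamma>" C D]])
      (auto simp: un_def e)
next
  case (COneBot xs y \<Sigma> \<Psi> \<Gamma>)
  note r = rule.COneBot[of "map f xs" "f y" "rE f \<Sigma>" "rH f \<Psi>" "rC f \<Gamma>"]
  show ?case
    by (intro exI[of _ "un (Closes (map f xs) (f y))"] conjI, rule rule_eqI[OF r]) (auto simp: un_def)
next
  case (COplusWith1 H x B ys D us E \<Sigma> \<Sigma>i G \<Psi> \<Psi>i \<Gamma> A \<Gamma>i C \<Delta>)
  have "map_gtype f H \<Turnstile> {#(f x, B)#} + fam (map f ys) D + fam (map f us) E"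
    using coherent_rename[OF COplusWith1] by simp
  note r = rule.COplusWith1[OF this, of "rE f \<Sigma>" "\<lambda>i. rE f (\<Sigma>i i)" "map_gtype f G" "rH f \<Psi>" "\<lambda>i. rH f (\<Psi>i i)"
     "rC f \<Gamma>" A "\<lambda>i. rC f (\<Gamma>i i)" C "\<lambda>i. rC f (\<Delta> i)"]
  show ?case
    by (intro exI[of _ "\<lambda>Ps. CInl (f x) (map f ys) (hd Ps) (tl Ps)"] conjI, rule rule_eqI[OF r])
      (auto simp: hd_map_Suc map_tl)
next
  case (COplusWith2 G x A ys C us E \<Sigma> \<Sigma>i H \<Psi> \<Psi>i \<Gamma> B \<Gamma>i D \<Delta>)
  have "map_gtype f G \<Turnstile> {#(f x, A)#} + fam (map f ys) C + fam (map f us) E"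
    using coherent_rename[OF COplusWith2] by simp
  note r = rule.COplusWith2[OF this, of "rE f \<Sigma>" "\<lambda>i. rE f (\<Sigma>i i)" "map_gtype f H" "rH f \<Psi>" "\<lambda>i. rH f (\<Psi>i i)"
     "rC f \<Gamma>" B "\<lambda>i. rC f (\<Gamma>i i)" D "\<lambda>i. rC f (\<Delta> i)"]
  show ?case
    by (intro exI[of _ "\<lambda>Ps. CInr (f x) (map f ys) (tl Ps) (hd Ps)"] conjI, rule rule_eqI[OF r])
      (auto simp: hd_map_Suc map_tl)
next
  case (COplusWith x ys \<Sigma> us G \<Psi> \<Gamma> A \<Gamma>i C H B D)
  show ?case
    by (intro exI[of _ "bin (CSel (f x) (map f ys))"] conjI,
        rule rule_eqI[OF rule.COplusWith[of "f x" "map f ys" "rE f \<Sigma>" "map f us" "map_gtype f G" "rH f \<Psi>"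
         "rC f \<Gamma>" A "\<lambda>i. rC f (\<Gamma>i i)" C "map_gtype f H" B D]])
      (auto simp: bin_def)
next
  case (CBangQuest ys \<Gamma>i \<Sigma> x G \<Psi> \<Gamma> A B)
  have "\<forall>i<length (map f ys). quest_ctx (rC f (\<Gamma>i i)) \<and>
      set_mset (names (rC f (\<Gamma>i i))) \<inter> evars (rE f \<Sigma>) = {}"
    using CBangQuest by (fastforce dest: injD)
  note r = rule.CBangQuest[OF this, of "f x" "map_gtype f G" "rH f \<Psi>" "rC f \<Gamma>" A B]
  show ?case
    by (intro exI[of _ "un (Starts (f x) (map f ys))"] conjI, rule rule_eqI[OF r])
      (auto simp: un_def)
next
  case (CBangWeaken G x A ys B \<Gamma>i \<Sigma> \<Psi> \<Gamma>)
  have "map_gtype f G \<Turnstile> {#(f x, A)#} + fam (map f ys) B"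
    using coherent_rename[OF CBangWeaken(1,3)] by simp
  moreover have "\<forall>i<length (map f ys). quest_ctx (rC f (\<Gamma>i i))"
    using CBangWeaken by simp
  ultimately have r: "rule (\<lambda>Ps. Kills (f x) (map f ys) (tl Ps) (hd Ps))
       ((rE f \<Sigma>, rH f \<Psi> + {#rC f \<Gamma>#}) # map (\<lambda>i. ({#}, {#rC f (\<Gamma>i i) + {#(map f ys ! i, B i)#}#})) [0..<length (map f ys)])
       (rE f \<Sigma> + {#({#f x#} + mset (map f ys), GBang (f x) (map f ys) (map_gtype f G))#})
       (rH f \<Psi> + {#rC f \<Gamma> + {#(f x, Quest A)#}#} + seqs (map f ys) (\<lambda>i. rC f (\<Gamma>i i)) (\<lambda>i. Bang (B i)))"
    by (rule rule.CBangWeaken)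
  show ?case
    by (intro exI[of _ "\<lambda>Ps. Kills (f x) (map f ys) (tl Ps) (hd Ps)"] conjI, rule rule_eqI[OF r])
      (auto simp: hd_map_Suc map_tl)
next
  case (CBangContract ys' ys zs' zs \<Gamma>i \<Gamma>i' \<Sigma> x x' G \<Psi> \<Gamma> A B)
  have l: "length (map f ys') = length (map f ys)" "length (map f zs') = length (map f zs)"
    using CBangContract by simp_all
  have "image_mset f (mset zs) = image_mset f (\<Sum>i<length ys. names (\<Gamma>i i))"
    using CBangContract by simp
  then have z: "mset (map f zs) = (\<Sum>i<length (map f ys). names (rC f (\<Gamma>i i)))"
    by (simp add: image_mset_sum)
  have g: "(\<lambda>i. rC f (\<Gamma>i' i)) =
      (\<lambda>i. image_mset (map_prod (exch (map f zs) (map f zs')) id) (rC f (\<Gamma>i i)))"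
    using exch_natural'[OF CBangContract(6), of zs zs']
    by (simp add: CBangContract(4) rC_def[symmetric] rC_comp)
  have s: "\<forall>i<length (map f ys). quest_ctx (rC f (\<Gamma>i i)) \<and>
      (set_mset (names (rC f (\<Gamma>i i))) \<union> set_mset (names (rC f (\<Gamma>i' i)))) \<inter> evars (rE f \<Sigma>) = {}"
  proof (intro allI impI conjI)
    fix i assume i: "i < length (map f ys)"
    then show "quest_ctx (rC f (\<Gamma>i i))" using CBangContract(5) by simp
    have "(set_mset (names (\<Gamma>i i)) \<union> set_mset (names (\<Gamma>i' i))) \<inter> evars \<Sigma> = {}"
      using CBangContract(5) i by simp
    then show "(set_mset (names (rC f (\<Gamma>i i))) \<union> set_mset (names (rC f (\<Gamma>i' i)))) \<inter> evars (rE f \<Sigma>) = {}"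
      using CBangContract(6) by (auto dest: injD)
  qed
  have e: "map_gtype (exch (map f (x # ys)) (map f (x' # ys'))) (map_gtype f G) =
      map_gtype f (map_gtype (exch (x # ys) (x' # ys')) G)"
    using exch_natural'[OF CBangContract(6), of "x # ys" "x' # ys'"] by (simp only: gtype.map_comp)
  note r = rule.CBangContract[OF l z g s, of "f x" "f x'" "map_gtype f G" "rH f \<Psi>" "rC f \<Gamma>" A B]
  show ?case
    by (intro exI[of _ "un (Clones (f x) (map f ys) (f x') (map f ys') (map f zs) (map f zs'))"] conjI,
        rule rule_eqI[OF r])
      (use e in \<open>auto simp: un_def\<close>)
qed

lemma wf_rename: "wf \<Sigma> \<Psi> \<Longrightarrow> inj f \<Longrightarrow> wf (rE f \<Sigma>) (rH f \<Psi>)"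
  by (simp add: wf_def nodup_image)

lemma typed_rename: "\<Sigma> \<tturnstile> P \<Colon> \<Psi> \<Longrightarrow> inj f \<Longrightarrow> rE f \<Sigma> \<tturnstile> map_trm f P \<Colon> rH f \<Psi>"
proof (induction rule: typed.induct)
  case (1 F J \<Sigma> \<Psi> Ps)
  obtain F' where F': "rule F' (map (map_prod (rE f) (rH f)) J) (rE f \<Sigma>) (rH f \<Psi>)"
    "F' (map (map_trm f) Ps) = map_trm f (F Ps)"
    using rule_rename[OF 1(1,6)] 1(3) by metis
  have "rE f \<Sigma> \<tturnstile> F' (map (map_trm f) Ps) \<Colon> rH f \<Psi>"
    by (rule typed.intros[OF F'(1)]) (use 1 in \<open>auto simp: wf_rename\<close>)
  then show ?case by (simp add: F'(2))
qed

lemma fv_rename: "inj f \<Longrightarrow> fv (map_trm f P) = f ` fv P"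
proof (induction P)
  case (Res xs G P)
  then show ?case by (auto simp: gtype.set_map dest: injD)
next
  case (Send x x' P Q)
  then show ?case by (auto dest: injD)
next
  case (Clones x1 x2 x3 x4 x5 x6 P)
  then show ?case by (auto dest: injD)
next
  case (Comm x1 x2 x3 x4 P)
  then show ?case by (auto dest: injD)
qed (auto dest: injD)

lemma map_exch_snd:
  assumes "distinct ys" "length ys = length xs" "set xs \<inter> set ys = {}"
  shows "map (exch xs ys) ys = xs"
  using assms by (auto intro!: nth_equalityI simp: exch_snd)

section \<open>Sessions\<close>

definition rst :: "ep multiset \<Rightarrow> ctx \<Rightarrow> ctx" where
  "rst M \<Gamma> = {#p \<in># \<Gamma>. fst p \<in># M#}"

lemma rst_simps [simp]:
  "rst M {#} = {#}"
  "rst M (add_mset (x, A) \<Gamma>) = (if x \<in># M then add_mset (x, A) (rst M \<Gamma>) else rst M \<Gamma>)"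
  "rst M (\<Gamma> + \<Delta>) = rst M \<Gamma> + rst M \<Delta>"
  "rst M (\<Sum>i<(n::nat). g i) = (\<Sum>i<n. rst M (g i))"
  by (auto simp: rst_def filter_mset_sum)

lemma rst_all: "set_mset (names \<Gamma>) \<subseteq> set_mset M \<Longrightarrow> rst M \<Gamma> = \<Gamma>"
  unfolding rst_def by (intro filter_mset_cong[THEN trans, OF refl _ filter_mset_True]) (force simp: names_def)

lemma rst_none: "set_mset (names \<Gamma>) \<inter> set_mset M = {} \<Longrightarrow> rst M \<Gamma> = {#}"
  unfolding rst_def by (intro filter_mset_cong[THEN trans, OF refl _ filter_mset_False]) (force simp: names_def)

lemma in_names_rst: "x \<in># names (rst M \<Gamma>) \<longleftrightarrow> x \<in># M \<and> x \<in># names \<Gamma>"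
  by (auto simp: names_def rst_def)

text \<open>The second conjunct says that every endpoint of the session is declared, and exactly
  once. Coherence of the restricted context alone would allow endpoints of the session without a
  type.\<close>

definition sess_ok :: "env \<Rightarrow> ctx \<Rightarrow> bool" where
  "sess_ok \<Sigma> \<Gamma> \<longleftrightarrow> (\<forall>(M, G) \<in># \<Sigma>. G \<Turnstile> rst M \<Gamma> \<and> names (rst M \<Gamma>) = M)"

lemma sess_ok_simps [simp]:
  "sess_ok {#} \<Gamma>"
  "sess_ok (add_mset (M, G) \<Sigma>) \<Gamma> \<longleftrightarrow> (G \<Turnstile> rst M \<Gamma> \<and> names (rst M \<Gamma>) = M) \<and> sess_ok \<Sigma> \<Gamma>"
  "sess_ok (\<Sigma> + \<Sigma>') \<Gamma> \<longleftrightarrow> sess_ok \<Sigma> \<Gamma> \<and> sess_ok \<Sigma>' \<Gamma>"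
  "sess_ok (\<Sum>i<(n::nat). e i) \<Gamma> \<longleftrightarrow> (\<forall>i<n. sess_ok (e i) \<Gamma>)"
  by (fastforce simp: sess_ok_def)+

lemma sess_ok_edom: "sess_ok \<Sigma> \<Gamma> \<Longrightarrow> set_mset (edom \<Sigma>) \<subseteq> set_mset (names \<Gamma>)"
proof
  fix x assume ok: "sess_ok \<Sigma> \<Gamma>" and "x \<in># edom \<Sigma>"
  then obtain M G where "(M, G) \<in># \<Sigma>" "x \<in># M" by (auto simp: in_edom)
  then show "x \<in># names \<Gamma>" using ok in_names_rst[of x M \<Gamma>] by (auto simp: sess_ok_def)
qed

lemma sess_ok_evars: "sess_ok \<Sigma> \<Gamma> \<Longrightarrow> evars \<Sigma> = set_mset (edom \<Sigma>)"
  using coherent_vars by (fastforce simp: sess_ok_def evars_def in_edom)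

lemma sess_ok_nonempty: "sess_ok \<Sigma> \<Gamma> \<Longrightarrow> (M, G) \<in># \<Sigma> \<Longrightarrow> M \<noteq> {#}"
  using coherent_nonempty by (fastforce simp: sess_ok_def names_def)

lemma sess_ok_cong:
  assumes "sess_ok \<Sigma> \<Gamma>" "\<And>M. set_mset M \<subseteq> set_mset (edom \<Sigma>) \<Longrightarrow> rst M \<Gamma> = rst M \<Delta>"
  shows "sess_ok \<Sigma> \<Delta>"
  unfolding sess_ok_def
proof safe
  fix M G assume "(M, G) \<in># \<Sigma>"
  then have "set_mset M \<subseteq> set_mset (edom \<Sigma>)" unfolding in_edom subset_iff by blast
  then have "rst M \<Gamma> = rst M \<Delta>" by (rule assms(2))
  then show "G \<Turnstile> rst M \<Delta>" "names (rst M \<Delta>) = M"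
    using assms(1) \<open>(M, G) \<in># \<Sigma>\<close> by (auto simp: sess_ok_def)
qed

text \<open>The common step of the action rules: the endpoints whose typing is replaced lie outside
  every session, so no session sees the difference.\<close>

lemma sess_ok_change:
  assumes "sess_ok \<Sigma> (R + X)"
    "set_mset (names X) \<inter> set_mset (edom \<Sigma>) = {}" "set_mset (names Y) \<inter> set_mset (edom \<Sigma>) = {}"
  shows "sess_ok \<Sigma> (R + Y)"
proof (rule sess_ok_cong[OF assms(1)])
  fix M assume "set_mset M \<subseteq> set_mset (edom \<Sigma>)"
  then have "rst M X = {#}" "rst M Y = {#}"
    using assms(2,3) by (blast intro: rst_none)+
  then show "rst M (R + X) = rst M (R + Y)" by simp
qed

lemma sess_ok_mono:
  assumes "sess_ok \<Sigma> \<Gamma>" "\<Gamma> \<subseteq># \<Delta>" "nodup (names \<Delta>)"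
  shows "sess_ok \<Sigma> \<Delta>"
proof -
  obtain X where X: "\<Delta> = \<Gamma> + X" using assms(2) by (auto elim: subset_mset.less_eqE)
  then show ?thesis
    using sess_ok_change[of \<Sigma> \<Gamma> "{#}" X] sess_ok_edom[OF assms(1)] assms by auto
qed

lemma flat_subset: "\<Psi> \<subseteq># \<Phi> \<Longrightarrow> flat \<Psi> \<subseteq># flat \<Phi>"
  by (auto elim!: subset_mset.less_eqE)

lemma edom_subset_evars: "set_mset (edom \<Sigma>) \<subseteq> evars \<Sigma>"
  by (fastforce simp: in_edom evars_def)

definition well :: "env \<Rightarrow> hyp \<Rightarrow> bool" where
  "well \<Sigma> \<Psi> \<longleftrightarrow> wf \<Sigma> \<Psi> \<and> sess_ok \<Sigma> (flat \<Psi>)"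

lemma rst_fam: "\<forall>x \<in> set xs. x \<in># M \<Longrightarrow> rst M (fam xs A) = fam xs A"
  by (rule rst_all) auto

lemma rst_fam_none: "\<forall>x \<in> set xs. x \<notin># M \<Longrightarrow> rst M (fam xs A) = {#}"
  by (rule rst_none) auto

lemma rst_disjoint:
  assumes "nodup (hdom \<Psi>)" "flat \<Psi> = R + X" "set_mset M \<subseteq> set_mset (names X)"
  shows "rst M R = {#}"
proof -
  have "nodup (names R + names X)"
    using assms(1,2) by (metis names_flat names_simps(3))
  then show ?thesis using assms(3) by (intro rst_none) (auto simp only: nodup_union)
qed

text \<open>A session of the conclusion is either inherited, and then the rule does not touch the
  types at its endpoints, or it is the one displayed by the rule, and then its coherence is rebuilt
  from the coherence in the premises and the side conditions. A branch of a global type that no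
  premise types is covered by a side condition.\<close>

lemma rule_well:
  assumes "rule F J \<Sigma> \<Psi>" "wf \<Sigma> \<Psi>" "\<forall>(S, H) \<in> set J. well S H"
  shows "sess_ok \<Sigma> (flat \<Psi>)"
  using assms
proof (induction rule: rule.induct)
  case (Conn G xs A \<Sigma>i \<Psi>i \<Gamma>i)
  let ?F = "flat (\<Sum>i<length xs. \<Psi>i i + {#\<Gamma>i i + {#(xs ! i, A i)#}#})"
  have nd: "nodup (names ?F)" using Conn(2) by (simp only: wf_def names_flat)
  have F: "?F = (\<Sum>i<length xs. flat (\<Psi>i i) + \<Gamma>i i) + fam xs A"
    by (simp add: fam_def sum.distrib[symmetric] add.commute)
  have "sess_ok (\<Sigma>i i) ?F" if i: "i < length xs" for i
  proof (rule sess_ok_mono[OF _ _ nd])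
    show "sess_ok (\<Sigma>i i) (flat (\<Psi>i i + {#\<Gamma>i i + {#(xs ! i, A i)#}#}))"
      using Conn(3) i by (auto simp: well_def)
    show "flat (\<Psi>i i + {#\<Gamma>i i + {#(xs ! i, A i)#}#}) \<subseteq># ?F"
      by (rule flat_subset, rule mset_subset_sum[OF i])
  qed
  moreover have "rst (mset xs) ?F = fam xs A"
  proof -
    have "set_mset (names (\<Sum>i<length xs. flat (\<Psi>i i) + \<Gamma>i i)) \<inter> set xs = {}"
      using nd unfolding F by simp
    then show ?thesis
      unfolding F rst_simps(3) by (subst rst_none) (simp_all add: rst_fam)
  qed
  ultimately show ?case
    using Conn(1) by (simp del: flat_simps)
next
  case (Scope xs G \<Sigma> \<Psi> \<Gamma>i A)
  from Scope(2) have w: "well (\<Sigma> + {#(mset xs, G)#}) (\<Psi> + seqs xs \<Gamma>i A)" by simp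
  then have "sess_ok \<Sigma> ((flat \<Psi> + (\<Sum>i<length xs. \<Gamma>i i)) + fam xs A)"
    by (simp add: well_def add.assoc)
  then have "sess_ok \<Sigma> ((flat \<Psi> + (\<Sum>i<length xs. \<Gamma>i i)) + {#})"
    by (rule sess_ok_change) (use w in \<open>auto simp: well_def wf_def\<close>)
  then show ?case by (simp add: add.commute)
next
  case (Tensor x \<Sigma>1 \<Sigma>2 x' \<Psi>1 \<Gamma>1 A \<Psi>2 \<Gamma>2 B)
  let ?F = "flat (\<Psi>1 + \<Psi>2 + {#\<Gamma>1 + \<Gamma>2 + {#(x, ltype.Tensor A B)#}#})"
  have nd: "nodup (names ?F)" using Tensor(3) by (simp only: wf_def names_flat)
  have "sess_ok \<Sigma>1 ((flat \<Psi>1 + \<Gamma>1) + {#(x', A)#})"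
    using Tensor(4) by (simp add: well_def add.commute)
  then have "sess_ok \<Sigma>1 ((flat \<Psi>1 + \<Gamma>1) + {#})"
    by (rule sess_ok_change) (use Tensor(1,2) in auto)
  then have 1: "sess_ok \<Sigma>1 ?F"
    by (rule sess_ok_mono[OF _ _ nd]) (simp add: subseteq_mset_def)
  have "sess_ok \<Sigma>2 ((flat \<Psi>2 + \<Gamma>2) + {#(x, B)#})"
    using Tensor(4) by (simp add: well_def add.commute)
  then have "sess_ok \<Sigma>2 ((flat \<Psi>2 + \<Gamma>2) + {#})"
    by (rule sess_ok_change) (use Tensor(1,2) in auto)
  then have 2: "sess_ok \<Sigma>2 ?F"
    by (rule sess_ok_mono[OF _ _ nd]) (simp add: subseteq_mset_def)
  from 1 2 show ?case unfolding sess_ok_simps by blast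
next
  case (Parr y \<Sigma> y' \<Psi> \<Gamma> A B)
  have "sess_ok \<Sigma> (flat \<Psi> + \<Gamma> + {#(y', A), (y, B)#})"
    using Parr by (simp add: well_def ac_simps)
  then have "sess_ok \<Sigma> (flat \<Psi> + \<Gamma> + {#(y, ltype.Parr A B)#})"
    by (rule sess_ok_change) (use Parr in auto)
  then show ?case by (simp add: ac_simps)
next
  case (Bot y \<Sigma> \<Psi> \<Gamma>)
  have "sess_ok \<Sigma> (flat \<Psi> + \<Gamma> + {#})"
    using Bot by (simp add: well_def ac_simps)
  then have "sess_ok \<Sigma> (flat \<Psi> + \<Gamma> + {#(y, TBot)#})"
    by (rule sess_ok_change) (use Bot in auto)
  then show ?case by (simp add: ac_simps)
next
  case (Oplus1 x \<Sigma> \<Psi> \<Gamma> A B)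
  have "sess_ok \<Sigma> (flat \<Psi> + \<Gamma> + {#(x, A)#})"
    using Oplus1 by (simp add: well_def ac_simps)
  then have "sess_ok \<Sigma> (flat \<Psi> + \<Gamma> + {#(x, ltype.Oplus A B)#})"
    by (rule sess_ok_change) (use Oplus1 in auto)
  then show ?case by (simp add: ac_simps)
next
  case (Oplus2 x \<Sigma> \<Psi> \<Gamma> B A)
  have "sess_ok \<Sigma> (flat \<Psi> + \<Gamma> + {#(x, B)#})"
    using Oplus2 by (simp add: well_def ac_simps)
  then have "sess_ok \<Sigma> (flat \<Psi> + \<Gamma> + {#(x, ltype.Oplus A B)#})"
    by (rule sess_ok_change) (use Oplus2 in auto)
  then show ?case by (simp add: ac_simps)
next
  case (Oplus x \<Sigma> \<Psi> \<Gamma> A B)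
  have "sess_ok \<Sigma> (flat \<Psi> + \<Gamma> + {#(x, A)#})"
    using Oplus by (simp add: well_def ac_simps)
  then have "sess_ok \<Sigma> (flat \<Psi> + \<Gamma> + {#(x, ltype.Oplus A B)#})"
    by (rule sess_ok_change) (use Oplus in auto)
  then show ?case by (simp add: ac_simps)
next
  case (With x \<Sigma> \<Psi> \<Gamma> A B)
  have "sess_ok \<Sigma> (flat \<Psi> + \<Gamma> + {#(x, A)#})"
    using With by (simp add: well_def ac_simps)
  then have "sess_ok \<Sigma> (flat \<Psi> + \<Gamma> + {#(x, ltype.With A B)#})"
    by (rule sess_ok_change) (use With in auto)
  then show ?case by (simp add: ac_simps)
next
  case (Quest x \<Sigma> \<Psi> \<Gamma> A)
  have "sess_ok \<Sigma> (flat \<Psi> + \<Gamma> + {#(x, A)#})"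
    using Quest by (simp add: well_def ac_simps)
  then have "sess_ok \<Sigma> (flat \<Psi> + \<Gamma> + {#(x, ltype.Quest A)#})"
    by (rule sess_ok_change) (use Quest in auto)
  then show ?case by (simp add: ac_simps)
next
  case (Weaken x \<Sigma> \<Psi> \<Gamma> A)
  have "sess_ok \<Sigma> (flat \<Psi> + \<Gamma> + {#})"
    using Weaken by (simp add: well_def ac_simps)
  then have "sess_ok \<Sigma> (flat \<Psi> + \<Gamma> + {#(x, ltype.Quest A)#})"
    by (rule sess_ok_change) (use Weaken in auto)
  then show ?case by (simp add: ac_simps)
next
  case (Contract x \<Sigma> x' \<Psi> \<Gamma> A)
  have "sess_ok \<Sigma> (flat \<Psi> + \<Gamma> + {#(x, ltype.Quest A), (x', ltype.Quest A)#})"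
    using Contract by (simp add: well_def ac_simps)
  then have "sess_ok \<Sigma> (flat \<Psi> + \<Gamma> + {#(x, ltype.Quest A)#})"
    by (rule sess_ok_change) (use Contract in auto)
  then show ?case by (simp add: ac_simps)
next
  case (CAx w \<Sigma> A B y x \<Psi> \<Gamma>)
  have w: "well \<Sigma> (\<Psi> + {#\<Gamma> + {#(w, A)#}#})" using CAx by simp
  have "set_mset (edom \<Sigma>) \<subseteq> insert w (set_mset (hdom \<Psi>) \<union> set_mset (names \<Gamma>))"
    using w sess_ok_edom[of \<Sigma> "flat (\<Psi> + {#\<Gamma> + {#(w, A)#}#})"] by (auto simp: well_def)
  then have e: "set_mset (edom \<Sigma>) \<inter> {x, y, w} = {}"
    using CAx(1,4) by (auto simp: wf_def evars_def in_edom)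
  have "sess_ok \<Sigma> (flat \<Psi> + \<Gamma> + {#(w, A)#})"
    using w by (simp add: well_def ac_simps)
  then have "sess_ok \<Sigma> (flat \<Psi> + \<Gamma> + {#(x, A), (w, A), (y, B)#})"
    by (rule sess_ok_change) (use e in auto)
  moreover have "x \<noteq> y" "w \<noteq> x" "w \<noteq> y" "rst {#x, y#} (flat \<Psi> + \<Gamma>) = {#}"
    using CAx(4) by (auto simp: wf_def intro!: rst_none)
  moreover have "GLink x A y \<Turnstile> {#(x, A), (y, B)#}"
    using coh_link[OF \<open>x \<noteq> y\<close> CAx(3)] CAx(2) by simp
  ultimately show ?case by (simp add: ac_simps add_mset_commute)
next
  case (CTensorParr xs' xs y y' \<Sigma> us H G \<Psi> \<Gamma>1 A \<Gamma>2 B \<Gamma> C D)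
  let ?\<rho> = "exch (xs @ [y]) (xs' @ [y'])"
  let ?R = "flat \<Psi> + (\<Sum>i<length xs. \<Gamma>1 i + \<Gamma>2 i) + \<Gamma>"
  let ?S = "\<Sigma> + {#(mset xs + {#y#} + mset us, H), (mset xs' + {#y'#}, map_gtype ?\<rho> G)#}"
  let ?F = "flat (\<Psi> + seqs xs' \<Gamma>1 A + seqs xs \<Gamma>2 B + {#\<Gamma> + {#(y', C), (y, D)#}#})"
  have wf: "wf ?S (\<Psi> + seqs xs' \<Gamma>1 A + seqs xs \<Gamma>2 B + {#\<Gamma> + {#(y', C), (y, D)#}#})"
    and ok: "sess_ok ?S ?F"
    using CTensorParr(3) by (simp_all add: well_def)
  have e: "set_mset (edom \<Sigma>) \<inter> set (xs @ y # xs' @ [y']) = {}"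
    using wf by (auto simp: wf_def)
  have F: "?F = ?R + (fam xs B + {#(y, D)#} + (fam xs' A + {#(y', C)#}))"
    using CTensorParr(1) by (simp add: sum.distrib ac_simps)
  have ok\<Sigma>: "sess_ok \<Sigma> (?R + (fam xs B + {#(y, D)#} + (fam xs' A + {#(y', C)#})))"
    using ok unfolding F sess_ok_simps by blast
  have dis: "distinct (xs @ [y])" "distinct (xs' @ [y'])" "set (xs @ [y]) \<inter> set (xs' @ [y']) = {}"
    "set us \<inter> set (xs' @ [y']) = {}" "set us \<inter> set (xs @ [y]) = {}"
    using wf by (auto simp: wf_def)
  have R: "set_mset (names ?R) \<inter> set (xs @ y # xs' @ [y']) = {}"
    using wf CTensorParr(1) by (auto simp: wf_def set_mset_sum)
  let ?M = "mset xs + {#y#} + mset us" and ?M' = "mset xs' + {#y'#}"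
  have n: "rst ?M (fam xs' A) = {#}" "rst ?M' (fam xs B) = {#}"
    by (rule rst_fam_none; use dis in auto)+
  have n': "rst ?M (fam xs B) = fam xs B" "rst ?M' (fam xs' A) = fam xs' A"
    by (rule rst_fam; simp)+
  have mem: "y \<in># ?M" "y' \<notin># ?M" "y \<notin># ?M'" "y' \<in># ?M'"
    using dis by auto
  have r1: "rst ?M (fam xs B + {#(y, D)#} + (fam xs' A + {#(y', C)#})) = fam xs B + {#(y, D)#}"
    by (simp only: rst_simps n n' mem if_True if_False) simp
  have r1': "rst ?M (fam xs (\<lambda>i. ltype.Tensor (A i) (B i)) + {#(y, ltype.Parr C D)#}) =
     fam xs (\<lambda>i. ltype.Tensor (A i) (B i)) + {#(y, ltype.Parr C D)#}"
    by (auto simp: rst_fam)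
  have r2: "rst ?M' (fam xs B + {#(y, D)#} + (fam xs' A + {#(y', C)#})) = fam xs' A + {#(y', C)#}"
    by (simp only: rst_simps n n' mem if_True if_False) simp
  \<comment> \<open>The further endpoints \<open>us\<close> of the session keep their types, which
    are found in the part \<open>?R\<close> common to premise and conclusion.\<close>
  have H: "H \<Turnstile> rst ?M ?R + (fam xs B + {#(y, D)#})" "names (rst ?M ?R) + mset xs + {#y#} = ?M"
  proof -
    have "rst ?M ?F = rst ?M ?R + (fam xs B + {#(y, D)#})"
      unfolding F rst_simps(3)[of ?M ?R] r1 ..
    then show "H \<Turnstile> rst ?M ?R + (fam xs B + {#(y, D)#})" "names (rst ?M ?R) + mset xs + {#y#} = ?M"
      using ok unfolding sess_ok_simps by simp_all
  qed
  have "rst ?M' ?R = {#}" by (rule rst_none) (use R in auto)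
  then have G: "map_gtype ?\<rho> G \<Turnstile> fam xs' A + {#(y', C)#}"
    using ok r2 unfolding F sess_ok_simps rst_simps(3)[of ?M' ?R] by simp
  \<comment> \<open>The premise carries the renamed \<open>G\<close>; as the exchange is an
    involution, coherence of \<open>G\<close> itself is recovered by renaming once more.\<close>
  have inv: "map_gtype ?\<rho> (map_gtype ?\<rho> G) = G"
    using dis CTensorParr(1)
    by (simp add: gtype.map_comp comp_def exch_involutive gtype.map_ident)
  have "map ?\<rho> (xs' @ [y']) = xs @ [y]"
    by (rule map_exch_snd) (use dis CTensorParr(1) in auto)
  then have "map ?\<rho> xs' = xs" "?\<rho> y' = y" by simp_all
  then have G': "G \<Turnstile> fam xs A + {#(y, C)#}"
    using coherent_rename[OF G exch_inj[OF dis(1,2) _ dis(3)]] inv CTensorParr(1) by simp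
  have "GComm xs y G H \<Turnstile> rst ?M ?R + fam xs (\<lambda>i. ltype.Tensor (A i) (B i)) + {#(y, ltype.Parr C D)#}"
    by (rule coh_comm[OF G']) (use H in \<open>simp add: ac_simps\<close>)
  moreover have "sess_ok \<Sigma> (?R + (fam xs (\<lambda>i. ltype.Tensor (A i) (B i)) + {#(y, ltype.Parr C D)#}))"
    by (rule sess_ok_change[OF ok\<Sigma>]) (use e in auto)
  moreover have "flat (\<Psi> + seqs xs (\<lambda>i. \<Gamma>1 i + \<Gamma>2 i) (\<lambda>i. ltype.Tensor (A i) (B i)) + {#\<Gamma> + {#(y, ltype.Parr C D)#}#})
    = ?R + (fam xs (\<lambda>i. ltype.Tensor (A i) (B i)) + {#(y, ltype.Parr C D)#})"
    by (simp add: ac_simps)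
  moreover have "rst ?M (?R + (fam xs (\<lambda>i. ltype.Tensor (A i) (B i)) + {#(y, ltype.Parr C D)#}))
    = rst ?M ?R + fam xs (\<lambda>i. ltype.Tensor (A i) (B i)) + {#(y, ltype.Parr C D)#}"
    unfolding rst_simps(3)[of _ ?R] r1' by simp
  ultimately show ?case
    using H(2) by (simp only: sess_ok_simps) simp
next
  case (COneBot xs y \<Sigma> \<Psi> \<Gamma>)
  let ?M = "mset xs + {#y#}"
  have "sess_ok \<Sigma> (flat \<Psi> + \<Gamma> + {#})"
    using COneBot by (simp add: well_def ac_simps)
  then have "sess_ok \<Sigma> (flat \<Psi> + \<Gamma> + (fam xs (\<lambda>i. TOne) + {#(y, TBot)#}))"
    by (rule sess_ok_change) (use COneBot in \<open>auto simp: wf_def\<close>)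
  moreover have "rst ?M (flat \<Psi> + \<Gamma>) = {#}"
    by (rule rst_none) (use COneBot in \<open>auto simp: wf_def\<close>)
  moreover have "rst ?M (fam xs (\<lambda>i. TOne) + {#(y, TBot)#}) = fam xs (\<lambda>i. TOne) + {#(y, TBot)#}"
    by (auto simp: rst_fam)
  moreover have "GClose xs y \<Turnstile> fam xs (\<lambda>i. TOne) + {#(y, TBot)#}"
    by (rule coh_close) (use COneBot in \<open>auto simp: wf_def\<close>)
  ultimately show ?case by (simp add: ac_simps)
next
  case (COplusWith1 H x B ys D us E \<Sigma> \<Sigma>i G \<Psi> \<Psi>i \<Gamma> A \<Gamma>i C \<Delta>)
  let ?M = "{#x#} + mset ys + mset us"
  let ?R = "flat \<Psi> + (\<Sum>i<length ys. flat (\<Psi>i i) + \<Gamma>i i) + \<Gamma> + (\<Sum>i<length us. \<Delta> i)"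
  let ?X = "{#(x, A)#} + fam ys C + fam us E"
  let ?Y = "{#(x, ltype.Oplus A B)#} + fam ys (\<lambda>i. ltype.With (C i) (D i)) + fam us E"
  from COplusWith1(3) have w: "well (\<Sigma> + (\<Sum>i<length ys. \<Sigma>i i) + {#({#x#} + mset ys + mset us, G)#})
         (\<Psi> + (\<Sum>i<length ys. \<Psi>i i) + {#\<Gamma> + {#(x, A)#}#} + seqs ys \<Gamma>i C + seqs us \<Delta> E)" by simp
  note wf = w[unfolded well_def wf_def, THEN conjunct1]
  have F: "flat (\<Psi> + (\<Sum>i<length ys. \<Psi>i i) + {#\<Gamma> + {#(x, A)#}#} + seqs ys \<Gamma>i C + seqs us \<Delta> E) = ?R + ?X"
    by (simp add: sum.distrib ac_simps)
  have ok: "sess_ok (\<Sigma> + (\<Sum>i<length ys. \<Sigma>i i)) (?R + ?X)" "G \<Turnstile> rst ?M (?R + ?X)"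
    using w unfolding well_def F sess_ok_simps by blast+
  have "sess_ok (\<Sigma> + (\<Sum>i<length ys. \<Sigma>i i)) (?R + ?Y)"
    by (rule sess_ok_change[OF ok(1)]) (use wf[THEN conjunct1] in auto)
  moreover have R: "rst ?M ?R = {#}"
    by (rule rst_disjoint[OF wf[THEN conjunct2] F]) auto
  moreover have X: "rst ?M ?X = ?X" "rst ?M ?Y = ?Y"
    by (auto simp: rst_fam)
  moreover have G: "G \<Turnstile> ?X"
    using ok(2) unfolding rst_simps(3)[of ?M ?R] R X by simp
  moreover have "GCase x ys G H \<Turnstile> ?Y"
    using coh_case[of G "fam us E" x A ys C H B D] COplusWith1(1) G by (simp add: ac_simps)
  moreover have "flat (\<Psi> + (\<Sum>i<length ys. \<Psi>i i) + {#\<Gamma> + {#(x, ltype.Oplus A B)#}#}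
          + seqs ys \<Gamma>i (\<lambda>i. ltype.With (C i) (D i)) + seqs us \<Delta> E) = ?R + ?Y"
    by (simp add: sum.distrib ac_simps)
  ultimately show ?case
    by (simp only: sess_ok_simps rst_simps(3)[of _ ?R]) simp
next
  case (COplusWith2 G x A ys C us E \<Sigma> \<Sigma>i H \<Psi> \<Psi>i \<Gamma> B \<Gamma>i D \<Delta>)
  let ?M = "{#x#} + mset ys + mset us"
  let ?R = "flat \<Psi> + (\<Sum>i<length ys. flat (\<Psi>i i) + \<Gamma>i i) + \<Gamma> + (\<Sum>i<length us. \<Delta> i)"
  let ?X = "{#(x, B)#} + fam ys D + fam us E"
  let ?Y = "{#(x, ltype.Oplus A B)#} + fam ys (\<lambda>i. ltype.With (C i) (D i)) + fam us E"
  from COplusWith2(3) have w: "well (\<Sigma> + (\<Sum>i<length ys. \<Sigma>i i) + {#({#x#} + mset ys + mset us, H)#})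
         (\<Psi> + (\<Sum>i<length ys. \<Psi>i i) + {#\<Gamma> + {#(x, B)#}#} + seqs ys \<Gamma>i D + seqs us \<Delta> E)" by simp
  note wf = w[unfolded well_def wf_def, THEN conjunct1]
  have F: "flat (\<Psi> + (\<Sum>i<length ys. \<Psi>i i) + {#\<Gamma> + {#(x, B)#}#} + seqs ys \<Gamma>i D + seqs us \<Delta> E) = ?R + ?X"
    by (simp add: sum.distrib ac_simps)
  have ok: "sess_ok (\<Sigma> + (\<Sum>i<length ys. \<Sigma>i i)) (?R + ?X)" "H \<Turnstile> rst ?M (?R + ?X)"
    using w unfolding well_def F sess_ok_simps by blast+
  have "sess_ok (\<Sigma> + (\<Sum>i<length ys. \<Sigma>i i)) (?R + ?Y)"
    by (rule sess_ok_change[OF ok(1)]) (use wf[THEN conjunct1] in auto)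
  moreover have R: "rst ?M ?R = {#}"
    by (rule rst_disjoint[OF wf[THEN conjunct2] F]) auto
  moreover have X: "rst ?M ?X = ?X" "rst ?M ?Y = ?Y"
    by (auto simp: rst_fam)
  moreover have G: "H \<Turnstile> ?X"
    using ok(2) unfolding rst_simps(3)[of ?M ?R] R X by simp
  moreover have "GCase x ys G H \<Turnstile> ?Y"
    using coh_case[of G "fam us E" x A ys C H B D] COplusWith2(1) G by (simp add: ac_simps)
  moreover have "flat (\<Psi> + (\<Sum>i<length ys. \<Psi>i i) + {#\<Gamma> + {#(x, ltype.Oplus A B)#}#}
          + seqs ys \<Gamma>i (\<lambda>i. ltype.With (C i) (D i)) + seqs us \<Delta> E) = ?R + ?Y"
    by (simp add: sum.distrib ac_simps)
  ultimately show ?case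
    by (simp only: sess_ok_simps rst_simps(3)[of _ ?R]) simp
next
  case (COplusWith x ys \<Sigma> us G \<Psi> \<Gamma> A \<Gamma>i C H B D)
  let ?M = "{#x#} + mset ys + mset us"
  let ?R = "flat \<Psi> + (\<Sum>i<length ys. \<Gamma>i i) + \<Gamma>"
  let ?X = "{#(x, A)#} + fam ys C"
  let ?Y = "{#(x, B)#} + fam ys D"
  let ?Z = "{#(x, ltype.Oplus A B)#} + fam ys (\<lambda>i. ltype.With (C i) (D i))"
  from COplusWith(2) have w: "well (\<Sigma> + {#(?M, G)#}) (\<Psi> + {#\<Gamma> + {#(x, A)#}#} + seqs ys \<Gamma>i C)"
    "well (\<Sigma> + {#(?M, H)#}) (\<Psi> + {#\<Gamma> + {#(x, B)#}#} + seqs ys \<Gamma>i D)" by simp_all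
  note wf = w(1)[unfolded well_def wf_def, THEN conjunct1]
  have X: "rst ?M ?X = ?X" "rst ?M ?Y = ?Y" "rst ?M ?Z = ?Z"
    by (auto simp: rst_fam)
  have F: "flat (\<Psi> + {#\<Gamma> + {#(x, A)#}#} + seqs ys \<Gamma>i C) = ?R + ?X"
    "flat (\<Psi> + {#\<Gamma> + {#(x, B)#}#} + seqs ys \<Gamma>i D) = ?R + ?Y"
    "flat (\<Psi> + {#\<Gamma> + {#(x, ltype.Oplus A B)#}#} + seqs ys \<Gamma>i (\<lambda>i. ltype.With (C i) (D i))) = ?R + ?Z"
    by (simp_all add: ac_simps)
  have ok: "sess_ok \<Sigma> (?R + ?X)" "G \<Turnstile> rst ?M ?R + ?X" "H \<Turnstile> rst ?M ?R + ?Y" "names (rst ?M ?R) + ({#x#} + mset ys) = ?M"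
    using w unfolding well_def F sess_ok_simps rst_simps(3)[of _ ?R] X by simp_all
  have "sess_ok \<Sigma> (?R + ?Z)"
    by (rule sess_ok_change[OF ok(1)]) (use wf[THEN conjunct1] in auto)
  moreover have "GCase x ys G H \<Turnstile> rst ?M ?R + ?Z"
    using coh_case[of G "rst ?M ?R" x A ys C H B D] ok by (simp add: ac_simps)
  ultimately show ?case
    using ok(4) unfolding F sess_ok_simps rst_simps(3)[of _ ?R] X by simp
next
  case (CBangQuest ys \<Gamma>i \<Sigma> x G \<Psi> \<Gamma> A B)
  let ?M = "{#x#} + mset ys"
  let ?R = "flat \<Psi> + (\<Sum>i<length ys. \<Gamma>i i) + \<Gamma>"
  let ?X = "{#(x, A)#} + fam ys B"
  let ?Y = "{#(x, ltype.Quest A)#} + fam ys (\<lambda>i. ltype.Bang (B i))"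
  from CBangQuest(3) have w: "well (\<Sigma> + {#(?M, G)#}) (\<Psi> + {#\<Gamma> + {#(x, A)#}#} + seqs ys \<Gamma>i B)"
    by simp_all
  note wf = w[unfolded well_def wf_def, THEN conjunct1]
  have X: "rst ?M ?X = ?X" "rst ?M ?Y = ?Y"
    by (auto simp: rst_fam)
  have F: "flat (\<Psi> + {#\<Gamma> + {#(x, A)#}#} + seqs ys \<Gamma>i B) = ?R + ?X"
    "flat (\<Psi> + {#\<Gamma> + {#(x, ltype.Quest A)#}#} + seqs ys \<Gamma>i (\<lambda>i. ltype.Bang (B i))) = ?R + ?Y"
    by (simp_all add: ac_simps)
  have R: "rst ?M ?R = {#}"
    by (rule rst_disjoint[OF wf[THEN conjunct2] F(1)]) auto
  have ok: "sess_ok \<Sigma> (?R + ?X)" "G \<Turnstile> ?X"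
    using w unfolding well_def F sess_ok_simps rst_simps(3)[of _ ?R] X R by simp_all
  have "sess_ok \<Sigma> (?R + ?Y)"
    by (rule sess_ok_change[OF ok(1)]) (use wf[THEN conjunct1] in auto)
  moreover have "GBang x ys G \<Turnstile> ?Y"
    using coh_bang[of G x A ys B] ok by simp
  ultimately show ?case
    unfolding F sess_ok_simps rst_simps(3)[of _ ?R] X R by simp
next
  case (CBangWeaken G x A ys B \<Gamma>i \<Sigma> \<Psi> \<Gamma>)
  let ?M = "{#x#} + mset ys"
  let ?R = "flat \<Psi> + (\<Sum>i<length ys. \<Gamma>i i) + \<Gamma>"
  let ?Y = "{#(x, ltype.Quest A)#} + fam ys (\<lambda>i. ltype.Bang (B i))"
  have w: "well \<Sigma> (\<Psi> + {#\<Gamma>#})" using CBangWeaken(4) by simp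
  have X: "rst ?M ?Y = ?Y"
    by (auto simp: rst_fam)
  have F: "flat (\<Psi> + {#\<Gamma> + {#(x, ltype.Quest A)#}#} + seqs ys \<Gamma>i (\<lambda>i. ltype.Bang (B i))) = ?R + ?Y"
    by (simp_all add: ac_simps)
  have R: "rst ?M ?R = {#}"
    by (rule rst_disjoint[OF CBangWeaken(3)[unfolded wf_def, THEN conjunct2] F]) auto
  have "sess_ok \<Sigma> (?R + ?Y)"
  proof (rule sess_ok_mono)
    show "sess_ok \<Sigma> (flat (\<Psi> + {#\<Gamma>#}))" using w by (simp add: well_def)
    show "flat (\<Psi> + {#\<Gamma>#}) \<subseteq># ?R + ?Y" by (simp add: subseteq_mset_def)
    show "nodup (names (?R + ?Y))" using CBangWeaken(3) unfolding F[symmetric] names_flat wf_def by simp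
  qed
  moreover have "GBang x ys G \<Turnstile> ?Y"
    using coh_bang[of G x A ys B] CBangWeaken(1) by simp
  ultimately show ?case
    unfolding F sess_ok_simps rst_simps(3)[of _ ?R] X R by simp
next
  case (CBangContract ys' ys zs' zs \<Gamma>i \<Gamma>i' \<Sigma> x x' G \<Psi> \<Gamma> A B)
  let ?M = "{#x#} + mset ys"
  let ?G' = "map_gtype (exch (x # ys) (x' # ys')) G"
  let ?R = "flat \<Psi> + (\<Sum>i<length ys. \<Gamma>i i) + \<Gamma> + ({#(x, ltype.Quest A)#} + fam ys (\<lambda>i. ltype.Bang (B i)))"
  let ?X = "(\<Sum>i<length ys. \<Gamma>i' i) + {#(x', ltype.Quest A)#} + fam ys' (\<lambda>i. ltype.Bang (B i))"
  from CBangContract(7) have w: "well (\<Sigma> + {#(?M, GBang x ys G), ({#x'#} + mset ys', GBang x' ys' ?G')#})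
    (\<Psi> + {#\<Gamma> + {#(x, ltype.Quest A), (x', ltype.Quest A)#}#}
           + seqs ys \<Gamma>i (\<lambda>i. ltype.Bang (B i)) + seqs ys' \<Gamma>i' (\<lambda>i. ltype.Bang (B i)))"
    by simp
  note wf = w[unfolded well_def wf_def, THEN conjunct1]
  have F: "flat (\<Psi> + {#\<Gamma> + {#(x, ltype.Quest A), (x', ltype.Quest A)#}#}
           + seqs ys \<Gamma>i (\<lambda>i. ltype.Bang (B i)) + seqs ys' \<Gamma>i' (\<lambda>i. ltype.Bang (B i))) = ?R + ?X"
    "flat (\<Psi> + {#\<Gamma> + {#(x, ltype.Quest A)#}#} + seqs ys \<Gamma>i (\<lambda>i. ltype.Bang (B i))) = ?R + {#}"
    using CBangContract(1) by (simp_all add: ac_simps)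
  let ?S = "\<Sigma> + {#(?M, GBang x ys G)#}"
  have ev: "set_mset (edom \<Sigma>) \<subseteq> evars \<Sigma>" by (rule edom_subset_evars)
  have "sess_ok ?S (?R + ?X)"
    using w unfolding well_def F by simp
  then have "sess_ok ?S (?R + {#})"
  proof (rule sess_ok_change)
    \<comment> \<open>The copied contexts avoid \<Sigma> by the side condition of the rule;
      \<open>x'\<close> and \<open>ys'\<close> avoid it because they form a session of their own in
      the premise.\<close>
    have "set_mset (names ?X) \<inter> set_mset (edom \<Sigma>) = {}"
      using CBangContract(1,5) ev wf[THEN conjunct1] by (auto simp: set_mset_sum)
    moreover have "set_mset (names ?X) \<inter> set_mset ?M = {}"
      using wf[THEN conjunct2] wf[THEN conjunct1] CBangContract(1) by (auto simp: set_mset_sum)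
    ultimately show "set_mset (names ?X) \<inter> set_mset (edom ?S) = {}" by auto
  qed simp
  then show ?case unfolding F .
qed auto

section \<open>Free endpoints, and the count of sequents and sessions\<close>

lemma Union_fv_nth: "\<Union> (set (map fv Qs)) = (\<Union>i<length Qs. fv (Qs ! i))"
  by (force simp: in_set_conv_nth)

lemma exch_single_image: "w \<in> S \<Longrightarrow> x \<notin> S \<Longrightarrow> exch [x] [w] ` S = insert x (S - {w})"
  by (auto simp: image_iff)

text \<open>The free endpoints of a term do not depend on how it is typed, so any typing at all
  reveals the domain of the hypersequent in every other typing.\<close>

lemma rule_fv:
  assumes "rule F J \<Sigma> \<Psi>" "\<forall>(S, H) \<in> set J. well S H" "length Ps = length J" "wf \<Sigma> \<Psi>"
    "\<forall>i<length J. fv (Ps ! i) = set_mset (hdom (snd (J ! i)))"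
  shows "fv (F Ps) = set_mset (hdom \<Psi>)"
  using assms
proof (induction rule: rule.induct)
  case (Conn G xs A \<Sigma>i \<Psi>i \<Gamma>i)
  have "Ps \<noteq> []"
    using coherent_nonempty[OF Conn(1)] Conn(3) by (auto simp: fam_def)
  then have "fv (par Ps) = (\<Union>i<length xs. fv (Ps ! i))"
    using Conn(3) by (force simp: fv_par in_set_conv_nth)
  then show ?case using Conn(5) by (simp add: set_mset_sum)
next
  case (Scope xs G \<Sigma> \<Psi> \<Gamma>i A)
  let ?H = "\<Psi> + seqs xs \<Gamma>i A"
  have w: "well (\<Sigma> + {#(mset xs, G)#}) ?H" using Scope by simp
  then have "G \<Turnstile> rst (mset xs) (flat ?H)" "names (rst (mset xs) (flat ?H)) = mset xs"
    by (simp_all only: well_def sess_ok_simps)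
  \<comment> \<open>Coherence puts the names of \<open>G\<close> among the hidden endpoints, so the
    annotation of the restriction contributes nothing free.\<close>
  then have "set_gtype G \<subseteq> set xs"
    using coherent_vars by fastforce
  moreover have "set_mset (hdom \<Psi> + (\<Sum>i<length xs. names (\<Gamma>i i))) \<inter> set xs = {}"
    using w by (auto simp: well_def wf_def)
  moreover have "fv (Ps ! 0) = set_mset (hdom \<Psi> + (\<Sum>i<length xs. names (\<Gamma>i i))) \<union> set xs"
    using Scope by auto
  ultimately show ?case by (auto simp: un_def)
next
  case (CAx w \<Sigma> A B y x \<Psi> \<Gamma>)
  have "fv (Ps ! 0) = insert w (set_mset (names \<Gamma>) \<union> set_mset (hdom \<Psi>))"
    using CAx by simp
  moreover have "x \<notin># names \<Gamma>" "x \<notin># hdom \<Psi>" "x \<noteq> w" "w \<notin># names \<Gamma>" "w \<notin># hdom \<Psi>"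
    using CAx by (auto simp: wf_def)
  moreover from calculation have "exch [x] [w] ` fv (Ps ! 0) = insert x (fv (Ps ! 0) - {w})"
    by (intro exch_single_image) auto
  ultimately have "fv (map_trm (exch [x] [w]) (Ps ! 0)) = insert x (set_mset (names \<Gamma>) \<union> set_mset (hdom \<Psi>))"
    unfolding fv_rename[OF inj_exch_single] by auto
  then show ?case by (auto simp: un_def)
next
  case (CTensorParr xs' xs y y' \<Sigma> us H G \<Psi> \<Gamma>1 A \<Gamma>2 B \<Gamma> C D)
  let ?N = "set_mset (hdom \<Psi> + (\<Sum>i<length xs. names (\<Gamma>1 i)) + (\<Sum>i<length xs. names (\<Gamma>2 i)) + names \<Gamma>) \<union> set xs \<union> {y}"
  have "?N \<inter> (set xs' \<union> {y'}) = {}"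
    using CTensorParr(1,2) by (auto simp: well_def wf_def simp del: sess_ok_simps member_sum)
  moreover have "fv (Ps ! 0) = ?N \<union> set xs' \<union> {y'}"
    using CTensorParr by auto
  moreover have "set_mset (hdom (\<Psi> + seqs xs (\<lambda>i. \<Gamma>1 i + \<Gamma>2 i) (\<lambda>i. ltype.Tensor (A i) (B i)) + {#\<Gamma> + {#(y, ltype.Parr C D)#}#})) = ?N"
    by (auto simp: sum.distrib)
  ultimately show ?case unfolding un_def fv.simps by blast
next
  case (COplusWith1 H x B ys D us E \<Sigma> \<Sigma>i G \<Psi> \<Psi>i \<Gamma> A \<Gamma>i C \<Delta>)
  obtain P Qs where Ps: "Ps = P # Qs" "length Qs = length ys" using COplusWith1(3) by (cases Ps) auto
  then show ?case using COplusWith1(5) by (auto simp: Union_fv_nth All_less_Suc2 set_mset_sum simp del: set_map)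
next
  case (COplusWith2 G x A ys C us E \<Sigma> \<Sigma>i H \<Psi> \<Psi>i \<Gamma> B \<Gamma>i D \<Delta>)
  obtain P Qs where Ps: "Ps = P # Qs" "length Qs = length ys" using COplusWith2(3) by (cases Ps) auto
  then show ?case using COplusWith2(5) by (auto simp: Union_fv_nth All_less_Suc2 set_mset_sum simp del: set_map)
next
  case (CBangWeaken G x A ys B \<Gamma>i \<Sigma> \<Psi> \<Gamma>)
  obtain P Qs where Ps: "Ps = P # Qs" "length Qs = length ys" using CBangWeaken(4) by (cases Ps) auto
  then show ?case using CBangWeaken(6) by (auto simp: Union_fv_nth All_less_Suc2 set_mset_sum simp del: set_map)
next
  case (CBangContract ys' ys zs' zs \<Gamma>i \<Gamma>i' \<Sigma> x x' G \<Psi> \<Gamma> A B)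
  let ?N = "set_mset (hdom \<Psi> + (\<Sum>i<length ys. names (\<Gamma>i i)) + names \<Gamma>) \<union> set ys \<union> {x}"
  let ?N' = "set_mset (\<Sum>i<length ys. names (\<Gamma>i' i)) \<union> set ys' \<union> {x'}"
  have "?N \<inter> ?N' = {}"
    using CBangContract(1,6) by (auto simp: well_def wf_def simp del: sess_ok_simps member_sum)
  moreover have "fv (Ps ! 0) = ?N \<union> ?N'"
    using CBangContract(1,9) by (auto simp del: member_sum)
  \<comment> \<open>By well-formedness \<open>zs\<close> lists the names of the server contexts
    without repetition, so the exchange sends it to \<open>zs'\<close>, which therefore lists the
    names of the copies.\<close>
  moreover have "set zs' = set_mset (\<Sum>i<length ys. names (\<Gamma>i' i))"
  proof -
    have "distinct zs"
      using CBangContract(3,8) by (auto simp: wf_def simp flip: nodup_mset)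
    moreover have "(\<Sum>i<length ys. names (\<Gamma>i' i)) = image_mset (exch zs zs') (mset zs)"
      unfolding CBangContract(3,4) by (simp add: image_mset_sum flip: rC_def)
    ultimately show ?thesis
      using CBangContract(2) by (simp add: map_exch flip: mset_map)
  qed
  moreover have "set zs = set_mset (\<Sum>i<length ys. names (\<Gamma>i i))"
    using CBangContract(3) by (metis set_mset_mset)
  ultimately show ?case by (simp add: un_def) blast
qed (auto simp: un_def bin_def well_def wf_def less_Suc_eq all_conj_distrib set_mset_sum simp flip: set_mset_mset)

text \<open>Vertices minus edges of the bipartite graph described at the beginning.
  \<open>Conn\<close> joins n trees by one new vertex and n edges; \<open>Scope\<close> contracts a
  vertex and its n edges, merging n sequents into one.\<close>

lemma rule_count:
  assumes "rule F J \<Sigma> \<Psi>" "\<forall>(S, H) \<in> set J. size H + size S = Suc (size (edom S))"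
  shows "size \<Psi> + size \<Sigma> = Suc (size (edom \<Sigma>))"
  using assms
proof (induction rule: rule.induct)
  case (Conn G xs A \<Sigma>i \<Psi>i \<Gamma>i)
  \<comment> \<open>The displayed sequent of each component is left out here; it cancels the 1 on
    the right of that component's equation.\<close>
  have "(\<Sum>i<length xs. size (\<Psi>i i) + size (\<Sigma>i i)) = (\<Sum>i<length xs. size (edom (\<Sigma>i i)))"
    by (rule sum.cong) (use Conn(2) in auto)
  then show ?case by (simp add: sum.distrib sum_Suc)
qed auto

section \<open>Connectedness\<close>

text \<open>
  In a derivable judgement, the sequents and the sessions are the edges of a hypergraph on the
  endpoints. It is connected (\<open>linked\<close>: a set of endpoints that splits no edge is trivial) and has
  the number of edges of a tree (\<open>rule_count\<close>).
\<close>

definition unif :: "ep set \<Rightarrow> ep set \<Rightarrow> bool" where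
  "unif N X \<longleftrightarrow> X \<subseteq> N \<or> X \<inter> N = {}"

definition linked :: "env \<Rightarrow> hyp \<Rightarrow> bool" where
  "linked \<Sigma> \<Psi> \<longleftrightarrow> (\<forall>N. (\<forall>(M, G) \<in># \<Sigma>. unif N (set_mset M)) \<longrightarrow>
     (\<forall>\<Gamma> \<in># \<Psi>. unif N (set_mset (names \<Gamma>))) \<longrightarrow> unif N (set_mset (hdom \<Psi>)))"

lemma linkedD:
  assumes "linked \<Sigma> \<Psi>" "\<And>M G. (M, G) \<in># \<Sigma> \<Longrightarrow> unif N (set_mset M)"
    "\<And>\<Gamma>. \<Gamma> \<in># \<Psi> \<Longrightarrow> unif N (set_mset (names \<Gamma>))"
  shows "unif N (set_mset (hdom \<Psi>))"
  using assms by (auto simp: linked_def)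

lemma linkedI:
  assumes "\<And>N. (\<And>M G. (M, G) \<in># \<Sigma> \<Longrightarrow> unif N (set_mset M)) \<Longrightarrow>
    (\<And>\<Gamma>. \<Gamma> \<in># \<Psi> \<Longrightarrow> unif N (set_mset (names \<Gamma>))) \<Longrightarrow> unif N (set_mset (hdom \<Psi>))"
  shows "linked \<Sigma> \<Psi>"
  using assms by (auto simp: linked_def)

lemma unif_subset: "unif N S \<Longrightarrow> T \<subseteq> S \<Longrightarrow> unif N T"
  by (auto simp: unif_def)

lemma unif_hit: "unif N S \<Longrightarrow> N \<subseteq> S \<Longrightarrow> N \<noteq> {} \<Longrightarrow> S \<subseteq> N"
  by (auto simp: unif_def)

text \<open>\<open>X\<close> are the endpoints bound by the rule, \<open>c\<close> is the side of \<open>N\<close> on which they are put.\<close>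

lemma linked_bound:
  assumes "linked \<Sigma> \<Psi>"
    "\<And>M G. (M, G) \<in># \<Sigma> \<Longrightarrow>
       set_mset M \<inter> X = {} \<and> unif N (set_mset M) \<or> (\<forall>z \<in> set_mset M - X. z \<in> N \<longleftrightarrow> c)"
    "\<And>\<Gamma>. \<Gamma> \<in># \<Psi> \<Longrightarrow>
       set_mset (names \<Gamma>) \<inter> X = {} \<and> unif N (set_mset (names \<Gamma>)) \<or>
       (\<forall>z \<in> set_mset (names \<Gamma>) - X. z \<in> N \<longleftrightarrow> c)"
  shows "unif N (set_mset (hdom \<Psi>) - X) \<and>
    (X \<inter> set_mset (hdom \<Psi>) \<noteq> {} \<longrightarrow> (\<forall>z \<in> set_mset (hdom \<Psi>) - X. z \<in> N \<longleftrightarrow> c))"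
proof -
  define N' where "N' = (if c then N \<union> X else N - X)"
  have *: "unif N' S" if "S \<inter> X = {} \<and> unif N S \<or> (\<forall>z \<in> S - X. z \<in> N \<longleftrightarrow> c)" for S
    using that by (cases c) (auto simp: unif_def N'_def)
  have "unif N' (set_mset (hdom \<Psi>))"
    using assms by (intro linkedD[OF assms(1)] *) auto
  then show ?thesis
    by (cases c) (auto simp: unif_def N'_def)
qed

lemma names_seqs: "image_mset names (seqs xs \<Gamma> A) = (\<Sum>i<length xs. {#add_mset (xs ! i) (names (\<Gamma> i))#})"
  by (simp add: seqs_def image_mset_sum)

text \<open>Connectedness ignores types and global types. This settles every rule that changes
  nothing else.\<close>

lemma linked_same:
  assumes "linked \<Sigma> \<Psi>" "image_mset fst \<Sigma> = image_mset fst \<Sigma>'"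
    "image_mset names \<Psi> = image_mset names \<Psi>'"
  shows "linked \<Sigma>' \<Psi>'"
proof -
  have "linked \<Sigma> \<Psi> \<longleftrightarrow> (\<forall>N. (\<forall>M \<in># image_mset fst \<Sigma>. unif N (set_mset M)) \<longrightarrow>
     (\<forall>X \<in># image_mset names \<Psi>. unif N (set_mset X)) \<longrightarrow> unif N (set_mset (\<Sum>\<^sub># (image_mset names \<Psi>))))" for \<Sigma> \<Psi>
    by (fastforce simp: linked_def hdom_def)
  then show ?thesis using assms by metis
qed

lemma linked_single: "linked \<Sigma> {#\<Gamma>#}"
  by (auto simp: linked_def)

text \<open>Connectedness cannot see an empty sequent, because no set of endpoints splits it. If one
  stood beside others, adding an endpoint to it, as \<open>Bot\<close>, \<open>Weaken\<close>,
  \<open>COneBot\<close> or \<open>CBangWeaken\<close> may do, would disconnect the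
  judgement.\<close>

definition solo :: "hyp \<Rightarrow> bool" where
  "solo \<Psi> \<longleftrightarrow> ({#} \<in># \<Psi> \<longrightarrow> size \<Psi> = 1)"

lemma solo_add: "solo (add_mset {#} \<Psi>) \<longleftrightarrow> \<Psi> = {#}"
  by (auto simp: solo_def)

text \<open>A set \<open>N\<close> that splits no edge of the conclusion is extended to the
  endpoints bound by the rule, by putting them on the side of the edge to which they are attached.
  The extended set splits no edge of the premise, to which the assumption applies.\<close>

lemma rule_linked:
  assumes "rule F J \<Sigma> \<Psi>" "wf \<Sigma> \<Psi>" "\<forall>(S, H) \<in> set J. well S H \<and> linked S H \<and> solo H"
  shows "linked \<Sigma> \<Psi>"
  using assms
proof (induction rule: rule.induct)
  case (Conn G xs A \<Sigma>i \<Psi>i \<Gamma>i)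
  let ?H = "\<lambda>i. \<Psi>i i + {#\<Gamma>i i + {#(xs ! i, A i)#}#}"
  show ?case
  proof (rule linkedI)
    fix N assume M: "\<And>M G'. (M, G') \<in># sum \<Sigma>i {..<length xs} + {#(mset xs, G)#} \<Longrightarrow> unif N (set_mset M)"
      and S: "\<And>\<Gamma>. \<Gamma> \<in># (\<Sum>i<length xs. ?H i) \<Longrightarrow> unif N (set_mset (names \<Gamma>))"
    have H: "unif N (set_mset (hdom (?H i)))" if "i < length xs" for i
    proof (rule linkedD)
      show "linked (\<Sigma>i i) (?H i)" using Conn(3) that by auto
      show "unif N (set_mset M)" if "(M, G') \<in># \<Sigma>i i" for M G'
        using M[of M G'] \<open>i < length xs\<close> that by auto
      show "unif N (set_mset (names \<Gamma>))" if "\<Gamma> \<in># ?H i" for \<Gamma>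
        using S[of \<Gamma>] \<open>i < length xs\<close> that unfolding member_sum by blast
    qed
    have x: "xs ! i \<in># hdom (?H i)" for i by simp
    have xs: "unif N (set xs)" using M[of "mset xs" G] by simp
    have "unif N (\<Union>i<length xs. set_mset (hdom (?H i)))"
    proof (cases "set xs \<subseteq> N")
      case True
      then have "set_mset (hdom (?H i)) \<subseteq> N" if "i < length xs" for i
        using H[OF that] x[of i] nth_mem[OF that] unfolding unif_def by blast
      then show ?thesis unfolding unif_def by blast
    next
      case False
      then have "set_mset (hdom (?H i)) \<inter> N = {}" if "i < length xs" for i
        using H[OF that] x[of i] nth_mem[OF that] xs unfolding unif_def by blast
      then show ?thesis unfolding unif_def by blast
    qed
    then show "unif N (set_mset (hdom (\<Sum>i<length xs. ?H i)))"
      by (simp only: hdom_simps(4) set_mset_sum finite_lessThan)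
  qed
next
  case (Scope xs G \<Sigma> \<Psi> \<Gamma>i A)
  let ?H = "\<Psi> + seqs xs \<Gamma>i A" and ?Y = "set_mset (\<Sum>i<length xs. names (\<Gamma>i i))"
  have w: "well (\<Sigma> + {#(mset xs, G)#}) ?H" and l: "linked (\<Sigma> + {#(mset xs, G)#}) ?H" using Scope by simp_all
  have d: "set xs \<inter> set_mset (hdom \<Psi>) = {}" "set xs \<inter> ?Y = {}" "set xs \<inter> set_mset (edom \<Sigma>) = {}"
    using w by (auto simp: well_def wf_def simp del: member_sum)
  show ?case
  proof (rule linkedI)
    fix N assume M: "\<And>M G'. (M, G') \<in># \<Sigma> \<Longrightarrow> unif N (set_mset M)"
      and S: "\<And>\<Gamma>. \<Gamma> \<in># \<Psi> + {#\<Sum>i<length xs. \<Gamma>i i#} \<Longrightarrow> unif N (set_mset (names \<Gamma>))"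
    have Y: "unif N ?Y" using S[of "\<Sum>i<length xs. \<Gamma>i i"] by simp
    \<comment> \<open>The merged sequent lies on one side of \<open>N\<close>, and the hidden
      endpoints are put there. If it is empty, the test \<open>?Y \<subseteq> N\<close> holds and
      the side of \<open>N\<close> is taken.\<close>
    have c: "\<forall>z \<in> ?Y. z \<in> N \<longleftrightarrow> ?Y \<subseteq> N" using Y by (auto simp: unif_def)
    have "unif N (set_mset (hdom ?H) - set xs)"
    proof (rule linked_bound[OF l, THEN conjunct1])
      fix M G' assume "(M, G') \<in># \<Sigma> + {#(mset xs, G)#}"
      then consider "(M, G') \<in># \<Sigma>" | "M = mset xs" by auto
      then show "set_mset M \<inter> set xs = {} \<and> unif N (set_mset M) \<or> (\<forall>z \<in> set_mset M - set xs. z \<in> N \<longleftrightarrow> ?Y \<subseteq> N)"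
        using M[of M G'] d(3) unfolding disjoint_iff in_edom by cases auto
    next
      fix \<Gamma> assume "\<Gamma> \<in># ?H"
      then consider "\<Gamma> \<in># \<Psi>" | i where "i < length xs" "\<Gamma> = add_mset (xs ! i, A i) (\<Gamma>i i)"
        by (auto simp: in_seqs)
      then show "set_mset (names \<Gamma>) \<inter> set xs = {} \<and> unif N (set_mset (names \<Gamma>)) \<or> (\<forall>z \<in> set_mset (names \<Gamma>) - set xs. z \<in> N \<longleftrightarrow> ?Y \<subseteq> N)"
        using S[of \<Gamma>] d(1) c unfolding disjoint_iff in_hdom member_sum by cases auto
    qed
    moreover have "set_mset (hdom (\<Psi> + {#\<Sum>i<length xs. \<Gamma>i i#})) = set_mset (hdom ?H) - set xs"
      using d(1,2) by auto
    ultimately show "unif N (set_mset (hdom (\<Psi> + {#\<Sum>i<length xs. \<Gamma>i i#})))" by simp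
  qed
next
  case (Tensor x \<Sigma>1 \<Sigma>2 x' \<Psi>1 \<Gamma>1 A \<Psi>2 \<Gamma>2 B)
  let ?H1 = "\<Psi>1 + {#\<Gamma>1 + {#(x', A)#}#}" and ?H2 = "\<Psi>2 + {#\<Gamma>2 + {#(x, B)#}#}"
  have w: "well \<Sigma>1 ?H1" "linked \<Sigma>1 ?H1" "linked \<Sigma>2 ?H2"
    using Tensor by simp_all
  have d: "x' \<notin># names \<Gamma>1" "\<And>\<Gamma>. \<Gamma> \<in># \<Psi>1 \<Longrightarrow> x' \<notin># names \<Gamma>"
    "\<And>M G. (M, G) \<in># \<Sigma>1 \<Longrightarrow> x' \<notin># M" "x' \<notin># hdom \<Psi>1"
    using w(1) Tensor(2) by (auto simp: well_def wf_def in_hdom in_edom)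
  show ?case
  proof (rule linkedI)
    fix N assume M: "\<And>M G'. (M, G') \<in># \<Sigma>1 + \<Sigma>2 \<Longrightarrow> unif N (set_mset M)"
      and S: "\<And>\<Gamma>. \<Gamma> \<in># \<Psi>1 + \<Psi>2 + {#\<Gamma>1 + \<Gamma>2 + {#(x, ltype.Tensor A B)#}#} \<Longrightarrow> unif N (set_mset (names \<Gamma>))"
    have S0: "unif N (insert x (set_mset (names \<Gamma>1) \<union> set_mset (names \<Gamma>2)))"
      using S[of "\<Gamma>1 + \<Gamma>2 + {#(x, ltype.Tensor A B)#}"] by simp
    have 2: "unif N (set_mset (hdom ?H2))"
      by (rule linkedD[OF w(3)])
        (use M S S0 in \<open>auto elim: unif_subset\<close>)
    \<comment> \<open>The bound \<open>x'\<close> is put on the side of \<open>x\<close>. As it does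
      occur in the first premise, that whole premise follows it to this side, where the second
      premise already has \<open>x\<close>.\<close>
    have "{x'} \<inter> set_mset (hdom ?H1) \<noteq> {} \<longrightarrow> (\<forall>z \<in> set_mset (hdom ?H1) - {x'}. z \<in> N \<longleftrightarrow> x \<in> N)"
      by (rule linked_bound[OF w(2), THEN conjunct2])
        (use M S S0 d in \<open>auto simp: unif_def\<close>)
    then have "\<forall>z \<in> set_mset (hdom \<Psi>1). z \<in> N \<longleftrightarrow> x \<in> N"
      using d(4) by auto
    then show "unif N (set_mset (hdom (\<Psi>1 + \<Psi>2 + {#\<Gamma>1 + \<Gamma>2 + {#(x, ltype.Tensor A B)#}#})))"
      using 2 S0 by (auto simp: unif_def)
  qed
next
  case (Parr y \<Sigma> y' \<Psi> \<Gamma> A B)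
  let ?H = "\<Psi> + {#\<Gamma> + {#(y', A), (y, B)#}#}"
  have w: "well \<Sigma> ?H" "linked \<Sigma> ?H" using Parr by simp_all
  have d: "y' \<notin># names \<Gamma>" "\<And>\<Gamma>. \<Gamma> \<in># \<Psi> \<Longrightarrow> y' \<notin># names \<Gamma>"
    "\<And>M G. (M, G) \<in># \<Sigma> \<Longrightarrow> y' \<notin># M" "y' \<notin># hdom \<Psi>" "y' \<noteq> y"
    using w(1) Parr(2) by (auto simp: well_def wf_def in_hdom in_edom)
  show ?case
  proof (rule linkedI)
    fix N assume M: "\<And>M G'. (M, G') \<in># \<Sigma> \<Longrightarrow> unif N (set_mset M)"
      and S: "\<And>\<Gamma>'. \<Gamma>' \<in># \<Psi> + {#\<Gamma> + {#(y, ltype.Parr A B)#}#} \<Longrightarrow> unif N (set_mset (names \<Gamma>'))"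
    have S0: "unif N (insert y (set_mset (names \<Gamma>)))"
      using S[of "\<Gamma> + {#(y, ltype.Parr A B)#}"] by simp
    have "unif N (set_mset (hdom ?H) - {y'})"
      by (rule linked_bound[OF w(2), where c = "y \<in> N", THEN conjunct1])
        (use M S S0 d in \<open>auto simp: unif_def\<close>)
    moreover have "set_mset (hdom (\<Psi> + {#\<Gamma> + {#(y, ltype.Parr A B)#}#})) = set_mset (hdom ?H) - {y'}"
      using d by auto
    ultimately show "unif N (set_mset (hdom (\<Psi> + {#\<Gamma> + {#(y, ltype.Parr A B)#}#})))" by simp
  qed
next
  case (Contract x \<Sigma> x' \<Psi> \<Gamma> A)
  let ?H = "\<Psi> + {#\<Gamma> + {#(x, ltype.Quest A), (x', ltype.Quest A)#}#}"
  have w: "well \<Sigma> ?H" "linked \<Sigma> ?H" using Contract by simp_all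
  have d: "x' \<notin># names \<Gamma>" "\<And>\<Gamma>. \<Gamma> \<in># \<Psi> \<Longrightarrow> x' \<notin># names \<Gamma>"
    "\<And>M G. (M, G) \<in># \<Sigma> \<Longrightarrow> x' \<notin># M" "x' \<notin># hdom \<Psi>" "x' \<noteq> x"
    using w(1) Contract(2) by (auto simp: well_def wf_def in_hdom in_edom)
  show ?case
  proof (rule linkedI)
    fix N assume M: "\<And>M G'. (M, G') \<in># \<Sigma> \<Longrightarrow> unif N (set_mset M)"
      and S: "\<And>\<Gamma>'. \<Gamma>' \<in># \<Psi> + {#\<Gamma> + {#(x, ltype.Quest A)#}#} \<Longrightarrow> unif N (set_mset (names \<Gamma>'))"
    have S0: "unif N (insert x (set_mset (names \<Gamma>)))"
      using S[of "\<Gamma> + {#(x, ltype.Quest A)#}"] by simp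
    have "unif N (set_mset (hdom ?H) - {x'})"
      by (rule linked_bound[OF w(2), where c = "x \<in> N", THEN conjunct1])
        (use M S S0 d in \<open>auto simp: unif_def\<close>)
    moreover have "set_mset (hdom (\<Psi> + {#\<Gamma> + {#(x, ltype.Quest A)#}#})) = set_mset (hdom ?H) - {x'}"
      using d by auto
    ultimately show "unif N (set_mset (hdom (\<Psi> + {#\<Gamma> + {#(x, ltype.Quest A)#}#})))" by simp
  qed
next
  case (Bot y \<Sigma> \<Psi> \<Gamma>)
  show ?case
  proof (cases "\<Gamma> = {#}")
    case True
    then have "\<Psi> = {#}" using Bot by (simp add: solo_add)
    then show ?thesis by (simp add: linked_single)
  next
    case False
    then obtain z where z: "z \<in># names \<Gamma>" by (metis names_def image_mset_is_empty_iff multiset_nonemptyE)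
    show ?thesis
    proof (rule linkedI)
      fix N assume M: "\<And>M G'. (M, G') \<in># \<Sigma> \<Longrightarrow> unif N (set_mset M)"
        and S: "\<And>\<Gamma>'. \<Gamma>' \<in># \<Psi> + {#\<Gamma> + {#(y, TBot)#}#} \<Longrightarrow> unif N (set_mset (names \<Gamma>'))"
      have S0: "unif N (insert y (set_mset (names \<Gamma>)))"
        using S[of "\<Gamma> + {#(y, TBot)#}"] by simp
      have "unif N (set_mset (hdom (\<Psi> + {#\<Gamma>#})))"
        by (rule linkedD[of \<Sigma>]) (use Bot M S S0 in \<open>auto elim: unif_subset\<close>)
      then show "unif N (set_mset (hdom (\<Psi> + {#\<Gamma> + {#(y, TBot)#}#})))"
        using S0 z by (auto simp: unif_def)
    qed
  qed
next
  case (Weaken x \<Sigma> \<Psi> \<Gamma> A)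
  show ?case
  proof (cases "\<Gamma> = {#}")
    case True
    then have "\<Psi> = {#}" using Weaken by (simp add: solo_add)
    then show ?thesis by (simp add: linked_single)
  next
    case False
    then obtain z where z: "z \<in># names \<Gamma>" by (metis names_def image_mset_is_empty_iff multiset_nonemptyE)
    show ?thesis
    proof (rule linkedI)
      fix N assume M: "\<And>M G'. (M, G') \<in># \<Sigma> \<Longrightarrow> unif N (set_mset M)"
        and S: "\<And>\<Gamma>'. \<Gamma>' \<in># \<Psi> + {#\<Gamma> + {#(x, ltype.Quest A)#}#} \<Longrightarrow> unif N (set_mset (names \<Gamma>'))"
      have S0: "unif N (insert x (set_mset (names \<Gamma>)))"
        using S[of "\<Gamma> + {#(x, ltype.Quest A)#}"] by simp
      have "unif N (set_mset (hdom (\<Psi> + {#\<Gamma>#})))"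
        by (rule linkedD[of \<Sigma>]) (use Weaken M S S0 in \<open>auto elim: unif_subset\<close>)
      then show "unif N (set_mset (hdom (\<Psi> + {#\<Gamma> + {#(x, ltype.Quest A)#}#})))"
        using S0 z by (auto simp: unif_def)
    qed
  qed
next
  case (CAx w \<Sigma> A B y x \<Psi> \<Gamma>)
  show ?case
  proof (rule linkedI)
    fix N assume M: "\<And>M G'. (M, G') \<in># \<Sigma> + {#({#x, y#}, GLink x A y)#} \<Longrightarrow> unif N (set_mset M)"
      and S: "\<And>\<Gamma>'. \<Gamma>' \<in># \<Psi> + {#\<Gamma> + {#(x, A)#}, {#(w, A), (y, B)#}#} \<Longrightarrow> unif N (set_mset (names \<Gamma>'))"
    have S0: "unif N (insert x (set_mset (names \<Gamma>)))" "unif N {w, y}" "unif N {x, y}"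
      using S[of "\<Gamma> + {#(x, A)#}"] S[of "{#(w, A), (y, B)#}"] M[of "{#x, y#}" "GLink x A y"] by simp_all
    \<comment> \<open>In the conclusion \<open>w\<close> still hangs on the context: it shares a
      sequent with \<open>y\<close>, \<open>y\<close> shares the new session with \<open>x\<close>,
      and \<open>x\<close> shares a sequent with \<Gamma>.\<close>
    then have S1: "unif N (insert w (set_mset (names \<Gamma>)))" by (auto simp: unif_def)
    have "unif N (set_mset (hdom (\<Psi> + {#\<Gamma> + {#(w, A)#}#})))"
      by (rule linkedD[of \<Sigma>]) (use CAx M S S1 in auto)
    then show "unif N (set_mset (hdom (\<Psi> + {#\<Gamma> + {#(x, A)#}, {#(w, A), (y, B)#}#})))"
      using S0 by (auto simp: unif_def)
  qed
next
  case (CTensorParr xs' xs y y' \<Sigma> us H G \<Psi> \<Gamma>1 A \<Gamma>2 B \<Gamma> C D)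
  let ?S = "\<Sigma> + {#(mset xs + {#y#} + mset us, H),
               (mset xs' + {#y'#}, map_gtype (exch (xs @ [y]) (xs' @ [y'])) G)#}"
  let ?H = "\<Psi> + seqs xs' \<Gamma>1 A + seqs xs \<Gamma>2 B + {#\<Gamma> + {#(y', C), (y, D)#}#}"
  let ?X = "set xs' \<union> {y'}"
  let ?K = "\<Psi> + seqs xs (\<lambda>i. \<Gamma>1 i + \<Gamma>2 i) (\<lambda>i. ltype.Tensor (A i) (B i)) + {#\<Gamma> + {#(y, ltype.Parr C D)#}#}"
  have w: "well ?S ?H" and l: "linked ?S ?H" using CTensorParr by simp_all
  have d: "?X \<inter> set_mset (hdom ?K) = {}" "?X \<inter> set_mset (edom \<Sigma>) = {}"
    using w CTensorParr(1) by (auto simp: well_def wf_def sum.distrib simp del: member_sum sess_ok_simps)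
  show ?case
  proof (rule linkedI)
    fix N assume M: "\<And>M G'. (M, G') \<in># \<Sigma> + {#(mset xs + {#y#} + mset us, GComm xs y G H)#} \<Longrightarrow> unif N (set_mset M)"
      and S: "\<And>\<Gamma>'. \<Gamma>' \<in># ?K \<Longrightarrow> unif N (set_mset (names \<Gamma>'))"
    \<comment> \<open>The session alone puts all its endpoints on the side of \<open>y\<close>; the
      sequents of these endpoints follow, and so may the bound endpoints.\<close>
    have c: "\<forall>z \<in> set xs \<union> set us. z \<in> N \<longleftrightarrow> y \<in> N"
      using M[of "mset xs + {#y#} + mset us" "GComm xs y G H"] by (auto simp: unif_def)
    have c1: "\<forall>z \<in> set_mset (names (\<Gamma>1 i)) \<union> set_mset (names (\<Gamma>2 i)). z \<in> N \<longleftrightarrow> y \<in> N" if i: "i < length xs" for i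
    proof -
      have "xs ! i \<in> N \<longleftrightarrow> y \<in> N" using c i by simp
      moreover have "add_mset (xs ! i, ltype.Tensor (A i) (B i)) (\<Gamma>1 i + \<Gamma>2 i) \<in># ?K"
        using i by (auto simp: in_seqs)
      from S[OF this] have "unif N (insert (xs ! i) (set_mset (names (\<Gamma>1 i)) \<union> set_mset (names (\<Gamma>2 i))))" by simp
      ultimately show ?thesis by (auto simp: unif_def)
    qed
    have c2: "\<forall>z \<in> set_mset (names \<Gamma>). z \<in> N \<longleftrightarrow> y \<in> N"
      using S[of "\<Gamma> + {#(y, ltype.Parr C D)#}"] by (auto simp: unif_def)
    have "unif N (set_mset (hdom ?H) - ?X)"
    proof (rule linked_bound[OF l, where c = "y \<in> N", THEN conjunct1])
      fix M G' assume "(M, G') \<in># ?S"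
      then consider "(M, G') \<in># \<Sigma>" | "M = mset xs + {#y#} + mset us" | "M = mset xs' + {#y'#}" by auto
      then show "set_mset M \<inter> ?X = {} \<and> unif N (set_mset M) \<or> (\<forall>z \<in> set_mset M - ?X. z \<in> N \<longleftrightarrow> y \<in> N)"
      proof cases
        case 1
        then show ?thesis using M[of M G'] d(2) unfolding disjoint_iff in_edom by auto
      qed (use c in auto)
    next
      fix \<Gamma>' assume "\<Gamma>' \<in># ?H"
      then consider "\<Gamma>' \<in># \<Psi>" | i where "i < length xs" "\<Gamma>' = add_mset (xs' ! i, A i) (\<Gamma>1 i)"
        | i where "i < length xs" "\<Gamma>' = add_mset (xs ! i, B i) (\<Gamma>2 i)" | "\<Gamma>' = \<Gamma> + {#(y', C), (y, D)#}"
        using CTensorParr(1) by (auto simp: in_seqs)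
      then show "set_mset (names \<Gamma>') \<inter> ?X = {} \<and> unif N (set_mset (names \<Gamma>')) \<or> (\<forall>z \<in> set_mset (names \<Gamma>') - ?X. z \<in> N \<longleftrightarrow> y \<in> N)"
      proof cases
        case 1
        then have "\<Gamma>' \<in># ?K" by simp
        with S[of \<Gamma>'] d(1) show ?thesis unfolding disjoint_iff in_hdom by blast
      next
        case (2 i)
        then show ?thesis using c1[of i] CTensorParr(1) by auto
      next
        case (3 i)
        then show ?thesis using c1[of i] c by auto
      next
        case 4
        then show ?thesis using c2 by auto
      qed
    qed
    moreover have "set_mset (hdom ?K) = set_mset (hdom ?H) - ?X"
      using d(1) CTensorParr(1) by (auto simp: sum.distrib simp del: member_sum)
    ultimately show "unif N (set_mset (hdom ?K))" by simp
  qed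
next
  case (COneBot xs y \<Sigma> \<Psi> \<Gamma>)
  let ?H = "\<Psi> + {#\<Gamma>#}"
  let ?K = "\<Psi> + seqs xs (\<lambda>i. {#}) (\<lambda>i. TOne) + {#\<Gamma> + {#(y, TBot)#}#}"
  have l: "linked \<Sigma> ?H" and s: "solo ?H" using COneBot by simp_all
  show ?case
  proof (rule linkedI)
    fix N assume M: "\<And>M G'. (M, G') \<in># \<Sigma> + {#(mset xs + {#y#}, GClose xs y)#} \<Longrightarrow> unif N (set_mset M)"
      and S: "\<And>\<Gamma>'. \<Gamma>' \<in># ?K \<Longrightarrow> unif N (set_mset (names \<Gamma>'))"
    have c: "unif N (insert y (set xs))" "unif N (insert y (set_mset (names \<Gamma>)))"
      using M[of "mset xs + {#y#}" "GClose xs y"] S[of "\<Gamma> + {#(y, TBot)#}"] by simp_all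
    have "unif N (set_mset (hdom ?H))"
      by (rule linkedD[OF l]) (use M S c(2) in \<open>auto elim: unif_subset\<close>)
    moreover have "\<Psi> = {#} \<or> (\<exists>z. z \<in># names \<Gamma>)"
      using s by (metis solo_add add_mset_add_single names_def image_mset_is_empty_iff multiset_nonemptyE)
    ultimately show "unif N (set_mset (hdom ?K))"
      using c by (auto simp: unif_def)
  qed
next
  case (CBangWeaken G x A ys B \<Gamma>i \<Sigma> \<Psi> \<Gamma>)
  let ?H = "\<Psi> + {#\<Gamma>#}"
  let ?K = "\<Psi> + {#\<Gamma> + {#(x, ltype.Quest A)#}#} + seqs ys \<Gamma>i (\<lambda>i. ltype.Bang (B i))"
  have l: "linked \<Sigma> ?H" and s: "solo ?H" using CBangWeaken by simp_all
  show ?case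
  proof (rule linkedI)
    fix N assume M: "\<And>M G'. (M, G') \<in># \<Sigma> + {#({#x#} + mset ys, GBang x ys G)#} \<Longrightarrow> unif N (set_mset M)"
      and S: "\<And>\<Gamma>'. \<Gamma>' \<in># ?K \<Longrightarrow> unif N (set_mset (names \<Gamma>'))"
    have c: "unif N (insert x (set ys))" "unif N (insert x (set_mset (names \<Gamma>)))"
      using M[of "{#x#} + mset ys" "GBang x ys G"] S[of "\<Gamma> + {#(x, ltype.Quest A)#}"] by simp_all
    have c1: "\<forall>z \<in> set_mset (names (\<Gamma>i i)). z \<in> N \<longleftrightarrow> x \<in> N" if i: "i < length ys" for i
    proof -
      have "ys ! i \<in> N \<longleftrightarrow> x \<in> N" using c nth_mem[OF i] unfolding unif_def by blast
      moreover have "add_mset (ys ! i, ltype.Bang (B i)) (\<Gamma>i i) \<in># ?K"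
        using i by (auto simp: in_seqs)
      from S[OF this] have "unif N (insert (ys ! i) (set_mset (names (\<Gamma>i i))))" by simp
      ultimately show ?thesis by (auto simp: unif_def)
    qed
    have "unif N (set_mset (hdom ?H))"
      by (rule linkedD[OF l]) (use M S c(2) in \<open>auto elim: unif_subset\<close>)
    moreover have "\<Psi> = {#} \<or> (\<exists>z. z \<in># names \<Gamma>)"
      using s by (metis solo_add add_mset_add_single names_def image_mset_is_empty_iff multiset_nonemptyE)
    ultimately have "\<forall>z \<in> set_mset (hdom ?H) \<union> set ys. z \<in> N \<longleftrightarrow> x \<in> N"
      using c by (auto simp: unif_def)
    then have "\<forall>z \<in> set_mset (hdom ?K). z \<in> N \<longleftrightarrow> x \<in> N"
      using c1 by auto
    then show "unif N (set_mset (hdom ?K))" unfolding unif_def by blast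
  qed
next
  case (CBangContract ys' ys zs' zs \<Gamma>i \<Gamma>i' \<Sigma> x x' G \<Psi> \<Gamma> A B)
  let ?S = "\<Sigma> + {#({#x#} + mset ys, GBang x ys G),
               ({#x'#} + mset ys', GBang x' ys' (map_gtype (exch (x # ys) (x' # ys')) G))#}"
  let ?H = "\<Psi> + {#\<Gamma> + {#(x, ltype.Quest A), (x', ltype.Quest A)#}#}
           + seqs ys \<Gamma>i (\<lambda>i. ltype.Bang (B i)) + seqs ys' \<Gamma>i' (\<lambda>i. ltype.Bang (B i))"
  let ?K = "\<Psi> + {#\<Gamma> + {#(x, ltype.Quest A)#}#} + seqs ys \<Gamma>i (\<lambda>i. ltype.Bang (B i))"
  \<comment> \<open>Everything that disappears in the conclusion: the new session and the copied
    contexts, whose names are bound as well.\<close>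
  let ?X = "set_mset (\<Sum>i<length ys. names (\<Gamma>i' i)) \<union> set ys' \<union> {x'}"
  have w: "well ?S ?H" and l: "linked ?S ?H" using CBangContract(7) by simp_all
  have d: "?X \<inter> set_mset (hdom ?K) = {}" "?X \<inter> set_mset (edom \<Sigma>) = {}"
  proof -
    show "?X \<inter> set_mset (hdom ?K) = {}"
      using w CBangContract(1) by (auto simp: well_def wf_def simp del: member_sum sess_ok_simps)
    have "(set ys' \<union> {x'}) \<inter> set_mset (edom \<Sigma>) = {}"
      using w CBangContract(1) by (auto simp: well_def wf_def simp del: member_sum sess_ok_simps)
    moreover have "set_mset (\<Sum>i<length ys. names (\<Gamma>i' i)) \<inter> set_mset (edom \<Sigma>) = {}"
      using CBangContract(5) edom_subset_evars[of \<Sigma>] by (fastforce simp: set_mset_sum)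
    ultimately show "?X \<inter> set_mset (edom \<Sigma>) = {}" by blast
  qed
  show ?case
  proof (rule linkedI)
    fix N assume M: "\<And>M G'. (M, G') \<in># \<Sigma> + {#({#x#} + mset ys, GBang x ys G)#} \<Longrightarrow> unif N (set_mset M)"
      and S: "\<And>\<Gamma>'. \<Gamma>' \<in># ?K \<Longrightarrow> unif N (set_mset (names \<Gamma>'))"
    have c: "unif N (insert x (set ys))" "unif N (insert x (set_mset (names \<Gamma>)))"
      using M[of "{#x#} + mset ys" "GBang x ys G"] S[of "\<Gamma> + {#(x, ltype.Quest A)#}"] by simp_all
    have "unif N (set_mset (hdom ?H) - ?X)"
    proof (rule linked_bound[OF l, where c = "x \<in> N", THEN conjunct1])
      fix M G' assume "(M, G') \<in># ?S"
      then consider "(M, G') \<in># \<Sigma>" | "M = {#x#} + mset ys" | "M = {#x'#} + mset ys'" by auto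
      then show "set_mset M \<inter> ?X = {} \<and> unif N (set_mset M) \<or> (\<forall>z \<in> set_mset M - ?X. z \<in> N \<longleftrightarrow> x \<in> N)"
      proof cases
        case 1
        then have "set_mset M \<inter> ?X = {}" using d(2) unfolding disjoint_iff in_edom by blast
        then show ?thesis using M[of M G'] 1 by auto
      next
        case 2
        then show ?thesis using c(1) by (auto simp: unif_def)
      qed auto
    next
      fix \<Gamma>' assume "\<Gamma>' \<in># ?H"
      then consider "\<Gamma>' \<in># \<Psi>" | i where "i < length ys" "\<Gamma>' = add_mset (ys ! i, ltype.Bang (B i)) (\<Gamma>i i)"
        | i where "i < length ys" "\<Gamma>' = add_mset (ys' ! i, ltype.Bang (B i)) (\<Gamma>i' i)"
        | "\<Gamma>' = \<Gamma> + {#(x, ltype.Quest A), (x', ltype.Quest A)#}"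
        using CBangContract(1) by (auto simp: in_seqs)
      then show "set_mset (names \<Gamma>') \<inter> ?X = {} \<and> unif N (set_mset (names \<Gamma>')) \<or> (\<forall>z \<in> set_mset (names \<Gamma>') - ?X. z \<in> N \<longleftrightarrow> x \<in> N)"
      proof cases
        case 1
        then have "\<Gamma>' \<in># ?K" by simp
        with S[of \<Gamma>'] d(1) show ?thesis unfolding disjoint_iff in_hdom by blast
      next
        case (2 i)
        then have "\<Gamma>' \<in># ?K" by (auto simp: in_seqs)
        with S[of \<Gamma>'] d(1) show ?thesis unfolding disjoint_iff in_hdom by blast
      next
        case (3 i)
        then have "set_mset (names \<Gamma>') \<subseteq> ?X"
          using CBangContract(1) by auto
        then show ?thesis by blast
      next
        case 4
        then show ?thesis using c(2) by (auto simp: unif_def)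
      qed
    qed
    moreover have "set_mset (hdom ?K) = set_mset (hdom ?H) - ?X"
      using d(1) CBangContract(1) by (auto simp del: member_sum)
    ultimately show "unif N (set_mset (hdom ?K))" by simp
  qed
next
  case (COplusWith1 H x B ys D us E \<Sigma> \<Sigma>i G \<Psi> \<Psi>i \<Gamma> A \<Gamma>i C \<Delta>)
  then have "linked (\<Sigma> + (\<Sum>i<length ys. \<Sigma>i i) + {#({#x#} + mset ys + mset us, G)#})
         (\<Psi> + (\<Sum>i<length ys. \<Psi>i i) + {#\<Gamma> + {#(x, A)#}#} + seqs ys \<Gamma>i C + seqs us \<Delta> E)" by simp
  then show ?case by (rule linked_same) (simp_all add: names_seqs)
next
  case (COplusWith2 G x A ys C us E \<Sigma> \<Sigma>i H \<Psi> \<Psi>i \<Gamma> B \<Gamma>i D \<Delta>)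
  then have "linked (\<Sigma> + (\<Sum>i<length ys. \<Sigma>i i) + {#({#x#} + mset ys + mset us, H)#})
         (\<Psi> + (\<Sum>i<length ys. \<Psi>i i) + {#\<Gamma> + {#(x, B)#}#} + seqs ys \<Gamma>i D + seqs us \<Delta> E)" by simp
  then show ?case by (rule linked_same) (simp_all add: names_seqs)
next
  case (Oplus1 x \<Sigma> \<Psi> \<Gamma> A B)
  then have "linked \<Sigma> (\<Psi> + {#\<Gamma> + {#(x, A)#}#})" by simp
  then show ?case by (rule linked_same) (simp_all add: names_seqs)
next
  case (Oplus2 x \<Sigma> \<Psi> \<Gamma> B A)
  then have "linked \<Sigma> (\<Psi> + {#\<Gamma> + {#(x, B)#}#})" by simp
  then show ?case by (rule linked_same) (simp_all add: names_seqs)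
next
  case (Oplus x \<Sigma> \<Psi> \<Gamma> A B)
  then have "linked \<Sigma> (\<Psi> + {#\<Gamma> + {#(x, A)#}#})" by simp
  then show ?case by (rule linked_same) (simp_all add: names_seqs)
next
  case (With x \<Sigma> \<Psi> \<Gamma> A B)
  then have "linked \<Sigma> (\<Psi> + {#\<Gamma> + {#(x, A)#}#})" by simp
  then show ?case by (rule linked_same) (simp_all add: names_seqs)
next
  case (Quest x \<Sigma> \<Psi> \<Gamma> A)
  then have "linked \<Sigma> (\<Psi> + {#\<Gamma> + {#(x, A)#}#})" by simp
  then show ?case by (rule linked_same) (simp_all add: names_seqs)
next
  case (COplusWith x ys \<Sigma> us G \<Psi> \<Gamma> A \<Gamma>i C H B D)
  then have "linked (\<Sigma> + {#({#x#} + mset ys + mset us, G)#}) (\<Psi> + {#\<Gamma> + {#(x, A)#}#} + seqs ys \<Gamma>i C)" by simp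
  then show ?case by (rule linked_same) (simp_all add: names_seqs)
next
  case (CBangQuest ys \<Gamma>i \<Sigma> x G \<Psi> \<Gamma> A B)
  then have "linked (\<Sigma> + {#({#x#} + mset ys, G)#}) (\<Psi> + {#\<Gamma> + {#(x, A)#}#} + seqs ys \<Gamma>i B)" by simp
  then show ?case by (rule linked_same) (simp_all add: names_seqs)
qed (simp_all add: linked_single)

lemma solo_tail: "solo (\<Psi> + X) \<Longrightarrow> X \<noteq> {#} \<Longrightarrow> {#} \<notin># \<Psi>"
  by (auto simp: solo_def dest!: multi_member_split)

lemma solo_tail': "solo (add_mset \<Gamma> \<Psi>) \<Longrightarrow> {#} \<notin># \<Psi>"
  using solo_tail[of \<Psi> "{#\<Gamma>#}"] by simp

text \<open>\<open>Scope\<close> is the critical case: it merges sequents after removing their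
  displayed endpoints, and the result may be empty. Then connectedness of the premise leaves no room
  for other sequents.\<close>

lemma rule_solo:
  assumes "rule F J \<Sigma> \<Psi>" "\<forall>(S, H) \<in> set J. well S H \<and> linked S H \<and> solo H"
  shows "solo \<Psi>"
  using assms
proof (induction rule: rule.induct)
  case (Conn G xs A \<Sigma>i \<Psi>i \<Gamma>i)
  have "{#} \<notin># \<Psi>i i + {#\<Gamma>i i + {#(xs ! i, A i)#}#}" if "i < length xs" for i
    using Conn(2) that by (auto simp: solo_def)
  then show ?case by (auto simp: solo_def)
next
  case (Scope xs G \<Sigma> \<Psi> \<Gamma>i A)
  let ?H = "\<Psi> + seqs xs \<Gamma>i A" and ?S = "\<Sigma> + {#(mset xs, G)#}"
  have w: "well ?S ?H" and l: "linked ?S ?H" and s: "solo ?H" using Scope by simp_all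
  have xs: "xs \<noteq> []"
    using w coherent_nonempty by (fastforce simp: well_def names_def)
  have d: "set xs \<inter> set_mset (hdom \<Psi>) = {}" "set xs \<inter> set_mset (edom \<Sigma>) = {}"
    using w by (auto simp: well_def wf_def simp del: member_sum)
  have "{#} \<notin># \<Psi>"
    using s xs by (cases xs) (auto simp: solo_def dest!: multi_member_split)
  moreover have "\<Psi> = {#}" if e: "(\<Sum>i<length xs. \<Gamma>i i) = {#}"
  proof -
    have \<Gamma>: "\<Gamma>i i = {#}" if "i < length xs" for i
      using e that mset_subset_sum[of i "length xs" \<Gamma>i] by simp
    \<comment> \<open>If all the \<Gamma>i are empty, then the hidden session and the one-element
      sequents of its endpoints are the only edges meeting \<open>set xs\<close>, so this set splits
      nothing and must contain all endpoints.\<close>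
    have "unif (set xs) (set_mset (hdom ?H))"
    proof (rule linkedD[OF l])
      show "unif (set xs) (set_mset M)" if "(M, G') \<in># ?S" for M G'
        using that d(2) unfolding disjoint_iff in_edom by (auto simp: unif_def)
      show "unif (set xs) (set_mset (names \<Gamma>))" if "\<Gamma> \<in># ?H" for \<Gamma>
        using that d(1) \<Gamma> unfolding disjoint_iff in_hdom by (auto simp: unif_def in_seqs)
    qed
    moreover have "set xs \<subseteq> set_mset (hdom ?H)" "set xs \<noteq> {}"
      using xs by simp_all blast
    ultimately have "set_mset (hdom ?H) \<subseteq> set xs"
      by (rule unif_hit)
    then have "set_mset (hdom \<Psi>) \<subseteq> set xs" by simp
    then have "hdom \<Psi> = {#}" using d(1) by (metis Int_absorb1 set_mset_eq_empty_iff)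
    then have "names \<Gamma> = {#}" if "\<Gamma> \<in># \<Psi>" for \<Gamma>
      using that by (auto simp: hdom_def)
    then have "\<Gamma> = {#}" if "\<Gamma> \<in># \<Psi>" for \<Gamma>
      using that by (simp add: names_def)
    then show ?thesis using \<open>{#} \<notin># \<Psi>\<close> by (metis multiset_nonemptyE)
  qed
  moreover have "{#} \<in># \<Psi> + {#\<Sum>i<length xs. \<Gamma>i i#} \<Longrightarrow> {#} \<in># \<Psi> \<or> (\<Sum>i<length xs. \<Gamma>i i) = {#}"
    by (metis add_mset_add_single insert_iff set_mset_add_mset_insert)
  ultimately show ?case unfolding solo_def by (metis add_0 size_single)
next
  case (Tensor x \<Sigma>1 \<Sigma>2 x' \<Psi>1 \<Gamma>1 A \<Psi>2 \<Gamma>2 B)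
  then have "{#} \<notin># \<Psi>1" "{#} \<notin># \<Psi>2" by (auto dest: solo_tail')
  then show ?case by (simp add: solo_def)
next
  case (COplusWith1 H x B ys D us E \<Sigma> \<Sigma>i G \<Psi> \<Psi>i \<Gamma> A \<Gamma>i C \<Delta>)
  then have "solo ((\<Psi> + (\<Sum>i<length ys. \<Psi>i i)) + ({#\<Gamma> + {#(x, A)#}#} + seqs ys \<Gamma>i C + seqs us \<Delta> E))" by (simp add: ac_simps)
  then have "{#} \<notin># \<Psi> + (\<Sum>i<length ys. \<Psi>i i)" by (rule solo_tail) simp
  then show ?case by (auto simp: solo_def in_seqs)
next
  case (COplusWith2 G x A ys C us E \<Sigma> \<Sigma>i H \<Psi> \<Psi>i \<Gamma> B \<Gamma>i D \<Delta>)
  then have "solo ((\<Psi> + (\<Sum>i<length ys. \<Psi>i i)) + ({#\<Gamma> + {#(x, B)#}#} + seqs ys \<Gamma>i D + seqs us \<Delta> E))" by (simp add: ac_simps)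
  then have "{#} \<notin># \<Psi> + (\<Sum>i<length ys. \<Psi>i i)" by (rule solo_tail) simp
  then show ?case by (auto simp: solo_def in_seqs)
next
  case (CTensorParr xs' xs y y' \<Sigma> us H G \<Psi> \<Gamma>1 A \<Gamma>2 B \<Gamma> C D)
  then have "solo (\<Psi> + (seqs xs' \<Gamma>1 A + seqs xs \<Gamma>2 B + {#\<Gamma> + {#(y', C), (y, D)#}#}))" by (simp add: ac_simps)
  then have "{#} \<notin># \<Psi>" by (rule solo_tail) simp
  then show ?case by (auto simp: solo_def in_seqs)
next
  case (COplusWith x ys \<Sigma> us G \<Psi> \<Gamma> A \<Gamma>i C H B D)
  then have "solo (\<Psi> + ({#\<Gamma> + {#(x, A)#}#} + seqs ys \<Gamma>i C))" by (simp add: ac_simps)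
  then have "{#} \<notin># \<Psi>" by (rule solo_tail) simp
  then show ?case by (auto simp: solo_def in_seqs)
next
  case (CBangQuest ys \<Gamma>i \<Sigma> x G \<Psi> \<Gamma> A B)
  then have "solo (\<Psi> + ({#\<Gamma> + {#(x, A)#}#} + seqs ys \<Gamma>i B))" by (simp add: ac_simps)
  then have "{#} \<notin># \<Psi>" by (rule solo_tail) simp
  then show ?case by (auto simp: solo_def in_seqs)
next
  case (CBangContract ys' ys zs' zs \<Gamma>i \<Gamma>i' \<Sigma> x x' G \<Psi> \<Gamma> A B)
  from CBangContract(6) have "solo (\<Psi> + ({#\<Gamma> + {#(x, ltype.Quest A), (x', ltype.Quest A)#}#}
           + seqs ys \<Gamma>i (\<lambda>i. ltype.Bang (B i)) + seqs ys' \<Gamma>i' (\<lambda>i. ltype.Bang (B i))))" by (simp add: ac_simps)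
  then have "{#} \<notin># \<Psi>" by (rule solo_tail) simp
  then show ?case by (auto simp: solo_def in_seqs)
qed (auto simp: solo_def in_seqs dest!: solo_tail')

text \<open>The invariants are bundled because preservation of connectedness assumes
  \<open>solo\<close> of the premises, and preservation of \<open>solo\<close> assumes
  connectedness.\<close>

definition good :: "env \<Rightarrow> hyp \<Rightarrow> bool" where
  "good \<Sigma> \<Psi> \<longleftrightarrow> well \<Sigma> \<Psi> \<and> linked \<Sigma> \<Psi> \<and> solo \<Psi> \<and> size \<Psi> + size \<Sigma> = Suc (size (edom \<Sigma>))"

lemma typed_good: "\<Sigma> \<tturnstile> P \<Colon> \<Psi> \<Longrightarrow> good \<Sigma> \<Psi> \<and> fv P = set_mset (hdom \<Psi>)"
proof (induction rule: typed.induct)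
  case (1 F J \<Sigma> \<Psi> Ps)
  then have g: "\<forall>i<length J. good (fst (J ! i)) (snd (J ! i)) \<and> fv (Ps ! i) = set_mset (hdom (snd (J ! i)))"
    by blast
  then have J: "\<forall>(S, H) \<in> set J. good S H"
    by (fastforce simp: in_set_conv_nth)
  then have w: "\<forall>(S, H) \<in> set J. well S H" by (auto simp: good_def)
  have "fv (F Ps) = set_mset (hdom \<Psi>)"
    by (rule rule_fv[OF 1(1) w 1(3,2)]) (use g in blast)
  moreover have "good \<Sigma> \<Psi>"
    unfolding good_def well_def
    by (intro conjI 1(2) rule_well[OF 1(1,2) w] rule_linked[OF 1(1,2)] rule_solo[OF 1(1)] rule_count[OF 1(1)])
      (use J in \<open>auto simp: good_def\<close>)
  ultimately show ?case by blast
qed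

lemma typed_wf: "\<Sigma> \<tturnstile> P \<Colon> \<Psi> \<Longrightarrow> wf \<Sigma> \<Psi>"
  using typed_good by (auto simp: good_def well_def)

lemma typed_fv: "\<Sigma> \<tturnstile> P \<Colon> \<Psi> \<Longrightarrow> fv P = set_mset (hdom \<Psi>)"
  using typed_good by blast

lemma typed_sess: "\<Sigma> \<tturnstile> P \<Colon> \<Psi> \<Longrightarrow> sess_ok \<Sigma> (flat \<Psi>)"
  using typed_good by (auto simp: good_def well_def)

lemma typed_edom: "\<Sigma> \<tturnstile> P \<Colon> \<Psi> \<Longrightarrow> set_mset (edom \<Sigma>) \<subseteq> fv P"
  using typed_sess[THEN sess_ok_edom] by (fastforce simp: typed_fv)

text \<open>Side conditions stated with \<open>evars\<close> can thus be checked by disjointness of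
  declared endpoints.\<close>

lemma typed_evars: "\<Sigma> \<tturnstile> P \<Colon> \<Psi> \<Longrightarrow> evars \<Sigma> = set_mset (edom \<Sigma>)"
  using typed_sess[THEN sess_ok_evars] .

lemma in_flat: "p \<in># flat \<Psi> \<longleftrightarrow> (\<exists>\<Gamma>. \<Gamma> \<in># \<Psi> \<and> p \<in># \<Gamma>)"
  by (auto simp: flat_def)

section \<open>Sessions with a single endpoint\<close>

text \<open>
  Conn with a single component leaves the term unchanged (\<open>par [P] = P\<close>) and only adds a session
  with one endpoint. A derivation may end with such invisible steps.
\<close>

definition unary :: "env \<Rightarrow> ctx \<Rightarrow> bool" where
  "unary U \<Gamma> \<longleftrightarrow> (\<forall>(M, G) \<in># U. \<exists>x A. M = {#x#} \<and> G \<Turnstile> {#(x, A)#} \<and> (x, A) \<in># \<Gamma>)"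

lemma unary_simps [simp]:
  "unary {#} \<Gamma>"
  "unary (add_mset (M, G) U) \<Gamma> \<longleftrightarrow> (\<exists>x A. M = {#x#} \<and> G \<Turnstile> {#(x, A)#} \<and> (x, A) \<in># \<Gamma>) \<and> unary U \<Gamma>"
  "unary (U + V) \<Gamma> \<longleftrightarrow> unary U \<Gamma> \<and> unary V \<Gamma>"
  "unary (\<Sum>i<(n::nat). f i) \<Gamma> \<longleftrightarrow> (\<forall>i<n. unary (f i) \<Gamma>)"
  by (simp_all add: unary_def ball_Un set_mset_sum lessThan_def)

lemma unary_mono: "unary U \<Gamma> \<Longrightarrow> set_mset \<Gamma> \<subseteq> set_mset \<Delta> \<Longrightarrow> unary U \<Delta>"
  unfolding unary_def by blast

lemma typed_unary:
  "\<Sigma> \<tturnstile> P \<Colon> \<Psi> \<Longrightarrow> unary U (flat \<Psi>) \<Longrightarrow> nodup (edom (\<Sigma> + U)) \<Longrightarrow> \<Sigma> + U \<tturnstile> P \<Colon> \<Psi>"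
proof (induction U)
  case (add s U)
  obtain x A G where s: "s = ({#x#}, G)" "G \<Turnstile> {#(x, A)#}" "(x, A) \<in># flat \<Psi>"
    using add.prems(2) by (cases s) auto
  then obtain \<Gamma> where "add_mset (x, A) \<Gamma> \<in># \<Psi>"
    by (metis in_flat mset_add)
  then obtain \<Psi>' where \<Psi>: "\<Psi> = \<Psi>' + {#\<Gamma> + {#(x, A)#}#}"
    by (metis mset_add add_mset_add_single)
  have t: "\<Sigma> + U \<tturnstile> P \<Colon> \<Psi>"
    using add by (cases s) auto
  have "G \<Turnstile> fam [x] (\<lambda>_. A)" using s(2) by (simp add: fam_def)
  from rule.Conn[OF this, of "\<lambda>_. \<Sigma> + U" "\<lambda>_. \<Psi>'" "\<lambda>_. \<Gamma>"]
  have r: "rule par [(\<Sigma> + U, \<Psi>)] (\<Sigma> + U + {#s#}) \<Psi>"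
    by (simp add: \<Psi> s(1))
  have "\<Sigma> + U + {#s#} \<tturnstile> par [P] \<Colon> \<Psi>"
    by (rule typed.intros[OF r]) (use t typed_wf[OF t] add.prems(3) in \<open>auto simp: wf_def\<close>)
  then show ?case by simp
qed simp

lemma rule_par:
  assumes "rule par J \<Sigma> \<Psi>"
  obtains G xs A \<Sigma>i \<Psi>i \<Gamma>i where "G \<Turnstile> fam xs A"
    "J = map (\<lambda>i. (\<Sigma>i i, \<Psi>i i + {#\<Gamma>i i + {#(xs ! i, A i)#}#})) [0..<length xs]"
    "\<Sigma> = (\<Sum>i<length xs. \<Sigma>i i) + {#(mset xs, G)#}"
    "\<Psi> = (\<Sum>i<length xs. \<Psi>i i + {#\<Gamma>i i + {#(xs ! i, A i)#}#})"
  using assms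
  \<comment> \<open>The term formers are functions, so an equation between \<open>par\<close> and
    another one is refuted by applying both to a list of two terms, where only \<open>par\<close>
    yields a \<open>Par\<close>; \<open>Close 0\<close> is an arbitrary choice.\<close>
  by (cases rule: rule.cases)
    ((rule that; assumption),
     (drule fun_cong[where x = "[Close 0, Close 0]"], simp add: un_def bin_def)+)

lemma fam_nonempty: "G \<Turnstile> fam xs A \<Longrightarrow> xs \<noteq> []"
  using coherent_nonempty by (fastforce simp: fam_def)

lemma strip:
  assumes "\<Sigma> \<tturnstile> T \<Colon> \<Psi>" "\<And>K L. T \<noteq> Par K L"
  obtains \<Sigma>' U F J Ps where "\<Sigma> = \<Sigma>' + U" "unary U (flat \<Psi>)" "infers F J Ps \<Sigma>' \<Psi>" "F \<noteq> par" "T = F Ps"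
proof -
  have "\<exists>\<Sigma>' U F J Ps. \<Sigma> = \<Sigma>' + U \<and> unary U (flat \<Psi>) \<and> infers F J Ps \<Sigma>' \<Psi> \<and> F \<noteq> par \<and> T = F Ps"
    using assms
  proof (induction rule: typed.induct)
    case (1 F J \<Sigma> \<Psi> Ps)
    show ?case
    proof (cases "F = par")
      case False
      then show ?thesis using 1
        by (intro exI[of _ \<Sigma>] exI[of _ "{#}"] exI[of _ F] exI[of _ J] exI[of _ Ps]) (auto simp: infers_def)
    next
      case True
      with 1(1) have "rule par J \<Sigma> \<Psi>" by simp
      then obtain G xs A \<Sigma>i \<Psi>i \<Gamma>i where c: "G \<Turnstile> fam xs A"
        "J = map (\<lambda>i. (\<Sigma>i i, \<Psi>i i + {#\<Gamma>i i + {#(xs ! i, A i)#}#})) [0..<length xs]"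
        "\<Sigma> = (\<Sum>i<length xs. \<Sigma>i i) + {#(mset xs, G)#}"
        "\<Psi> = (\<Sum>i<length xs. \<Psi>i i + {#\<Gamma>i i + {#(xs ! i, A i)#}#})"
        by (rule rule_par)
      have l: "length Ps = length xs" using 1(3) c(2) by simp
      \<comment> \<open>A Conn with two or more components would show as a \<open>Par\<close>, which
        is excluded, so the step is one of the invisible ones.\<close>
      obtain P where P: "Ps = [P]"
        using fam_nonempty[OF c(1)] l 1(6) True
        by (cases Ps rule: par.cases) auto
      then obtain x where x: "xs = [x]" using l by (cases xs) auto
      have "\<exists>\<Sigma>' U F J Ps. \<Sigma>i 0 = \<Sigma>' + U \<and> unary U (flat \<Psi>) \<and> infers F J Ps \<Sigma>' \<Psi> \<and> F \<noteq> par \<and> P = F Ps"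
        using 1(5)[of 0] 1(6) by (simp add: c x P True)
      then obtain \<Sigma>' U F' J' Ps' where i: "\<Sigma>i 0 = \<Sigma>' + U" "unary U (flat \<Psi>)" "infers F' J' Ps' \<Sigma>' \<Psi>" "F' \<noteq> par" "P = F' Ps'"
        by blast
      have "unary (U + {#({#x#}, G)#}) (flat \<Psi>)"
        using i(2) c(1) by (auto simp: c(4) x fam_def intro!: exI[of _ "A 0"])
      moreover have "\<Sigma> = \<Sigma>' + (U + {#({#x#}, G)#})"
        by (simp add: c(3) x i(1))
      moreover have "F Ps = F' Ps'" using i(5) P True by simp
      ultimately show ?thesis using i(3,4) by metis
    qed
  qed
  then show thesis using that by blast
qed

section \<open>Parallel components\<close>

text \<open>One premise of a Conn: its endpoint, term, environment, other sequents, rest of the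
  endpoint's sequent, and type. Unlike the indexed families of the rule, lists of such records are
  easily split, appended and changed at one place.\<close>

datatype comp = Comp (cx: ep) (cK: "ep trm") (cS: env) (cH: hyp) (cG: ctx) (cA: ltype)

definition chyp :: "comp \<Rightarrow> hyp" where
  "chyp c = add_mset (add_mset (cx c, cA c) (cG c)) (cH c)"

definition cty :: "comp \<Rightarrow> ep \<times> ltype" where
  "cty c = (cx c, cA c)"

definition ctyped :: "comp \<Rightarrow> bool" where
  "ctyped c \<longleftrightarrow> cS c \<tturnstile> cK c \<Colon> chyp c"

lemma comp_simps [simp]:
  "chyp (Comp x K S H \<Gamma> A) = add_mset (add_mset (x, A) \<Gamma>) H"
  "cty (Comp x K S H \<Gamma> A) = (x, A)"
  "ctyped (Comp x K S H \<Gamma> A) \<longleftrightarrow> S \<tturnstile> K \<Colon> add_mset (add_mset (x, A) \<Gamma>) H"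
  by (auto simp: chyp_def cty_def ctyped_def)

lemma mset_cty: "mset (map cty cs) = fam (map cx cs) (\<lambda>i. cA (cs ! i))"
proof -
  have "fam (map cx cs) (\<lambda>i. cA (cs ! i)) = (\<Sum>i<length cs. {#cty (cs ! i)#})"
    by (auto simp: fam_def cty_def intro!: sum.cong)
  also have "\<dots> = mset (map cty cs)"
    by (simp only: sum_length_nth[of "\<lambda>c. {#cty c#}"]) simp
  finally show ?thesis by simp
qed

lemma typed_conn:
  assumes "G \<Turnstile> mset (map cty cs)" "\<And>c. c \<in> set cs \<Longrightarrow> ctyped c" "wf \<Sigma> \<Psi>"
    "\<Sigma> = sum_list (map cS cs) + {#(mset (map cx cs), G)#}" "\<Psi> = sum_list (map chyp cs)"
  shows "\<Sigma> \<tturnstile> par (map cK cs) \<Colon> \<Psi>"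
proof -
  let ?J = "map (\<lambda>i. (cS (cs ! i), cH (cs ! i) + {#cG (cs ! i) + {#(map cx cs ! i, cA (cs ! i))#}#})) [0..<length (map cx cs)]"
  have J: "?J ! i = (cS (cs ! i), chyp (cs ! i))" if "i < length cs" for i
    using that by (simp add: chyp_def)
  have r: "rule par ?J \<Sigma> \<Psi>"
  proof (rule rule_eqI)
    show "rule par ?J ((\<Sum>i<length (map cx cs). cS (cs ! i)) + {#(mset (map cx cs), G)#})
       (\<Sum>i<length (map cx cs). cH (cs ! i) + {#cG (cs ! i) + {#(map cx cs ! i, cA (cs ! i))#}#})"
      by (rule rule.Conn) (use assms(1)[unfolded mset_cty] in simp)
    show "(\<Sum>i<length (map cx cs). cS (cs ! i)) + {#(mset (map cx cs), G)#} = \<Sigma>"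
      by (simp add: assms(4) sum_length_nth)
    have "(\<Sum>i<length (map cx cs). cH (cs ! i) + {#cG (cs ! i) + {#(map cx cs ! i, cA (cs ! i))#}#}) = (\<Sum>i<length cs. chyp (cs ! i))"
      by (auto simp: chyp_def intro!: sum.cong)
    then show "(\<Sum>i<length (map cx cs). cH (cs ! i) + {#cG (cs ! i) + {#(map cx cs ! i, cA (cs ! i))#}#}) = \<Psi>"
      by (simp add: assms(5) sum_length_nth)
  qed simp
  show ?thesis
  proof (rule typed.intros[OF r assms(3)])
    fix i assume "i < length ?J"
    then have i: "i < length cs" by simp
    then show "fst (?J ! i) \<tturnstile> map cK cs ! i \<Colon> snd (?J ! i)"
      using assms(2)[OF nth_mem[OF i]] by (simp add: ctyped_def chyp_def)
  qed simp
qed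

definition comps :: "env \<Rightarrow> hyp \<Rightarrow> ep gtype \<Rightarrow> ep list \<Rightarrow> ep trm list \<Rightarrow> comp list \<Rightarrow> bool" where
  "comps \<Sigma> \<Psi> G es Ks cs \<longleftrightarrow> map cx cs = es \<and> map cK cs = Ks \<and> (\<forall>c \<in> set cs. ctyped c) \<and>
     \<Sigma> = sum_list (map cS cs) + {#(mset es, G)#} \<and> \<Psi> = sum_list (map chyp cs) \<and> G \<Turnstile> mset (map cty cs)"

lemma par_is_Par: "2 \<le> length Ks \<Longrightarrow> \<exists>R. par Ks = Par (hd Ks) R \<and> R = par (tl Ks) \<and> tl Ks \<noteq> []"
  by (cases Ks rule: par.cases) auto

text \<open>The last visible Conn must be the one that introduces the session \<open>es\<close>. If
  that session came from inside one component, all its endpoints would be free there, whereas by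
  \<open>joined\<close> they are spread over at least two components, whose free endpoints are
  disjoint.\<close>

lemma joined_inv:
  assumes "\<Sigma> \<tturnstile> par Ks \<Colon> \<Psi>" "joined \<Sigma> G es Ks"
  obtains cs where "comps \<Sigma> \<Psi> G es Ks cs"
proof -
  have len: "2 \<le> length Ks" "length es = length Ks" and fv: "\<forall>i<length Ks. es ! i \<in> fv (Ks ! i)"
    and "(mset es, G) \<in># \<Sigma>"
    using assms(2) by (auto simp: joined_def)
  have "\<exists>cs. comps \<Sigma> \<Psi> G es Ks cs" if "\<Sigma> \<tturnstile> T \<Colon> \<Psi>" "T = par Ks" "(mset es, G) \<in># \<Sigma>" for T
    using that
  proof (induction rule: typed.induct)
    case (1 F J \<Sigma> \<Psi> Ps)
    have fPs: "F Ps = par Ks" by fact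
    obtain R where R: "par Ks = Par (hd Ks) R" "R = par (tl Ks)" "tl Ks \<noteq> []" using par_is_Par[OF len(1)] by blast
    have "F = par"
      using 1(1) fPs[unfolded R(1)] by (cases rule: rule.cases) (auto simp: un_def bin_def)
    with 1(1) have "rule par J \<Sigma> \<Psi>" by simp
    then obtain G' xs A \<Sigma>i \<Psi>i \<Gamma>i where c: "G' \<Turnstile> fam xs A"
      "J = map (\<lambda>i. (\<Sigma>i i, \<Psi>i i + {#\<Gamma>i i + {#(xs ! i, A i)#}#})) [0..<length xs]"
      "\<Sigma> = (\<Sum>i<length xs. \<Sigma>i i) + {#(mset xs, G')#}"
      "\<Psi> = (\<Sum>i<length xs. \<Psi>i i + {#\<Gamma>i i + {#(xs ! i, A i)#}#})"
      by (rule rule_par)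
    have l: "length Ps = length xs" using 1(3) c(2) by simp
    have nd: "nodup (edom \<Sigma>)" "nodup (hdom \<Psi>)" using 1(2) by (auto simp: wf_def)
    have tp: "\<Sigma>i i \<tturnstile> Ps ! i \<Colon> \<Psi>i i + {#\<Gamma>i i + {#(xs ! i, A i)#}#}" if "i < length xs" for i
      using 1(4)[of i] that by (simp add: c(2))
    have dj: "fv (Ps ! i) \<inter> fv (Ps ! j) = {}" if "i < length xs" "j < length xs" "i \<noteq> j" for i j
      using nd(2) that unfolding c(4) hdom_simps(4) nodup_sum
      using typed_fv[OF tp[OF that(1)]] typed_fv[OF tp[OF that(2)]] by auto
    have xf: "xs ! i \<in> fv (Ps ! i)" if "i < length xs" for i
      using typed_fv[OF tp[OF that]] by simp
    have G: "(mset es, G) \<in># \<Sigma>" by fact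
    consider P x where "Ps = [P]" "xs = [x]" | "2 \<le> length xs" "(mset es, G) = (mset xs, G')"
      | j where "2 \<le> length xs" "j < length xs" "(mset es, G) \<in># \<Sigma>i j"
    proof (cases "2 \<le> length xs")
      case True
      then show thesis using G that(2,3) by (auto simp: c(3))
    next
      case False
      moreover have "xs \<noteq> []" using fam_nonempty[OF c(1)] .
      then have "0 < length xs" by simp
      ultimately have "length xs = Suc 0" by linarith
      then show thesis using l that(1) by (metis length_0_conv length_Suc_conv)
    qed
    then show ?case
    proof cases
      case (1 P x)
      have "size (mset es) \<noteq> 1" using len by simp
      then have "mset es \<noteq> {#x#}" by auto
      then have "(mset es, G) \<in># \<Sigma>i 0" using G by (auto simp: c(3) 1)
      moreover have "P = par Ks" using fPs \<open>F = par\<close> 1 by simp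
      ultimately have "\<exists>cs. comps (\<Sigma>i 0) \<Psi> G es Ks cs"
        using "1.IH"[of 0] by (simp add: c 1)
      then obtain cs where cs: "comps (\<Sigma>i 0) \<Psi> G es Ks cs" ..
      have "(x, A 0) \<in># flat \<Psi>" by (simp add: c(4) 1)
      moreover have "\<Psi> = sum_list (map chyp cs)" using cs by (simp add: comps_def)
      \<comment> \<open>An invisible step on the whole composition is moved inwards, to the
        component that declares its endpoint, where the same session can be added.\<close>
      ultimately obtain d where d: "d \<in> set cs" "(x, A 0) \<in># flat (chyp d)"
        by (auto simp: in_flat)
      then obtain as bs where s: "cs = as @ d # bs" by (meson split_list)
      define d' where "d' = Comp (cx d) (cK d) (cS d + {#({#x#}, G')#}) (cH d) (cG d) (cA d)"
      have td: "ctyped d" using cs d(1) by (auto simp: comps_def)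
      have "G' \<Turnstile> {#(x, A 0)#}" using c(1) by (simp add: 1 fam_def)
      then have u: "unary {#({#x#}, G')#} (flat (chyp d))" using d(2) by auto
      have "cS d + {#({#x#}, G')#} \<subseteq># \<Sigma>"
        using cs by (simp add: comps_def c(3) 1 s subseteq_mset_def)
      then have "nodup (edom (cS d + {#({#x#}, G')#}))"
        using wf_subset[OF \<open>wf \<Sigma> \<Psi>\<close>] unfolding wf_def by blast
      from typed_unary[OF td[unfolded ctyped_def] u this] have "ctyped d'"
        by (simp add: d'_def chyp_def)
      then have "comps \<Sigma> \<Psi> G es Ks (as @ d' # bs)"
        using cs by (auto simp: comps_def s c(3) 1 d'_def chyp_def cty_def)
      then show ?thesis by blast
    next
      case 2
      have "length xs = length es" using 2 by (metis prod.inject size_mset)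
      \<comment> \<open>The two lists of endpoints have the same length, so the bars of the term can
        be read back in only one way.\<close>
      then have PK: "Ps = Ks"
        using par_inj[of Ps Ks] l len fPs \<open>F = par\<close> by fastforce
      \<comment> \<open>The two lists are equal as multisets; the order agrees as well because each
        endpoint is free in a single component.\<close>
      have "es = xs"
      proof (rule nth_equalityI)
        show "length es = length xs" using \<open>length xs = length es\<close> by simp
        fix i assume i: "i < length es"
        then have "es ! i \<in> set xs" using 2 by (metis nth_mem prod.inject set_mset_mset)
        then obtain j where j: "j < length xs" "es ! i = xs ! j" by (metis in_set_conv_nth)
        then have "es ! i \<in> fv (Ps ! i) \<inter> fv (Ps ! j)"
          using xf[OF j(1)] fv i len PK by auto
        then show "es ! i = xs ! i" using dj[of i j] i j \<open>length xs = length es\<close> by fastforce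
      qed
      let ?cs = "map (\<lambda>i. Comp (xs ! i) (Ps ! i) (\<Sigma>i i) (\<Psi>i i) (\<Gamma>i i) (A i)) [0..<length xs]"
      have xs': "map ((!) xs) [0..<length xs] = xs" "map ((!) Ks) [0..<length xs] = Ks"
        using l PK by (simp_all add: map_nth) (metis map_nth)
      have "comps \<Sigma> \<Psi> G es Ks ?cs"
        unfolding comps_def
      proof (intro conjI ballI)
        show "ctyped d" if "d \<in> set ?cs" for d using that tp by auto
        have "fam (map cx ?cs) (\<lambda>i. cA (?cs ! i)) = fam xs A"
          by (simp add: comp_def xs') (rule fam_cong, simp)
        then show "G \<Turnstile> mset (map cty ?cs)"
          using c(1) 2(2) unfolding mset_cty by simp
      qed (use \<open>es = xs\<close> 2 in \<open>simp_all add: comp_def c(3,4) xs' PK\<close>)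
      then show ?thesis by blast
    next
      case (3 j)
      \<comment> \<open>This case is contradictory: \<open>es ! 0\<close> is free in the first
        component and \<open>es ! 1\<close> in a later one, so component \<open>j\<close> would have
        to be both.\<close>
      have sub: "set es \<subseteq> fv (Ps ! j)"
      proof -
        have "set es \<subseteq> set_mset (edom (\<Sigma>i j))" using 3(3) by (fastforce simp: in_edom)
        then show ?thesis using typed_edom[OF tp[OF 3(2)]] by blast
      qed
      obtain R' where R': "par Ps = Par (hd Ps) R'" "R' = par (tl Ps)" "tl Ps \<noteq> []" using par_is_Par[of Ps] 3(1) l by auto
      have h: "hd Ps = hd Ks" "par (tl Ps) = par (tl Ks)"
        using fPs \<open>F = par\<close> R R' by simp_all
      have e0: "es ! 0 \<in> fv (hd Ks)" using fv len by (metis Suc_1 hd_conv_nth le_zero_eq length_0_conv not_less_eq_eq not_gr_zero zero_neq_numeral)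
      have "Ks ! 1 \<in> set (tl Ks)" using len by (cases Ks rule: par.cases) auto
      then have "es ! 1 \<in> fv (par (tl Ks))" using fv len unfolding fv_par[OF R(3)] by (intro UN_I[of "Ks ! 1"]) auto
      then obtain K where K: "K \<in> set (tl Ps)" "es ! 1 \<in> fv K"
        unfolding h(2)[symmetric] fv_par[OF R'(3)] by blast
      then obtain m where m: "0 < m" "m < length xs" "K = Ps ! m"
      proof -
        obtain k where k: "k < length (tl Ps)" "K = tl Ps ! k" using K(1) by (metis in_set_conv_nth)
        show thesis using k l by (intro that[of "Suc k"]) (auto simp: nth_tl)
      qed
      have "hd Ps = Ps ! 0" using l 3(1) by (metis hd_conv_nth le_zero_eq list.size(3) zero_neq_numeral)
      have "es ! 0 \<in> set es" "es ! 1 \<in> set es" using len by (intro nth_mem; linarith)+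
      then have "es ! 0 \<in> fv (Ps ! 0) \<inter> fv (Ps ! j)" "es ! 1 \<in> fv (Ps ! m) \<inter> fv (Ps ! j)"
        using sub e0 h(1) K(2) m \<open>hd Ps = Ps ! 0\<close> by auto
      then have "j = 0" "j = m" using dj[of 0 j] dj[of m j] 3 m by fastforce+
      then show ?thesis using m by simp
    qed
  qed
  then show thesis using assms(1) \<open>(mset es, G) \<in># \<Sigma>\<close> that by blast
qed

text \<open>Passes from the indexed families in which the rules are stated to lists of
  components.\<close>

definition mk :: "ep list \<Rightarrow> ep trm list \<Rightarrow> (nat \<Rightarrow> env) \<Rightarrow> (nat \<Rightarrow> hyp) \<Rightarrow> (nat \<Rightarrow> ctx) \<Rightarrow> (nat \<Rightarrow> ltype) \<Rightarrow> comp list" where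
  "mk xs Ks S H \<Gamma> A = map (\<lambda>i. Comp (xs ! i) (Ks ! i) (S i) (H i) (\<Gamma> i) (A i)) [0..<length xs]"

lemma map_nth_upt: "n = length xs \<Longrightarrow> map (\<lambda>i. xs ! i) [0..<n] = xs"
  by (simp add: map_nth)

lemma sum_seqs:
  "(\<Sum>i<length xs. add_mset (add_mset (xs ! i, A i) (\<Gamma> i)) (H i)) = (\<Sum>i<length xs. H i) + seqs xs \<Gamma> A"
  by (simp add: seqs_def sum.distrib [symmetric])

lemma mk_simps [simp]:
  "map cx (mk xs Ks S H \<Gamma> A) = xs"
  "length Ks = length xs \<Longrightarrow> map cK (mk xs Ks S H \<Gamma> A) = Ks"
  "sum_list (map cS (mk xs Ks S H \<Gamma> A)) = (\<Sum>i<length xs. S i)"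
  "sum_list (map chyp (mk xs Ks S H \<Gamma> A)) = (\<Sum>i<length xs. H i) + seqs xs \<Gamma> A"
  "image_mset cty (mset (mk xs Ks S H \<Gamma> A)) = fam xs A"
  "image_mset cx (mset (mk xs Ks S H \<Gamma> A)) = mset xs"
proof -
  let ?c = "mk xs Ks S H \<Gamma> A"
  show cx: "map cx ?c = xs"
    by (simp add: mk_def comp_def map_nth_upt)
  then show "image_mset cx (mset ?c) = mset xs"
    by (metis mset_map)
  show "map cK ?c = Ks" if "length Ks = length xs"
    using that by (simp add: mk_def comp_def map_nth_upt)
  show "sum_list (map cS ?c) = (\<Sum>i<length xs. S i)"
    by (simp add: mk_def comp_def)
  show "sum_list (map chyp ?c) = (\<Sum>i<length xs. H i) + seqs xs \<Gamma> A"
    by (simp add: mk_def comp_def sum_seqs)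
  have "fam (map cx ?c) (\<lambda>i. cA (?c ! i)) = fam xs A"
    unfolding cx by (rule fam_cong) (simp add: mk_def)
  then show "image_mset cty (mset ?c) = fam xs A"
    using mset_cty[of ?c] by simp
qed

lemma ctyped_mk:
  "(\<forall>c \<in> set (mk xs Ks S H \<Gamma> A). ctyped c) \<longleftrightarrow>
   (\<forall>i<length xs. S i \<tturnstile> Ks ! i \<Colon> add_mset (add_mset (xs ! i, A i) (\<Gamma> i)) (H i))"
  by (auto simp: mk_def)

lemma mk_ex:
  assumes "map cx cs = xs" "map cK cs = Ks"
  shows "\<exists>S H \<Gamma> A. cs = mk xs Ks S H \<Gamma> A"
proof -
  have "cs = mk xs Ks (\<lambda>i. cS (cs ! i)) (\<lambda>i. cH (cs ! i)) (\<lambda>i. cG (cs ! i)) (\<lambda>i. cA (cs ! i))"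
    unfolding mk_def using assms by (auto intro!: nth_equalityI)
  then show ?thesis by blast
qed

lemma append_maps_split:
  assumes "map f cs = xs @ ys" "map g cs = Ks @ Ls" "length Ks = length xs"
  obtains as bs where "cs = as @ bs" "map f as = xs" "map g as = Ks" "map f bs = ys" "map g bs = Ls"
proof -
  obtain as bs where s: "cs = as @ bs" "map f as = xs" "map f bs = ys"
    using assms(1) by (auto simp: map_eq_append_conv)
  then have "map g as @ map g bs = Ks @ Ls" "length (map g as) = length Ks"
    using assms by auto
  then show thesis using that s by auto
qed

text \<open>The shape common to most interactions: one acting component, its partners
  \<open>ys\<close>, and bystanders \<open>us\<close> of the same session. The \<open>snoc\<close>
  variants below serve communication and closing, where the senders precede the receiver.\<close>

lemma conn_cons:
  assumes "S0 \<tturnstile> K \<Colon> add_mset (add_mset (x, A0) \<Gamma>0) H0"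
    "\<forall>i<length ys. S i \<tturnstile> Ks ! i \<Colon> add_mset (add_mset (ys ! i, A i) (\<Gamma> i)) (H i)" "length Ks = length ys"
    "\<forall>i<length us. S' i \<tturnstile> Ls ! i \<Colon> add_mset (add_mset (us ! i, A' i) (\<Gamma>' i)) (H' i)" "length Ls = length us"
    "G \<Turnstile> add_mset (x, A0) (fam ys A + fam us A')" "wf \<Sigma> \<Psi>"
    "\<Sigma> = S0 + (\<Sum>i<length ys. S i) + (\<Sum>i<length us. S' i) + {#({#x#} + mset ys + mset us, G)#}"
    "\<Psi> = add_mset (add_mset (x, A0) \<Gamma>0) H0 + ((\<Sum>i<length ys. H i) + seqs ys \<Gamma> A) + ((\<Sum>i<length us. H' i) + seqs us \<Gamma>' A')"
  shows "\<Sigma> \<tturnstile> par (K # Ks @ Ls) \<Colon> \<Psi>"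
proof -
  let ?cs = "Comp x K S0 H0 \<Gamma>0 A0 # mk ys Ks S H \<Gamma> A @ mk us Ls S' H' \<Gamma>' A'"
  have "\<Sigma> \<tturnstile> par (map cK ?cs) \<Colon> \<Psi>"
  proof (rule typed_conn)
    show "ctyped c" if "c \<in> set ?cs" for c
      using that assms(1,2,4) by (auto simp flip: ctyped_mk)
  qed (use assms in \<open>simp_all add: ac_simps\<close>)
  then show ?thesis by (simp add: assms)
qed

lemma joined_cons:
  assumes "\<Sigma> \<tturnstile> par (K # Ks @ Ls) \<Colon> \<Psi>" "joined \<Sigma> G (x # ys @ us) (K # Ks @ Ls)" "length Ks = length ys"
  obtains S0 H0 \<Gamma>0 A0 S H \<Gamma> A S' H' \<Gamma>' A' where
    "S0 \<tturnstile> K \<Colon> add_mset (add_mset (x, A0) \<Gamma>0) H0"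
    "\<forall>i<length ys. S i \<tturnstile> Ks ! i \<Colon> add_mset (add_mset (ys ! i, A i) (\<Gamma> i)) (H i)"
    "\<forall>i<length us. S' i \<tturnstile> Ls ! i \<Colon> add_mset (add_mset (us ! i, A' i) (\<Gamma>' i)) (H' i)" "length Ls = length us"
    "G \<Turnstile> add_mset (x, A0) (fam ys A + fam us A')"
    "\<Sigma> = S0 + (\<Sum>i<length ys. S i) + (\<Sum>i<length us. S' i) + {#({#x#} + mset ys + mset us, G)#}"
    "\<Psi> = add_mset (add_mset (x, A0) \<Gamma>0) H0 + ((\<Sum>i<length ys. H i) + seqs ys \<Gamma> A) + ((\<Sum>i<length us. H' i) + seqs us \<Gamma>' A')"
proof -
  obtain cs where cs: "comps \<Sigma> \<Psi> G (x # ys @ us) (K # Ks @ Ls) cs"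
    using joined_inv[OF assms(1,2)] .
  then obtain c cs' where c: "cs = c # cs'" "cx c = x" "cK c = K" "map cx cs' = ys @ us" "map cK cs' = Ks @ Ls"
    by (cases cs) (auto simp: comps_def)
  obtain as bs where s: "cs' = as @ bs" "map cx as = ys" "map cK as = Ks" "map cx bs = us" "map cK bs = Ls"
    using append_maps_split[OF c(4,5) assms(3)] by blast
  obtain S H \<Gamma> A where a: "as = mk ys Ks S H \<Gamma> A" using mk_ex[OF s(2,3)] by blast
  obtain S' H' \<Gamma>' A' where b: "bs = mk us Ls S' H' \<Gamma>' A'" using mk_ex[OF s(4,5)] by blast
  have l: "length Ls = length us" using s(4,5) by (metis length_map)
  obtain S0 H0 \<Gamma>0 A0 where c': "c = Comp x K S0 H0 \<Gamma>0 A0" using c(2,3) by (cases c) auto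
  show thesis
  proof (rule that)
    show "S0 \<tturnstile> K \<Colon> add_mset (add_mset (x, A0) \<Gamma>0) H0"
      using cs by (simp add: comps_def c(1) c')
    show "\<forall>i<length ys. S i \<tturnstile> Ks ! i \<Colon> add_mset (add_mset (ys ! i, A i) (\<Gamma> i)) (H i)"
      using cs unfolding ctyped_mk[symmetric] by (auto simp: comps_def c(1) s(1) a)
    show "\<forall>i<length us. S' i \<tturnstile> Ls ! i \<Colon> add_mset (add_mset (us ! i, A' i) (\<Gamma>' i)) (H' i)"
      using cs unfolding ctyped_mk[symmetric] by (auto simp: comps_def c(1) s(1) b)
  qed (use cs l in \<open>simp_all add: comps_def c(1) s(1) a b c' ac_simps\<close>)
qed

lemma conn_snoc:
  assumes "\<forall>i<length xs. S i \<tturnstile> Ks ! i \<Colon> add_mset (add_mset (xs ! i, A i) (\<Gamma> i)) (H i)" "length Ks = length xs"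
    "S0 \<tturnstile> K \<Colon> add_mset (add_mset (y, A0) \<Gamma>0) H0"
    "\<forall>i<length us. S' i \<tturnstile> Ls ! i \<Colon> add_mset (add_mset (us ! i, A' i) (\<Gamma>' i)) (H' i)" "length Ls = length us"
    "G \<Turnstile> add_mset (y, A0) (fam xs A + fam us A')" "wf \<Sigma> \<Psi>"
    "\<Sigma> = S0 + (\<Sum>i<length xs. S i) + (\<Sum>i<length us. S' i) + {#(mset xs + {#y#} + mset us, G)#}"
    "\<Psi> = add_mset (add_mset (y, A0) \<Gamma>0) H0 + ((\<Sum>i<length xs. H i) + seqs xs \<Gamma> A) + ((\<Sum>i<length us. H' i) + seqs us \<Gamma>' A')"
  shows "\<Sigma> \<tturnstile> par (Ks @ K # Ls) \<Colon> \<Psi>"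
proof -
  let ?cs = "mk xs Ks S H \<Gamma> A @ Comp y K S0 H0 \<Gamma>0 A0 # mk us Ls S' H' \<Gamma>' A'"
  have "\<Sigma> \<tturnstile> par (map cK ?cs) \<Colon> \<Psi>"
  proof (rule typed_conn)
    show "ctyped c" if "c \<in> set ?cs" for c
      using that assms(1,3,4) by (auto simp flip: ctyped_mk)
  qed (use assms in \<open>simp_all add: ac_simps\<close>)
  then show ?thesis by (simp add: assms)
qed

lemma joined_snoc:
  assumes "\<Sigma> \<tturnstile> par (Ks @ K # Ls) \<Colon> \<Psi>" "joined \<Sigma> G (xs @ y # us) (Ks @ K # Ls)" "length Ks = length xs"
  obtains S H \<Gamma> A S0 H0 \<Gamma>0 A0 S' H' \<Gamma>' A' where
    "\<forall>i<length xs. S i \<tturnstile> Ks ! i \<Colon> add_mset (add_mset (xs ! i, A i) (\<Gamma> i)) (H i)"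
    "S0 \<tturnstile> K \<Colon> add_mset (add_mset (y, A0) \<Gamma>0) H0"
    "\<forall>i<length us. S' i \<tturnstile> Ls ! i \<Colon> add_mset (add_mset (us ! i, A' i) (\<Gamma>' i)) (H' i)" "length Ls = length us"
    "G \<Turnstile> add_mset (y, A0) (fam xs A + fam us A')"
    "\<Sigma> = S0 + (\<Sum>i<length xs. S i) + (\<Sum>i<length us. S' i) + {#(mset xs + {#y#} + mset us, G)#}"
    "\<Psi> = add_mset (add_mset (y, A0) \<Gamma>0) H0 + ((\<Sum>i<length xs. H i) + seqs xs \<Gamma> A) + ((\<Sum>i<length us. H' i) + seqs us \<Gamma>' A')"
proof -
  obtain cs where cs: "comps \<Sigma> \<Psi> G (xs @ y # us) (Ks @ K # Ls) cs"
    using joined_inv[OF assms(1,2)] .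
  then have "map cx cs = xs @ y # us" "map cK cs = Ks @ K # Ls" by (auto simp: comps_def)
  then obtain as cs' where s: "cs = as @ cs'" "map cx as = xs" "map cK as = Ks" "map cx cs' = y # us" "map cK cs' = K # Ls"
    using append_maps_split[of cx cs xs "y # us" cK Ks "K # Ls"] assms(3) by blast
  then obtain c bs where c: "cs' = c # bs" "cx c = y" "cK c = K" "map cx bs = us" "map cK bs = Ls"
    by (cases cs') auto
  obtain S H \<Gamma> A where a: "as = mk xs Ks S H \<Gamma> A" using mk_ex[OF s(2,3)] by blast
  obtain S' H' \<Gamma>' A' where b: "bs = mk us Ls S' H' \<Gamma>' A'" using mk_ex[OF c(4,5)] by blast
  have l: "length Ls = length us" using c(4,5) by (metis length_map)
  obtain S0 H0 \<Gamma>0 A0 where c': "c = Comp y K S0 H0 \<Gamma>0 A0" using c(2,3) by (cases c) auto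
  show thesis
  proof (rule that)
    show "S0 \<tturnstile> K \<Colon> add_mset (add_mset (y, A0) \<Gamma>0) H0"
      using cs by (simp add: comps_def s(1) c(1) c')
    show "\<forall>i<length xs. S i \<tturnstile> Ks ! i \<Colon> add_mset (add_mset (xs ! i, A i) (\<Gamma> i)) (H i)"
      using cs unfolding ctyped_mk[symmetric] by (auto simp: comps_def c(1) s(1) a)
    show "\<forall>i<length us. S' i \<tturnstile> Ls ! i \<Colon> add_mset (add_mset (us ! i, A' i) (\<Gamma>' i)) (H' i)"
      using cs unfolding ctyped_mk[symmetric] by (auto simp: comps_def c(1) s(1) b)
  qed (use cs l in \<open>simp_all add: comps_def c(1) s(1) a b c' ac_simps\<close>)
qed

section \<open>Inversion\<close>

lemma focus_eq:
  assumes "nodup (hdom (add_mset (add_mset (x, T) \<Gamma>) \<Psi>))"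
    "add_mset (add_mset (x, T) \<Gamma>) \<Psi> = add_mset (add_mset (x, T') \<Gamma>') \<Psi>'"
  shows "T = T' \<and> \<Gamma> = \<Gamma>' \<and> \<Psi> = \<Psi>'"
proof -
  have "add_mset (x, T') \<Gamma>' \<in># add_mset (add_mset (x, T) \<Gamma>) \<Psi>" unfolding assms(2) by simp
  then have "T = T' \<and> \<Gamma> = \<Gamma>'"
    by (rule focus_unique[OF assms(1), rotated]) simp
  then show ?thesis using assms(2) by simp
qed

lemma focus_eq':
  assumes "add_mset (add_mset (x, T) \<Gamma>) \<Psi> = add_mset (add_mset (x, T') \<Gamma>') \<Psi>'"
    "nodup (hdom (add_mset (add_mset (x, T') \<Gamma>') \<Psi>'))"
  shows "T = T' \<and> \<Gamma> = \<Gamma>' \<and> \<Psi> = \<Psi>'"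
  using focus_eq[OF assms(2) assms(1)[symmetric]] by blast

lemma focus_single:
  "add_mset (x, T) \<Gamma> = add_mset (x, T') \<Gamma>' \<Longrightarrow> nodup (hdom {#add_mset (x, T') \<Gamma>'#}) \<Longrightarrow> T = T' \<and> \<Gamma> = \<Gamma>'"
  using focus_eq'[of x T \<Gamma> "{#}" T' \<Gamma>' "{#}"] by simp

text \<open>Inverting several components yields a smaller environment for each of them. This
  relation lets the losses be added up and restored in a single step by
  \<open>typed_stripped\<close>.\<close>

definition stripped :: "env \<Rightarrow> hyp \<Rightarrow> env \<Rightarrow> bool" where
  "stripped \<Sigma> \<Psi> \<Sigma>' \<longleftrightarrow> (\<exists>U. \<Sigma> = \<Sigma>' + U \<and> unary U (flat \<Psi>))"

lemma strippedI: "\<Sigma> = \<Sigma>' + U \<Longrightarrow> unary U (flat \<Psi>) \<Longrightarrow> stripped \<Sigma> \<Psi> \<Sigma>'"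
  by (auto simp: stripped_def)

lemma typed_stripped: "\<Sigma>' \<tturnstile> P \<Colon> \<Psi> \<Longrightarrow> stripped \<Sigma> \<Psi> \<Sigma>' \<Longrightarrow> wf \<Sigma> \<Psi> \<Longrightarrow> \<Sigma> \<tturnstile> P \<Colon> \<Psi>"
  by (auto simp: stripped_def wf_def intro: typed_unary)

lemma strip':
  assumes "\<Sigma> \<tturnstile> T \<Colon> \<Psi>" "\<And>K L. T \<noteq> Par K L"
    "\<And>\<Sigma>' F J Ps. stripped \<Sigma> \<Psi> \<Sigma>' \<Longrightarrow> rule F J \<Sigma>' \<Psi> \<Longrightarrow> nodup (hdom \<Psi>) \<Longrightarrow> nodup (edom \<Sigma>') \<Longrightarrow> F \<noteq> par \<Longrightarrow> T = F Ps \<Longrightarrow>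
      length Ps = length J \<Longrightarrow> \<forall>i<length J. fst (J ! i) \<tturnstile> Ps ! i \<Colon> snd (J ! i) \<Longrightarrow> thesis"
  shows thesis
  using assms(1,2)
  by (rule strip) (rule assms(3); auto simp: infers_def wf_def intro: strippedI)

text \<open>In this and the following inversions the hypersequent is given with the principal
  endpoint in focus. As no endpoint is declared twice, the decomposition used by the rule must be
  this one, so the same \<Gamma> and \<Psi> appear in the premise.\<close>

lemma inv_Inl:
  assumes "\<Sigma> \<tturnstile> Inl x P \<Colon> add_mset (add_mset (x, T) \<Gamma>) \<Psi>"
  shows "\<exists>\<Sigma>' A B. stripped \<Sigma> (add_mset (add_mset (x, T) \<Gamma>) \<Psi>) \<Sigma>' \<and> T = Oplus A B \<and>
    \<Sigma>' \<tturnstile> P \<Colon> add_mset (add_mset (x, A) \<Gamma>) \<Psi>"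
  apply (rule strip'[OF assms], simp, erule rule.cases)
  apply (simp_all add: un_def bin_def less_Suc_eq all_conj_distrib del: hdom_simps nodup_simps nodup_union)
  apply (auto dest!: focus_eq' simp: add_mset_commute simp del: hdom_simps nodup_simps nodup_union)
  done

lemma inv_Inr:
  assumes "\<Sigma> \<tturnstile> Inr x P \<Colon> add_mset (add_mset (x, T) \<Gamma>) \<Psi>"
  shows "\<exists>\<Sigma>' A B. stripped \<Sigma> (add_mset (add_mset (x, T) \<Gamma>) \<Psi>) \<Sigma>' \<and> T = Oplus A B \<and>
    \<Sigma>' \<tturnstile> P \<Colon> add_mset (add_mset (x, B) \<Gamma>) \<Psi>"
  apply (rule strip'[OF assms], simp, erule rule.cases)
  apply (simp_all add: un_def bin_def less_Suc_eq all_conj_distrib del: hdom_simps nodup_simps nodup_union)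
  apply (auto dest!: focus_eq' simp: add_mset_commute simp del: hdom_simps nodup_simps nodup_union)
  done

lemma inv_Sel:
  assumes "\<Sigma> \<tturnstile> Sel x P Q \<Colon> add_mset (add_mset (x, T) \<Gamma>) \<Psi>"
  shows "\<exists>\<Sigma>' A B. stripped \<Sigma> (add_mset (add_mset (x, T) \<Gamma>) \<Psi>) \<Sigma>' \<and> T = Oplus A B \<and>
    \<Sigma>' \<tturnstile> P \<Colon> add_mset (add_mset (x, A) \<Gamma>) \<Psi> \<and> \<Sigma>' \<tturnstile> Q \<Colon> add_mset (add_mset (x, B) \<Gamma>) \<Psi>"
  apply (rule strip'[OF assms], simp, erule rule.cases)
  apply (simp_all add: un_def bin_def less_Suc_eq all_conj_distrib del: hdom_simps nodup_simps nodup_union)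
  apply (auto dest!: focus_eq' simp: add_mset_commute simp del: hdom_simps nodup_simps nodup_union)
  done

lemma inv_Case:
  assumes "\<Sigma> \<tturnstile> Case x P Q \<Colon> add_mset (add_mset (x, T) \<Gamma>) \<Psi>"
  shows "\<exists>\<Sigma>' A B. stripped \<Sigma> (add_mset (add_mset (x, T) \<Gamma>) \<Psi>) \<Sigma>' \<and> T = With A B \<and>
    \<Sigma>' \<tturnstile> P \<Colon> add_mset (add_mset (x, A) \<Gamma>) \<Psi> \<and> \<Sigma>' \<tturnstile> Q \<Colon> add_mset (add_mset (x, B) \<Gamma>) \<Psi>"
  apply (rule strip'[OF assms], simp, erule rule.cases)
  apply (simp_all add: un_def bin_def less_Suc_eq all_conj_distrib del: hdom_simps nodup_simps nodup_union)
  apply (auto dest!: focus_eq' simp: add_mset_commute simp del: hdom_simps nodup_simps nodup_union)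
  done

lemma inv_Use:
  assumes "\<Sigma> \<tturnstile> Use x P \<Colon> add_mset (add_mset (x, T) \<Gamma>) \<Psi>"
  shows "\<exists>\<Sigma>' A. stripped \<Sigma> (add_mset (add_mset (x, T) \<Gamma>) \<Psi>) \<Sigma>' \<and> T = Quest A \<and>
    \<Sigma>' \<tturnstile> P \<Colon> add_mset (add_mset (x, A) \<Gamma>) \<Psi>"
  apply (rule strip'[OF assms], simp, erule rule.cases)
  apply (simp_all add: un_def bin_def less_Suc_eq all_conj_distrib del: hdom_simps nodup_simps nodup_union)
  apply (auto dest!: focus_eq' simp: add_mset_commute simp del: hdom_simps nodup_simps nodup_union)
  done

lemma inv_Kill:
  assumes "\<Sigma> \<tturnstile> Kill x P \<Colon> add_mset (add_mset (x, T) \<Gamma>) \<Psi>"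
  shows "\<exists>\<Sigma>' A. stripped \<Sigma> (add_mset (add_mset (x, T) \<Gamma>) \<Psi>) \<Sigma>' \<and> T = Quest A \<and> \<Sigma>' \<tturnstile> P \<Colon> add_mset \<Gamma> \<Psi>"
  apply (rule strip'[OF assms], simp, erule rule.cases)
  apply (simp_all add: un_def bin_def less_Suc_eq all_conj_distrib del: hdom_simps nodup_simps nodup_union)
  apply (auto dest!: focus_eq' simp: add_mset_commute simp del: hdom_simps nodup_simps nodup_union)
  done

lemma inv_Wait:
  assumes "\<Sigma> \<tturnstile> Wait x P \<Colon> add_mset (add_mset (x, T) \<Gamma>) \<Psi>"
  shows "\<exists>\<Sigma>'. stripped \<Sigma> (add_mset (add_mset (x, T) \<Gamma>) \<Psi>) \<Sigma>' \<and> T = TBot \<and> \<Sigma>' \<tturnstile> P \<Colon> add_mset \<Gamma> \<Psi>"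
  apply (rule strip'[OF assms], simp, erule rule.cases)
  apply (simp_all add: un_def bin_def less_Suc_eq all_conj_distrib del: hdom_simps nodup_simps nodup_union)
  apply (auto dest!: focus_eq' simp: add_mset_commute simp del: hdom_simps nodup_simps nodup_union)
  done

lemma inv_Clone:
  assumes "\<Sigma> \<tturnstile> Clone x x' P \<Colon> add_mset (add_mset (x, T) \<Gamma>) \<Psi>"
  shows "\<exists>\<Sigma>' A. stripped \<Sigma> (add_mset (add_mset (x, T) \<Gamma>) \<Psi>) \<Sigma>' \<and> T = Quest A \<and>
    \<Sigma>' \<tturnstile> P \<Colon> add_mset (add_mset (x, Quest A) (add_mset (x', Quest A) \<Gamma>)) \<Psi>"
  apply (rule strip'[OF assms], simp, erule rule.cases)
  apply (simp_all add: un_def bin_def less_Suc_eq all_conj_distrib del: hdom_simps nodup_simps nodup_union)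
  apply (auto dest!: focus_eq' simp: add_mset_commute simp del: hdom_simps nodup_simps nodup_union)
  done

lemma inv_Recv:
  assumes "\<Sigma> \<tturnstile> Recv y y' P \<Colon> add_mset (add_mset (y, T) \<Gamma>) \<Psi>"
  shows "\<exists>\<Sigma>' C D. stripped \<Sigma> (add_mset (add_mset (y, T) \<Gamma>) \<Psi>) \<Sigma>' \<and> T = Parr C D \<and>
    \<Sigma>' \<tturnstile> P \<Colon> add_mset (add_mset (y, D) (add_mset (y', C) \<Gamma>)) \<Psi>"
  apply (rule strip'[OF assms], simp, erule rule.cases)
  apply (simp_all add: un_def bin_def less_Suc_eq all_conj_distrib del: hdom_simps nodup_simps nodup_union)
  apply (auto dest!: focus_eq' simp: add_mset_commute simp del: hdom_simps nodup_simps nodup_union)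
  done

lemma inv_Close:
  assumes "\<Sigma> \<tturnstile> Close x \<Colon> add_mset (add_mset (x, T) \<Gamma>) \<Psi>"
  shows "stripped \<Sigma> (add_mset (add_mset (x, T) \<Gamma>) \<Psi>) {#} \<and> T = TOne \<and> \<Gamma> = {#} \<and> \<Psi> = {#}"
  apply (rule strip'[OF assms], simp, erule rule.cases)
  apply (simp_all add: un_def bin_def less_Suc_eq all_conj_distrib del: hdom_simps nodup_simps nodup_union)
  done

lemma inv_Srv:
  assumes "\<Sigma> \<tturnstile> Srv x P \<Colon> add_mset (add_mset (x, T) \<Gamma>) \<Psi>"
  shows "\<exists>A. stripped \<Sigma> (add_mset (add_mset (x, T) \<Gamma>) \<Psi>) {#} \<and> T = Bang A \<and> \<Psi> = {#} \<and> quest_ctx \<Gamma> \<and>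
    {#} \<tturnstile> P \<Colon> {#add_mset (x, A) \<Gamma>#}"
  apply (rule strip'[OF assms], simp, erule rule.cases)
  apply (simp_all add: un_def bin_def less_Suc_eq all_conj_distrib del: hdom_simps nodup_simps nodup_union)
  apply (auto dest!: focus_eq' focus_single simp: add_mset_commute simp del: hdom_simps nodup_simps nodup_union)
  done

lemma inv_Send:
  assumes "\<Sigma> \<tturnstile> Send x x' P Q \<Colon> add_mset (add_mset (x, T) \<Gamma>) \<Psi>"
  shows "\<exists>\<Sigma>1 \<Sigma>2 \<Gamma>1 \<Gamma>2 \<Psi>1 \<Psi>2 A B. stripped \<Sigma> (add_mset (add_mset (x, T) \<Gamma>) \<Psi>) (\<Sigma>1 + \<Sigma>2) \<and> T = Tensor A B \<and>
    \<Gamma> = \<Gamma>1 + \<Gamma>2 \<and> \<Psi> = \<Psi>1 + \<Psi>2 \<and>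
    \<Sigma>1 \<tturnstile> P \<Colon> add_mset (add_mset (x', A) \<Gamma>1) \<Psi>1 \<and> \<Sigma>2 \<tturnstile> Q \<Colon> add_mset (add_mset (x, B) \<Gamma>2) \<Psi>2"
  apply (rule strip'[OF assms], simp, erule rule.cases)
  apply (simp_all add: un_def bin_def less_Suc_eq all_conj_distrib del: hdom_simps nodup_simps nodup_union)
  apply (auto dest!: focus_eq' simp: add_mset_commute simp del: hdom_simps nodup_simps nodup_union)
  done

lemma inv_Link:
  assumes "\<Sigma> \<tturnstile> Link x A y \<Colon> \<Psi>"
  shows "stripped \<Sigma> \<Psi> {#} \<and> \<Psi> = {#{#(x, A), (y, dual A)#}#}"
  apply (rule strip'[OF assms], simp, erule rule.cases)
  apply (simp_all add: un_def bin_def less_Suc_eq all_conj_distrib del: hdom_simps nodup_simps nodup_union)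
  done

lemma inv_CInl:
  assumes "\<Sigma> \<tturnstile> CInl x ys P Qs \<Colon> \<Psi>"
  obtains \<Sigma>0 Si us G H \<Psi>0 Hi \<Gamma> \<Gamma>i A B C D \<Delta> E where
    "stripped \<Sigma> \<Psi> (\<Sigma>0 + (\<Sum>i<length ys. Si i) + {#({#x#} + mset ys + mset us, GCase x ys G H)#})"
    "H \<Turnstile> {#(x, B)#} + fam ys D + fam us E" "length Qs = length ys"
    "\<Psi> = \<Psi>0 + (\<Sum>i<length ys. Hi i) + {#\<Gamma> + {#(x, Oplus A B)#}#} + seqs ys \<Gamma>i (\<lambda>i. With (C i) (D i)) + seqs us \<Delta> E"
    "\<Sigma>0 + (\<Sum>i<length ys. Si i) + {#({#x#} + mset ys + mset us, G)#} \<tturnstile> P \<Colon>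
      \<Psi>0 + (\<Sum>i<length ys. Hi i) + {#\<Gamma> + {#(x, A)#}#} + seqs ys \<Gamma>i C + seqs us \<Delta> E"
    "\<forall>i<length ys. Si i \<tturnstile> Qs ! i \<Colon> Hi i + {#\<Gamma>i i + {#(ys ! i, D i)#}#}"
proof (rule strip'[OF assms])
  fix \<Sigma>' F J Ps
  assume a: "stripped \<Sigma> \<Psi> \<Sigma>'" "rule F J \<Sigma>' \<Psi>"
    and e: "F \<noteq> par" "CInl x ys P Qs = F Ps" "length Ps = length J" "\<forall>i<length J. fst (J ! i) \<tturnstile> Ps ! i \<Colon> snd (J ! i)"
  from a(2) show thesis
  proof (cases rule: rule.cases)
    case (COplusWith1 H x1 B ys1 D us E \<Sigma>0 Si G \<Psi>0 Hi \<Gamma> A \<Gamma>i C \<Delta>)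
    note c = COplusWith1
    have [simp]: "x1 = x" "ys1 = ys" "Ps = P # Qs" "length Qs = length ys"
      using e(2,3) c(1,2) by (cases Ps; simp)+
    show thesis
      by (rule that[of \<Sigma>0 Si us G H B D E \<Psi>0 Hi \<Gamma> A \<Gamma>i C \<Delta>])
        (use a(1) c e(4) in \<open>simp_all add: All_less_Suc2\<close>)
  qed (use e in \<open>auto simp: un_def bin_def\<close>)
qed simp

lemma inv_CInr:
  assumes "\<Sigma> \<tturnstile> CInr x ys Qs P \<Colon> \<Psi>"
  obtains \<Sigma>0 Si us G H \<Psi>0 Hi \<Gamma> \<Gamma>i A B C D \<Delta> E where
    "stripped \<Sigma> \<Psi> (\<Sigma>0 + (\<Sum>i<length ys. Si i) + {#({#x#} + mset ys + mset us, GCase x ys G H)#})"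
    "G \<Turnstile> {#(x, A)#} + fam ys C + fam us E" "length Qs = length ys"
    "\<Psi> = \<Psi>0 + (\<Sum>i<length ys. Hi i) + {#\<Gamma> + {#(x, Oplus A B)#}#} + seqs ys \<Gamma>i (\<lambda>i. With (C i) (D i)) + seqs us \<Delta> E"
    "\<Sigma>0 + (\<Sum>i<length ys. Si i) + {#({#x#} + mset ys + mset us, H)#} \<tturnstile> P \<Colon>
      \<Psi>0 + (\<Sum>i<length ys. Hi i) + {#\<Gamma> + {#(x, B)#}#} + seqs ys \<Gamma>i D + seqs us \<Delta> E"
    "\<forall>i<length ys. Si i \<tturnstile> Qs ! i \<Colon> Hi i + {#\<Gamma>i i + {#(ys ! i, C i)#}#}"
proof (rule strip'[OF assms])
  fix \<Sigma>' F J Ps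
  assume a: "stripped \<Sigma> \<Psi> \<Sigma>'" "rule F J \<Sigma>' \<Psi>"
    and e: "F \<noteq> par" "CInr x ys Qs P = F Ps" "length Ps = length J" "\<forall>i<length J. fst (J ! i) \<tturnstile> Ps ! i \<Colon> snd (J ! i)"
  from a(2) show thesis
  proof (cases rule: rule.cases)
    case (COplusWith2 G x1 A ys1 C us E \<Sigma>0 Si H \<Psi>0 Hi \<Gamma> B \<Gamma>i D \<Delta>)
    note c = COplusWith2
    have [simp]: "x1 = x" "ys1 = ys" "Ps = P # Qs" "length Qs = length ys"
      using e(2,3) c(1,2) by (cases Ps; simp)+
    show thesis
      by (rule that[of \<Sigma>0 Si us G H A C E \<Psi>0 Hi \<Gamma> B \<Gamma>i D \<Delta>])
        (use a(1) c e(4) in \<open>simp_all add: All_less_Suc2\<close>)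
  qed (use e in \<open>auto simp: un_def bin_def\<close>)
qed simp

lemma inv_CSel:
  assumes "\<Sigma> \<tturnstile> CSel x ys P Q \<Colon> \<Psi>"
  obtains \<Sigma>0 us G H \<Psi>0 \<Gamma> \<Gamma>i A B C D where
    "stripped \<Sigma> \<Psi> (\<Sigma>0 + {#({#x#} + mset ys + mset us, GCase x ys G H)#})"
    "\<Psi> = \<Psi>0 + {#\<Gamma> + {#(x, Oplus A B)#}#} + seqs ys \<Gamma>i (\<lambda>i. With (C i) (D i))"
    "\<Sigma>0 + {#({#x#} + mset ys + mset us, G)#} \<tturnstile> P \<Colon> \<Psi>0 + {#\<Gamma> + {#(x, A)#}#} + seqs ys \<Gamma>i C"
    "\<Sigma>0 + {#({#x#} + mset ys + mset us, H)#} \<tturnstile> Q \<Colon> \<Psi>0 + {#\<Gamma> + {#(x, B)#}#} + seqs ys \<Gamma>i D"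
proof (rule strip'[OF assms])
  fix \<Sigma>' F J Ps
  assume a: "stripped \<Sigma> \<Psi> \<Sigma>'" "rule F J \<Sigma>' \<Psi>"
    and e: "F \<noteq> par" "CSel x ys P Q = F Ps" "length Ps = length J" "\<forall>i<length J. fst (J ! i) \<tturnstile> Ps ! i \<Colon> snd (J ! i)"
  from a(2) show thesis
  proof (cases rule: rule.cases)
    case (COplusWith x1 ys1 \<Sigma>0 us G \<Psi>0 \<Gamma> A \<Gamma>i C H B D)
    note c = COplusWith
    have [simp]: "x1 = x" "ys1 = ys" "Ps ! 0 = P" "Ps ! Suc 0 = Q"
      using e(2) c(1) by (simp_all add: bin_def)
    show thesis
      by (rule that[of \<Sigma>0 us G H \<Psi>0 \<Gamma> A B \<Gamma>i C D])
        (use a(1) c e(4) in \<open>simp_all add: less_Suc_eq all_conj_distrib\<close>)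
  qed (use e in \<open>auto simp: un_def bin_def\<close>)
qed simp

lemma inv_Starts:
  assumes "\<Sigma> \<tturnstile> Starts x ys P \<Colon> \<Psi>"
  obtains \<Sigma>0 G \<Psi>0 \<Gamma> \<Gamma>i A B where
    "stripped \<Sigma> \<Psi> (\<Sigma>0 + {#({#x#} + mset ys, GBang x ys G)#})"
    "\<forall>i<length ys. quest_ctx (\<Gamma>i i) \<and> set_mset (names (\<Gamma>i i)) \<inter> evars \<Sigma>0 = {}"
    "\<Psi> = \<Psi>0 + {#\<Gamma> + {#(x, Quest A)#}#} + seqs ys \<Gamma>i (\<lambda>i. Bang (B i))"
    "\<Sigma>0 + {#({#x#} + mset ys, G)#} \<tturnstile> P \<Colon> \<Psi>0 + {#\<Gamma> + {#(x, A)#}#} + seqs ys \<Gamma>i B"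
proof (rule strip'[OF assms])
  fix \<Sigma>' F J Ps
  assume a: "stripped \<Sigma> \<Psi> \<Sigma>'" "rule F J \<Sigma>' \<Psi>"
    and e: "F \<noteq> par" "Starts x ys P = F Ps" "length Ps = length J" "\<forall>i<length J. fst (J ! i) \<tturnstile> Ps ! i \<Colon> snd (J ! i)"
  from a(2) show thesis
  proof (cases rule: rule.cases)
    case (CBangQuest ys1 \<Gamma>i \<Sigma>0 x1 G \<Psi>0 \<Gamma> A B)
    note c = CBangQuest
    have [simp]: "x1 = x" "ys1 = ys" "Ps ! 0 = P"
      using e(2) c(1) by (simp_all add: un_def)
    show thesis
      by (rule that[of \<Sigma>0 G \<Gamma>i \<Psi>0 \<Gamma> A B]) (use a(1) c e(4) in simp_all)
  qed (use e in \<open>auto simp: un_def bin_def\<close>)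
qed simp

lemma inv_Kills:
  assumes "\<Sigma> \<tturnstile> Kills x ys Qs P \<Colon> \<Psi>"
  obtains \<Sigma>0 G \<Psi>0 \<Gamma> \<Gamma>i A B where
    "stripped \<Sigma> \<Psi> (\<Sigma>0 + {#({#x#} + mset ys, GBang x ys G)#})"
    "G \<Turnstile> {#(x, A)#} + fam ys B" "\<forall>i<length ys. quest_ctx (\<Gamma>i i)" "length Qs = length ys"
    "\<Psi> = \<Psi>0 + {#\<Gamma> + {#(x, Quest A)#}#} + seqs ys \<Gamma>i (\<lambda>i. Bang (B i))"
    "\<Sigma>0 \<tturnstile> P \<Colon> \<Psi>0 + {#\<Gamma>#}"
    "\<forall>i<length ys. {#} \<tturnstile> Qs ! i \<Colon> {#\<Gamma>i i + {#(ys ! i, B i)#}#}"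
proof (rule strip'[OF assms])
  fix \<Sigma>' F J Ps
  assume a: "stripped \<Sigma> \<Psi> \<Sigma>'" "rule F J \<Sigma>' \<Psi>"
    and e: "F \<noteq> par" "Kills x ys Qs P = F Ps" "length Ps = length J" "\<forall>i<length J. fst (J ! i) \<tturnstile> Ps ! i \<Colon> snd (J ! i)"
  from a(2) show thesis
  proof (cases rule: rule.cases)
    case (CBangWeaken G x1 A ys1 B \<Gamma>i \<Sigma>0 \<Psi>0 \<Gamma>)
    note c = CBangWeaken
    have [simp]: "x1 = x" "ys1 = ys" "Ps = P # Qs" "length Qs = length ys"
      using e(2,3) c(1,2) by (cases Ps; simp)+
    show thesis
      by (rule that[of \<Sigma>0 G A B \<Gamma>i \<Psi>0 \<Gamma>]) (use a(1) c e(4) in \<open>simp_all add: All_less_Suc2\<close>)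
  qed (use e in \<open>auto simp: un_def bin_def\<close>)
qed simp

lemma inv_Closes:
  assumes "\<Sigma> \<tturnstile> Closes xs y P \<Colon> \<Psi>"
  obtains \<Sigma>0 \<Psi>0 \<Gamma> where
    "stripped \<Sigma> \<Psi> (\<Sigma>0 + {#(mset xs + {#y#}, GClose xs y)#})"
    "\<Psi> = \<Psi>0 + seqs xs (\<lambda>i. {#}) (\<lambda>i. TOne) + {#\<Gamma> + {#(y, TBot)#}#}"
    "\<Sigma>0 \<tturnstile> P \<Colon> \<Psi>0 + {#\<Gamma>#}"
proof (rule strip'[OF assms])
  fix \<Sigma>' F J Ps
  assume a: "stripped \<Sigma> \<Psi> \<Sigma>'" "rule F J \<Sigma>' \<Psi>"
    and e: "F \<noteq> par" "Closes xs y P = F Ps" "length Ps = length J" "\<forall>i<length J. fst (J ! i) \<tturnstile> Ps ! i \<Colon> snd (J ! i)"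
  from a(2) show thesis
  proof (cases rule: rule.cases)
    case (COneBot xs1 y1 \<Sigma>0 \<Psi>0 \<Gamma>)
    note c = COneBot
    have [simp]: "xs1 = xs" "y1 = y" "Ps ! 0 = P"
      using e(2) c(1) by (simp_all add: un_def)
    show thesis
      by (rule that[of \<Sigma>0 \<Psi>0 \<Gamma>]) (use a(1) c e(4) in simp_all)
  qed (use e in \<open>auto simp: un_def bin_def\<close>)
qed simp

lemma inv_CLink:
  assumes "\<Sigma> \<tturnstile> CLink w y B x P \<Colon> \<Psi>"
  obtains \<Sigma>0 \<Psi>0 \<Gamma> A Q where
    "stripped \<Sigma> \<Psi> (\<Sigma>0 + {#({#x, y#}, GLink x A y)#})" "w \<notin> evars \<Sigma>0" "dual A = B" "atomic A"
    "\<Psi> = \<Psi>0 + {#\<Gamma> + {#(x, A)#}, {#(w, A), (y, B)#}#}"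
    "P = map_trm (exch [x] [w]) Q" "\<Sigma>0 \<tturnstile> Q \<Colon> \<Psi>0 + {#\<Gamma> + {#(w, A)#}#}" "x \<notin># edom \<Sigma>0"
proof (rule strip'[OF assms])
  fix \<Sigma>' F J Ps
  assume a: "stripped \<Sigma> \<Psi> \<Sigma>'" "rule F J \<Sigma>' \<Psi>" "nodup (edom \<Sigma>')"
    and e: "F \<noteq> par" "CLink w y B x P = F Ps" "length Ps = length J" "\<forall>i<length J. fst (J ! i) \<tturnstile> Ps ! i \<Colon> snd (J ! i)"
  from a(2) show thesis
  proof (cases rule: rule.cases)
    case (CAx w1 \<Sigma>0 A B1 y1 x1 \<Psi>0 \<Gamma>)
    note c = CAx
    have [simp]: "x1 = x" "w1 = w" "y1 = y" "B1 = B" "P = map_trm (exch [x] [w]) (Ps ! 0)"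
      using e(2) c(1) by (simp_all add: un_def)
    show thesis
      by (rule that[of \<Sigma>0 A \<Psi>0 \<Gamma> "Ps ! 0"]) (use a c e(4) in simp_all)
  qed (use e in \<open>auto simp: un_def bin_def\<close>)
qed simp

lemma inv_Comm:
  assumes "\<Sigma> \<tturnstile> Comm xs xs' y y' P \<Colon> \<Psi>"
  obtains \<Sigma>0 us G H \<Psi>0 \<Gamma>1 A \<Gamma>2 B \<Gamma> C D where
    "stripped \<Sigma> \<Psi> (\<Sigma>0 + {#(mset xs + {#y#} + mset us, GComm xs y G H)#})" "length xs' = length xs"
    "\<Psi> = \<Psi>0 + seqs xs (\<lambda>i. \<Gamma>1 i + \<Gamma>2 i) (\<lambda>i. Tensor (A i) (B i)) + {#\<Gamma> + {#(y, Parr C D)#}#}"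
    "\<Sigma>0 + {#(mset xs + {#y#} + mset us, H), (mset xs' + {#y'#}, map_gtype (exch (xs @ [y]) (xs' @ [y'])) G)#} \<tturnstile> P \<Colon>
       \<Psi>0 + seqs xs' \<Gamma>1 A + seqs xs \<Gamma>2 B + {#\<Gamma> + {#(y', C), (y, D)#}#}"
proof (rule strip'[OF assms])
  fix \<Sigma>' F J Ps
  assume a: "stripped \<Sigma> \<Psi> \<Sigma>'" "rule F J \<Sigma>' \<Psi>" "nodup (edom \<Sigma>')"
    and e: "F \<noteq> par" "Comm xs xs' y y' P = F Ps" "length Ps = length J" "\<forall>i<length J. fst (J ! i) \<tturnstile> Ps ! i \<Colon> snd (J ! i)"
  from a(2) show thesis
  proof (cases rule: rule.cases)
    case (CTensorParr xs1' xs1 y1 y1' \<Sigma>0 us H G \<Psi>0 \<Gamma>1 A \<Gamma>2 B \<Gamma> C D)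
    note c = CTensorParr
    have [simp]: "xs1 = xs" "xs1' = xs'" "y1 = y" "y1' = y'" "P = Ps ! 0"
      using e(2) c(1) by (simp_all add: un_def)
    show thesis
      by (rule that[of \<Sigma>0 us G H \<Psi>0 \<Gamma>1 \<Gamma>2 A B \<Gamma> C D]) (use a c e(4) in simp_all)
  qed (use e in \<open>auto simp: un_def bin_def\<close>)
qed simp

lemma inv_Clones:
  assumes "\<Sigma> \<tturnstile> Clones x ys x' ys' zs zs' P \<Colon> \<Psi>"
  obtains \<Sigma>0 G \<Psi>0 \<Gamma> \<Gamma>i \<Gamma>i' A B where
    "stripped \<Sigma> \<Psi> (\<Sigma>0 + {#({#x#} + mset ys, GBang x ys G)#})" "length ys' = length ys"
    "\<forall>i<length ys. quest_ctx (\<Gamma>i i) \<and> (set_mset (names (\<Gamma>i i)) \<union> set_mset (names (\<Gamma>i' i))) \<inter> evars \<Sigma>0 = {}"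
    "\<Psi> = \<Psi>0 + {#\<Gamma> + {#(x, Quest A)#}#} + seqs ys \<Gamma>i (\<lambda>i. Bang (B i))"
    "\<Sigma>0 + {#({#x#} + mset ys, GBang x ys G), ({#x'#} + mset ys', GBang x' ys' (map_gtype (exch (x # ys) (x' # ys')) G))#} \<tturnstile> P \<Colon>
       \<Psi>0 + {#\<Gamma> + {#(x, Quest A), (x', Quest A)#}#} + seqs ys \<Gamma>i (\<lambda>i. Bang (B i)) + seqs ys' \<Gamma>i' (\<lambda>i. Bang (B i))"
proof (rule strip'[OF assms])
  fix \<Sigma>' F J Ps
  assume a: "stripped \<Sigma> \<Psi> \<Sigma>'" "rule F J \<Sigma>' \<Psi>" "nodup (edom \<Sigma>')"
    and e: "F \<noteq> par" "Clones x ys x' ys' zs zs' P = F Ps" "length Ps = length J" "\<forall>i<length J. fst (J ! i) \<tturnstile> Ps ! i \<Colon> snd (J ! i)"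
  from a(2) show thesis
  proof (cases rule: rule.cases)
    case (CBangContract ys1' ys1 zs1' zs1 \<Gamma>i \<Gamma>i' \<Sigma>0 x1 x1' G \<Psi>0 \<Gamma> A B)
    note c = CBangContract
    have [simp]: "x1 = x" "ys1 = ys" "x1' = x'" "ys1' = ys'" "P = Ps ! 0"
      using e(2) c(1) by (simp_all add: un_def)
    show thesis
      by (rule that[of \<Sigma>0 G \<Gamma>i \<Gamma>i' \<Psi>0 \<Gamma> A B]) (use a c(1-4,5-8) c(9) e(4) in simp_all)
  qed (use e in \<open>auto simp: un_def bin_def\<close>)
qed simp

section \<open>Inversion of coherence\<close>

lemma fam_unique:
  assumes "nodup (names (fam xs A + \<Gamma>))" "fam xs A + \<Gamma> = fam xs B + \<Delta>"
  shows "fam xs A = fam xs B" "\<And>i. i < length xs \<Longrightarrow> A i = B i" "\<Gamma> = \<Delta>"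
proof -
  show *: "A i = B i" if i: "i < length xs" for i
  proof (rule typing_unique[OF assms(1)])
    show "(xs ! i, A i) \<in># fam xs A + \<Gamma>" using i by (auto simp: in_fam)
    show "(xs ! i, B i) \<in># fam xs A + \<Gamma>" unfolding assms(2) using i by (auto simp: in_fam)
  qed
  show "fam xs A = fam xs B" by (rule fam_cong) (rule *)
  then show "\<Gamma> = \<Delta>" using assms(2) by simp
qed

text \<open>Case analysis returns families of types that a priori differ from the given ones.
  Distinctness of the endpoints identifies them, and then also the remaining contexts.\<close>

lemma coherent_case_inv:
  assumes "GCase x ys G H \<Turnstile> add_mset (x, Oplus A B) (fam ys (\<lambda>i. With (C i) (D i)) + \<Gamma>)"
  shows "G \<Turnstile> add_mset (x, A) (fam ys C + \<Gamma>)" "H \<Turnstile> add_mset (x, B) (fam ys D + \<Gamma>)"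
proof -
  define \<Delta>0 where "\<Delta>0 = add_mset (x, Oplus A B) (fam ys (\<lambda>i. With (C i) (D i)) + \<Gamma>)"
  have nd: "nodup (names \<Delta>0)"
    unfolding \<Delta>0_def by (rule coherent_nodup[OF assms])
  obtain \<Delta> A' B' C' D' where e: "add_mset (x, Oplus A B) (fam ys (\<lambda>i. With (C i) (D i)) + \<Gamma>) =
      add_mset (x, Oplus A' B') (\<Delta> + fam ys (\<lambda>i. With (C' i) (D' i)))"
    "G \<Turnstile> add_mset (x, A') (\<Delta> + fam ys C')" "H \<Turnstile> add_mset (x, B') (\<Delta> + fam ys D')"
    using assms by (rule coherent_caseE) (rule that; assumption)
  have "(x, Oplus A' B') \<in># \<Delta>0" unfolding \<Delta>0_def e(1) by simp
  then have AB: "A = A' \<and> B = B'"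
    using typing_unique[OF nd, of x "Oplus A B" "Oplus A' B'"] by (simp add: \<Delta>0_def)
  then have e': "fam ys (\<lambda>i. With (C i) (D i)) + \<Gamma> = fam ys (\<lambda>i. With (C' i) (D' i)) + \<Delta>"
    using e(1) by (simp add: ac_simps)
  note u = fam_unique[OF _ e']
  have nd': "nodup (names (fam ys (\<lambda>i. With (C i) (D i)) + \<Gamma>))" using nd by (simp add: \<Delta>0_def)
  have "fam ys C = fam ys C'" "fam ys D = fam ys D'"
    using u(2)[OF nd'] by (auto intro!: fam_cong)
  then show "G \<Turnstile> add_mset (x, A) (fam ys C + \<Gamma>)" "H \<Turnstile> add_mset (x, B) (fam ys D + \<Gamma>)"
    using e(2,3) u(3)[OF nd'] AB by (simp_all add: ac_simps)
qed

lemma coherent_bang_inv: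
  assumes "GBang x ys G \<Turnstile> add_mset (x, Quest A) (fam ys (\<lambda>i. Bang (B i)))"
  shows "G \<Turnstile> add_mset (x, A) (fam ys B)"
proof -
  define \<Delta>0 where "\<Delta>0 = add_mset (x, Quest A) (fam ys (\<lambda>i. Bang (B i)))"
  have nd: "nodup (names \<Delta>0)"
    unfolding \<Delta>0_def by (rule coherent_nodup[OF assms])
  obtain A' B' where e: "add_mset (x, Quest A) (fam ys (\<lambda>i. Bang (B i))) = add_mset (x, Quest A') (fam ys (\<lambda>i. Bang (B' i)))"
    "G \<Turnstile> add_mset (x, A') (fam ys B')"
    using assms by (rule coherent_bangE) (rule that; assumption)
  have "(x, Quest A') \<in># \<Delta>0" unfolding \<Delta>0_def e(1) by simp
  then have A: "A = A'"
    using typing_unique[OF nd, of x "Quest A" "Quest A'"] by (simp add: \<Delta>0_def)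
  then have e': "fam ys (\<lambda>i. Bang (B i)) + {#} = fam ys (\<lambda>i. Bang (B' i)) + {#}"
    using e(1) by simp
  have "fam ys B = fam ys B'"
    using fam_unique(2)[OF _ e'] nd by (auto simp: \<Delta>0_def intro!: fam_cong)
  then show ?thesis using e(2) A by simp
qed

lemma coherent_comm_inv:
  assumes "GComm xs y G H \<Turnstile> add_mset (y, Parr C D) (fam xs (\<lambda>i. Tensor (A i) (B i)) + \<Gamma>)"
  shows "G \<Turnstile> add_mset (y, C) (fam xs A)" "H \<Turnstile> add_mset (y, D) (fam xs B + \<Gamma>)"
proof -
  define \<Delta>0 where "\<Delta>0 = add_mset (y, Parr C D) (fam xs (\<lambda>i. Tensor (A i) (B i)) + \<Gamma>)"
  have nd: "nodup (names \<Delta>0)"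
    unfolding \<Delta>0_def by (rule coherent_nodup[OF assms])
  obtain \<Delta> A' B' C' D' where e: "add_mset (y, Parr C D) (fam xs (\<lambda>i. Tensor (A i) (B i)) + \<Gamma>) =
      add_mset (y, Parr C' D') (\<Delta> + fam xs (\<lambda>i. Tensor (A' i) (B' i)))"
    "G \<Turnstile> add_mset (y, C') (fam xs A')" "H \<Turnstile> add_mset (y, D') (\<Delta> + fam xs B')"
    using assms by (rule coherent_commE) (rule that; assumption)
  have "(y, Parr C' D') \<in># \<Delta>0" unfolding \<Delta>0_def e(1) by simp
  then have CD: "C = C' \<and> D = D'"
    using typing_unique[OF nd, of y "Parr C D" "Parr C' D'"] by (simp add: \<Delta>0_def)
  then have e': "fam xs (\<lambda>i. Tensor (A i) (B i)) + \<Gamma> = fam xs (\<lambda>i. Tensor (A' i) (B' i)) + \<Delta>"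
    using e(1) by (simp add: ac_simps)
  note u = fam_unique[OF _ e']
  have nd': "nodup (names (fam xs (\<lambda>i. Tensor (A i) (B i)) + \<Gamma>))" using nd by (simp add: \<Delta>0_def)
  have "fam xs A = fam xs A'" "fam xs B = fam xs B'"
    using u(2)[OF nd'] by (auto intro!: fam_cong)
  then show "G \<Turnstile> add_mset (y, C) (fam xs A)" "H \<Turnstile> add_mset (y, D) (fam xs B + \<Gamma>)"
    using e(2,3) u(3)[OF nd'] CD by (simp_all add: ac_simps)
qed

lemma coherent_link_inv:
  assumes "GLink x A y \<Turnstile> \<Gamma>"
  shows "\<Gamma> = {#(x, A), (y, dual A)#}" "atomic A" "x \<noteq> y"
  using assms by (auto elim: coherent_linkE)

section \<open>Adding up stripped sessions; applying rules to given derivations\<close>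

lemma stripped_refl: "stripped \<Sigma> \<Psi> \<Sigma>"
  by (auto simp: stripped_def intro: exI[of _ "{#}"])

lemma stripped_mono: "stripped \<Sigma> \<Psi> \<Sigma>' \<Longrightarrow> set_mset (flat \<Psi>) \<subseteq> set_mset (flat \<Phi>) \<Longrightarrow> stripped \<Sigma> \<Phi> \<Sigma>'"
  by (auto simp: stripped_def intro: unary_mono)

lemma stripped_add: "stripped \<Sigma>1 \<Psi> \<Sigma>1' \<Longrightarrow> stripped \<Sigma>2 \<Psi> \<Sigma>2' \<Longrightarrow> stripped (\<Sigma>1 + \<Sigma>2) \<Psi> (\<Sigma>1' + \<Sigma>2')"
  unfolding stripped_def by (metis add.assoc add.left_commute unary_simps(3))

lemma stripped_sum: "\<forall>i<n. stripped (S i) \<Psi> (S' i) \<Longrightarrow> stripped (\<Sum>i<(n::nat). S i) \<Psi> (\<Sum>i<n. S' i)"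
  by (induction n) (auto simp: stripped_refl intro: stripped_add)

lemma stripped_subset: "stripped \<Sigma> \<Psi> \<Sigma>' \<Longrightarrow> \<Sigma>' \<subseteq># \<Sigma>"
  by (auto simp: stripped_def)

lemma stripped_wf: "stripped \<Sigma> \<Psi> \<Sigma>' \<Longrightarrow> wf \<Sigma> \<Psi> \<Longrightarrow> wf \<Sigma>' \<Psi>"
  using wf_subset stripped_subset by blast

lemma wf_cong: "wf \<Sigma> \<Psi> \<Longrightarrow> edom \<Sigma>' = edom \<Sigma> \<Longrightarrow> hdom \<Psi>' = hdom \<Psi> \<Longrightarrow> wf \<Sigma>' \<Psi>'"
  by (simp add: wf_def)

lemma typed_un:
  "rule (un f) [(S, H)] \<Sigma> \<Psi> \<Longrightarrow> S \<tturnstile> P \<Colon> H \<Longrightarrow> wf \<Sigma> \<Psi> \<Longrightarrow> \<Sigma> \<tturnstile> f P \<Colon> \<Psi>"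
  using typed.intros[of "un f" "[(S, H)]" \<Sigma> \<Psi> "[P]"] by (simp add: un_def)

lemma typed_bin:
  "rule (bin f) [(S, H), (S', H')] \<Sigma> \<Psi> \<Longrightarrow> S \<tturnstile> P \<Colon> H \<Longrightarrow> S' \<tturnstile> Q \<Colon> H' \<Longrightarrow> wf \<Sigma> \<Psi> \<Longrightarrow> \<Sigma> \<tturnstile> f P Q \<Colon> \<Psi>"
  using typed.intros[of "bin f" "[(S, H), (S', H')]" \<Sigma> \<Psi> "[P, Q]"]
  by (simp add: bin_def less_Suc_eq all_conj_distrib) (metis One_nat_def nth_Cons_0 nth_Cons_Suc less_one fst_conv snd_conv)

lemma typed_list:
  assumes "rule (\<lambda>Ps. f (hd Ps) (tl Ps)) ((S, H) # map (\<lambda>i. (Si i, Hi i)) [0..<n]) \<Sigma> \<Psi>"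
    "S \<tturnstile> P \<Colon> H" "\<forall>i<n. Si i \<tturnstile> Qs ! i \<Colon> Hi i" "length Qs = n" "wf \<Sigma> \<Psi>"
  shows "\<Sigma> \<tturnstile> f P Qs \<Colon> \<Psi>"
proof -
  have "fst (((S, H) # map (\<lambda>i. (Si i, Hi i)) [0..<n]) ! i) \<tturnstile> (P # Qs) ! i \<Colon> snd (((S, H) # map (\<lambda>i. (Si i, Hi i)) [0..<n]) ! i)"
    if "i < Suc n" for i
    using assms(2,3) that by (cases i) auto
  then show ?thesis
    using typed.intros[OF assms(1,5), of "P # Qs"] assms(4) by simp
qed

lemma fam_Nil [simp]: "fam [] A = {#}" and seqs_Nil [simp]: "seqs [] \<Gamma> A = {#}"
  by (simp_all add: fam_def seqs_def)

lemma flat_part_seqs: "i < length ys \<Longrightarrow> \<Psi> = X + ((\<Sum>i<length ys. H i) + seqs ys \<Gamma> A) + Y \<Longrightarrow>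
    set_mset (flat (add_mset (add_mset (ys ! i, A i) (\<Gamma> i)) (H i))) \<subseteq> set_mset (flat \<Psi>)"
  by (auto simp: in_fam)

lemma flat_part_head: "\<Psi> = add_mset \<Gamma> H + X + Y \<Longrightarrow> set_mset (flat (add_mset \<Gamma> H)) \<subseteq> set_mset (flat \<Psi>)"
  by auto

section \<open>Extraction\<close>

text \<open>Inverting a \<open>Case\<close> gives both branches the same environment
  \<open>Si i\<close>. This is what \<open>COplusWith1\<close> asks for: \<open>Si i\<close> is part
  of the environment of the selected composition and is at the same time the environment of the
  discarded branch.\<close>

lemma extr_inl:
  assumes t: "\<Sigma> \<tturnstile> par Ks \<Colon> \<Psi>" and l: "length Qs = length ys" "length Rs = length ys"
    and Ks: "Ks = Inl x P # map (\<lambda>i. Case (ys ! i) (Qs ! i) (Rs ! i)) [0..<length ys] @ Ss"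
    and j: "joined \<Sigma> (GCase x ys G H) (x # ys @ us) Ks"
  shows "\<Sigma> \<tturnstile> CInl x ys (par (P # Qs @ Ss)) Rs \<Colon> \<Psi>"
proof -
  obtain S0 H0 \<Gamma>0 T0 S Hi \<Gamma> T S' H' \<Gamma>' T' where c:
    "S0 \<tturnstile> Inl x P \<Colon> add_mset (add_mset (x, T0) \<Gamma>0) H0"
    "\<forall>i<length ys. S i \<tturnstile> map (\<lambda>i. Case (ys ! i) (Qs ! i) (Rs ! i)) [0..<length ys] ! i \<Colon> add_mset (add_mset (ys ! i, T i) (\<Gamma> i)) (Hi i)"
    "\<forall>i<length us. S' i \<tturnstile> Ss ! i \<Colon> add_mset (add_mset (us ! i, T' i) (\<Gamma>' i)) (H' i)" "length Ss = length us"
    "GCase x ys G H \<Turnstile> add_mset (x, T0) (fam ys T + fam us T')"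
    and S: "\<Sigma> = S0 + (\<Sum>i<length ys. S i) + (\<Sum>i<length us. S' i) + {#({#x#} + mset ys + mset us, GCase x ys G H)#}"
    and H: "\<Psi> = add_mset (add_mset (x, T0) \<Gamma>0) H0 + ((\<Sum>i<length ys. Hi i) + seqs ys \<Gamma> T) + ((\<Sum>i<length us. H' i) + seqs us \<Gamma>' T')"
    by (rule joined_cons[OF t[unfolded Ks] j[unfolded Ks]]) simp
  obtain S0' A B where x: "stripped S0 (add_mset (add_mset (x, T0) \<Gamma>0) H0) S0'" "T0 = Oplus A B"
    "S0' \<tturnstile> P \<Colon> add_mset (add_mset (x, A) \<Gamma>0) H0"
    using inv_Inl[OF c(1)] by blast
  have "\<forall>i<length ys. \<exists>S' A B. stripped (S i) (add_mset (add_mset (ys ! i, T i) (\<Gamma> i)) (Hi i)) S' \<and> T i = With A B \<and>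
      S' \<tturnstile> Qs ! i \<Colon> add_mset (add_mset (ys ! i, A) (\<Gamma> i)) (Hi i) \<and> S' \<tturnstile> Rs ! i \<Colon> add_mset (add_mset (ys ! i, B) (\<Gamma> i)) (Hi i)"
    using c(2) inv_Case by simp
  then obtain Si C D where y: "\<forall>i<length ys. stripped (S i) (add_mset (add_mset (ys ! i, T i) (\<Gamma> i)) (Hi i)) (Si i) \<and> T i = With (C i) (D i) \<and>
      Si i \<tturnstile> Qs ! i \<Colon> add_mset (add_mset (ys ! i, C i) (\<Gamma> i)) (Hi i) \<and> Si i \<tturnstile> Rs ! i \<Colon> add_mset (add_mset (ys ! i, D i) (\<Gamma> i)) (Hi i)"
    unfolding choice_iff' by blast
  have T: "fam ys T = fam ys (\<lambda>i. With (C i) (D i))" "seqs ys \<Gamma> T = seqs ys \<Gamma> (\<lambda>i. With (C i) (D i))"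
    using y by (auto intro: fam_cong seqs_cong)
  note coh = coherent_case_inv[OF c(5)[unfolded T x(2)]]
  let ?S = "S0' + (\<Sum>i<length ys. Si i) + (\<Sum>i<length us. S' i) + {#({#x#} + mset ys + mset us, GCase x ys G H)#}"
  have st: "stripped \<Sigma> \<Psi> ?S"
    unfolding S
    by (intro stripped_add stripped_sum stripped_refl allI impI)
      (use x(1) y flat_part_seqs[OF _ H] flat_part_head[OF H] in \<open>blast intro: stripped_mono\<close>)+
  have wf: "wf ?S \<Psi>" by (rule stripped_wf[OF st typed_wf[OF t]])
  have p: "S0' + (\<Sum>i<length ys. Si i) + (\<Sum>i<length us. S' i) + {#({#x#} + mset ys + mset us, G)#} \<tturnstile> par (P # Qs @ Ss) \<Colon>
     add_mset (add_mset (x, A) \<Gamma>0) H0 + ((\<Sum>i<length ys. Hi i) + seqs ys \<Gamma> C) + ((\<Sum>i<length us. H' i) + seqs us \<Gamma>' T')"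
    by (rule conn_cons[OF x(3) _ l(1) c(3,4) coh(1)])
      (use y in \<open>auto intro!: wf_cong[OF wf] simp: H T\<close>)
  \<comment> \<open>The discarded half of the global type appears in no premise, so the rule wants
    its coherence separately; it is contained in the coherence of the whole case.\<close>
  have "H \<Turnstile> {#(x, B)#} + fam ys D + fam us T'"
    using coh(2) by simp
  note r = rule.COplusWith1[OF this, of "S0' + (\<Sum>i<length us. S' i)" Si G "H0 + (\<Sum>i<length us. H' i)" Hi \<Gamma>0 A \<Gamma> C \<Gamma>']
  have "?S \<tturnstile> CInl x ys (par (P # Qs @ Ss)) Rs \<Colon> \<Psi>"
    by (rule typed_list[where f = "CInl x ys", OF rule_eqI[OF r refl]])
      (use p y l wf in \<open>simp_all add: H T x(2) ac_simps\<close>)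
  then show ?thesis using st typed_wf[OF t] by (rule typed_stripped)
qed

lemma extr_inr:
  assumes t: "\<Sigma> \<tturnstile> par Ks \<Colon> \<Psi>" and l: "length Qs = length ys" "length Rs = length ys"
    and Ks: "Ks = Inr x P # map (\<lambda>i. Case (ys ! i) (Qs ! i) (Rs ! i)) [0..<length ys] @ Ss"
    and j: "joined \<Sigma> (GCase x ys G H) (x # ys @ us) Ks"
  shows "\<Sigma> \<tturnstile> CInr x ys Qs (par (P # Rs @ Ss)) \<Colon> \<Psi>"
proof -
  obtain S0 H0 \<Gamma>0 T0 S Hi \<Gamma> T S' H' \<Gamma>' T' where c:
    "S0 \<tturnstile> Inr x P \<Colon> add_mset (add_mset (x, T0) \<Gamma>0) H0"
    "\<forall>i<length ys. S i \<tturnstile> map (\<lambda>i. Case (ys ! i) (Qs ! i) (Rs ! i)) [0..<length ys] ! i \<Colon> add_mset (add_mset (ys ! i, T i) (\<Gamma> i)) (Hi i)"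
    "\<forall>i<length us. S' i \<tturnstile> Ss ! i \<Colon> add_mset (add_mset (us ! i, T' i) (\<Gamma>' i)) (H' i)" "length Ss = length us"
    "GCase x ys G H \<Turnstile> add_mset (x, T0) (fam ys T + fam us T')"
    and S: "\<Sigma> = S0 + (\<Sum>i<length ys. S i) + (\<Sum>i<length us. S' i) + {#({#x#} + mset ys + mset us, GCase x ys G H)#}"
    and H: "\<Psi> = add_mset (add_mset (x, T0) \<Gamma>0) H0 + ((\<Sum>i<length ys. Hi i) + seqs ys \<Gamma> T) + ((\<Sum>i<length us. H' i) + seqs us \<Gamma>' T')"
    by (rule joined_cons[OF t[unfolded Ks] j[unfolded Ks]]) simp
  obtain S0' A B where x: "stripped S0 (add_mset (add_mset (x, T0) \<Gamma>0) H0) S0'" "T0 = Oplus A B"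
    "S0' \<tturnstile> P \<Colon> add_mset (add_mset (x, B) \<Gamma>0) H0"
    using inv_Inr[OF c(1)] by blast
  have "\<forall>i<length ys. \<exists>S' A B. stripped (S i) (add_mset (add_mset (ys ! i, T i) (\<Gamma> i)) (Hi i)) S' \<and> T i = With A B \<and>
      S' \<tturnstile> Qs ! i \<Colon> add_mset (add_mset (ys ! i, A) (\<Gamma> i)) (Hi i) \<and> S' \<tturnstile> Rs ! i \<Colon> add_mset (add_mset (ys ! i, B) (\<Gamma> i)) (Hi i)"
    using c(2) inv_Case by simp
  then obtain Si C D where y: "\<forall>i<length ys. stripped (S i) (add_mset (add_mset (ys ! i, T i) (\<Gamma> i)) (Hi i)) (Si i) \<and> T i = With (C i) (D i) \<and>
      Si i \<tturnstile> Qs ! i \<Colon> add_mset (add_mset (ys ! i, C i) (\<Gamma> i)) (Hi i) \<and> Si i \<tturnstile> Rs ! i \<Colon> add_mset (add_mset (ys ! i, D i) (\<Gamma> i)) (Hi i)"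
    unfolding choice_iff' by blast
  have T: "fam ys T = fam ys (\<lambda>i. With (C i) (D i))" "seqs ys \<Gamma> T = seqs ys \<Gamma> (\<lambda>i. With (C i) (D i))"
    using y by (auto intro: fam_cong seqs_cong)
  note coh = coherent_case_inv[OF c(5)[unfolded T x(2)]]
  let ?S = "S0' + (\<Sum>i<length ys. Si i) + (\<Sum>i<length us. S' i) + {#({#x#} + mset ys + mset us, GCase x ys G H)#}"
  have st: "stripped \<Sigma> \<Psi> ?S"
    unfolding S
    by (intro stripped_add stripped_sum stripped_refl allI impI)
      (use x(1) y flat_part_seqs[OF _ H] flat_part_head[OF H] in \<open>blast intro: stripped_mono\<close>)+
  have wf: "wf ?S \<Psi>" by (rule stripped_wf[OF st typed_wf[OF t]])
  have p: "S0' + (\<Sum>i<length ys. Si i) + (\<Sum>i<length us. S' i) + {#({#x#} + mset ys + mset us, H)#} \<tturnstile> par (P # Rs @ Ss) \<Colon>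
     add_mset (add_mset (x, B) \<Gamma>0) H0 + ((\<Sum>i<length ys. Hi i) + seqs ys \<Gamma> D) + ((\<Sum>i<length us. H' i) + seqs us \<Gamma>' T')"
    by (rule conn_cons[OF x(3) _ l(2) c(3,4) coh(2)])
      (use y in \<open>auto intro!: wf_cong[OF wf] simp: H T\<close>)
  have "G \<Turnstile> {#(x, A)#} + fam ys C + fam us T'"
    using coh(1) by simp
  note r = rule.COplusWith2[OF this, of "S0' + (\<Sum>i<length us. S' i)" Si H "H0 + (\<Sum>i<length us. H' i)" Hi \<Gamma>0 B \<Gamma> D \<Gamma>']
  have "?S \<tturnstile> CInr x ys Qs (par (P # Rs @ Ss)) \<Colon> \<Psi>"
    by (rule typed_list[where f = "\<lambda>P Qs. CInr x ys Qs P", OF rule_eqI[OF r refl]])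
      (use p y l wf in \<open>simp_all add: H T x(2) ac_simps\<close>)
  then show ?thesis using st typed_wf[OF t] by (rule typed_stripped)
qed

lemma extr_sel:
  assumes t: "\<Sigma> \<tturnstile> par Ks \<Colon> \<Psi>" and l: "length Qs = length ys" "length Rs = length ys"
    and Ks: "Ks = Sel x P P' # map (\<lambda>i. Case (ys ! i) (Qs ! i) (Rs ! i)) [0..<length ys] @ Ss"
    and j: "joined \<Sigma> (GCase x ys G H) (x # ys @ us) Ks"
  shows "\<Sigma> \<tturnstile> CSel x ys (par (P # Qs @ Ss)) (par (P' # Rs @ Ss)) \<Colon> \<Psi>"
proof -
  obtain S0 H0 \<Gamma>0 T0 S Hi \<Gamma> T S' H' \<Gamma>' T' where c:
    "S0 \<tturnstile> Sel x P P' \<Colon> add_mset (add_mset (x, T0) \<Gamma>0) H0"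
    "\<forall>i<length ys. S i \<tturnstile> map (\<lambda>i. Case (ys ! i) (Qs ! i) (Rs ! i)) [0..<length ys] ! i \<Colon> add_mset (add_mset (ys ! i, T i) (\<Gamma> i)) (Hi i)"
    "\<forall>i<length us. S' i \<tturnstile> Ss ! i \<Colon> add_mset (add_mset (us ! i, T' i) (\<Gamma>' i)) (H' i)" "length Ss = length us"
    "GCase x ys G H \<Turnstile> add_mset (x, T0) (fam ys T + fam us T')"
    and S: "\<Sigma> = S0 + (\<Sum>i<length ys. S i) + (\<Sum>i<length us. S' i) + {#({#x#} + mset ys + mset us, GCase x ys G H)#}"
    and H: "\<Psi> = add_mset (add_mset (x, T0) \<Gamma>0) H0 + ((\<Sum>i<length ys. Hi i) + seqs ys \<Gamma> T) + ((\<Sum>i<length us. H' i) + seqs us \<Gamma>' T')"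
    by (rule joined_cons[OF t[unfolded Ks] j[unfolded Ks]]) simp
  obtain S0' A B where x: "stripped S0 (add_mset (add_mset (x, T0) \<Gamma>0) H0) S0'" "T0 = Oplus A B"
    "S0' \<tturnstile> P \<Colon> add_mset (add_mset (x, A) \<Gamma>0) H0" "S0' \<tturnstile> P' \<Colon> add_mset (add_mset (x, B) \<Gamma>0) H0"
    using inv_Sel[OF c(1)] by blast
  have "\<forall>i<length ys. \<exists>S' A B. stripped (S i) (add_mset (add_mset (ys ! i, T i) (\<Gamma> i)) (Hi i)) S' \<and> T i = With A B \<and>
      S' \<tturnstile> Qs ! i \<Colon> add_mset (add_mset (ys ! i, A) (\<Gamma> i)) (Hi i) \<and> S' \<tturnstile> Rs ! i \<Colon> add_mset (add_mset (ys ! i, B) (\<Gamma> i)) (Hi i)"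
    using c(2) inv_Case by simp
  then obtain Si C D where y: "\<forall>i<length ys. stripped (S i) (add_mset (add_mset (ys ! i, T i) (\<Gamma> i)) (Hi i)) (Si i) \<and> T i = With (C i) (D i) \<and>
      Si i \<tturnstile> Qs ! i \<Colon> add_mset (add_mset (ys ! i, C i) (\<Gamma> i)) (Hi i) \<and> Si i \<tturnstile> Rs ! i \<Colon> add_mset (add_mset (ys ! i, D i) (\<Gamma> i)) (Hi i)"
    unfolding choice_iff' by blast
  have T: "fam ys T = fam ys (\<lambda>i. With (C i) (D i))" "seqs ys \<Gamma> T = seqs ys \<Gamma> (\<lambda>i. With (C i) (D i))"
    using y by (auto intro: fam_cong seqs_cong)
  note coh = coherent_case_inv[OF c(5)[unfolded T x(2)]]
  let ?S = "S0' + (\<Sum>i<length ys. Si i) + (\<Sum>i<length us. S' i) + {#({#x#} + mset ys + mset us, GCase x ys G H)#}"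
  have st: "stripped \<Sigma> \<Psi> ?S"
    unfolding S
    by (intro stripped_add stripped_sum stripped_refl allI impI)
      (use x(1) y flat_part_seqs[OF _ H] flat_part_head[OF H] in \<open>blast intro: stripped_mono\<close>)+
  have wf: "wf ?S \<Psi>" by (rule stripped_wf[OF st typed_wf[OF t]])
  have p: "S0' + (\<Sum>i<length ys. Si i) + (\<Sum>i<length us. S' i) + {#({#x#} + mset ys + mset us, G)#} \<tturnstile> par (P # Qs @ Ss) \<Colon>
     add_mset (add_mset (x, A) \<Gamma>0) H0 + ((\<Sum>i<length ys. Hi i) + seqs ys \<Gamma> C) + ((\<Sum>i<length us. H' i) + seqs us \<Gamma>' T')"
    by (rule conn_cons[OF x(3) _ l(1) c(3,4) coh(1)])
      (use y in \<open>auto intro!: wf_cong[OF wf] simp: H T\<close>)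
  have q: "S0' + (\<Sum>i<length ys. Si i) + (\<Sum>i<length us. S' i) + {#({#x#} + mset ys + mset us, H)#} \<tturnstile> par (P' # Rs @ Ss) \<Colon>
     add_mset (add_mset (x, B) \<Gamma>0) H0 + ((\<Sum>i<length ys. Hi i) + seqs ys \<Gamma> D) + ((\<Sum>i<length us. H' i) + seqs us \<Gamma>' T')"
    by (rule conn_cons[OF x(4) _ l(2) c(3,4) coh(2)])
      (use y in \<open>auto intro!: wf_cong[OF wf] simp: H T\<close>)
  note r = rule.COplusWith[of x ys "S0' + (\<Sum>i<length ys. Si i) + (\<Sum>i<length us. S' i)" us G
    "H0 + (\<Sum>i<length ys. Hi i) + ((\<Sum>i<length us. H' i) + seqs us \<Gamma>' T')" \<Gamma>0 A \<Gamma> C H B D]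
  have "?S \<tturnstile> CSel x ys (par (P # Qs @ Ss)) (par (P' # Rs @ Ss)) \<Colon> \<Psi>"
    by (rule typed_bin[OF rule_eqI[OF r refl]])
      (use p q wf in \<open>simp_all add: H T x(2) ac_simps\<close>)
  then show ?thesis using st typed_wf[OF t] by (rule typed_stripped)
qed


text \<open>The sessions of one component mention only endpoints declared by that component. This
  yields the side conditions of the server rules.\<close>

lemma evars_disjoint:
  assumes "S \<tturnstile> P \<Colon> H" "wf \<Sigma> (H' + \<Phi>)" "set_mset (hdom H) \<subseteq> set_mset (hdom H')" "X \<subseteq> set_mset (hdom \<Phi>)"
  shows "X \<inter> evars S = {}"
proof -
  have "evars S \<subseteq> set_mset (hdom H)"
    using typed_evars[OF assms(1)] typed_edom[OF assms(1)] typed_fv[OF assms(1)] by simp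
  then show ?thesis using assms(2-4) unfolding wf_def hdom_simps nodup_union by blast
qed

lemma extr_starts:
  assumes t: "\<Sigma> \<tturnstile> par Ks \<Colon> \<Psi>" and l: "length Qs = length ys"
    and Ks: "Ks = Use x P # map2 Srv ys Qs"
    and j: "joined \<Sigma> (GBang x ys G) (x # ys) Ks"
  shows "\<Sigma> \<tturnstile> Starts x ys (par (P # Qs)) \<Colon> \<Psi>"
proof -
  obtain S0 H0 \<Gamma>0 T0 S Hi \<Gamma> T where c:
    "S0 \<tturnstile> Use x P \<Colon> add_mset (add_mset (x, T0) \<Gamma>0) H0"
    "\<forall>i<length ys. S i \<tturnstile> map2 Srv ys Qs ! i \<Colon> add_mset (add_mset (ys ! i, T i) (\<Gamma> i)) (Hi i)"
    "GBang x ys G \<Turnstile> add_mset (x, T0) (fam ys T)"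
    and S: "\<Sigma> = S0 + (\<Sum>i<length ys. S i) + {#({#x#} + mset ys, GBang x ys G)#}"
    and H: "\<Psi> = add_mset (add_mset (x, T0) \<Gamma>0) H0 + ((\<Sum>i<length ys. Hi i) + seqs ys \<Gamma> T) + {#}"
    using l by (rule_tac joined_cons[of \<Sigma> "Use x P" "map2 Srv ys Qs" "[]" \<Psi> "GBang x ys G" x ys "[]"])
      (use t j Ks in simp_all)
  obtain S0' A where x: "stripped S0 (add_mset (add_mset (x, T0) \<Gamma>0) H0) S0'" "T0 = Quest A"
    "S0' \<tturnstile> P \<Colon> add_mset (add_mset (x, A) \<Gamma>0) H0"
    using inv_Use[OF c(1)] by blast
  have "\<forall>i<length ys. \<exists>A. stripped (S i) (add_mset (add_mset (ys ! i, T i) (\<Gamma> i)) (Hi i)) {#} \<and> T i = Bang A \<and>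
      Hi i = {#} \<and> quest_ctx (\<Gamma> i) \<and> {#} \<tturnstile> Qs ! i \<Colon> {#add_mset (ys ! i, A) (\<Gamma> i)#}"
    using c(2) l by simp (blast dest: inv_Srv)
  then obtain B where y: "\<forall>i<length ys. stripped (S i) (add_mset (add_mset (ys ! i, T i) (\<Gamma> i)) (Hi i)) {#} \<and> T i = Bang (B i) \<and>
      Hi i = {#} \<and> quest_ctx (\<Gamma> i) \<and> {#} \<tturnstile> Qs ! i \<Colon> {#add_mset (ys ! i, B i) (\<Gamma> i)#}"
    unfolding choice_iff' by blast
  have T: "fam ys T = fam ys (\<lambda>i. Bang (B i))" "seqs ys \<Gamma> T = seqs ys \<Gamma> (\<lambda>i. Bang (B i))" "(\<Sum>i<length ys. Hi i) = {#}"
    using y by (auto intro: fam_cong seqs_cong)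
  note coh = coherent_bang_inv[OF c(3)[unfolded T x(2)]]
  \<comment> \<open>A server has no sessions once the invisible ones are stripped. The sum of empty
    environments is kept to fit \<open>stripped_sum\<close>.\<close>
  let ?S = "S0' + (\<Sum>i<length ys. {#}) + {#({#x#} + mset ys, GBang x ys G)#}"
  have st: "stripped \<Sigma> \<Psi> ?S"
    unfolding S
    by (intro stripped_add stripped_sum stripped_refl allI impI)
      (use x(1) y flat_part_seqs[OF _ H] flat_part_head[OF H] in \<open>blast intro: stripped_mono\<close>)+
  have wf: "wf ?S \<Psi>" by (rule stripped_wf[OF st typed_wf[OF t]])
  have p: "S0' + {#({#x#} + mset ys, G)#} \<tturnstile> par (P # Qs @ []) \<Colon>
     add_mset (add_mset (x, A) \<Gamma>0) H0 + seqs ys \<Gamma> B"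
    by (rule conn_cons[where us = "[]", OF x(3) _ l, of "\<lambda>_. {#}" B \<Gamma> "\<lambda>_. {#}"])
      (use y coh in \<open>auto intro!: wf_cong[OF wf] simp: H T\<close>)
  have "\<forall>i<length ys. quest_ctx (\<Gamma> i) \<and> set_mset (names (\<Gamma> i)) \<inter> evars S0' = {}"
  proof (intro allI impI conjI)
    fix i assume i: "i < length ys"
    show "quest_ctx (\<Gamma> i)" using y i by blast
    show "set_mset (names (\<Gamma> i)) \<inter> evars S0' = {}"
      by (rule evars_disjoint[OF x(3) wf[unfolded H add_0_right]]) (use i in auto)
  qed
  note r = rule.CBangQuest[OF this, of x G H0 \<Gamma>0 A B]
  have "?S \<tturnstile> Starts x ys (par (P # Qs)) \<Colon> \<Psi>"
    by (rule typed_un[OF rule_eqI[OF r refl]])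
      (use p wf in \<open>simp_all add: H T x(2) ac_simps\<close>)
  then show ?thesis using st typed_wf[OF t] by (rule typed_stripped)
qed

lemma extr_kills:
  assumes t: "\<Sigma> \<tturnstile> par Ks \<Colon> \<Psi>" and l: "length Qs = length ys"
    and Ks: "Ks = Kill x P # map2 Srv ys Qs"
    and j: "joined \<Sigma> (GBang x ys G) (x # ys) Ks"
  shows "\<Sigma> \<tturnstile> Kills x ys Qs P \<Colon> \<Psi>"
proof -
  obtain S0 H0 \<Gamma>0 T0 S Hi \<Gamma> T where c:
    "S0 \<tturnstile> Kill x P \<Colon> add_mset (add_mset (x, T0) \<Gamma>0) H0"
    "\<forall>i<length ys. S i \<tturnstile> map2 Srv ys Qs ! i \<Colon> add_mset (add_mset (ys ! i, T i) (\<Gamma> i)) (Hi i)"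
    "GBang x ys G \<Turnstile> add_mset (x, T0) (fam ys T)"
    and S: "\<Sigma> = S0 + (\<Sum>i<length ys. S i) + {#({#x#} + mset ys, GBang x ys G)#}"
    and H: "\<Psi> = add_mset (add_mset (x, T0) \<Gamma>0) H0 + ((\<Sum>i<length ys. Hi i) + seqs ys \<Gamma> T) + {#}"
    using l by (rule_tac joined_cons[of \<Sigma> "Kill x P" "map2 Srv ys Qs" "[]" \<Psi> "GBang x ys G" x ys "[]"])
      (use t j Ks in simp_all)
  obtain S0' A where x: "stripped S0 (add_mset (add_mset (x, T0) \<Gamma>0) H0) S0'" "T0 = Quest A"
    "S0' \<tturnstile> P \<Colon> add_mset \<Gamma>0 H0"
    using inv_Kill[OF c(1)] by blast
  have "\<forall>i<length ys. \<exists>A. stripped (S i) (add_mset (add_mset (ys ! i, T i) (\<Gamma> i)) (Hi i)) {#} \<and> T i = Bang A \<and>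
      Hi i = {#} \<and> quest_ctx (\<Gamma> i) \<and> {#} \<tturnstile> Qs ! i \<Colon> {#add_mset (ys ! i, A) (\<Gamma> i)#}"
    using c(2) l by simp (blast dest: inv_Srv)
  then obtain B where y: "\<forall>i<length ys. stripped (S i) (add_mset (add_mset (ys ! i, T i) (\<Gamma> i)) (Hi i)) {#} \<and> T i = Bang (B i) \<and>
      Hi i = {#} \<and> quest_ctx (\<Gamma> i) \<and> {#} \<tturnstile> Qs ! i \<Colon> {#add_mset (ys ! i, B i) (\<Gamma> i)#}"
    unfolding choice_iff' by blast
  have T: "fam ys T = fam ys (\<lambda>i. Bang (B i))" "seqs ys \<Gamma> T = seqs ys \<Gamma> (\<lambda>i. Bang (B i))" "(\<Sum>i<length ys. Hi i) = {#}"
    using y by (auto intro: fam_cong seqs_cong)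
  note coh = coherent_bang_inv[OF c(3)[unfolded T x(2)]]
  let ?S = "S0' + (\<Sum>i<length ys. {#}) + {#({#x#} + mset ys, GBang x ys G)#}"
  have st: "stripped \<Sigma> \<Psi> ?S"
    unfolding S
    by (intro stripped_add stripped_sum stripped_refl allI impI)
      (use x(1) y flat_part_seqs[OF _ H] flat_part_head[OF H] in \<open>blast intro: stripped_mono\<close>)+
  have wf: "wf ?S \<Psi>" by (rule stripped_wf[OF st typed_wf[OF t]])
  have q: "\<forall>i<length ys. quest_ctx (\<Gamma> i)" using y by blast
  have "G \<Turnstile> {#(x, A)#} + fam ys B" using coh by simp
  note r = rule.CBangWeaken[OF this q, of S0' H0 \<Gamma>0]
  have "?S \<tturnstile> Kills x ys Qs P \<Colon> \<Psi>"
    by (rule typed_list[where f = "\<lambda>P Qs. Kills x ys Qs P", OF rule_eqI[OF r refl]])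
      (use x(3) y l wf in \<open>simp_all add: H T x(2) ac_simps\<close>)
  then show ?thesis using st typed_wf[OF t] by (rule typed_stripped)
qed

lemma extr_close:
  assumes t: "\<Sigma> \<tturnstile> par (map Close xs @ [Wait y P]) \<Colon> \<Psi>"
    and j: "joined \<Sigma> (GClose xs y) (xs @ [y]) (map Close xs @ [Wait y P])"
  shows "\<Sigma> \<tturnstile> Closes xs y P \<Colon> \<Psi>"
proof -
  obtain S Hi \<Gamma> T S0 H0 \<Gamma>0 T0 where c:
    "\<forall>i<length xs. S i \<tturnstile> map Close xs ! i \<Colon> add_mset (add_mset (xs ! i, T i) (\<Gamma> i)) (Hi i)"
    "S0 \<tturnstile> Wait y P \<Colon> add_mset (add_mset (y, T0) \<Gamma>0) H0"
    and S: "\<Sigma> = S0 + (\<Sum>i<length xs. S i) + {#(mset xs + {#y#}, GClose xs y)#}"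
    and H: "\<Psi> = add_mset (add_mset (y, T0) \<Gamma>0) H0 + ((\<Sum>i<length xs. Hi i) + seqs xs \<Gamma> T) + {#}"
    by (rule_tac joined_snoc[of \<Sigma> "map Close xs" "Wait y P" "[]" \<Psi> "GClose xs y" xs y "[]"])
      (use t j in simp_all)
  obtain S0' where x: "stripped S0 (add_mset (add_mset (y, T0) \<Gamma>0) H0) S0'" "T0 = TBot"
    "S0' \<tturnstile> P \<Colon> add_mset \<Gamma>0 H0"
    using inv_Wait[OF c(2)] by blast
  have y: "\<forall>i<length xs. stripped (S i) (add_mset (add_mset (xs ! i, T i) (\<Gamma> i)) (Hi i)) {#} \<and> T i = TOne \<and>
      \<Gamma> i = {#} \<and> Hi i = {#}"
    using c(1) by simp (blast dest: inv_Close)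
  have T: "seqs xs \<Gamma> T = seqs xs (\<lambda>i. {#}) (\<lambda>i. TOne)" "(\<Sum>i<length xs. Hi i) = {#}"
    using y by (auto intro: seqs_cong)
  let ?S = "S0' + (\<Sum>i<length xs. {#}) + {#(mset xs + {#y#}, GClose xs y)#}"
  have st: "stripped \<Sigma> \<Psi> ?S"
    unfolding S
    by (intro stripped_add stripped_sum stripped_refl allI impI)
      (use x(1) y flat_part_seqs[OF _ H] flat_part_head[OF H] in \<open>blast intro: stripped_mono\<close>)+
  have wf: "wf ?S \<Psi>" by (rule stripped_wf[OF st typed_wf[OF t]])
  have "?S \<tturnstile> Closes xs y P \<Colon> \<Psi>"
    by (rule typed_un[OF rule_eqI[OF rule.COneBot[of xs y S0' H0 \<Gamma>0] refl]])
      (use x(3) wf in \<open>simp_all add: H T x(2) ac_simps\<close>)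
  then show ?thesis using st typed_wf[OF t] by (rule typed_stripped)
qed

lemma exch_single_twice: "map_trm (exch [a] [b]) (map_trm (exch [a] [b]) P) = P"
proof -
  have "exch [a] [b] \<circ> exch [a] [b] = id" by (auto simp: fun_eq_iff)
  then show ?thesis by (simp add: trm.map_comp trm.map_id)
qed

text \<open>Neither endpoint belongs to a session, so the exchange fixes the environment and moves
  only the focused endpoint.\<close>

lemma typed_exch:
  assumes "S \<tturnstile> P \<Colon> add_mset (add_mset (w, A) \<Gamma>) \<Psi>" "w \<notin># edom S" "x \<noteq> w" "x \<notin># names \<Gamma>" "x \<notin># hdom \<Psi>"
  shows "S \<tturnstile> map_trm (exch [w] [x]) P \<Colon> add_mset (add_mset (x, A) \<Gamma>) \<Psi>"
proof -
  let ?f = "exch [w] [x]"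
  have w: "w \<notin># names \<Gamma>" "w \<notin># hdom \<Psi>"
    using typed_wf[OF assms(1)] by (auto simp: wf_def)
  have "x \<notin># edom S"
    using typed_edom[OF assms(1)] assms(3-5) by (auto simp: typed_fv[OF assms(1)])
  then have S: "rE ?f S = S"
    using assms(2) typed_evars[OF assms(1)] by (intro rE_ident) auto
  have H: "rH ?f (add_mset (add_mset (w, A) \<Gamma>) \<Psi>) = add_mset (add_mset (x, A) \<Gamma>) \<Psi>"
  proof -
    have "rC ?f \<Gamma> = \<Gamma>" "rH ?f \<Psi> = \<Psi>"
      by (rule rC_ident rH_ident; use w assms(4,5) in auto)+
    then show ?thesis by simp
  qed
  show ?thesis
    using typed_rename[OF assms(1) inj_exch_single, of w x] unfolding S H .
qed

lemma add_two: "add_mset a M = {#b, c#} \<Longrightarrow> a \<noteq> b \<Longrightarrow> a = c \<and> M = {#b#}"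
  by (auto simp: add_eq_conv_ex)

text \<open>Both orientations of the link are treated at once: of \<open>L\<close> only its possible
  typings are assumed. In terms of \<open>CAx\<close> the roles are swapped: the rule's
  \<open>w\<close> is \<open>x\<close> here, and its \<open>x\<close> is \<open>w\<close>.\<close>

lemma extr_link:
  assumes t: "\<Sigma> \<tturnstile> Par P L \<Colon> \<Psi>"
    and j: "joined \<Sigma> (GLink w A y) [w, y] [P, L]"
    and L: "\<And>S H. S \<tturnstile> L \<Colon> H \<Longrightarrow> stripped S H {#} \<and> H = {#{#(x, A), (y, dual A)#}#}"
  shows "\<Sigma> \<tturnstile> CLink x y (dual A) w P \<Colon> \<Psi>"
proof -
  obtain S0 H0 \<Gamma>0 T0 S Hi \<Gamma> T where c:
    "S0 \<tturnstile> P \<Colon> add_mset (add_mset (w, T0) \<Gamma>0) H0"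
    "S \<tturnstile> L \<Colon> add_mset (add_mset (y, T) \<Gamma>) Hi"
    "GLink w A y \<Turnstile> {#(w, T0), (y, T)#}"
    and S: "\<Sigma> = S0 + S + {#({#w, y#}, GLink w A y)#}"
    and H: "\<Psi> = add_mset (add_mset (w, T0) \<Gamma>0) H0 + (add_mset (add_mset (y, T) \<Gamma>) Hi)"
    by (rule_tac joined_cons[of \<Sigma> P "[L]" "[]" \<Psi> "GLink w A y" w "[y]" "[]"])
      (use t j in \<open>simp_all add: fam_Cons seqs_def add_mset_commute\<close>)
  have L': "stripped S (add_mset (add_mset (y, T) \<Gamma>) Hi) {#}" "Hi = {#}" "add_mset (y, T) \<Gamma> = {#(x, A), (y, dual A)#}"
    using L[OF c(2)] by auto
  note wf0 = typed_wf[OF t]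
  have "x \<noteq> y"
    using wf0 unfolding H L' wf_def by auto
  \<comment> \<open>Since \<open>x\<close> and \<open>y\<close> differ, the focus on
    \<open>y\<close> tells which of the two typings of the link is meant.\<close>
  then have \<Gamma>: "\<Gamma> = {#(x, A)#}" "T = dual A"
    using add_two[OF L'(3)] by auto
  have coh: "{#(w, T0), (y, T)#} = {#(w, A), (y, dual A)#}" "atomic A" "w \<noteq> y"
    using coherent_link_inv[OF c(3)] by auto
  then have T0: "T0 = A" using \<Gamma>(2) by simp
  have d: "x \<noteq> w" "x \<notin># names \<Gamma>0" "x \<notin># hdom H0" "w \<notin># edom S0"
    using wf0 unfolding H S \<Gamma> wf_def by auto
  let ?S = "S0 + {#} + {#({#w, y#}, GLink w A y)#}"
  have st: "stripped \<Sigma> \<Psi> ?S"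
    unfolding S by (intro stripped_add stripped_refl stripped_mono[OF L'(1)]) (auto simp: H)
  have wf: "wf ?S \<Psi>" by (rule stripped_wf[OF st wf0])
  have p: "S0 \<tturnstile> map_trm (exch [w] [x]) P \<Colon> add_mset (add_mset (x, A) \<Gamma>0) H0"
    by (rule typed_exch[OF c(1)[unfolded T0] d(4,1-3)])
  have "x \<notin># edom S0"
    using typed_edom[OF c(1)] d by (auto simp: typed_fv[OF c(1)])
  then have "x \<notin> evars S0"
    using typed_evars[OF c(1)] by simp
  note r = rule.CAx[OF this refl coh(2), of y w H0 \<Gamma>0]
  \<comment> \<open>The rule applies an exchange to the term of its premise; feeding it the
    exchanged \<open>P\<close> gives back \<open>P\<close>.\<close>
  have "?S \<tturnstile> CLink x y (dual A) w (map_trm (exch [w] [x]) (map_trm (exch [w] [x]) P)) \<Colon> \<Psi>"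
    by (rule typed_un[OF rule_eqI[OF r refl]])
      (use p wf in \<open>simp_all add: H L' \<Gamma> T0 ac_simps add_mset_commute\<close>)
  then show ?thesis using st wf0 unfolding exch_single_twice by (rule typed_stripped)
qed

text \<open>The continuation lives in two sessions. An inner Conn joins \<open>Qs\<close>,
  \<open>R\<close> and \<open>Ss\<close> by \<open>H\<close>; an outer one joins \<open>Ps\<close>
  to the result by the copy of \<open>G\<close> on the fresh endpoints, where the inner composition
  takes part through \<open>y'\<close>. \<open>par_append_par\<close> flattens the nested
  term.\<close>

lemma extr_comm:
  assumes t: "\<Sigma> \<tturnstile> par Ks \<Colon> \<Psi>"
    and l: "xs \<noteq> []" "length xs' = length xs" "length Ps = length xs" "length Qs = length xs"
    and Ks: "Ks = map (\<lambda>i. Send (xs ! i) (xs' ! i) (Ps ! i) (Qs ! i)) [0..<length xs] @ Recv y y' R # Ss"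
    and fresh: "distinct (xs' @ [y'])" "(set xs' \<union> {y'}) \<inter> fv (par Ks) = {}"
    and j: "joined \<Sigma> (GComm xs y G H) (xs @ y # us) Ks"
  shows "\<Sigma> \<tturnstile> Comm xs xs' y y' (par (Ps @ Qs @ R # Ss)) \<Colon> \<Psi>"
proof -
  let ?\<rho> = "exch (xs @ [y]) (xs' @ [y'])"
  obtain S Hi \<Gamma> T S0 H0 \<Gamma>0 T0 S' H' \<Gamma>' T' where c:
    "\<forall>i<length xs. S i \<tturnstile> map (\<lambda>i. Send (xs ! i) (xs' ! i) (Ps ! i) (Qs ! i)) [0..<length xs] ! i \<Colon> add_mset (add_mset (xs ! i, T i) (\<Gamma> i)) (Hi i)"
    "S0 \<tturnstile> Recv y y' R \<Colon> add_mset (add_mset (y, T0) \<Gamma>0) H0"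
    "\<forall>i<length us. S' i \<tturnstile> Ss ! i \<Colon> add_mset (add_mset (us ! i, T' i) (\<Gamma>' i)) (H' i)" "length Ss = length us"
    "GComm xs y G H \<Turnstile> add_mset (y, T0) (fam xs T + fam us T')"
    and S: "\<Sigma> = S0 + (\<Sum>i<length xs. S i) + (\<Sum>i<length us. S' i) + {#(mset xs + {#y#} + mset us, GComm xs y G H)#}"
    and H: "\<Psi> = add_mset (add_mset (y, T0) \<Gamma>0) H0 + ((\<Sum>i<length xs. Hi i) + seqs xs \<Gamma> T) + ((\<Sum>i<length us. H' i) + seqs us \<Gamma>' T')"
    by (rule joined_snoc[OF t[unfolded Ks] j[unfolded Ks]]) simp
  obtain S0' C D where y: "stripped S0 (add_mset (add_mset (y, T0) \<Gamma>0) H0) S0'" "T0 = Parr C D"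
    "S0' \<tturnstile> R \<Colon> add_mset (add_mset (y, D) (add_mset (y', C) \<Gamma>0)) H0"
    using inv_Recv[OF c(2)] by blast
  have "\<forall>i<length xs. \<exists>\<Sigma>1 \<Sigma>2 \<Gamma>1 \<Gamma>2 \<Psi>1 \<Psi>2 A B. stripped (S i) (add_mset (add_mset (xs ! i, T i) (\<Gamma> i)) (Hi i)) (\<Sigma>1 + \<Sigma>2) \<and>
      T i = Tensor A B \<and> \<Gamma> i = \<Gamma>1 + \<Gamma>2 \<and> Hi i = \<Psi>1 + \<Psi>2 \<and>
      \<Sigma>1 \<tturnstile> Ps ! i \<Colon> add_mset (add_mset (xs' ! i, A) \<Gamma>1) \<Psi>1 \<and> \<Sigma>2 \<tturnstile> Qs ! i \<Colon> add_mset (add_mset (xs ! i, B) \<Gamma>2) \<Psi>2"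
    using c(1) inv_Send by simp
  then obtain S1 S2 \<Gamma>1 \<Gamma>2 H1 H2 A B where x: "\<forall>i<length xs. stripped (S i) (add_mset (add_mset (xs ! i, T i) (\<Gamma> i)) (Hi i)) (S1 i + S2 i) \<and>
      T i = Tensor (A i) (B i) \<and> \<Gamma> i = \<Gamma>1 i + \<Gamma>2 i \<and> Hi i = H1 i + H2 i \<and>
      S1 i \<tturnstile> Ps ! i \<Colon> add_mset (add_mset (xs' ! i, A i) (\<Gamma>1 i)) (H1 i) \<and> S2 i \<tturnstile> Qs ! i \<Colon> add_mset (add_mset (xs ! i, B i) (\<Gamma>2 i)) (H2 i)"
    unfolding choice_iff' by blast
  have T: "fam xs T = fam xs (\<lambda>i. Tensor (A i) (B i))"
    "seqs xs \<Gamma> T = seqs xs (\<lambda>i. \<Gamma>1 i + \<Gamma>2 i) (\<lambda>i. Tensor (A i) (B i))"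
    "(\<Sum>i<length xs. Hi i) = (\<Sum>i<length xs. H1 i) + (\<Sum>i<length xs. H2 i)"
    using x by (auto intro!: fam_cong seqs_cong sum.cong simp flip: sum.distrib)
  note coh = coherent_comm_inv[OF c(5)[unfolded T y(2)]]
  let ?S = "S0' + (\<Sum>i<length xs. S1 i + S2 i) + (\<Sum>i<length us. S' i) + {#(mset xs + {#y#} + mset us, GComm xs y G H)#}"
  have st: "stripped \<Sigma> \<Psi> ?S"
    unfolding S
    by (intro stripped_add stripped_sum stripped_refl allI impI)
      (use x y(1) flat_part_seqs[OF _ H] flat_part_head[OF H] in \<open>blast intro: stripped_mono\<close>)+
  have wf: "wf ?S \<Psi>" by (rule stripped_wf[OF st typed_wf[OF t]])
  let ?F = "mset xs' + {#y'#}"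
  have fr: "set_mset ?F \<inter> set_mset (hdom \<Psi>) = {}"
    using fresh(2) typed_fv[OF t] by simp
  \<comment> \<open>Freshness is assumed for free endpoints only; it extends to the environment
    because session endpoints are declared, hence free.\<close>
  moreover have "set_mset (edom ?S) \<subseteq> set_mset (hdom \<Psi>)"
    using stripped_subset[OF st] typed_edom[OF t] typed_fv[OF t] by (auto elim!: subset_mset.less_eqE)
  ultimately have fre: "set_mset ?F \<inter> set_mset (edom ?S) = {}" by blast
  have ndF: "nodup ?F" using fresh(1) by simp
  let ?Sp = "S0' + (\<Sum>i<length xs. S2 i) + (\<Sum>i<length us. S' i) + {#(mset xs + {#y#} + mset us, H)#}"
  let ?H0 = "H0 + ((\<Sum>i<length xs. H2 i) + seqs xs \<Gamma>2 B) + ((\<Sum>i<length us. H' i) + seqs us \<Gamma>' T')"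
  let ?Hp = "add_mset (add_mset (y, D) (add_mset (y', C) \<Gamma>0)) ?H0"
  let ?Sq = "?Sp + (\<Sum>i<length xs. S1 i) + {#(?F, map_gtype ?\<rho> G)#}"
  let ?Hq = "?Hp + ((\<Sum>i<length xs. H1 i) + seqs xs' \<Gamma>1 A)"
  have eq: "edom ?Sq = edom ?S + ?F" "hdom ?Hq = hdom \<Psi> + ?F"
    unfolding H T y(2) by (simp_all add: sum.distrib l(2) ac_simps)
  have wfq: "wf ?Sq ?Hq"
    using wf fr fre ndF unfolding wf_def eq nodup_union by blast
  have wfp: "wf ?Sp ?Hp"
    using wfq unfolding wf_def edom_simps(3) hdom_simps(3) nodup_union by blast
  have p: "?Sp \<tturnstile> par (Qs @ R # Ss) \<Colon> ?Hp"
    by (rule conn_snoc[OF _ l(4) y(3) c(3,4) coh(2) wfp refl]) (use x in \<open>auto simp: ac_simps\<close>)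
  have dis: "distinct (xs @ [y])" "set (xs @ [y]) \<inter> set (xs' @ [y']) = {}"
    using wfq by (auto simp: wf_def)
  have cG: "map_gtype ?\<rho> G \<Turnstile> add_mset (y', C) (fam xs' A)"
  proof -
    have m: "map ?\<rho> (xs @ [y]) = xs' @ [y']" by (rule map_exch) (use dis l in auto)
    have "inj ?\<rho>" by (rule exch_inj) (use dis l fresh(1) in auto)
    from coherent_rename[OF coh(1) this] show ?thesis
      using m by simp
  qed
  have lq: "length Ps = length xs'" using l by simp
  have q: "?Sq \<tturnstile> par (Ps @ par (Qs @ R # Ss) # []) \<Colon> ?Hq"
    by (rule conn_snoc[where us = "[]", OF _ lq, where S = S1 and A = A and \<Gamma> = \<Gamma>1 and H = H1 and y = y' and ?A0.0 = C and ?\<Gamma>0.0 = "add_mset (y, D) \<Gamma>0" and ?H0.0 = ?H0 and ?S0.0 = ?Sp])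
      (use x p cG wfq l in \<open>simp_all add: ac_simps add_mset_commute\<close>)
  note r = rule.CTensorParr[OF l(2), of y y' "S0' + (\<Sum>i<length xs. S1 i + S2 i) + (\<Sum>i<length us. S' i)" us H G
    "H0 + (\<Sum>i<length xs. H1 i) + (\<Sum>i<length xs. H2 i) + ((\<Sum>i<length us. H' i) + seqs us \<Gamma>' T')" \<Gamma>1 A \<Gamma>2 B \<Gamma>0 C D]
  have "?S \<tturnstile> Comm xs xs' y y' (par (Ps @ Qs @ R # Ss)) \<Colon> \<Psi>"
    by (rule typed_un[OF rule_eqI[OF r refl]])
      (use q wf in \<open>simp_all add: H T y(2) ac_simps add_mset_commute sum.distrib par_append_par\<close>)
  then show ?thesis using st typed_wf[OF t] by (rule typed_stripped)
qed

lemma nodup_eqI: "nodup M \<Longrightarrow> nodup N \<Longrightarrow> set_mset M = set_mset N \<Longrightarrow> M = N"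
  by (rule multiset_eqI) (metis count_eq_zero_iff le_antisym less_one nodup_def not_less)

lemma typed_Srv:
  assumes "{#} \<tturnstile> P \<Colon> {#add_mset (y, A) \<Gamma>#}" "quest_ctx \<Gamma>"
  shows "{#} \<tturnstile> Srv y P \<Colon> {#add_mset (y, Bang A) \<Gamma>#}"
  using typed_un[OF rule.Bang[OF assms(2), of y A]] assms(1) wf_cong[OF typed_wf[OF assms(1)]]
  by simp

text \<open>Again two Conns: the old servers join \<open>P\<close> by the session of
  \<open>x\<close>, and their copies join the result by the session of \<open>x'\<close>. The copies
  are typed by renaming the derivations of the servers.\<close>

lemma extr_clones:
  assumes t: "\<Sigma> \<tturnstile> par Ks \<Colon> \<Psi>"
    and l: "length Qs = length ys" "length ys' = length ys" "length zs' = length zs"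
    and Ks: "Ks = Clone x x' P # map2 Srv ys Qs"
    and zs: "set zs = (\<Union>Q \<in> set Qs. fv Q) - set ys" "distinct zs"
    and fresh: "distinct (x' # ys' @ zs')" "({x'} \<union> set ys' \<union> set zs') \<inter> fv (par Ks) = {}"
    and j: "joined \<Sigma> (GBang x ys G) (x # ys) Ks"
  shows "\<Sigma> \<tturnstile> Clones x ys x' ys' zs zs'
         (par (par (P # map2 Srv ys Qs) # map2 Srv ys' (map (map_trm (exch (ys @ zs) (ys' @ zs'))) Qs))) \<Colon> \<Psi>"
proof -
  let ?\<rho> = "exch (ys @ zs) (ys' @ zs')" and ?f = "exch (x # ys) (x' # ys')"
  obtain S0 H0 \<Gamma>0 T0 S Hi \<Gamma> T where c:
    "S0 \<tturnstile> Clone x x' P \<Colon> add_mset (add_mset (x, T0) \<Gamma>0) H0"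
    "\<forall>i<length ys. S i \<tturnstile> map2 Srv ys Qs ! i \<Colon> add_mset (add_mset (ys ! i, T i) (\<Gamma> i)) (Hi i)"
    "GBang x ys G \<Turnstile> add_mset (x, T0) (fam ys T)"
    and S: "\<Sigma> = S0 + (\<Sum>i<length ys. S i) + {#({#x#} + mset ys, GBang x ys G)#}"
    and H: "\<Psi> = add_mset (add_mset (x, T0) \<Gamma>0) H0 + ((\<Sum>i<length ys. Hi i) + seqs ys \<Gamma> T) + {#}"
    using l by (rule_tac joined_cons[of \<Sigma> "Clone x x' P" "map2 Srv ys Qs" "[]" \<Psi> "GBang x ys G" x ys "[]"])
      (use t j Ks in simp_all)
  obtain S0' A where x: "stripped S0 (add_mset (add_mset (x, T0) \<Gamma>0) H0) S0'" "T0 = Quest A"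
    "S0' \<tturnstile> P \<Colon> add_mset (add_mset (x, Quest A) (add_mset (x', Quest A) \<Gamma>0)) H0"
    using inv_Clone[OF c(1)] by blast
  have "\<forall>i<length ys. \<exists>A. stripped (S i) (add_mset (add_mset (ys ! i, T i) (\<Gamma> i)) (Hi i)) {#} \<and> T i = Bang A \<and>
      Hi i = {#} \<and> quest_ctx (\<Gamma> i) \<and> {#} \<tturnstile> Qs ! i \<Colon> {#add_mset (ys ! i, A) (\<Gamma> i)#}"
    using c(2) l by simp (blast dest: inv_Srv)
  then obtain B where y: "\<forall>i<length ys. stripped (S i) (add_mset (add_mset (ys ! i, T i) (\<Gamma> i)) (Hi i)) {#} \<and> T i = Bang (B i) \<and>
      Hi i = {#} \<and> quest_ctx (\<Gamma> i) \<and> {#} \<tturnstile> Qs ! i \<Colon> {#add_mset (ys ! i, B i) (\<Gamma> i)#}"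
    unfolding choice_iff' by blast
  have T: "fam ys T = fam ys (\<lambda>i. Bang (B i))" "seqs ys \<Gamma> T = seqs ys \<Gamma> (\<lambda>i. Bang (B i))" "(\<Sum>i<length ys. Hi i) = {#}"
    using y by (auto intro: fam_cong seqs_cong)
  let ?S = "S0' + (\<Sum>i<length ys. {#}) + {#({#x#} + mset ys, GBang x ys G)#}"
  have st: "stripped \<Sigma> \<Psi> ?S"
    unfolding S
    by (intro stripped_add stripped_sum stripped_refl allI impI)
      (use x(1) y flat_part_seqs[OF _ H] flat_part_head[OF H] in \<open>blast intro: stripped_mono\<close>)+
  note wf0 = typed_wf[OF t]
  have wf: "wf ?S \<Psi>" by (rule stripped_wf[OF st wf0])
  have nd: "nodup (hdom \<Psi>)" using wf by (simp add: wf_def)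
  \<comment> \<open>The transformation describes \<open>zs\<close> by free endpoints, the rule by
    the names of the server contexts. These are equal as sets by \<open>typed_fv\<close>, and as
    multisets because nothing is repeated.\<close>
  have N: "mset zs = (\<Sum>i<length ys. names (\<Gamma> i))"
  proof (rule nodup_eqI)
    show "nodup (mset zs)" using zs(2) by simp
    show "nodup (\<Sum>i<length ys. names (\<Gamma> i))" using nd by (simp add: H)
    have "(\<Union>Q \<in> set Qs. fv Q) = (\<Union>i<length ys. fv (Qs ! i))"
      by (force simp: in_set_conv_nth l)
    also have "\<dots> = (\<Union>i<length ys. insert (ys ! i) (set_mset (names (\<Gamma> i))))"
      using y by (intro SUP_cong) (auto dest!: typed_fv)
    also have "\<dots> = set ys \<union> set_mset (\<Sum>i<length ys. names (\<Gamma> i))"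
      by (auto simp: in_set_conv_nth) 
    finally have "set zs = set ys \<union> set_mset (\<Sum>i<length ys. names (\<Gamma> i)) - set ys"
      using zs(1) by simp
    moreover have "set_mset (\<Sum>i<length ys. names (\<Gamma> i)) \<inter> set ys = {}"
      using nd by (simp add: H)
    ultimately show "set_mset (mset zs) = set_mset (\<Sum>i<length ys. names (\<Gamma> i))"
      by auto
  qed
  define \<Gamma>' where "\<Gamma>' = (\<lambda>i. image_mset (map_prod (exch zs zs') id) (\<Gamma> i))"
  have fvK: "fv (par Ks) = set_mset (hdom \<Psi>)" by (rule typed_fv[OF t])
  have dzs: "set zs \<union> set ys \<union> {x} \<subseteq> set_mset (hdom \<Psi>)"
  proof -
    have "set zs = set_mset (\<Sum>i<length ys. names (\<Gamma> i))" by (metis N set_mset_mset)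
    then show ?thesis by (auto simp: H)
  qed
  have dys: "distinct (ys @ zs)" "distinct (x # ys)"
  proof -
    have "nodup (mset zs + mset ys)" "nodup (add_mset x (mset ys))" using nd by (simp_all add: H N)
    then show "distinct (ys @ zs)" "distinct (x # ys)" by auto
  qed
  have dj: "set (x # ys @ zs) \<inter> set (x' # ys' @ zs') = {}"
    using fresh(2) dzs unfolding fvK by auto
  have inj: "inj ?\<rho>" by (rule exch_inj) (use dys dj fresh(1) l in auto)
  have m: "map ?\<rho> (ys @ zs) = ys' @ zs'" by (rule map_exch) (use dys l in auto)
  then have m1: "map ?\<rho> ys = ys'" "map ?\<rho> zs = zs'" using l by simp_all
  have mz: "map (exch zs zs') zs = zs'" by (rule map_exch) (use dys l in auto)
  \<comment> \<open>The rule renames the contexts by \<open>zs\<close> alone, the copied terms are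
    renamed by \<open>ys\<close> and \<open>zs\<close> together; on the contexts the two exchanges
    agree.\<close>
  have \<Gamma>': "\<Gamma>' i = rC ?\<rho> (\<Gamma> i)" if i: "i < length ys" for i
    unfolding \<Gamma>'_def rC_def[symmetric]
  proof (rule rC_cong)
    fix z assume "z \<in># names (\<Gamma> i)"
    then have "z \<in># mset zs" unfolding N using i by auto
    then show "exch zs zs' z = ?\<rho> z"
      using mz m1(2) by (metis map_eq_conv set_mset_mset)
  qed
  have N': "(\<Sum>i<length ys. names (\<Gamma>' i)) = mset zs'"
  proof -
    have "(\<Sum>i<length ys. names (\<Gamma>' i)) = image_mset (exch zs zs') (mset zs)"
      unfolding N \<Gamma>'_def rC_def[symmetric] by (simp add: image_mset_sum)
    then show ?thesis using mz by (metis mset_map)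
  qed
  have srv: "\<forall>i<length ys. {#} \<tturnstile> map2 Srv ys Qs ! i \<Colon> add_mset (add_mset (ys ! i, Bang (B i)) (\<Gamma> i)) {#}"
    using y l by (simp add: typed_Srv)
  have srv': "\<forall>i<length ys'. {#} \<tturnstile> map2 Srv ys' (map (map_trm ?\<rho>) Qs) ! i \<Colon> add_mset (add_mset (ys' ! i, Bang (B i)) (\<Gamma>' i)) {#}"
  proof (intro allI impI)
    fix i assume i: "i < length ys'"
    then have i': "i < length ys" using l by simp
    have "?\<rho> (ys ! i) = ys' ! i" using m1(1) i' by (metis nth_map)
    moreover have "rE ?\<rho> {#} \<tturnstile> map_trm ?\<rho> (Qs ! i) \<Colon> rH ?\<rho> {#add_mset (ys ! i, B i) (\<Gamma> i)#}"
      using y i' by (intro typed_rename inj) simp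
    ultimately have "{#} \<tturnstile> map_trm ?\<rho> (Qs ! i) \<Colon> {#add_mset (ys' ! i, B i) (\<Gamma>' i)#}"
      by (simp add: \<Gamma>'[OF i'])
    moreover have "quest_ctx (\<Gamma>' i)" using y i' by (simp add: \<Gamma>'[OF i'])
    ultimately have "{#} \<tturnstile> Srv (ys' ! i) (map_trm ?\<rho> (Qs ! i)) \<Colon> {#add_mset (ys' ! i, Bang (B i)) (\<Gamma>' i)#}"
      by (rule typed_Srv)
    then show "{#} \<tturnstile> map2 Srv ys' (map (map_trm ?\<rho>) Qs) ! i \<Colon> add_mset (add_mset (ys' ! i, Bang (B i)) (\<Gamma>' i)) {#}"
      using i i' l by simp
  qed
  let ?Sp = "S0' + {#({#x#} + mset ys, GBang x ys G)#}"
  let ?Hp = "add_mset (add_mset (x, Quest A) (add_mset (x', Quest A) \<Gamma>0)) H0 + seqs ys \<Gamma> (\<lambda>i. Bang (B i))"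
  let ?Sq = "?Sp + {#({#x'#} + mset ys', GBang x' ys' (map_gtype ?f G))#}"
  let ?Hq = "?Hp + seqs ys' \<Gamma>' (\<lambda>i. Bang (B i))"
  have eq: "edom ?Sq = edom ?S + mset (x' # ys')" "hdom ?Hq = hdom \<Psi> + mset (x' # ys' @ zs')"
    unfolding H T x(2) by (simp_all add: l N')
  have fr: "set_mset (mset (x' # ys' @ zs')) \<inter> set_mset (hdom \<Psi>) = {}"
    using fresh(2) unfolding fvK by auto
  have "set_mset (edom ?S) \<subseteq> set_mset (hdom \<Psi>)"
    using stripped_subset[OF st] typed_edom[OF t] fvK by (auto elim!: subset_mset.less_eqE)
  then have fre: "set_mset (mset (x' # ys')) \<inter> set_mset (edom ?S) = {}" using fr by auto
  have wfq: "wf ?Sq ?Hq"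
    using wf fr fre fresh(1) unfolding wf_def eq nodup_union nodup_mset by auto
  have wfp: "wf ?Sp ?Hp"
    using wfq unfolding wf_def edom_simps(3) hdom_simps(3) nodup_union by blast
  have p: "?Sp \<tturnstile> par (P # map2 Srv ys Qs @ []) \<Colon> ?Hp"
    by (rule conn_cons[where us = "[]", OF x(3) srv])
      (use c(3) wfp l in \<open>simp_all add: T x(2)\<close>)
  have cG: "GBang x' ys' (map_gtype ?f G) \<Turnstile> add_mset (x', Quest A) (fam ys' (\<lambda>i. Bang (B i)))"
  proof -
    have m: "map ?f (x # ys) = x' # ys'" by (rule map_exch) (use dys l in auto)
    have "inj ?f" by (rule exch_inj) (use dys dj fresh(1) l in auto)
    from coherent_rename[OF c(3)[unfolded T x(2)] this] show ?thesis using m by simp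
  qed
  have q: "?Sq \<tturnstile> par (par (P # map2 Srv ys Qs) # map2 Srv ys' (map (map_trm ?\<rho>) Qs) @ []) \<Colon> ?Hq"
    by (rule conn_cons[where us = "[]", OF _ srv', where x = x' and ?A0.0 = "Quest A" and ?\<Gamma>0.0 = "add_mset (x, Quest A) \<Gamma>0"
        and ?H0.0 = "H0 + seqs ys \<Gamma> (\<lambda>i. Bang (B i))" and ?S0.0 = ?Sp])
      (use p cG wfq l in \<open>simp_all add: ac_simps add_mset_commute\<close>)
  \<comment> \<open>The sessions of the client lie within the client, so they avoid the old
    contexts, which belong to other components, and the copies, which are fresh.\<close>
  have ev: "evars S0' \<subseteq> set_mset (hdom (add_mset (add_mset (x, T0) \<Gamma>0) H0))"
    using typed_evars[OF x(3)] stripped_subset[OF x(1)] typed_edom[OF c(1)] typed_fv[OF c(1)]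
    by (auto elim!: subset_mset.less_eqE)
  have side: "\<forall>i<length ys. quest_ctx (\<Gamma> i) \<and> (set_mset (names (\<Gamma> i)) \<union> set_mset (names (\<Gamma>' i))) \<inter> evars S0' = {}"
  proof (intro allI impI conjI)
    fix i assume i: "i < length ys"
    show "quest_ctx (\<Gamma> i)" using y i by blast
    have "set_mset (names (\<Gamma> i)) \<subseteq> set_mset (hdom ((\<Sum>i<length ys. Hi i) + seqs ys \<Gamma> T))" using i by auto
    then have "set_mset (names (\<Gamma> i)) \<inter> set_mset (hdom (add_mset (add_mset (x, T0) \<Gamma>0) H0)) = {}"
      using nd unfolding H hdom_simps(3) nodup_union by blast
    moreover have "set_mset (names (\<Gamma>' i)) \<subseteq> set zs'"
      using N' i by (metis member_sum set_mset_mset subsetI)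
    then have "set_mset (names (\<Gamma>' i)) \<inter> set_mset (hdom (add_mset (add_mset (x, T0) \<Gamma>0) H0)) = {}"
      using fr unfolding H by auto
    ultimately show "(set_mset (names (\<Gamma> i)) \<union> set_mset (names (\<Gamma>' i))) \<inter> evars S0' = {}"
      using ev by blast
  qed
  note r = rule.CBangContract[OF l(2,3) N \<Gamma>'_def side, of x x' G H0 \<Gamma>0 A B]
  have "?S \<tturnstile> Clones x ys x' ys' zs zs' (par (par (P # map2 Srv ys Qs) # map2 Srv ys' (map (map_trm ?\<rho>) Qs))) \<Colon> \<Psi>"
    by (rule typed_un[OF rule_eqI[OF r refl]])
      (use q wf in \<open>simp_all add: H T x(2) ac_simps add_mset_commute\<close>)
  then show ?thesis using st wf0 by (rule typed_stripped)
qed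

section \<open>Components of typable compositions\<close>

inductive leaf :: "ep trm \<Rightarrow> ep trm \<Rightarrow> bool" where
  "leaf K K"
| "leaf K P \<Longrightarrow> leaf K (Par P Q)"
| "leaf K Q \<Longrightarrow> leaf K (Par P Q)"

inductive_cases leaf_ParE: "leaf K (Par P Q)"

lemma leaf_par: "K \<in> set Ks \<Longrightarrow> leaf K (par Ks)"
  by (induction Ks rule: par.induct) (auto intro: leaf.intros)

lemma leaf_parD: "leaf K (par Ps) \<Longrightarrow> Ps \<noteq> [] \<Longrightarrow> \<nexists>P Q. K = Par P Q \<Longrightarrow> \<exists>P \<in> set Ps. leaf K P"
  by (induction Ps rule: par.induct) (auto elim!: leaf_ParE)

text \<open>A typing of \<open>par Ks\<close> in an unrelated environment may group the bars
  differently from \<open>Ks\<close>. Whatever the grouping, a component that is not itself a bar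
  stays within one premise of each Conn until it becomes a premise itself.\<close>

lemma typed_leaf:
  "\<Sigma> \<tturnstile> T \<Colon> \<Psi> \<Longrightarrow> leaf K T \<Longrightarrow> \<nexists>P Q. K = Par P Q \<Longrightarrow> \<exists>S H. S \<tturnstile> K \<Colon> H"
proof (induction rule: typed.induct)
  case (1 F J \<Sigma> \<Psi> Ps)
  show ?case
  proof (cases "F = par")
    case True
    obtain G xs A \<Sigma>i \<Psi>i \<Gamma>i where c: "G \<Turnstile> fam xs A"
      "J = map (\<lambda>i. (\<Sigma>i i, \<Psi>i i + {#\<Gamma>i i + {#(xs ! i, A i)#}#})) [0..<length xs]"
      using 1(1) unfolding True by (rule rule_par)
    have "Ps \<noteq> []" using fam_nonempty[OF c(1)] 1(3) c(2) by auto
    then obtain P where "P \<in> set Ps" "leaf K P"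
      using leaf_parD 1(6,7) True by blast
    then show ?thesis using 1(5,7) 1(3) by (metis in_set_conv_nth)
  next
    case False
    have "\<nexists>P Q. F Ps = Par P Q"
      using 1(1) False by (cases rule: rule.cases) (auto simp: un_def bin_def)
    with 1(6) have "K = F Ps" by (cases rule: leaf.cases) auto
    then show ?thesis using typed.intros[OF 1(1-3)] 1(4) by blast
  qed
qed

lemma typable_comp:
  "typable (par Ks) \<Longrightarrow> K \<in> set Ks \<Longrightarrow> \<nexists>P Q. K = Par P Q \<Longrightarrow> typable K"
  unfolding typable_def using typed_leaf leaf_par by blast

lemma focus_ex: "x \<in># hdom \<Psi> \<Longrightarrow> \<exists>T \<Gamma> \<Phi>. \<Psi> = add_mset (add_mset (x, T) \<Gamma>) \<Phi>"
  by (metis in_hdom in_names mset_add)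

lemma typable_focus:
  assumes "typable K" "x \<in> fv K"
  obtains \<Sigma> T \<Gamma> \<Psi> where "\<Sigma> \<tturnstile> K \<Colon> add_mset (add_mset (x, T) \<Gamma>) \<Psi>"
proof -
  obtain \<Sigma> \<Psi> where t: "\<Sigma> \<tturnstile> K \<Colon> \<Psi>" using assms(1) by (auto simp: typable_def)
  then show thesis using assms(2) focus_ex[of x \<Psi>] that by (auto simp: typed_fv[OF t])
qed

text \<open>In this and the following cases typability shows that the displayed endpoints are free
  in the continuations. Hence \<open>joined\<close> holds for the composition of the continuations
  too, and \<open>joined_inv\<close> can split it.\<close>

lemma typable_Inl: "typable (Inl x P) \<Longrightarrow> x \<in> fv P"
  by (erule typable_focus[where x = x], simp, drule inv_Inl, clarify, (drule typed_fv)+, simp)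

lemma typable_Inr: "typable (Inr x P) \<Longrightarrow> x \<in> fv P"
  by (erule typable_focus[where x = x], simp, drule inv_Inr, clarify, (drule typed_fv)+, simp)

lemma typable_Sel: "typable (Sel x P Q) \<Longrightarrow> x \<in> fv P \<and> fv Q = fv P"
  by (erule typable_focus[where x = x], simp, drule inv_Sel, clarify, (drule typed_fv)+, simp)

text \<open>The two premises differ only in the type of \<open>x\<close>. The equality of free
  endpoints is what later allows the sequents of the two branches to be identified.\<close>

lemma typable_Case: "typable (Case x P Q) \<Longrightarrow> x \<in> fv P \<and> fv Q = fv P"
  by (erule typable_focus[where x = x], simp, drule inv_Case, clarify, (drule typed_fv)+, simp)

lemma typable_Use: "typable (Use x P) \<Longrightarrow> x \<in> fv P"
  by (erule typable_focus[where x = x], simp, drule inv_Use, clarify, (drule typed_fv)+, simp)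

lemma typable_Srv: "typable (Srv x P) \<Longrightarrow> x \<in> fv P"
  by (erule typable_focus[where x = x], simp, drule inv_Srv, clarify, (drule typed_fv)+, simp)

lemma typable_Clone: "typable (Clone x x' P) \<Longrightarrow> x \<in> fv P \<and> x' \<in> fv P"
  by (erule typable_focus[where x = x], simp, drule inv_Clone, clarify, (drule typed_fv)+, simp)

lemma typable_Recv: "typable (Recv x x' P) \<Longrightarrow> x \<in> fv P \<and> x' \<in> fv P"
  by (erule typable_focus[where x = x], simp, drule inv_Recv, clarify, (drule typed_fv)+, simp)

lemma typable_Send: "typable (Send x x' P Q) \<Longrightarrow> x' \<in> fv P \<and> x \<in> fv Q"
  by (erule typable_focus[where x = x], simp, drule inv_Send, clarify, (drule typed_fv)+, simp)

section \<open>Uniqueness of decompositions\<close>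

lemma nodup_subset_set: "nodup M \<Longrightarrow> set_mset M \<subseteq> set_mset N \<Longrightarrow> M \<subseteq># N"
proof (rule mset_subset_eqI)
  fix a assume "nodup M" "set_mset M \<subseteq> set_mset N"
  then show "count M a \<le> count N a"
    by (metis count_greater_eq_one_iff not_in_iff nodup_def order_trans subsetD zero_le)
qed

lemma nodup_hyp: "nodup (hdom \<Psi>) \<Longrightarrow> {#} \<notin># \<Psi> \<Longrightarrow> nodup \<Psi>"
proof (induction \<Psi>)
  case (add \<Gamma> \<Psi>)
  then obtain z where "z \<in># names \<Gamma>"
    by (metis names_def image_mset_is_empty_iff multiset_nonemptyE union_single_eq_member)
  then show ?case using add by (fastforce simp: in_hdom)
qed simp

lemma nodup_env: "nodup (edom \<Sigma>) \<Longrightarrow> \<forall>(M, G) \<in># \<Sigma>. M \<noteq> {#} \<Longrightarrow> nodup \<Sigma>"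
proof (induction \<Sigma>)
  case (add s \<Sigma>)
  obtain M G z where "s = (M, G)" "z \<in># M"
    using add.prems(2) by (cases s) auto
  then show ?case using add by (fastforce simp: in_edom)
qed simp

text \<open>A nonempty sequent of a well-formed hypersequent is located by any of its endpoints, so
  a selection of such sequents is determined by the endpoints it covers.\<close>

lemma hyp_unique:
  assumes "nodup (hdom \<Phi>)" "X \<subseteq># \<Phi>" "Y \<subseteq># \<Phi>" "{#} \<notin># X" "{#} \<notin># Y" "set_mset (hdom X) = set_mset (hdom Y)"
  shows "X = Y"
proof -
  have *: "set_mset A \<subseteq> set_mset B"
    if h: "A \<subseteq># \<Phi>" "B \<subseteq># \<Phi>" "{#} \<notin># A" "set_mset (hdom A) = set_mset (hdom B)" for A B
  proof
    fix \<Gamma> assume g: "\<Gamma> \<in># A"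
    then obtain z where z: "z \<in># names \<Gamma>"
      using h(3) by (metis names_def image_mset_is_empty_iff multiset_nonemptyE)
    then have "z \<in># hdom B" using g h(4) by (auto simp: in_hdom)
    then obtain \<Delta> where "\<Delta> \<in># B" "z \<in># names \<Delta>" by (auto simp: in_hdom)
    then show "\<Gamma> \<in># B"
      using sequent_unique[OF assms(1) _ _ z, of \<Delta>] g h(1,2) by (metis mset_subset_eqD)
  qed
  have "nodup (hdom X)" "nodup (hdom Y)"
    using assms(1-3) by (metis hdom_simps(3) nodup_union subset_mset.le_iff_add)+
  then show ?thesis
    using assms(4,5) *[OF assms(2,3,4,6)] *[OF assms(3,2,5) assms(6)[symmetric]]
    by (intro nodup_eqI nodup_hyp) auto
qed

lemma ctx_unique:
  assumes "nodup (names \<Phi>)" "set_mset X \<subseteq> set_mset \<Phi>" "set_mset Y \<subseteq> set_mset \<Phi>" "names X = names Y" "nodup (names X)"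
  shows "X = Y"
proof -
  have *: "set_mset A \<subseteq> set_mset B"
    if h: "set_mset A \<subseteq> set_mset \<Phi>" "set_mset B \<subseteq> set_mset \<Phi>" "names A = names B" for A B
  proof
    fix p assume p: "p \<in># A"
    obtain z T where zT: "p = (z, T)" by (cases p)
    then have "z \<in># names B" using p h(3) by (metis in_names)
    then obtain T' where "(z, T') \<in># B" by (auto simp: in_names)
    then show "p \<in># B"
      using typing_unique[OF assms(1), of z T T'] p h(1,2) zT by blast
  qed
  have nd: "nodup A" if "nodup (names A)" for A :: ctx
    using that by (induction A) (auto simp: in_names)
  have "set_mset X = set_mset Y"
    using *[OF assms(2,3,4)] *[OF assms(3,2) assms(4)[symmetric]] by blast
  moreover have "nodup (names Y)" using assms(4,5) by simp
  ultimately show ?thesis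
    using assms(5) by (intro nodup_eqI nd)
qed

lemma comps_disjoint:
  assumes "S0 \<tturnstile> K \<Colon> add_mset \<Gamma>0 H0"
    "\<forall>i<length ys. S i \<tturnstile> Ks ! i \<Colon> add_mset (add_mset (ys ! i, A i) (\<Gamma> i)) (H i)"
    "\<forall>i<length us. S' i \<tturnstile> Ls ! i \<Colon> add_mset (add_mset (us ! i, A' i) (\<Gamma>' i)) (H' i)"
    "nodup (hdom (add_mset \<Gamma>0 H0 + ((\<Sum>i<length ys. H i) + seqs ys \<Gamma> A) + ((\<Sum>i<length us. H' i) + seqs us \<Gamma>' A')))"
  shows "i < length ys \<Longrightarrow> fv K \<inter> fv (Ks ! i) = {}"
    "j < length us \<Longrightarrow> fv K \<inter> fv (Ls ! j) = {}"
    "i < length ys \<Longrightarrow> k < length ys \<Longrightarrow> i \<noteq> k \<Longrightarrow> fv (Ks ! i) \<inter> fv (Ks ! k) = {}"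
    "i < length ys \<Longrightarrow> j < length us \<Longrightarrow> fv (Ks ! i) \<inter> fv (Ls ! j) = {}"
proof -
  let ?W = "\<lambda>i. hdom (add_mset (add_mset (ys ! i, A i) (\<Gamma> i)) (H i))"
  let ?V = "\<lambda>i. hdom (add_mset (add_mset (us ! i, A' i) (\<Gamma>' i)) (H' i))"
  have eq: "hdom (add_mset \<Gamma>0 H0 + ((\<Sum>i<length ys. H i) + seqs ys \<Gamma> A) + ((\<Sum>i<length us. H' i) + seqs us \<Gamma>' A')) =
    hdom (add_mset \<Gamma>0 H0) + (\<Sum>i<length ys. ?W i) + (\<Sum>i<length us. ?V i)"
    unfolding sum_seqs[symmetric] hdom_simps(3,4) ..
  have nd: "nodup (\<Sum>i<length ys. ?W i)"
    "set_mset (hdom (add_mset \<Gamma>0 H0)) \<inter> set_mset (\<Sum>i<length ys. ?W i) = {}"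
    "set_mset (hdom (add_mset \<Gamma>0 H0)) \<inter> set_mset (\<Sum>i<length us. ?V i) = {}"
    "set_mset (\<Sum>i<length ys. ?W i) \<inter> set_mset (\<Sum>i<length us. ?V i) = {}"
    using assms(4) unfolding eq nodup_union set_mset_union by blast+
  have K: "fv K = set_mset (hdom (add_mset \<Gamma>0 H0))" by (rule typed_fv[OF assms(1)])
  have W: "fv (Ks ! i) = set_mset (?W i)" "set_mset (?W i) \<subseteq> set_mset (\<Sum>i<length ys. ?W i)" if "i < length ys" for i
    using assms(2) that by (blast dest: typed_fv, auto simp: set_mset_sum simp del: hdom_simps)
  have V: "fv (Ls ! i) = set_mset (?V i)" "set_mset (?V i) \<subseteq> set_mset (\<Sum>i<length us. ?V i)" if "i < length us" for i
    using assms(3) that by (blast dest: typed_fv, auto simp: set_mset_sum simp del: hdom_simps)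
  show "i < length ys \<Longrightarrow> fv K \<inter> fv (Ks ! i) = {}" using nd(2) K W by blast
  show "j < length us \<Longrightarrow> fv K \<inter> fv (Ls ! j) = {}" using nd(3) K V by blast
  show "i < length ys \<Longrightarrow> j < length us \<Longrightarrow> fv (Ks ! i) \<inter> fv (Ls ! j) = {}" using nd(4) W V by blast
  show "i < length ys \<Longrightarrow> k < length ys \<Longrightarrow> i \<noteq> k \<Longrightarrow> fv (Ks ! i) \<inter> fv (Ks ! k) = {}"
    using nd(1)[unfolded nodup_sum] W(1) by blast
qed

text \<open>The components declare disjoint sets of endpoints, and all endpoints of a session are
  declared in the component that holds it. One endpoint therefore tells where a session
  belongs.\<close>

lemma comps_localize:
  assumes c: "S0 \<tturnstile> K \<Colon> add_mset \<Gamma>0 H0"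
    "\<forall>i<length ys. S i \<tturnstile> Ks ! i \<Colon> add_mset (add_mset (ys ! i, A i) (\<Gamma> i)) (H i)"
    "\<forall>i<length us. S' i \<tturnstile> Ls ! i \<Colon> add_mset (add_mset (us ! i, A' i) (\<Gamma>' i)) (H' i)"
    "nodup (hdom (add_mset \<Gamma>0 H0 + ((\<Sum>i<length ys. H i) + seqs ys \<Gamma> A) + ((\<Sum>i<length us. H' i) + seqs us \<Gamma>' A')))"
    and s: "(M, G) \<in># S0 + (\<Sum>i<length ys. S i) + (\<Sum>i<length us. S' i)" "z \<in># M"
  shows "z \<in> fv K \<Longrightarrow> (M, G) \<in># S0"
    "i < length ys \<Longrightarrow> z \<in> fv (Ks ! i) \<Longrightarrow> (M, G) \<in># S i"
proof -
  note d = comps_disjoint[OF c]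
  have z: "z \<in> fv P" if "(M, G) \<in># T" "T \<tturnstile> P \<Colon> \<Phi>" for T P \<Phi>
    using that s(2) typed_edom[OF that(2)] by (force simp: in_edom)
  consider "(M, G) \<in># S0" | k where "k < length ys" "(M, G) \<in># S k" | k where "k < length us" "(M, G) \<in># S' k"
    using s(1) by auto
  then show "z \<in> fv K \<Longrightarrow> (M, G) \<in># S0"
    by cases (use z c d(1,2) in blast)+
  show "i < length ys \<Longrightarrow> z \<in> fv (Ks ! i) \<Longrightarrow> (M, G) \<in># S i"
    using \<open>(M, G) \<in># S0 + (\<Sum>i<length ys. S i) + (\<Sum>i<length us. S' i)\<close>
  proof -
    assume i: "i < length ys" "z \<in> fv (Ks ! i)"
    consider "(M, G) \<in># S0" | k where "k < length ys" "(M, G) \<in># S k" | k where "k < length us" "(M, G) \<in># S' k"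
      using s(1) by auto
    then show "(M, G) \<in># S i"
    proof cases
      case 1
      then show ?thesis using z[OF 1 c(1)] d(1)[OF i(1)] i by blast
    next
      case (2 k)
      then have "z \<in> fv (Ks ! k)" using z c(2) by blast
      then have "k = i" using d(3)[OF 2(1) i(1)] i by blast
      then show ?thesis using 2 by simp
    next
      case (3 k)
      then have "z \<in> fv (Ls ! k)" using z c(3) by blast
      then show ?thesis using d(4)[OF i(1) 3(1)] i by blast
    qed
  qed
qed

lemma typed_nonempty: "\<Sigma> \<tturnstile> P \<Colon> \<Psi> \<Longrightarrow> \<forall>(M, G) \<in># \<Sigma>. M \<noteq> {#}"
  using sess_ok_nonempty[OF typed_sess] by blast

lemma size_edom: "\<forall>(M, G) \<in># U. M \<noteq> {#} \<Longrightarrow> size U \<le> size (edom U)"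
  by (induction U) (auto simp: Suc_le_eq nonempty_has_size intro: le_trans add_mono split: prod.splits)

text \<open>Every session has at least one endpoint, so equality leaves exactly one for
  each.\<close>

lemma size_edom_eq: "\<forall>(M, G) \<in># U. M \<noteq> {#} \<Longrightarrow> size U = size (edom U) \<Longrightarrow> \<forall>(M, G) \<in># U. size M = 1"
proof (induction U)
  case (add s U)
  obtain M G where s: "s = (M, G)" by (cases s)
  have "size M \<ge> 1" "size U \<le> size (edom U)"
    using add.prems(1) size_edom[of U] by (auto simp: s Suc_le_eq nonempty_has_size)
  then have "size M = 1" "size U = size (edom U)"
    using add.prems(2) by (auto simp: s)
  then show ?case using add by (auto simp: s)
qed simp

text \<open>
  Both premises of a branching must have the same sessions. If they have the same sequents, then
  one cannot have more sessions than the other but for unary ones, because the sequents and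
  sessions form a tree.
\<close>

lemma typed_transfer:
  assumes P: "S \<tturnstile> P \<Colon> add_mset (add_mset (y, C) \<Gamma>) H" and Q: "S' \<tturnstile> Q \<Colon> add_mset (add_mset (y, D) \<Gamma>) H"
    and sub: "S' \<subseteq># S" and y: "y \<notin># edom S"
  shows "S \<tturnstile> Q \<Colon> add_mset (add_mset (y, D) \<Gamma>) H"
proof -
  obtain U where U: "S = S' + U" using sub by (auto elim: subset_mset.less_eqE)
  \<comment> \<open>The two judgements have equally many sequents, so the difference of their counts
    is the count of the extra sessions alone.\<close>
  have "size U = size (edom U)"
    using typed_good[OF P] typed_good[OF Q] by (auto simp: good_def U)
  then have 1: "\<forall>(M, G) \<in># U. size M = 1"
    using typed_nonempty[OF P] by (intro size_edom_eq) (auto simp: U)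
  have "unary U (flat (add_mset (add_mset (y, D) \<Gamma>) H))"
    unfolding unary_def
  proof safe
    fix M G assume m: "(M, G) \<in># U"
    then have "size M = 1" using 1 by fastforce
    then obtain z where z: "M = {#z#}" using size_1_singleton_mset by blast
    let ?F = "flat (add_mset (add_mset (y, C) \<Gamma>) H)"
    have ok: "G \<Turnstile> rst M ?F" "names (rst M ?F) = M"
      using typed_sess[OF P] m by (auto simp: sess_ok_def U simp del: rst_simps flat_simps)
    \<comment> \<open>The typings of both branches differ only at \<open>y\<close>, so the endpoint
      of an extra session has the same type in \<open>Q\<close> as in \<open>P\<close>.\<close>
    have "z \<noteq> y" using y m z by (auto simp: U in_edom)
    obtain A where A: "rst M ?F = {#(z, A)#}"
    proof -
      have "size (rst M ?F) = 1" using ok(2) z by (metis names_def size_image_mset size_single)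
      then obtain p where "rst M ?F = {#p#}" using size_1_singleton_mset by blast
      then show thesis using ok(2) z that by (cases p) (simp del: rst_simps flat_simps)
    qed
    then have "(z, A) \<in># ?F" by (metis multi_member_last multiset_filter_subset mset_subset_eqD rst_def)
    then have "(z, A) \<in># flat (add_mset (add_mset (y, D) \<Gamma>) H)" using \<open>z \<noteq> y\<close> by auto
    then show "\<exists>x A. M = {#x#} \<and> G \<Turnstile> {#(x, A)#} \<and> (x, A) \<in># flat (add_mset (add_mset (y, D) \<Gamma>) H)"
      using ok(1) A z by auto
  qed
  then show ?thesis
    using typed_unary[OF Q] typed_wf[OF P] by (simp add: U wf_def)
qed

lemma branch_transfer:
  assumes P: "S \<tturnstile> P \<Colon> add_mset (add_mset (y, C) \<Gamma>) H" and Q: "S' \<tturnstile> Q \<Colon> add_mset (add_mset (y, D) \<Gamma>) H'"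
    and fv: "fv Q = fv P" and \<Phi>: "nodup (hdom \<Phi>)" "H \<subseteq># \<Phi>" "H' \<subseteq># \<Phi>"
    and S: "set_mset S' \<subseteq> set_mset S" and y: "y \<notin># edom S"
  shows "H' = H \<and> S \<tturnstile> Q \<Colon> add_mset (add_mset (y, D) \<Gamma>) H"
proof -
  have e: "{#} \<notin># H" "{#} \<notin># H'"
    using typed_good[OF P] typed_good[OF Q] solo_tail' by (auto simp: good_def)
  have "insert y (set_mset (names \<Gamma>) \<union> set_mset (hdom H')) = insert y (set_mset (names \<Gamma>) \<union> set_mset (hdom H))"
    using fv typed_fv[OF P] typed_fv[OF Q] by simp
  moreover have "insert y (set_mset (names \<Gamma>)) \<inter> set_mset (hdom H) = {}" "insert y (set_mset (names \<Gamma>)) \<inter> set_mset (hdom H') = {}"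
    using typed_wf[OF P] typed_wf[OF Q] by (auto simp: wf_def)
  ultimately have "set_mset (hdom H') = set_mset (hdom H)" by blast
  then have H: "H' = H"
    by (intro hyp_unique[OF \<Phi>(1,3,2) e(2,1)])
  have "nodup S'" using typed_wf[OF Q] typed_nonempty[OF Q] by (intro nodup_env) (simp_all add: wf_def)
  then have "S' \<subseteq># S" using S by (rule nodup_subset_set)
  then show ?thesis using typed_transfer[OF P Q[unfolded H] _ y] H by simp
qed

text \<open>No session meets the endpoints of \<Delta> and no other sequent does, so this set splits
  no edge and must be everything. It shows that a server context disjoint from the environment
  forces the server's component to be a single sequent without sessions.\<close>

lemma isolated:
  assumes t: "S \<tturnstile> P \<Colon> add_mset \<Delta> H" and d: "set_mset (names \<Delta>) \<inter> set_mset (edom S) = {}" "\<Delta> \<noteq> {#}"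
  shows "H = {#} \<and> S = {#}"
proof -
  let ?N = "set_mset (names \<Delta>)"
  have g: "good S (add_mset \<Delta> H)" using typed_good[OF t] by blast
  have dj: "?N \<inter> set_mset (hdom H) = {}" using typed_wf[OF t] by (auto simp: wf_def)
  have u: "unif ?N (set_mset (hdom (add_mset \<Delta> H)))"
  proof (rule linkedD)
    show "linked S (add_mset \<Delta> H)" using g by (simp add: good_def)
    show "unif ?N (set_mset M)" if "(M, G) \<in># S" for M G
      using that d(1) unfolding unif_def disjoint_iff in_edom by blast
    show "unif ?N (set_mset (names \<Gamma>))" if "\<Gamma> \<in># add_mset \<Delta> H" for \<Gamma>
      using that dj unfolding unif_def disjoint_iff in_hdom by auto
  qed
  have ne: "?N \<noteq> {}" using d(2) by (simp add: names_def)
  have "set_mset (hdom (add_mset \<Delta> H)) \<subseteq> ?N"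
    by (rule unif_hit[OF u _ ne]) simp
  then have H0: "set_mset (hdom H) = {}" using dj by auto
  have "H = {#}"
  proof (rule ccontr)
    assume "H \<noteq> {#}"
    then obtain \<Gamma> where \<Gamma>: "\<Gamma> \<in># H" by (metis multiset_nonemptyE)
    then have "names \<Gamma> = {#}" using H0 in_hdom by (metis multiset_nonemptyE empty_iff)
    then have "\<Gamma> = {#}" by (simp add: names_def)
    then show False using g \<Gamma> solo_tail' by (auto simp: good_def)
  qed
  moreover have "set_mset (edom S) = {}"
    using typed_edom[OF t] typed_fv[OF t] H0 d(1) by auto
  then have "S = {#}"
    using typed_nonempty[OF t] by (cases S) auto
  ultimately show ?thesis by blast
qed

section \<open>Applying single action rules; recognising the displayed session\<close>

lemma typed_Case:
  assumes "S \<tturnstile> P \<Colon> add_mset (add_mset (y, C) \<Gamma>) H" "S \<tturnstile> Q \<Colon> add_mset (add_mset (y, D) \<Gamma>) H" "y \<notin># edom S"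
  shows "S \<tturnstile> Case y P Q \<Colon> add_mset (add_mset (y, With C D) \<Gamma>) H"
  using typed_bin[OF rule.With[OF assms(3), of H \<Gamma> C D], of P Q] assms wf_cong[OF typed_wf[OF assms(1)]] by simp

lemma typed_Sel:
  assumes "S \<tturnstile> P \<Colon> add_mset (add_mset (y, C) \<Gamma>) H" "S \<tturnstile> Q \<Colon> add_mset (add_mset (y, D) \<Gamma>) H" "y \<notin># edom S"
  shows "S \<tturnstile> Sel y P Q \<Colon> add_mset (add_mset (y, Oplus C D) \<Gamma>) H"
  using typed_bin[OF rule.Oplus[OF assms(3), of H \<Gamma> C D], of P Q] assms wf_cong[OF typed_wf[OF assms(1)]] by simp

lemma typed_Inl:
  assumes "S \<tturnstile> P \<Colon> add_mset (add_mset (x, A) \<Gamma>) H" "x \<notin># edom S"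
  shows "S \<tturnstile> Inl x P \<Colon> add_mset (add_mset (x, Oplus A B) \<Gamma>) H"
  using typed_un[OF rule.Oplus1[OF assms(2), of H \<Gamma> A B], of P] assms wf_cong[OF typed_wf[OF assms(1)]] by simp

lemma typed_Inr:
  assumes "S \<tturnstile> P \<Colon> add_mset (add_mset (x, B) \<Gamma>) H" "x \<notin># edom S"
  shows "S \<tturnstile> Inr x P \<Colon> add_mset (add_mset (x, Oplus A B) \<Gamma>) H"
  using typed_un[OF rule.Oplus2[OF assms(2), of H \<Gamma> B A], of P] assms wf_cong[OF typed_wf[OF assms(1)]] by simp

lemma typed_Use:
  assumes "S \<tturnstile> P \<Colon> add_mset (add_mset (x, A) \<Gamma>) H" "x \<notin># edom S"
  shows "S \<tturnstile> Use x P \<Colon> add_mset (add_mset (x, Quest A) \<Gamma>) H"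
  using typed_un[OF rule.Quest[OF assms(2), of H \<Gamma> A], of P] assms wf_cong[OF typed_wf[OF assms(1)]] by simp

lemma typed_Clone:
  assumes "S \<tturnstile> P \<Colon> add_mset (add_mset (x, Quest A) (add_mset (x', Quest A) \<Gamma>)) H" "x \<notin># edom S" "x' \<notin># edom S"
  shows "S \<tturnstile> Clone x x' P \<Colon> add_mset (add_mset (x, Quest A) \<Gamma>) H"
  using typed_un[OF rule.Contract[OF assms(2,3), of H \<Gamma> A], of P] assms typed_wf[OF assms(1)]
  by (simp add: wf_def add_mset_commute)

lemma typed_Recv:
  assumes "S \<tturnstile> P \<Colon> add_mset (add_mset (y, D) (add_mset (y', C) \<Gamma>)) H" "y \<notin># edom S" "y' \<notin># edom S"
  shows "S \<tturnstile> Recv y y' P \<Colon> add_mset (add_mset (y, Parr C D) \<Gamma>) H"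
  using typed_un[OF rule.Parr[OF assms(2,3), of H \<Gamma> C D], of P] assms typed_wf[OF assms(1)]
  by (simp add: wf_def add_mset_commute)

lemma typed_Kill:
  assumes "S \<tturnstile> P \<Colon> add_mset \<Gamma> H" "x \<notin># edom S" "x \<notin># names \<Gamma>" "x \<notin># hdom H"
  shows "S \<tturnstile> Kill x P \<Colon> add_mset (add_mset (x, Quest A) \<Gamma>) H"
  using typed_un[OF rule.Weaken[OF assms(2), of H \<Gamma> A], of P] assms typed_wf[OF assms(1)]
  by (simp add: wf_def)

lemma typed_Wait:
  assumes "S \<tturnstile> P \<Colon> add_mset \<Gamma> H" "x \<notin># edom S" "x \<notin># names \<Gamma>" "x \<notin># hdom H"
  shows "S \<tturnstile> Wait x P \<Colon> add_mset (add_mset (x, TBot) \<Gamma>) H"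
  using typed_un[OF rule.Bot[OF assms(2), of H \<Gamma>], of P] assms typed_wf[OF assms(1)]
  by (simp add: wf_def)

lemma typed_Close: "{#} \<tturnstile> Close x \<Colon> {#{#(x, TOne)#}#}"
  using typed.intros[OF rule.One[of x], of "[]"] by (simp add: wf_def)

lemma joined_cons_iff:
  "length Ks = length ys \<Longrightarrow> joined \<Sigma> G (x # ys @ us) (K # Ks @ Ls) \<longleftrightarrow>
    1 \<le> length Ks + length Ls \<and> length Ls = length us \<and> x \<in> fv K \<and> (\<forall>i<length ys. ys ! i \<in> fv (Ks ! i)) \<and>
    (\<forall>i<length us. us ! i \<in> fv (Ls ! i)) \<and> ({#x#} + mset ys + mset us, G) \<in># \<Sigma>"
proof -
  assume l: "length Ks = length ys"
  have J: "joined \<Sigma> G es Ks \<longleftrightarrow> 2 \<le> length Ks \<and> list_all2 (\<lambda>e K. e \<in> fv K) es Ks \<and> (mset es, G) \<in># \<Sigma>" for es Ks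
    by (auto simp: joined_def list_all2_conv_all_nth)
  show ?thesis
    unfolding J using l by (simp add: list_all2_append) (auto simp: list_all2_conv_all_nth)
qed

lemma joined_snoc_iff:
  "length Ks = length xs \<Longrightarrow> joined \<Sigma> G (xs @ y # us) (Ks @ K # Ls) \<longleftrightarrow>
    1 \<le> length Ks + length Ls \<and> length Ls = length us \<and> y \<in> fv K \<and> (\<forall>i<length xs. xs ! i \<in> fv (Ks ! i)) \<and>
    (\<forall>i<length us. us ! i \<in> fv (Ls ! i)) \<and> (mset xs + {#y#} + mset us, G) \<in># \<Sigma>"
proof -
  assume l: "length Ks = length xs"
  have J: "joined \<Sigma> G es Ks \<longleftrightarrow> 2 \<le> length Ks \<and> list_all2 (\<lambda>e K. e \<in> fv K) es Ks \<and> (mset es, G) \<in># \<Sigma>" for es Ks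
    by (auto simp: joined_def list_all2_conv_all_nth)
  show ?thesis
    unfolding J using l by (simp add: list_all2_append) (auto simp: list_all2_conv_all_nth)
qed

text \<open>The session consumed by the choreography's typing rule and the one named by the
  transformation share an endpoint, hence coincide.\<close>

lemma joined_session:
  assumes "joined \<Sigma> G es Ks" "stripped \<Sigma> \<Psi> \<Sigma>'" "wf \<Sigma> \<Psi>" "(M, G') \<in># \<Sigma>'" "z \<in># M" "z \<in> set es"
  shows "M = mset es \<and> G' = G"
proof (rule session_unique)
  show "nodup (edom \<Sigma>)" using assms(3) by (simp add: wf_def)
  show "(mset es, G) \<in># \<Sigma>" using assms(1) by (simp add: joined_def)
  show "(M, G') \<in># \<Sigma>" using assms(2,4) stripped_subset mset_subset_eqD by metis
qed (use assms in auto)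

lemma seqs_unique:
  assumes "nodup (hdom \<Phi>)" "set_mset (seqs xs \<Gamma> A) \<subseteq> set_mset \<Phi>" "set_mset (seqs xs \<Gamma>' A') \<subseteq> set_mset \<Phi>"
  shows "\<forall>i<length xs. A i = A' i \<and> \<Gamma> i = \<Gamma>' i"
proof (intro allI impI)
  fix i assume i: "i < length xs"
  show "A i = A' i \<and> \<Gamma> i = \<Gamma>' i"
  proof (rule focus_unique[OF assms(1), of "xs ! i"])
    have "add_mset (xs ! i, A i) (\<Gamma> i) \<in># seqs xs \<Gamma> A" "add_mset (xs ! i, A' i) (\<Gamma>' i) \<in># seqs xs \<Gamma>' A'"
      using i by (auto simp: in_seqs)
    then show "add_mset (xs ! i, A i) (\<Gamma> i) \<in># \<Phi>" "add_mset (xs ! i, A' i) (\<Gamma>' i) \<in># \<Phi>"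
      using assms(2,3) by blast+
  qed
qed

lemma nodup_hdom_part: "nodup (hdom \<Psi>) \<Longrightarrow> \<Psi> = X + Y \<Longrightarrow> nodup (hdom X)"
  by simp

lemma session_fresh: "wf (\<Sigma> + {#(M, G)#}) \<Psi> \<Longrightarrow> z \<in># M \<Longrightarrow> z \<notin># edom \<Sigma>"
  by (auto simp: wf_def)

section \<open>Projection\<close>

lemma proj_close:
  assumes t: "\<Sigma> \<tturnstile> Closes xs y P \<Colon> \<Psi>"
  shows "\<Sigma> \<tturnstile> par (map Close xs @ [Wait y P]) \<Colon> \<Psi>"
proof -
  obtain \<Sigma>0 \<Psi>0 \<Gamma> where st: "stripped \<Sigma> \<Psi> (\<Sigma>0 + {#(mset xs + {#y#}, GClose xs y)#})"
    and H: "\<Psi> = \<Psi>0 + seqs xs (\<lambda>i. {#}) (\<lambda>i. TOne) + {#\<Gamma> + {#(y, TBot)#}#}"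
    and P: "\<Sigma>0 \<tturnstile> P \<Colon> \<Psi>0 + {#\<Gamma>#}"
    using inv_Closes[OF t] .
  note wf = stripped_wf[OF st typed_wf[OF t]]
  have y: "y \<notin># edom \<Sigma>0" using wf by (auto simp: wf_def)
  have W: "\<Sigma>0 \<tturnstile> Wait y P \<Colon> add_mset (add_mset (y, TBot) \<Gamma>) \<Psi>0"
    by (rule typed_Wait) (use P y wf in \<open>auto simp: wf_def H\<close>)
  have G: "GClose xs y \<Turnstile> add_mset (y, TBot) (fam xs (\<lambda>i. TOne))"
    using coh_close[of xs y] wf by (auto simp: wf_def)
  have "\<Sigma>0 + {#(mset xs + {#y#}, GClose xs y)#} \<tturnstile> par (map Close xs @ Wait y P # []) \<Colon> \<Psi>"
    by (rule conn_snoc[where us = "[]", OF _ _ W, of xs "\<lambda>_. {#}" _ "\<lambda>_. TOne" "\<lambda>_. {#}" "\<lambda>_. {#}"])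
      (use G wf in \<open>simp_all add: typed_Close H\<close>)
  then show ?thesis using st typed_wf[OF t] by (auto intro: typed_stripped)
qed

lemma proj_kills:
  assumes t: "\<Sigma> \<tturnstile> Kills x ys Qs P \<Colon> \<Psi>"
  shows "\<Sigma> \<tturnstile> par (Kill x P # map2 Srv ys Qs) \<Colon> \<Psi>"
proof -
  obtain \<Sigma>0 G \<Psi>0 \<Gamma> \<Gamma>i A B where st: "stripped \<Sigma> \<Psi> (\<Sigma>0 + {#({#x#} + mset ys, GBang x ys G)#})"
    and G: "G \<Turnstile> {#(x, A)#} + fam ys B" "\<forall>i<length ys. quest_ctx (\<Gamma>i i)" "length Qs = length ys"
    and H: "\<Psi> = \<Psi>0 + {#\<Gamma> + {#(x, Quest A)#}#} + seqs ys \<Gamma>i (\<lambda>i. Bang (B i))"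
    and P: "\<Sigma>0 \<tturnstile> P \<Colon> \<Psi>0 + {#\<Gamma>#}"
    and Q: "\<forall>i<length ys. {#} \<tturnstile> Qs ! i \<Colon> {#\<Gamma>i i + {#(ys ! i, B i)#}#}"
    using inv_Kills[OF t] .
  note wf = stripped_wf[OF st typed_wf[OF t]]
  have x: "x \<notin># edom \<Sigma>0" using wf by (auto simp: wf_def)
  have K: "\<Sigma>0 \<tturnstile> Kill x P \<Colon> add_mset (add_mset (x, Quest A) \<Gamma>) \<Psi>0"
    by (rule typed_Kill) (use P x wf in \<open>auto simp: wf_def H\<close>)
  have "\<Sigma>0 + {#({#x#} + mset ys, GBang x ys G)#} \<tturnstile> par (Kill x P # map2 Srv ys Qs @ []) \<Colon> \<Psi>"
    by (rule conn_cons[where us = "[]", OF K, of ys "\<lambda>_. {#}" _ "\<lambda>i. Bang (B i)" \<Gamma>i "\<lambda>_. {#}"])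
      (use G Q wf coh_bang[OF G(1)] in \<open>simp_all add: typed_Srv H\<close>)
  then show ?thesis using st typed_wf[OF t] by (auto intro: typed_stripped)
qed

text \<open>The premise of \<open>CBangQuest\<close> allows the servers any sessions and sequents a
  priori. The condition that their contexts avoid \<open>evars \<Sigma>0\<close> excludes them, as
  \<open>Bang\<close> requires.\<close>

lemma proj_starts:
  assumes t: "\<Sigma> \<tturnstile> Starts x ys (par (P # Qs)) \<Colon> \<Psi>" and l: "length Qs = length ys"
    and j: "joined \<Sigma> (GBang x ys G') (x # ys) (Use x P # map2 Srv ys Qs)"
    and ty: "typable (par (Use x P # map2 Srv ys Qs))"
  shows "\<Sigma> \<tturnstile> par (Use x P # map2 Srv ys Qs) \<Colon> \<Psi>"
proof -
  obtain \<Sigma>0 G \<Psi>0 \<Gamma> \<Gamma>i A B where st: "stripped \<Sigma> \<Psi> (\<Sigma>0 + {#({#x#} + mset ys, GBang x ys G)#})"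
    and q: "\<forall>i<length ys. quest_ctx (\<Gamma>i i) \<and> set_mset (names (\<Gamma>i i)) \<inter> evars \<Sigma>0 = {}"
    and H: "\<Psi> = \<Psi>0 + {#\<Gamma> + {#(x, Quest A)#}#} + seqs ys \<Gamma>i (\<lambda>i. Bang (B i))"
    and p: "\<Sigma>0 + {#({#x#} + mset ys, G)#} \<tturnstile> par (P # Qs) \<Colon> \<Psi>0 + {#\<Gamma> + {#(x, A)#}#} + seqs ys \<Gamma>i B"
    using inv_Starts[OF t] .
  note wf = stripped_wf[OF st typed_wf[OF t]]
  let ?Hp = "\<Psi>0 + {#\<Gamma> + {#(x, A)#}#} + seqs ys \<Gamma>i B"
  have nd: "nodup (hdom ?Hp)" using typed_wf[OF p] by (simp only: wf_def)
  have "ys \<noteq> []" using j l by (auto simp: joined_def)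
  have xP: "x \<in> fv P" by (rule typable_Use[OF typable_comp[OF ty]]) auto
  have yQ: "\<forall>i<length ys. ys ! i \<in> fv (Qs ! i)"
  proof (intro allI impI)
    fix i assume i: "i < length ys"
    have "Srv (ys ! i) (Qs ! i) \<in> set (Use x P # map2 Srv ys Qs)"
      using i l by (auto simp: set_zip)
    from typable_Srv[OF typable_comp[OF ty this]] show "ys ! i \<in> fv (Qs ! i)" by simp
  qed
  have jp: "joined (\<Sigma>0 + {#({#x#} + mset ys, G)#}) G (x # ys @ []) (P # Qs @ [])"
    unfolding joined_cons_iff[OF l] using xP yQ \<open>ys \<noteq> []\<close> l by (auto simp: Suc_le_eq)
  obtain S0 H0 \<Gamma>0 A0 S H1 \<Gamma>1 A1 where c:
    "S0 \<tturnstile> P \<Colon> add_mset (add_mset (x, A0) \<Gamma>0) H0"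
    "\<forall>i<length ys. S i \<tturnstile> Qs ! i \<Colon> add_mset (add_mset (ys ! i, A1 i) (\<Gamma>1 i)) (H1 i)"
    "G \<Turnstile> add_mset (x, A0) (fam ys A1)"
    and eS: "\<Sigma>0 + {#({#x#} + mset ys, G)#} = S0 + (\<Sum>i<length ys. S i) + {#({#x#} + mset ys, G)#}"
    and eH: "?Hp = add_mset (add_mset (x, A0) \<Gamma>0) H0 + ((\<Sum>i<length ys. H1 i) + seqs ys \<Gamma>1 A1)"
    by (rule joined_cons[OF _ jp l]) (use p in simp, rule that, assumption, assumption, simp_all)
  have m0: "A0 = A \<and> \<Gamma>0 = \<Gamma>"
    by (rule focus_unique[OF nd, of x]) (subst eH, simp, simp)
  have m1: "\<forall>i<length ys. A1 i = B i \<and> \<Gamma>1 i = \<Gamma>i i"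
    by (rule seqs_unique[OF nd]) (subst eH, auto)
  have T: "fam ys A1 = fam ys B" "seqs ys \<Gamma>1 A1 = seqs ys \<Gamma>i B"
    using m1 by (auto intro: fam_cong seqs_cong)
  have S: "\<Sigma>0 = S0 + (\<Sum>i<length ys. S i)" using eS by simp
  \<comment> \<open>The sessions of a server are among those of \<open>\<Sigma>0\<close>, which
    contain neither its context nor, since the displayed session is separate, its own
    endpoint.\<close>
  have iso: "H1 i = {#} \<and> S i = {#}" if i: "i < length ys" for i
  proof (rule isolated)
    show "S i \<tturnstile> Qs ! i \<Colon> add_mset (add_mset (ys ! i, A1 i) (\<Gamma>1 i)) (H1 i)" using c(2) i by blast
    have "set_mset (edom (S i)) \<subseteq> set_mset (edom \<Sigma>0)"
      unfolding S using i by auto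
    moreover have "set_mset (edom \<Sigma>0) \<subseteq> evars \<Sigma>0" by (rule edom_subset_evars)
    moreover have "ys ! i \<notin># edom \<Sigma>0" using wf nth_mem[OF i] by (auto simp: wf_def)
    ultimately show "set_mset (names (add_mset (ys ! i, A1 i) (\<Gamma>1 i))) \<inter> set_mset (edom (S i)) = {}"
      using q m1 i by auto
  qed simp
  have Z: "(\<Sum>i<length ys. H1 i) = {#}" "(\<Sum>i<length ys. S i) = {#}" using iso by auto
  have x: "x \<notin># edom S0" using wf by (auto simp: wf_def S)
  have H0: "\<Psi>0 = H0" using eH m0 T Z by simp
  have "\<Sigma>0 + {#({#x#} + mset ys, GBang x ys G)#} \<tturnstile> par (Use x P # map2 Srv ys Qs @ []) \<Colon> \<Psi>"
  proof (rule conn_cons[where us = "[]", OF typed_Use[OF c(1) x], of ys "\<lambda>_. {#}" _ "\<lambda>i. Bang (B i)" \<Gamma>i "\<lambda>_. {#}"])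
    show "\<forall>i<length ys. {#} \<tturnstile> map2 Srv ys Qs ! i \<Colon> add_mset (add_mset (ys ! i, Bang (B i)) (\<Gamma>i i)) {#}"
    proof (intro allI impI)
      fix i assume i: "i < length ys"
      then have "{#} \<tturnstile> Qs ! i \<Colon> {#add_mset (ys ! i, B i) (\<Gamma>i i)#}"
        using c(2) iso[OF i] m1 by fastforce
      then have "{#} \<tturnstile> Srv (ys ! i) (Qs ! i) \<Colon> {#add_mset (ys ! i, Bang (B i)) (\<Gamma>i i)#}"
        using q i by (intro typed_Srv) auto
      then show "{#} \<tturnstile> map2 Srv ys Qs ! i \<Colon> add_mset (add_mset (ys ! i, Bang (B i)) (\<Gamma>i i)) {#}"
        using i l by simp
    qed
    show "GBang x ys G \<Turnstile> add_mset (x, Quest A0) (fam ys (\<lambda>i. Bang (B i)) + fam [] A1)"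
      using coh_bang[of G x A0 ys B] c(3) T by simp
  qed (use l wf in \<open>simp_all add: H S Z m0 H0\<close>)
  then show ?thesis using st typed_wf[OF t] by (auto intro: typed_stripped)
qed

text \<open>The branch \<open>Rs ! i\<close> is typed by the rule with \<open>Si i\<close> and
  \<open>Hi i\<close>, while splitting the main premise types \<open>Qs ! i\<close> with
  \<open>S1 i\<close> and \<open>H1 i\<close>. The work consists in giving both the same judgement
  apart from the type at \<open>ys ! i\<close>, so that they form a \<open>Case\<close>.\<close>

lemma proj_inl:
  assumes t: "\<Sigma> \<tturnstile> CInl x ys (par (P # Qs @ Ss)) Rs \<Colon> \<Psi>" and l: "length Qs = length ys" "length Rs = length ys"
    and Ks: "Ks = Inl x P # map (\<lambda>i. Case (ys ! i) (Qs ! i) (Rs ! i)) [0..<length ys] @ Ss"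
    and j: "joined \<Sigma> (GCase x ys G0 H0) (x # ys @ us) Ks" and ty: "typable (par Ks)"
  shows "\<Sigma> \<tturnstile> par Ks \<Colon> \<Psi>"
proof -
  obtain \<Sigma>0 Si vs G H \<Psi>0 Hi \<Gamma> \<Gamma>i A B C D \<Delta> E where
    st: "stripped \<Sigma> \<Psi> (\<Sigma>0 + (\<Sum>i<length ys. Si i) + {#({#x#} + mset ys + mset vs, GCase x ys G H)#})"
    and cH: "H \<Turnstile> {#(x, B)#} + fam ys D + fam vs E"
    and H: "\<Psi> = \<Psi>0 + (\<Sum>i<length ys. Hi i) + {#\<Gamma> + {#(x, Oplus A B)#}#} + seqs ys \<Gamma>i (\<lambda>i. With (C i) (D i)) + seqs vs \<Delta> E"
    and p: "\<Sigma>0 + (\<Sum>i<length ys. Si i) + {#({#x#} + mset ys + mset vs, G)#} \<tturnstile> par (P # Qs @ Ss) \<Colon>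
      \<Psi>0 + (\<Sum>i<length ys. Hi i) + {#\<Gamma> + {#(x, A)#}#} + seqs ys \<Gamma>i C + seqs vs \<Delta> E"
    and R: "\<forall>i<length ys. Si i \<tturnstile> Rs ! i \<Colon> Hi i + {#\<Gamma>i i + {#(ys ! i, D i)#}#}"
    using inv_CInl[OF t] .
  note wf = stripped_wf[OF st typed_wf[OF t]]
  let ?Hp = "\<Psi>0 + (\<Sum>i<length ys. Hi i) + {#\<Gamma> + {#(x, A)#}#} + seqs ys \<Gamma>i C + seqs vs \<Delta> E"
  have nd: "nodup (hdom ?Hp)" using typed_wf[OF p] by (simp only: wf_def)
  have "{#x#} + mset ys + mset vs = mset (x # ys @ us)"
    using joined_session[OF j st typed_wf[OF t], of "{#x#} + mset ys + mset vs" "GCase x ys G H" x] by simp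
  then have vs: "mset vs = mset us" by simp
  have lK: "length (map (\<lambda>i. Case (ys ! i) (Qs ! i) (Rs ! i)) [0..<length ys]) = length ys" by simp
  note jd = j[unfolded Ks joined_cons_iff[OF lK]]
  have xP: "x \<in> fv P" by (rule typable_Inl[OF typable_comp[OF ty]]) (auto simp: Ks)
  have yQ: "\<forall>i<length ys. ys ! i \<in> fv (Qs ! i) \<and> fv (Rs ! i) = fv (Qs ! i)"
  proof (intro allI impI)
    fix i assume i: "i < length ys"
    have "Case (ys ! i) (Qs ! i) (Rs ! i) \<in> set Ks" using i by (auto simp: Ks)
    from typable_Case[OF typable_comp[OF ty this]] show "ys ! i \<in> fv (Qs ! i) \<and> fv (Rs ! i) = fv (Qs ! i)" by simp
  qed
  have jp: "joined (\<Sigma>0 + (\<Sum>i<length ys. Si i) + {#({#x#} + mset ys + mset vs, G)#}) G (x # ys @ us) (P # Qs @ Ss)"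
    unfolding joined_cons_iff[OF l(1)] using jd xP yQ l by (simp add: vs)
  obtain S0 H0 \<Gamma>0 A0 S1 H1 \<Gamma>1 A1 S2 H2 \<Gamma>2 A2 where c:
    "S0 \<tturnstile> P \<Colon> add_mset (add_mset (x, A0) \<Gamma>0) H0"
    "\<forall>i<length ys. S1 i \<tturnstile> Qs ! i \<Colon> add_mset (add_mset (ys ! i, A1 i) (\<Gamma>1 i)) (H1 i)"
    "\<forall>i<length us. S2 i \<tturnstile> Ss ! i \<Colon> add_mset (add_mset (us ! i, A2 i) (\<Gamma>2 i)) (H2 i)" "length Ss = length us"
    "G \<Turnstile> add_mset (x, A0) (fam ys A1 + fam us A2)"
    and eS: "\<Sigma>0 + (\<Sum>i<length ys. Si i) + {#({#x#} + mset ys + mset vs, G)#} =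
      S0 + (\<Sum>i<length ys. S1 i) + (\<Sum>i<length us. S2 i) + {#({#x#} + mset ys + mset us, G)#}"
    and eH: "?Hp = add_mset (add_mset (x, A0) \<Gamma>0) H0 + ((\<Sum>i<length ys. H1 i) + seqs ys \<Gamma>1 A1) + ((\<Sum>i<length us. H2 i) + seqs us \<Gamma>2 A2)"
    by (rule joined_cons[OF p jp l(1)])
  have m0: "A0 = A \<and> \<Gamma>0 = \<Gamma>"
    by (rule focus_unique[OF nd, of x]) (subst eH, simp, simp)
  have m1: "\<forall>i<length ys. A1 i = C i \<and> \<Gamma>1 i = \<Gamma>i i"
    by (rule seqs_unique[OF nd]) (subst eH, auto)
  have T: "fam ys A1 = fam ys C" "seqs ys \<Gamma>1 A1 = seqs ys \<Gamma>i C"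
    using m1 by (auto intro: fam_cong seqs_cong)
  have m2: "fam vs E = fam us A2"
  proof (rule ctx_unique[where \<Phi> = "flat ?Hp"])
    show "nodup (names (flat ?Hp))" using nd by (simp only: names_flat)
    show "set_mset (fam vs E) \<subseteq> set_mset (flat ?Hp)" by auto
    show "set_mset (fam us A2) \<subseteq> set_mset (flat ?Hp)" unfolding eH by auto
    show "names (fam vs E) = names (fam us A2)" by (simp add: vs)
    show "nodup (names (fam vs E))" using nd by simp
  qed
  have S: "\<Sigma>0 + (\<Sum>i<length ys. Si i) = S0 + (\<Sum>i<length ys. S1 i) + (\<Sum>i<length us. S2 i)"
    using eS by (simp add: vs)
  \<comment> \<open>The hypersequent without the sequents of \<open>x\<close> and \<open>ys\<close>.
    Both \<open>Hi i\<close> and \<open>H1 i\<close> are parts of it, which makes them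
    comparable.\<close>
  let ?\<Phi> = "H0 + (\<Sum>i<length ys. H1 i) + ((\<Sum>i<length us. H2 i) + seqs us \<Gamma>2 A2)"
  have \<Phi>: "\<Psi>0 + (\<Sum>i<length ys. Hi i) + seqs vs \<Delta> E = ?\<Phi>"
    using eH m0 T by (simp add: ac_simps)
  have nd\<Phi>: "nodup (hdom ?\<Phi>)"
  proof (rule nodup_hdom_part[OF nd])
    show "?Hp = ?\<Phi> + ({#\<Gamma> + {#(x, A)#}#} + seqs ys \<Gamma>i C)"
      unfolding \<Phi>[symmetric] by (simp add: ac_simps)
  qed
  have z: "x \<notin># edom (\<Sigma>0 + (\<Sum>i<length ys. Si i))" "\<And>i. i < length ys \<Longrightarrow> ys ! i \<notin># edom (\<Sigma>0 + (\<Sum>i<length ys. Si i))"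
    by (rule session_fresh[OF wf], simp)+
  have yS: "ys ! i \<notin># edom (S1 i)" if i: "i < length ys" for i
    using z(2)[OF i] i unfolding S by simp
  have case': "S1 i \<tturnstile> Case (ys ! i) (Qs ! i) (Rs ! i) \<Colon> add_mset (add_mset (ys ! i, With (C i) (D i)) (\<Gamma>i i)) (H1 i)"
    if i: "i < length ys" for i
  proof -
    have 1: "S1 i \<tturnstile> Qs ! i \<Colon> add_mset (add_mset (ys ! i, C i) (\<Gamma>i i)) (H1 i)"
      using c(2) m1 i by fastforce
    have 2: "Si i \<tturnstile> Rs ! i \<Colon> add_mset (add_mset (ys ! i, D i) (\<Gamma>i i)) (Hi i)"
      using R i by simp
    \<comment> \<open>A session used by the discarded branch has an endpoint free in that branch,
      hence free in the selected one, and so belongs to the component of the latter.\<close>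
    have sub: "set_mset (Si i) \<subseteq> set_mset (S1 i)"
    proof safe
      fix M g assume s: "(M, g) \<in># Si i"
      then obtain z where z: "z \<in># M" using typed_nonempty[OF 2] by (fastforce elim: multiset_nonemptyE)
      have "z \<in> fv (Rs ! i)" using typed_edom[OF 2] s z unfolding in_edom subset_iff by blast
      then have "z \<in> fv (Qs ! i)" using yQ i by blast
      moreover have "(M, g) \<in># S0 + (\<Sum>i<length ys. S1 i) + (\<Sum>i<length us. S2 i)"
        unfolding S[symmetric] using s i by auto
      ultimately show "(M, g) \<in># S1 i"
        using comps_localize(2)[OF c(1-3) nd[unfolded eH] _ z i] by blast
    qed
    have "Hi i = H1 i \<and> S1 i \<tturnstile> Rs ! i \<Colon> add_mset (add_mset (ys ! i, D i) (\<Gamma>i i)) (H1 i)"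
    proof (rule branch_transfer[OF 1 2 _ nd\<Phi>])
      show "fv (Rs ! i) = fv (Qs ! i)" using yQ i by blast
      have "H1 i \<subseteq># (\<Sum>i<length ys. H1 i)" by (rule mset_subset_sum[OF i])
      then show "H1 i \<subseteq># ?\<Phi>" by (metis mset_subset_eq_add_left mset_subset_eq_add_right subset_mset.order_trans)
      have "Hi i \<subseteq># (\<Sum>i<length ys. Hi i)" by (rule mset_subset_sum[OF i])
      then show "Hi i \<subseteq># ?\<Phi>" unfolding \<Phi>[symmetric] by (metis mset_subset_eq_add_left mset_subset_eq_add_right subset_mset.order_trans)
    qed (rule sub, rule yS[OF i])
    then show ?thesis using 1 yS[OF i] by (blast intro: typed_Case)
  qed
  have inl: "S0 \<tturnstile> Inl x P \<Colon> add_mset (add_mset (x, Oplus A B) \<Gamma>) H0"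
    using typed_Inl[OF c(1)] z(1) m0 unfolding S by simp
  have coh: "GCase x ys G H \<Turnstile> add_mset (x, Oplus A B) (fam ys (\<lambda>i. With (C i) (D i)) + fam us A2)"
    using coh_case[of G "fam us A2" x A ys C H B D] c(5) cH by (simp add: T m0 m2 ac_simps)
  have "\<Sigma>0 + (\<Sum>i<length ys. Si i) + {#({#x#} + mset ys + mset vs, GCase x ys G H)#} \<tturnstile> par Ks \<Colon> \<Psi>"
    unfolding Ks
  proof (rule conn_cons[OF inl _ lK c(3,4) coh wf])
    show "\<forall>i<length ys. S1 i \<tturnstile> map (\<lambda>i. Case (ys ! i) (Qs ! i) (Rs ! i)) [0..<length ys] ! i \<Colon>
        add_mset (add_mset (ys ! i, With (C i) (D i)) (\<Gamma>i i)) (H1 i)"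
      using case' by simp
    show "\<Psi> = add_mset (add_mset (x, Oplus A B) \<Gamma>) H0 + ((\<Sum>i<length ys. H1 i) + seqs ys \<Gamma>i (\<lambda>i. With (C i) (D i))) +
        ((\<Sum>i<length us. H2 i) + seqs us \<Gamma>2 A2)"
      unfolding H using \<Phi> by (simp add: ac_simps)
    show "\<Sigma>0 + (\<Sum>i<length ys. Si i) + {#({#x#} + mset ys + mset vs, GCase x ys G H)#} =
        S0 + (\<Sum>i<length ys. S1 i) + (\<Sum>i<length us. S2 i) + {#({#x#} + mset ys + mset us, GCase x ys G H)#}"
      unfolding S by (simp add: vs)
  qed
  then show ?thesis using st typed_wf[OF t] by (auto intro: typed_stripped)
qed

lemma proj_inr:
  assumes t: "\<Sigma> \<tturnstile> CInr x ys Qs (par (P # Rs @ Ss)) \<Colon> \<Psi>" and l: "length Qs = length ys" "length Rs = length ys"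
    and Ks: "Ks = Inr x P # map (\<lambda>i. Case (ys ! i) (Qs ! i) (Rs ! i)) [0..<length ys] @ Ss"
    and j: "joined \<Sigma> (GCase x ys G0 H0) (x # ys @ us) Ks" and ty: "typable (par Ks)"
  shows "\<Sigma> \<tturnstile> par Ks \<Colon> \<Psi>"
proof -
  obtain \<Sigma>0 Si vs G H \<Psi>0 Hi \<Gamma> \<Gamma>i A B C D \<Delta> E where
    st: "stripped \<Sigma> \<Psi> (\<Sigma>0 + (\<Sum>i<length ys. Si i) + {#({#x#} + mset ys + mset vs, GCase x ys G H)#})"
    and cG: "G \<Turnstile> {#(x, A)#} + fam ys C + fam vs E"
    and H: "\<Psi> = \<Psi>0 + (\<Sum>i<length ys. Hi i) + {#\<Gamma> + {#(x, Oplus A B)#}#} + seqs ys \<Gamma>i (\<lambda>i. With (C i) (D i)) + seqs vs \<Delta> E"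
    and p: "\<Sigma>0 + (\<Sum>i<length ys. Si i) + {#({#x#} + mset ys + mset vs, H)#} \<tturnstile> par (P # Rs @ Ss) \<Colon>
      \<Psi>0 + (\<Sum>i<length ys. Hi i) + {#\<Gamma> + {#(x, B)#}#} + seqs ys \<Gamma>i D + seqs vs \<Delta> E"
    and R: "\<forall>i<length ys. Si i \<tturnstile> Qs ! i \<Colon> Hi i + {#\<Gamma>i i + {#(ys ! i, C i)#}#}"
    using inv_CInr[OF t] .
  note wf = stripped_wf[OF st typed_wf[OF t]]
  let ?Hp = "\<Psi>0 + (\<Sum>i<length ys. Hi i) + {#\<Gamma> + {#(x, B)#}#} + seqs ys \<Gamma>i D + seqs vs \<Delta> E"
  have nd: "nodup (hdom ?Hp)" using typed_wf[OF p] by (simp only: wf_def)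
  have "{#x#} + mset ys + mset vs = mset (x # ys @ us)"
    using joined_session[OF j st typed_wf[OF t], of "{#x#} + mset ys + mset vs" "GCase x ys G H" x] by simp
  then have vs: "mset vs = mset us" by simp
  have lK: "length (map (\<lambda>i. Case (ys ! i) (Qs ! i) (Rs ! i)) [0..<length ys]) = length ys" by simp
  note jd = j[unfolded Ks joined_cons_iff[OF lK]]
  have xP: "x \<in> fv P" by (rule typable_Inr[OF typable_comp[OF ty]]) (auto simp: Ks)
  have yQ: "\<forall>i<length ys. ys ! i \<in> fv (Rs ! i) \<and> fv (Qs ! i) = fv (Rs ! i)"
  proof (intro allI impI)
    fix i assume i: "i < length ys"
    have "Case (ys ! i) (Qs ! i) (Rs ! i) \<in> set Ks" using i by (auto simp: Ks)
    from typable_Case[OF typable_comp[OF ty this]] show "ys ! i \<in> fv (Rs ! i) \<and> fv (Qs ! i) = fv (Rs ! i)" by simp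
  qed
  have jp: "joined (\<Sigma>0 + (\<Sum>i<length ys. Si i) + {#({#x#} + mset ys + mset vs, H)#}) H (x # ys @ us) (P # Rs @ Ss)"
    unfolding joined_cons_iff[OF l(2)] using jd xP yQ l by (simp add: vs)
  obtain S0 H0 \<Gamma>0 A0 S1 H1 \<Gamma>1 A1 S2 H2 \<Gamma>2 A2 where c:
    "S0 \<tturnstile> P \<Colon> add_mset (add_mset (x, A0) \<Gamma>0) H0"
    "\<forall>i<length ys. S1 i \<tturnstile> Rs ! i \<Colon> add_mset (add_mset (ys ! i, A1 i) (\<Gamma>1 i)) (H1 i)"
    "\<forall>i<length us. S2 i \<tturnstile> Ss ! i \<Colon> add_mset (add_mset (us ! i, A2 i) (\<Gamma>2 i)) (H2 i)" "length Ss = length us"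
    "H \<Turnstile> add_mset (x, A0) (fam ys A1 + fam us A2)"
    and eS: "\<Sigma>0 + (\<Sum>i<length ys. Si i) + {#({#x#} + mset ys + mset vs, H)#} =
      S0 + (\<Sum>i<length ys. S1 i) + (\<Sum>i<length us. S2 i) + {#({#x#} + mset ys + mset us, H)#}"
    and eH: "?Hp = add_mset (add_mset (x, A0) \<Gamma>0) H0 + ((\<Sum>i<length ys. H1 i) + seqs ys \<Gamma>1 A1) + ((\<Sum>i<length us. H2 i) + seqs us \<Gamma>2 A2)"
    by (rule joined_cons[OF p jp l(2)])
  have m0: "A0 = B \<and> \<Gamma>0 = \<Gamma>"
    by (rule focus_unique[OF nd, of x]) (subst eH, simp, simp)
  have m1: "\<forall>i<length ys. A1 i = D i \<and> \<Gamma>1 i = \<Gamma>i i"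
    by (rule seqs_unique[OF nd]) (subst eH, auto)
  have T: "fam ys A1 = fam ys D" "seqs ys \<Gamma>1 A1 = seqs ys \<Gamma>i D"
    using m1 by (auto intro: fam_cong seqs_cong)
  have m2: "fam vs E = fam us A2"
  proof (rule ctx_unique[where \<Phi> = "flat ?Hp"])
    show "nodup (names (flat ?Hp))" using nd by (simp only: names_flat)
    show "set_mset (fam vs E) \<subseteq> set_mset (flat ?Hp)" by auto
    show "set_mset (fam us A2) \<subseteq> set_mset (flat ?Hp)" unfolding eH by auto
    show "names (fam vs E) = names (fam us A2)" by (simp add: vs)
    show "nodup (names (fam vs E))" using nd by simp
  qed
  have S: "\<Sigma>0 + (\<Sum>i<length ys. Si i) = S0 + (\<Sum>i<length ys. S1 i) + (\<Sum>i<length us. S2 i)"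
    using eS by (simp add: vs)
  let ?\<Phi> = "H0 + (\<Sum>i<length ys. H1 i) + ((\<Sum>i<length us. H2 i) + seqs us \<Gamma>2 A2)"
  have \<Phi>: "\<Psi>0 + (\<Sum>i<length ys. Hi i) + seqs vs \<Delta> E = ?\<Phi>"
    using eH m0 T by (simp add: ac_simps)
  have nd\<Phi>: "nodup (hdom ?\<Phi>)"
  proof (rule nodup_hdom_part[OF nd])
    show "?Hp = ?\<Phi> + ({#\<Gamma> + {#(x, B)#}#} + seqs ys \<Gamma>i D)"
      unfolding \<Phi>[symmetric] by (simp add: ac_simps)
  qed
  have z: "x \<notin># edom (\<Sigma>0 + (\<Sum>i<length ys. Si i))" "\<And>i. i < length ys \<Longrightarrow> ys ! i \<notin># edom (\<Sigma>0 + (\<Sum>i<length ys. Si i))"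
    by (rule session_fresh[OF wf], simp)+
  have yS: "ys ! i \<notin># edom (S1 i)" if i: "i < length ys" for i
    using z(2)[OF i] i unfolding S by simp
  have case': "S1 i \<tturnstile> Case (ys ! i) (Qs ! i) (Rs ! i) \<Colon> add_mset (add_mset (ys ! i, With (C i) (D i)) (\<Gamma>i i)) (H1 i)"
    if i: "i < length ys" for i
  proof -
    have 1: "S1 i \<tturnstile> Rs ! i \<Colon> add_mset (add_mset (ys ! i, D i) (\<Gamma>i i)) (H1 i)"
      using c(2) m1 i by fastforce
    have 2: "Si i \<tturnstile> Qs ! i \<Colon> add_mset (add_mset (ys ! i, C i) (\<Gamma>i i)) (Hi i)"
      using R i by simp
    have sub: "set_mset (Si i) \<subseteq> set_mset (S1 i)"
    proof safe
      fix M g assume s: "(M, g) \<in># Si i"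
      then obtain z where z: "z \<in># M" using typed_nonempty[OF 2] by (fastforce elim: multiset_nonemptyE)
      have "z \<in> fv (Qs ! i)" using typed_edom[OF 2] s z unfolding in_edom subset_iff by blast
      then have "z \<in> fv (Rs ! i)" using yQ i by blast
      moreover have "(M, g) \<in># S0 + (\<Sum>i<length ys. S1 i) + (\<Sum>i<length us. S2 i)"
        unfolding S[symmetric] using s i by auto
      ultimately show "(M, g) \<in># S1 i"
        using comps_localize(2)[OF c(1-3) nd[unfolded eH] _ z i] by blast
    qed
    have "Hi i = H1 i \<and> S1 i \<tturnstile> Qs ! i \<Colon> add_mset (add_mset (ys ! i, C i) (\<Gamma>i i)) (H1 i)"
    proof (rule branch_transfer[OF 1 2 _ nd\<Phi>])
      show "fv (Qs ! i) = fv (Rs ! i)" using yQ i by blast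
      have "H1 i \<subseteq># (\<Sum>i<length ys. H1 i)" by (rule mset_subset_sum[OF i])
      then show "H1 i \<subseteq># ?\<Phi>" by (metis mset_subset_eq_add_left mset_subset_eq_add_right subset_mset.order_trans)
      have "Hi i \<subseteq># (\<Sum>i<length ys. Hi i)" by (rule mset_subset_sum[OF i])
      then show "Hi i \<subseteq># ?\<Phi>" unfolding \<Phi>[symmetric] by (metis mset_subset_eq_add_left mset_subset_eq_add_right subset_mset.order_trans)
    qed (rule sub, rule yS[OF i])
    then show ?thesis using 1 yS[OF i] by (blast intro: typed_Case)
  qed
  have inl: "S0 \<tturnstile> Inr x P \<Colon> add_mset (add_mset (x, Oplus A B) \<Gamma>) H0"
    using typed_Inr[OF c(1)] z(1) m0 unfolding S by simp
  have coh: "GCase x ys G H \<Turnstile> add_mset (x, Oplus A B) (fam ys (\<lambda>i. With (C i) (D i)) + fam us A2)"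
    using coh_case[of G "fam us A2" x A ys C H B D] c(5) cG by (simp add: T m0 m2 ac_simps)
  have "\<Sigma>0 + (\<Sum>i<length ys. Si i) + {#({#x#} + mset ys + mset vs, GCase x ys G H)#} \<tturnstile> par Ks \<Colon> \<Psi>"
    unfolding Ks
  proof (rule conn_cons[OF inl _ lK c(3,4) coh wf])
    show "\<forall>i<length ys. S1 i \<tturnstile> map (\<lambda>i. Case (ys ! i) (Qs ! i) (Rs ! i)) [0..<length ys] ! i \<Colon>
        add_mset (add_mset (ys ! i, With (C i) (D i)) (\<Gamma>i i)) (H1 i)"
      using case' by simp
    show "\<Psi> = add_mset (add_mset (x, Oplus A B) \<Gamma>) H0 + ((\<Sum>i<length ys. H1 i) + seqs ys \<Gamma>i (\<lambda>i. With (C i) (D i))) +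
        ((\<Sum>i<length us. H2 i) + seqs us \<Gamma>2 A2)"
      unfolding H using \<Phi> by (simp add: ac_simps)
    show "\<Sigma>0 + (\<Sum>i<length ys. Si i) + {#({#x#} + mset ys + mset vs, GCase x ys G H)#} =
        S0 + (\<Sum>i<length ys. S1 i) + (\<Sum>i<length us. S2 i) + {#({#x#} + mset ys + mset us, GCase x ys G H)#}"
      unfolding S by (simp add: vs)
  qed
  then show ?thesis using st typed_wf[OF t] by (auto intro: typed_stripped)
qed

lemma sum_part_subset: "i < n \<Longrightarrow> H i \<subseteq># X + (\<Sum>i<(n::nat). H i) + Y"
  by (metis mset_subset_sum mset_subset_eq_add_left mset_subset_eq_add_right subset_mset.order_trans)

text \<open>Both premises are split, which gives two partitions of the same \<open>\<Sigma>0\<close>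
  and \<open>\<Psi>0\<close>. Component by component, including the one of \<open>x\<close>, the
  partition obtained from the second premise is transferred to the first.\<close>

lemma proj_sel:
  assumes t: "\<Sigma> \<tturnstile> CSel x ys (par (P # Rs @ Ts)) (par (Q # Ss @ Ts)) \<Colon> \<Psi>" and l: "length Rs = length ys" "length Ss = length ys"
    and Ks: "Ks = Sel x P Q # map (\<lambda>i. Case (ys ! i) (Rs ! i) (Ss ! i)) [0..<length ys] @ Ts"
    and j: "joined \<Sigma> (GCase x ys G0 H0) (x # ys @ us) Ks" and ty: "typable (par Ks)"
  shows "\<Sigma> \<tturnstile> par Ks \<Colon> \<Psi>"
proof -
  obtain \<Sigma>0 vs G H \<Psi>0 \<Gamma> \<Gamma>i A B C D where
    st: "stripped \<Sigma> \<Psi> (\<Sigma>0 + {#({#x#} + mset ys + mset vs, GCase x ys G H)#})"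
    and H: "\<Psi> = \<Psi>0 + {#\<Gamma> + {#(x, Oplus A B)#}#} + seqs ys \<Gamma>i (\<lambda>i. With (C i) (D i))"
    and p: "\<Sigma>0 + {#({#x#} + mset ys + mset vs, G)#} \<tturnstile> par (P # Rs @ Ts) \<Colon> \<Psi>0 + {#\<Gamma> + {#(x, A)#}#} + seqs ys \<Gamma>i C"
    and q: "\<Sigma>0 + {#({#x#} + mset ys + mset vs, H)#} \<tturnstile> par (Q # Ss @ Ts) \<Colon> \<Psi>0 + {#\<Gamma> + {#(x, B)#}#} + seqs ys \<Gamma>i D"
    using inv_CSel[OF t] .
  note wf = stripped_wf[OF st typed_wf[OF t]]
  let ?Hp = "\<Psi>0 + {#\<Gamma> + {#(x, A)#}#} + seqs ys \<Gamma>i C"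
  let ?Hq = "\<Psi>0 + {#\<Gamma> + {#(x, B)#}#} + seqs ys \<Gamma>i D"
  have nd: "nodup (hdom ?Hp)" using typed_wf[OF p] by (simp only: wf_def)
  have nd': "nodup (hdom ?Hq)" using typed_wf[OF q] by (simp only: wf_def)
  have nd0: "nodup (hdom \<Psi>0)" by (rule nodup_hdom_part[OF nd]) (simp add: ac_simps)
  have "{#x#} + mset ys + mset vs = mset (x # ys @ us)"
    using joined_session[OF j st typed_wf[OF t], of "{#x#} + mset ys + mset vs" "GCase x ys G H" x] by simp
  then have vs: "mset vs = mset us" by simp
  have lK: "length (map (\<lambda>i. Case (ys ! i) (Rs ! i) (Ss ! i)) [0..<length ys]) = length ys" by simp
  note jd = j[unfolded Ks joined_cons_iff[OF lK]]
  have "typable (Sel x P Q)" by (rule typable_comp[OF ty]) (auto simp: Ks)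
  then have xP: "x \<in> fv P" "fv Q = fv P" using typable_Sel by blast+
  have yQ: "\<forall>i<length ys. ys ! i \<in> fv (Rs ! i) \<and> fv (Ss ! i) = fv (Rs ! i)"
  proof (intro allI impI)
    fix i assume i: "i < length ys"
    have "Case (ys ! i) (Rs ! i) (Ss ! i) \<in> set Ks" using i by (auto simp: Ks)
    from typable_Case[OF typable_comp[OF ty this]] show "ys ! i \<in> fv (Rs ! i) \<and> fv (Ss ! i) = fv (Rs ! i)" by simp
  qed
  have jp: "joined (\<Sigma>0 + {#({#x#} + mset ys + mset vs, G)#}) G (x # ys @ us) (P # Rs @ Ts)"
    unfolding joined_cons_iff[OF l(1)] using jd xP yQ l by (simp add: vs)
  have jq: "joined (\<Sigma>0 + {#({#x#} + mset ys + mset vs, H)#}) H (x # ys @ us) (Q # Ss @ Ts)"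
    unfolding joined_cons_iff[OF l(2)] using jd xP yQ l by (simp add: vs)
  obtain S0 H0 \<Gamma>0 A0 S1 H1 \<Gamma>1 A1 S2 H2 \<Gamma>2 A2 where c:
    "S0 \<tturnstile> P \<Colon> add_mset (add_mset (x, A0) \<Gamma>0) H0"
    "\<forall>i<length ys. S1 i \<tturnstile> Rs ! i \<Colon> add_mset (add_mset (ys ! i, A1 i) (\<Gamma>1 i)) (H1 i)"
    "\<forall>i<length us. S2 i \<tturnstile> Ts ! i \<Colon> add_mset (add_mset (us ! i, A2 i) (\<Gamma>2 i)) (H2 i)" "length Ts = length us"
    "G \<Turnstile> add_mset (x, A0) (fam ys A1 + fam us A2)"
    and eS: "\<Sigma>0 + {#({#x#} + mset ys + mset vs, G)#} =
      S0 + (\<Sum>i<length ys. S1 i) + (\<Sum>i<length us. S2 i) + {#({#x#} + mset ys + mset us, G)#}"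
    and eH: "?Hp = add_mset (add_mset (x, A0) \<Gamma>0) H0 + ((\<Sum>i<length ys. H1 i) + seqs ys \<Gamma>1 A1) + ((\<Sum>i<length us. H2 i) + seqs us \<Gamma>2 A2)"
    by (rule joined_cons[OF p jp l(1)])
  obtain S0' H0' \<Gamma>0' A0' S1' H1' \<Gamma>1' A1' S2' H2' \<Gamma>2' A2' where c':
    "S0' \<tturnstile> Q \<Colon> add_mset (add_mset (x, A0') \<Gamma>0') H0'"
    "\<forall>i<length ys. S1' i \<tturnstile> Ss ! i \<Colon> add_mset (add_mset (ys ! i, A1' i) (\<Gamma>1' i)) (H1' i)"
    "H \<Turnstile> add_mset (x, A0') (fam ys A1' + fam us A2')"
    and eS': "\<Sigma>0 + {#({#x#} + mset ys + mset vs, H)#} =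
      S0' + (\<Sum>i<length ys. S1' i) + (\<Sum>i<length us. S2' i) + {#({#x#} + mset ys + mset us, H)#}"
    and eH': "?Hq = add_mset (add_mset (x, A0') \<Gamma>0') H0' + ((\<Sum>i<length ys. H1' i) + seqs ys \<Gamma>1' A1') + ((\<Sum>i<length us. H2' i) + seqs us \<Gamma>2' A2')"
    by (rule joined_cons[OF q jq l(2)])
  have m0: "A0 = A \<and> \<Gamma>0 = \<Gamma>"
    by (rule focus_unique[OF nd, of x]) (subst eH, simp, simp)
  have m0': "A0' = B \<and> \<Gamma>0' = \<Gamma>"
    by (rule focus_unique[OF nd', of x]) (subst eH', simp, simp)
  have m1: "\<forall>i<length ys. A1 i = C i \<and> \<Gamma>1 i = \<Gamma>i i"
    by (rule seqs_unique[OF nd]) (subst eH, auto)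
  have m1': "\<forall>i<length ys. A1' i = D i \<and> \<Gamma>1' i = \<Gamma>i i"
    by (rule seqs_unique[OF nd']) (subst eH', auto)
  have T: "fam ys A1 = fam ys C" "seqs ys \<Gamma>1 A1 = seqs ys \<Gamma>i C" "fam ys A1' = fam ys D" "seqs ys \<Gamma>1' A1' = seqs ys \<Gamma>i D"
    using m1 m1' by (auto intro: fam_cong seqs_cong)
  have S: "\<Sigma>0 = S0 + (\<Sum>i<length ys. S1 i) + (\<Sum>i<length us. S2 i)"
    and S': "\<Sigma>0 = S0' + (\<Sum>i<length ys. S1' i) + (\<Sum>i<length us. S2' i)"
    using eS eS' by (simp_all add: vs)
  have \<Phi>: "\<Psi>0 = H0 + (\<Sum>i<length ys. H1 i) + ((\<Sum>i<length us. H2 i) + seqs us \<Gamma>2 A2)"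
    using eH m0 T by (simp add: ac_simps)
  have \<Phi>': "\<Psi>0 = H0' + (\<Sum>i<length ys. H1' i) + ((\<Sum>i<length us. H2' i) + seqs us \<Gamma>2' A2')"
    using eH' m0' T by (simp add: ac_simps)
  \<comment> \<open>The sequents of the bystanders belong to \<open>\<Psi>0\<close>, which both
    premises share, so both branches see the same types for them.\<close>
  have "\<forall>i<length us. A2 i = A2' i \<and> \<Gamma>2 i = \<Gamma>2' i"
    by (rule seqs_unique[OF nd0]) (subst \<Phi>, auto, subst \<Phi>', auto)
  then have m2: "fam us A2' = fam us A2" by (auto intro: fam_cong)
  have z: "x \<notin># edom \<Sigma>0" "\<And>i. i < length ys \<Longrightarrow> ys ! i \<notin># edom \<Sigma>0"
    by (rule session_fresh[OF wf], simp)+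
  have sel: "S0 \<tturnstile> Sel x P Q \<Colon> add_mset (add_mset (x, Oplus A B) \<Gamma>) H0"
  proof -
    have 1: "S0 \<tturnstile> P \<Colon> add_mset (add_mset (x, A) \<Gamma>) H0" using c(1) m0 by simp
    have 2: "S0' \<tturnstile> Q \<Colon> add_mset (add_mset (x, B) \<Gamma>) H0'" using c'(1) m0' by simp
    have xS: "x \<notin># edom S0" using z(1) unfolding S by simp
    have "H0' = H0 \<and> S0 \<tturnstile> Q \<Colon> add_mset (add_mset (x, B) \<Gamma>) H0"
    proof (rule branch_transfer[OF 1 2 xP(2) nd0 _ _ _ xS])
      show "H0 \<subseteq># \<Psi>0" unfolding \<Phi> by (simp add: add.assoc)
      show "H0' \<subseteq># \<Psi>0" unfolding \<Phi>' by (simp add: add.assoc)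
      show "set_mset S0' \<subseteq> set_mset S0"
      proof safe
        fix M g assume s: "(M, g) \<in># S0'"
        then obtain z where z: "z \<in># M" using typed_nonempty[OF 2] by (fastforce elim: multiset_nonemptyE)
        have "z \<in> fv Q" using typed_edom[OF 2] s z unfolding in_edom subset_iff by blast
        then have "z \<in> fv P" using xP by blast
        moreover have "(M, g) \<in># S0 + (\<Sum>i<length ys. S1 i) + (\<Sum>i<length us. S2 i)"
          unfolding S[symmetric] S' using s by auto
        ultimately show "(M, g) \<in># S0"
          using comps_localize(1)[OF c(1-3) nd[unfolded eH] _ z] by blast
      qed
    qed
    then show ?thesis using 1 xS by (blast intro: typed_Sel)
  qed
  have case': "S1 i \<tturnstile> Case (ys ! i) (Rs ! i) (Ss ! i) \<Colon> add_mset (add_mset (ys ! i, With (C i) (D i)) (\<Gamma>i i)) (H1 i)"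
    if i: "i < length ys" for i
  proof -
    have 1: "S1 i \<tturnstile> Rs ! i \<Colon> add_mset (add_mset (ys ! i, C i) (\<Gamma>i i)) (H1 i)"
      using c(2) m1 i by fastforce
    have 2: "S1' i \<tturnstile> Ss ! i \<Colon> add_mset (add_mset (ys ! i, D i) (\<Gamma>i i)) (H1' i)"
      using c'(2) m1' i by fastforce
    have yS: "ys ! i \<notin># edom (S1 i)"
      using z(2)[OF i] i unfolding S by simp
    have "H1' i = H1 i \<and> S1 i \<tturnstile> Ss ! i \<Colon> add_mset (add_mset (ys ! i, D i) (\<Gamma>i i)) (H1 i)"
    proof (rule branch_transfer[OF 1 2 _ nd0 _ _ _ yS])
      show "fv (Ss ! i) = fv (Rs ! i)" using yQ i by blast
      show "H1 i \<subseteq># \<Psi>0" unfolding \<Phi> by (rule sum_part_subset[OF i])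
      show "H1' i \<subseteq># \<Psi>0" unfolding \<Phi>' by (rule sum_part_subset[OF i])
      show "set_mset (S1' i) \<subseteq> set_mset (S1 i)"
      proof safe
        fix M g assume s: "(M, g) \<in># S1' i"
        then obtain z where z: "z \<in># M" using typed_nonempty[OF 2] by (fastforce elim: multiset_nonemptyE)
        have "z \<in> fv (Ss ! i)" using typed_edom[OF 2] s z unfolding in_edom subset_iff by blast
        then have "z \<in> fv (Rs ! i)" using yQ i by blast
        moreover have "(M, g) \<in># S0 + (\<Sum>i<length ys. S1 i) + (\<Sum>i<length us. S2 i)"
          unfolding S[symmetric] S' using s i by auto
        ultimately show "(M, g) \<in># S1 i"
          using comps_localize(2)[OF c(1-3) nd[unfolded eH] _ z i] by blast
      qed
    qed
    then show ?thesis using 1 yS by (blast intro: typed_Case)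
  qed
  have coh: "GCase x ys G H \<Turnstile> add_mset (x, Oplus A B) (fam ys (\<lambda>i. With (C i) (D i)) + fam us A2)"
    using coh_case[of G "fam us A2" x A ys C H B D] c(5) c'(3) by (simp add: T m0 m0' m2 ac_simps)
  have "\<Sigma>0 + {#({#x#} + mset ys + mset vs, GCase x ys G H)#} \<tturnstile> par Ks \<Colon> \<Psi>"
    unfolding Ks
  proof (rule conn_cons[OF sel _ lK c(3,4) coh wf])
    show "\<forall>i<length ys. S1 i \<tturnstile> map (\<lambda>i. Case (ys ! i) (Rs ! i) (Ss ! i)) [0..<length ys] ! i \<Colon>
        add_mset (add_mset (ys ! i, With (C i) (D i)) (\<Gamma>i i)) (H1 i)"
      using case' by simp
    show "\<Psi> = add_mset (add_mset (x, Oplus A B) \<Gamma>) H0 + ((\<Sum>i<length ys. H1 i) + seqs ys \<Gamma>i (\<lambda>i. With (C i) (D i))) +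
        ((\<Sum>i<length us. H2 i) + seqs us \<Gamma>2 A2)"
      unfolding H \<Phi> by (simp add: ac_simps)
    show "\<Sigma>0 + {#({#x#} + mset ys + mset vs, GCase x ys G H)#} =
        S0 + (\<Sum>i<length ys. S1 i) + (\<Sum>i<length us. S2 i) + {#({#x#} + mset ys + mset us, GCase x ys G H)#}"
      unfolding S by (simp add: vs)
  qed
  then show ?thesis using st typed_wf[OF t] by (auto intro: typed_stripped)
qed

text \<open>The premise is split twice: first at the session of \<open>x'\<close>, whose copied
  servers are dropped, then at the session of \<open>x\<close> inside the remaining component. At
  each level the side condition isolates the servers, so dropping the copies loses no session and no
  further sequent.\<close>

lemma proj_clones:
  assumes t: "\<Sigma> \<tturnstile> Clones x ys x' ys' zs zs' (par (par (P # map2 Srv ys Qs) # map2 Srv ys' Qs')) \<Colon> \<Psi>"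
    and l: "length Qs = length ys" "length Qs' = length ys'"
    and j: "joined \<Sigma> (GBang x ys G0) (x # ys) (Clone x x' P # map2 Srv ys Qs)"
    and ty: "typable (par (Clone x x' P # map2 Srv ys Qs))"
  shows "\<Sigma> \<tturnstile> par (Clone x x' P # map2 Srv ys Qs) \<Colon> \<Psi>"
proof -
  obtain \<Sigma>0 G \<Psi>0 \<Gamma> \<Gamma>i \<Gamma>i' A B where
    st: "stripped \<Sigma> \<Psi> (\<Sigma>0 + {#({#x#} + mset ys, GBang x ys G)#})" and l': "length ys' = length ys"
    and q: "\<forall>i<length ys. quest_ctx (\<Gamma>i i) \<and> (set_mset (names (\<Gamma>i i)) \<union> set_mset (names (\<Gamma>i' i))) \<inter> evars \<Sigma>0 = {}"
    and H: "\<Psi> = \<Psi>0 + {#\<Gamma> + {#(x, Quest A)#}#} + seqs ys \<Gamma>i (\<lambda>i. Bang (B i))"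
    and p: "\<Sigma>0 + {#({#x#} + mset ys, GBang x ys G), ({#x'#} + mset ys', GBang x' ys' (map_gtype (exch (x # ys) (x' # ys')) G))#} \<tturnstile>
      par (par (P # map2 Srv ys Qs) # map2 Srv ys' Qs') \<Colon>
       \<Psi>0 + {#\<Gamma> + {#(x, Quest A), (x', Quest A)#}#} + seqs ys \<Gamma>i (\<lambda>i. Bang (B i)) + seqs ys' \<Gamma>i' (\<lambda>i. Bang (B i))"
    using inv_Clones[OF t] .
  note wf = stripped_wf[OF st typed_wf[OF t]]
  let ?G' = "GBang x' ys' (map_gtype (exch (x # ys) (x' # ys')) G)"
  let ?Sp = "\<Sigma>0 + {#({#x#} + mset ys, GBang x ys G), ({#x'#} + mset ys', ?G')#}"
  let ?Hp = "\<Psi>0 + {#\<Gamma> + {#(x, Quest A), (x', Quest A)#}#} + seqs ys \<Gamma>i (\<lambda>i. Bang (B i)) + seqs ys' \<Gamma>i' (\<lambda>i. Bang (B i))"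
  have nd: "nodup (hdom ?Hp)" and wfp: "wf ?Sp ?Hp" using typed_wf[OF p] by (simp_all only: wf_def)
  have "ys \<noteq> []" using j l by (auto simp: joined_def)
  have "typable (Clone x x' P)" by (rule typable_comp[OF ty]) auto
  then have xP: "x \<in> fv P" "x' \<in> fv P" using typable_Clone by blast+
  have lm: "length (map2 Srv ys Qs) = length ys" "length (map2 Srv ys' Qs') = length ys'" using l by simp_all
  have jp: "joined ?Sp ?G' (x' # ys' @ []) (par (P # map2 Srv ys Qs) # map2 Srv ys' Qs' @ [])"
    unfolding joined_cons_iff[OF lm(2)] using xP \<open>ys \<noteq> []\<close> l l' by (auto simp: Suc_le_eq fv_par)
  obtain S0 H0 \<Gamma>0 A0 S H1 \<Gamma>1 A1 where c:
    "S0 \<tturnstile> par (P # map2 Srv ys Qs) \<Colon> add_mset (add_mset (x', A0) \<Gamma>0) H0"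
    "\<forall>i<length ys'. S i \<tturnstile> map2 Srv ys' Qs' ! i \<Colon> add_mset (add_mset (ys' ! i, A1 i) (\<Gamma>1 i)) (H1 i)"
    and eS: "?Sp = S0 + (\<Sum>i<length ys'. S i) + {#({#x'#} + mset ys', ?G')#}"
    and eH: "?Hp = add_mset (add_mset (x', A0) \<Gamma>0) H0 + ((\<Sum>i<length ys'. H1 i) + seqs ys' \<Gamma>1 A1)"
    by (rule joined_cons[OF _ jp lm(2)]) (use p in simp, rule that, assumption, assumption, simp_all)
  have m0: "A0 = Quest A \<and> \<Gamma>0 = add_mset (x, Quest A) \<Gamma>"
    by (rule focus_unique[OF nd, of x']) (subst eH, simp, simp add: add_mset_commute)
  have m1: "\<forall>i<length ys'. A1 i = Bang (B i) \<and> \<Gamma>1 i = \<Gamma>i' i"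
    by (rule seqs_unique[OF nd]) (subst eH, auto)
  have T: "seqs ys' \<Gamma>1 A1 = seqs ys' \<Gamma>i' (\<lambda>i. Bang (B i))"
    using m1 by (auto intro: seqs_cong)
  have S: "\<Sigma>0 + {#({#x#} + mset ys, GBang x ys G)#} = S0 + (\<Sum>i<length ys'. S i)" using eS by simp
  have wfp': "wf ((\<Sigma>0 + {#({#x#} + mset ys, GBang x ys G)#}) + {#({#x'#} + mset ys', ?G')#}) ?Hp"
    using wfp by (simp add: add_mset_commute)
  have iso: "H1 i = {#} \<and> S i = {#}" if i: "i < length ys'" for i
  proof (rule isolated)
    show "S i \<tturnstile> map2 Srv ys' Qs' ! i \<Colon> add_mset (add_mset (ys' ! i, A1 i) (\<Gamma>1 i)) (H1 i)" using c(2) i by blast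
    have "set_mset (edom (S i)) \<subseteq> set_mset (edom (\<Sigma>0 + {#({#x#} + mset ys, GBang x ys G)#}))"
      unfolding S using i by auto
    moreover have "set_mset (edom \<Sigma>0) \<subseteq> evars \<Sigma>0" by (rule edom_subset_evars)
    moreover have "ys' ! i \<notin># edom (\<Sigma>0 + {#({#x#} + mset ys, GBang x ys G)#})"
      by (rule session_fresh[OF wfp']) (use i in simp)
    \<comment> \<open>At the outer level the session of \<open>x\<close> is still in the
      environment. The side condition does not speak about it, but the copied contexts are declared
      beside \<open>x\<close> and \<open>ys\<close> in one hypersequent.\<close>
    moreover have "set_mset (names (\<Gamma>i' i)) \<inter> insert x (set ys) = {}"
    proof -
      have "names (\<Gamma>i' i) \<subseteq># (\<Sum>i<length ys'. names (\<Gamma>i' i))" by (rule mset_subset_sum[OF i])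
      then have "set_mset (names (\<Gamma>i' i)) \<subseteq> set_mset (hdom (seqs ys' \<Gamma>i' (\<lambda>i. Bang (B i))))"
        by (auto dest: set_mset_mono)
      moreover have "insert x (set ys) \<subseteq> set_mset (hdom (\<Psi>0 + {#\<Gamma> + {#(x, Quest A), (x', Quest A)#}#} + seqs ys \<Gamma>i (\<lambda>i. Bang (B i))))"
        by auto
      moreover have "set_mset (hdom (\<Psi>0 + {#\<Gamma> + {#(x, Quest A), (x', Quest A)#}#} + seqs ys \<Gamma>i (\<lambda>i. Bang (B i)))) \<inter>
          set_mset (hdom (seqs ys' \<Gamma>i' (\<lambda>i. Bang (B i)))) = {}"
        using nd unfolding hdom_simps(3)[of _ "seqs ys' \<Gamma>i' (\<lambda>i. Bang (B i))"] nodup_union by blast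
      ultimately show ?thesis by blast
    qed
    ultimately show "set_mset (names (add_mset (ys' ! i, A1 i) (\<Gamma>1 i))) \<inter> set_mset (edom (S i)) = {}"
      using q m1 i l' by (simp; blast)
  qed simp
  have Z: "(\<Sum>i<length ys'. H1 i) = {#}" "(\<Sum>i<length ys'. S i) = {#}" using iso by auto
  have H0: "H0 = \<Psi>0 + seqs ys \<Gamma>i (\<lambda>i. Bang (B i))"
    using eH m0 T Z by (simp add: add_mset_commute)
  have S0: "S0 = \<Sigma>0 + {#({#x#} + mset ys, GBang x ys G)#}" using S Z by simp
  \<comment> \<open>What remains after removing the copies: the hypersequent of the inner
    composition, from which \<open>P\<close> and the original servers are split off.\<close>
  let ?Hr = "add_mset (add_mset (x', Quest A) (add_mset (x, Quest A) \<Gamma>)) (\<Psi>0 + seqs ys \<Gamma>i (\<lambda>i. Bang (B i)))"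
  have r: "S0 \<tturnstile> par (P # map2 Srv ys Qs @ []) \<Colon> ?Hr"
    using c(1) by (simp add: m0 H0)
  have ndr: "nodup (hdom ?Hr)" using typed_wf[OF r] by (simp only: wf_def)
  have jr: "joined S0 (GBang x ys G) (x # ys @ []) (P # map2 Srv ys Qs @ [])"
    unfolding joined_cons_iff[OF lm(1)] using xP \<open>ys \<noteq> []\<close> l by (auto simp: Suc_le_eq S0)
  obtain S3 H3 \<Gamma>3 A3 S4 H4 \<Gamma>4 A4 where d:
    "S3 \<tturnstile> P \<Colon> add_mset (add_mset (x, A3) \<Gamma>3) H3"
    "\<forall>i<length ys. S4 i \<tturnstile> map2 Srv ys Qs ! i \<Colon> add_mset (add_mset (ys ! i, A4 i) (\<Gamma>4 i)) (H4 i)"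
    "GBang x ys G \<Turnstile> add_mset (x, A3) (fam ys A4)"
    and fS: "S0 = S3 + (\<Sum>i<length ys. S4 i) + {#({#x#} + mset ys, GBang x ys G)#}"
    and fH: "?Hr = add_mset (add_mset (x, A3) \<Gamma>3) H3 + ((\<Sum>i<length ys. H4 i) + seqs ys \<Gamma>4 A4)"
    by (rule joined_cons[OF r jr lm(1)]) (rule that, assumption, assumption, simp_all)
  have n0: "A3 = Quest A \<and> \<Gamma>3 = add_mset (x', Quest A) \<Gamma>"
    by (rule focus_unique[OF ndr, of x]) (subst fH, simp, simp add: add_mset_commute)
  have n1: "\<forall>i<length ys. A4 i = Bang (B i) \<and> \<Gamma>4 i = \<Gamma>i i"
    by (rule seqs_unique[OF ndr]) (subst fH, auto)
  have U: "seqs ys \<Gamma>4 A4 = seqs ys \<Gamma>i (\<lambda>i. Bang (B i))" "fam ys A4 = fam ys (\<lambda>i. Bang (B i))"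
    using n1 by (auto intro: seqs_cong fam_cong)
  have V: "\<Sigma>0 = S3 + (\<Sum>i<length ys. S4 i)" using fS S0 by simp
  have iso': "H4 i = {#} \<and> S4 i = {#}" if i: "i < length ys" for i
  proof (rule isolated)
    show "S4 i \<tturnstile> map2 Srv ys Qs ! i \<Colon> add_mset (add_mset (ys ! i, A4 i) (\<Gamma>4 i)) (H4 i)" using d(2) i by blast
    have "set_mset (edom (S4 i)) \<subseteq> set_mset (edom \<Sigma>0)"
      unfolding V using i by auto
    moreover have "set_mset (edom \<Sigma>0) \<subseteq> evars \<Sigma>0" by (rule edom_subset_evars)
    moreover have "ys ! i \<notin># edom \<Sigma>0" by (rule session_fresh[OF wf]) (use i in simp)
    ultimately show "set_mset (names (add_mset (ys ! i, A4 i) (\<Gamma>4 i))) \<inter> set_mset (edom (S4 i)) = {}"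
      using q n1 i by (simp; blast)
  qed simp
  have Z': "(\<Sum>i<length ys. H4 i) = {#}" "(\<Sum>i<length ys. S4 i) = {#}" using iso' by auto
  have H3: "H3 = \<Psi>0" using fH n0 U Z' by (simp add: add_mset_commute)
  have P: "\<Sigma>0 \<tturnstile> P \<Colon> add_mset (add_mset (x, Quest A) (add_mset (x', Quest A) \<Gamma>)) \<Psi>0"
    using d(1) V Z' n0 H3 by simp
  have x: "x \<notin># edom \<Sigma>0" by (rule session_fresh[OF wf]) simp
  have x': "x' \<notin># edom \<Sigma>0" using session_fresh[OF wfp', of x'] by simp
  have "\<Sigma>0 + {#({#x#} + mset ys, GBang x ys G)#} \<tturnstile> par (Clone x x' P # map2 Srv ys Qs @ []) \<Colon> \<Psi>"
  proof (rule conn_cons[where us = "[]", OF typed_Clone[OF P x x'], of ys "\<lambda>_. {#}" _ "\<lambda>i. Bang (B i)" \<Gamma>i "\<lambda>_. {#}"])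
    show "\<forall>i<length ys. {#} \<tturnstile> map2 Srv ys Qs ! i \<Colon> add_mset (add_mset (ys ! i, Bang (B i)) (\<Gamma>i i)) {#}"
      using d(2) iso' n1 by fastforce
    show "GBang x ys G \<Turnstile> add_mset (x, Quest A) (fam ys (\<lambda>i. Bang (B i)) + fam [] A4)"
      using d(3) U n0 by simp
  qed (use l wf in \<open>simp_all add: H\<close>)
  then show ?thesis using st typed_wf[OF t] by (auto intro: typed_stripped)
qed

lemma proj_link:
  assumes t: "\<Sigma> \<tturnstile> CLink x y (dual A) w P \<Colon> \<Psi>"
    and j: "joined \<Sigma> (GLink w A y) [w, y] [P, L]"
    and L: "atomic A \<Longrightarrow> x \<noteq> y \<Longrightarrow> {#} \<tturnstile> L \<Colon> {#{#(x, A), (y, dual A)#}#}"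
  shows "\<Sigma> \<tturnstile> Par P L \<Colon> \<Psi>"
proof -
  obtain \<Sigma>0 \<Psi>0 \<Gamma> A' Q where st: "stripped \<Sigma> \<Psi> (\<Sigma>0 + {#({#w, y#}, GLink w A' y)#})"
    and a: "x \<notin> evars \<Sigma>0" "dual A' = dual A" "atomic A'"
    and H: "\<Psi> = \<Psi>0 + {#\<Gamma> + {#(w, A')#}, {#(x, A'), (y, dual A)#}#}"
    and P: "P = map_trm (exch [w] [x]) Q" and p: "\<Sigma>0 \<tturnstile> Q \<Colon> \<Psi>0 + {#\<Gamma> + {#(x, A')#}#}" and w: "w \<notin># edom \<Sigma>0"
    using inv_CLink[OF t] .
  note wf = stripped_wf[OF st typed_wf[OF t]]
  \<comment> \<open>The global type of a link records the type of its first endpoint, and the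
    session determines the global type.\<close>
  have A: "A' = A"
    using joined_session[OF j st typed_wf[OF t], of "{#w, y#}" "GLink w A' y" w] by simp
  have d: "w \<noteq> x" "w \<noteq> y" "x \<noteq> y" "w \<notin># names \<Gamma>" "w \<notin># hdom \<Psi>0"
    using wf by (auto simp: wf_def H)
  have "exch [x] [w] = exch [w] [x]" by (auto simp: fun_eq_iff)
  moreover have "x \<notin># edom \<Sigma>0" using a(1) edom_subset_evars by blast
  ultimately have P': "\<Sigma>0 \<tturnstile> P \<Colon> add_mset (add_mset (w, A) \<Gamma>) \<Psi>0"
    unfolding P using typed_exch[of \<Sigma>0 Q x A \<Gamma> \<Psi>0 w] p d by (simp add: A)
  have "\<Sigma>0 + {#({#w, y#}, GLink w A' y)#} \<tturnstile> par (P # [L] @ []) \<Colon> \<Psi>"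
  proof (rule conn_cons[where us = "[]" and ys = "[y]", OF P', of "\<lambda>_. {#}" _ "\<lambda>_. dual A" "\<lambda>_. {#(x, A)#}" "\<lambda>_. {#}"])
    show "GLink w A' y \<Turnstile> add_mset (w, A) (fam [y] (\<lambda>_. dual A) + fam [] (\<lambda>_. A))"
      using coh_link[OF d(2), of A] a(3) by (simp add: A fam_Cons)
  qed (use L a d wf in \<open>simp_all add: A H seqs_def add_mset_commute\<close>)
  then show ?thesis using st typed_wf[OF t] by (auto intro: typed_stripped)
qed

text \<open>Disjointness of the free endpoints is what makes the joint environment and hypersequent
  well formed.\<close>

lemma typed_Send:
  assumes P: "S1 \<tturnstile> P \<Colon> add_mset (add_mset (x', A) \<Gamma>1) H1" and Q: "S2 \<tturnstile> Q \<Colon> add_mset (add_mset (x, B) \<Gamma>2) H2"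
    and d: "fv P \<inter> fv Q = {}" and x: "x \<notin># edom (S1 + S2)" "x' \<notin># edom (S1 + S2)"
  shows "S1 + S2 \<tturnstile> Send x x' P Q \<Colon> add_mset (add_mset (x, Tensor A B) (\<Gamma>1 + \<Gamma>2)) (H1 + H2)"
proof -
  have e: "set_mset (edom S1) \<inter> set_mset (edom S2) = {}"
    using typed_edom[OF P] typed_edom[OF Q] d by blast
  have wf: "wf (S1 + S2) (add_mset (add_mset (x, Tensor A B) (\<Gamma>1 + \<Gamma>2)) (H1 + H2))"
    using typed_wf[OF P] typed_wf[OF Q] d[unfolded typed_fv[OF P] typed_fv[OF Q]] e
    unfolding wf_def by auto
  show ?thesis
    by (rule typed_bin[OF rule_eqI[OF rule.Tensor[OF x, of H1 \<Gamma>1 A H2 \<Gamma>2 B] refl refl]])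
      (use P Q wf in \<open>simp_all add: ac_simps\<close>)
qed

text \<open>The flat continuation is regrouped as a Conn of \<open>Ps\<close> with the composition
  of the rest, split at the session of the received endpoints, and then split again at the session
  \<open>H\<close>.\<close>

lemma proj_comm:
  assumes t: "\<Sigma> \<tturnstile> Comm xs xs' y y' (par (Ps @ Qs @ R # Ss)) \<Colon> \<Psi>"
    and l: "xs \<noteq> []" "length xs' = length xs" "length Ps = length xs" "length Qs = length xs"
    and Ks: "Ks = map (\<lambda>i. Send (xs ! i) (xs' ! i) (Ps ! i) (Qs ! i)) [0..<length xs] @ Recv y y' R # Ss"
    and j: "joined \<Sigma> (GComm xs y G0 H0) (xs @ y # us) Ks" and ty: "typable (par Ks)"
  shows "\<Sigma> \<tturnstile> par Ks \<Colon> \<Psi>"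
proof -
  let ?\<rho> = "exch (xs @ [y]) (xs' @ [y'])"
  obtain \<Sigma>0 vs G H \<Psi>0 \<Gamma>1 A \<Gamma>2 B \<Gamma> C D where
    st: "stripped \<Sigma> \<Psi> (\<Sigma>0 + {#(mset xs + {#y#} + mset vs, GComm xs y G H)#})"
    and H: "\<Psi> = \<Psi>0 + seqs xs (\<lambda>i. \<Gamma>1 i + \<Gamma>2 i) (\<lambda>i. Tensor (A i) (B i)) + {#\<Gamma> + {#(y, Parr C D)#}#}"
    and p: "\<Sigma>0 + {#(mset xs + {#y#} + mset vs, H), (mset xs' + {#y'#}, map_gtype ?\<rho> G)#} \<tturnstile> par (Ps @ Qs @ R # Ss) \<Colon>
       \<Psi>0 + seqs xs' \<Gamma>1 A + seqs xs \<Gamma>2 B + {#\<Gamma> + {#(y', C), (y, D)#}#}"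
    using inv_Comm[OF t] .
  note wf = stripped_wf[OF st typed_wf[OF t]]
  let ?Sp = "(\<Sigma>0 + {#(mset xs + {#y#} + mset vs, H)#}) + {#(mset xs' + {#y'#}, map_gtype ?\<rho> G)#}"
  let ?Hp = "\<Psi>0 + seqs xs' \<Gamma>1 A + seqs xs \<Gamma>2 B + {#\<Gamma> + {#(y', C), (y, D)#}#}"
  have p': "?Sp \<tturnstile> par (Ps @ par (Qs @ R # Ss) # []) \<Colon> ?Hp"
    using p by (simp add: par_append_par add_mset_commute)
  note wfp = typed_wf[OF p']
  have nd: "nodup (hdom ?Hp)" using wfp by (simp only: wf_def)
  have "mset xs + {#y#} + mset vs = mset (xs @ y # us)"
    using joined_session[OF j st typed_wf[OF t], of "mset xs + {#y#} + mset vs" "GComm xs y G H" y] by simp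
  then have vs: "mset vs = mset us" by simp
  have lK: "length (map (\<lambda>i. Send (xs ! i) (xs' ! i) (Ps ! i) (Qs ! i)) [0..<length xs]) = length xs" by simp
  note jd = j[unfolded Ks joined_snoc_iff[OF lK]]
  have "typable (Recv y y' R)" by (rule typable_comp[OF ty]) (auto simp: Ks)
  then have yR: "y \<in> fv R" "y' \<in> fv R" using typable_Recv by blast+
  have xPQ: "\<forall>i<length xs. xs' ! i \<in> fv (Ps ! i) \<and> xs ! i \<in> fv (Qs ! i)"
  proof (intro allI impI)
    fix i assume i: "i < length xs"
    have "Send (xs ! i) (xs' ! i) (Ps ! i) (Qs ! i) \<in> set Ks" using i by (auto simp: Ks)
    from typable_Send[OF typable_comp[OF ty this]] show "xs' ! i \<in> fv (Ps ! i) \<and> xs ! i \<in> fv (Qs ! i)" by simp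
  qed
  have lP: "length Ps = length xs'" using l by simp
  have fQ: "fv (par (Qs @ R # Ss)) = (\<Union>K \<in> set (Qs @ R # Ss). fv K)" by (rule fv_par) simp
  have jp: "joined ?Sp (map_gtype ?\<rho> G) (xs' @ y' # []) (Ps @ par (Qs @ R # Ss) # [])"
    unfolding joined_snoc_iff[OF lP] using xPQ yR l by (auto simp: fQ Suc_le_eq)
  obtain S1 H1 \<Gamma>a A1 S3 H3 \<Gamma>3 A3 where c:
    "\<forall>i<length xs'. S1 i \<tturnstile> Ps ! i \<Colon> add_mset (add_mset (xs' ! i, A1 i) (\<Gamma>a i)) (H1 i)"
    "S3 \<tturnstile> par (Qs @ R # Ss) \<Colon> add_mset (add_mset (y', A3) \<Gamma>3) H3"
    "map_gtype ?\<rho> G \<Turnstile> add_mset (y', A3) (fam xs' A1)"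
    and eS: "?Sp = S3 + (\<Sum>i<length xs'. S1 i) + {#(mset xs' + {#y'#}, map_gtype ?\<rho> G)#}"
    and eH: "?Hp = add_mset (add_mset (y', A3) \<Gamma>3) H3 + ((\<Sum>i<length xs'. H1 i) + seqs xs' \<Gamma>a A1)"
    by (rule joined_snoc[OF p' jp lP]) (rule that, assumption, assumption, simp_all)
  have m0: "A3 = C \<and> \<Gamma>3 = add_mset (y, D) \<Gamma>"
    by (rule focus_unique[OF nd, of y']) (subst eH, simp, simp add: add_mset_commute)
  have m1: "\<forall>i<length xs'. A1 i = A i \<and> \<Gamma>a i = \<Gamma>1 i"
    by (rule seqs_unique[OF nd]) (subst eH, auto)
  have T: "seqs xs' \<Gamma>a A1 = seqs xs' \<Gamma>1 A" "fam xs' A1 = fam xs' A"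
    using m1 by (auto intro: seqs_cong fam_cong)
  have S: "\<Sigma>0 + {#(mset xs + {#y#} + mset vs, H)#} = S3 + (\<Sum>i<length xs'. S1 i)" using eS by simp
  have H31: "\<Psi>0 + seqs xs \<Gamma>2 B = H3 + (\<Sum>i<length xs'. H1 i)"
    using eH m0 T by (simp add: ac_simps add_mset_commute)
  have PQ: "fv (Ps ! i) \<inter> fv (par (Qs @ R # Ss)) = {}" if "i < length xs" for i
    by (subst Int_commute, rule comps_disjoint(1)[where us = "[]" and S' = "\<lambda>_. {#}" and H' = "\<lambda>_. {#}" and A' = "\<lambda>_. TOne" and \<Gamma>' = "\<lambda>_. {#}" and Ls = "[]", OF c(2,1)])
      (use nd[unfolded eH] that l in simp_all)
  \<comment> \<open>The session \<open>H\<close> must lie in the inner composition, because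
    \<open>y\<close> is free there; only then can that composition be split.\<close>
  have m: "(mset xs + {#y#} + mset vs, H) \<in># S3"
    by (rule comps_localize(1)[where us = "[]" and S' = "\<lambda>_. {#}" and H' = "\<lambda>_. {#}" and A' = "\<lambda>_. TOne"
          and \<Gamma>' = "\<lambda>_. {#}" and Ls = "[]" and z = y, OF c(2,1)])
      (use nd[unfolded eH] S[symmetric] yR fQ in simp_all)
  have js: "joined S3 H (xs @ y # us) (Qs @ R # Ss)"
    unfolding joined_snoc_iff[OF l(4)] using xPQ yR jd l m by (simp add: vs)
  obtain S2 H2 \<Gamma>b A2 S4 H4 \<Gamma>4 A4 S5 H5 \<Gamma>5 A5 where d:
    "\<forall>i<length xs. S2 i \<tturnstile> Qs ! i \<Colon> add_mset (add_mset (xs ! i, A2 i) (\<Gamma>b i)) (H2 i)"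
    "S4 \<tturnstile> R \<Colon> add_mset (add_mset (y, A4) \<Gamma>4) H4"
    "\<forall>i<length us. S5 i \<tturnstile> Ss ! i \<Colon> add_mset (add_mset (us ! i, A5 i) (\<Gamma>5 i)) (H5 i)" "length Ss = length us"
    "H \<Turnstile> add_mset (y, A4) (fam xs A2 + fam us A5)"
    and fS: "S3 = S4 + (\<Sum>i<length xs. S2 i) + (\<Sum>i<length us. S5 i) + {#(mset xs + {#y#} + mset us, H)#}"
    and fH: "add_mset (add_mset (y', A3) \<Gamma>3) H3 =
      add_mset (add_mset (y, A4) \<Gamma>4) H4 + ((\<Sum>i<length xs. H2 i) + seqs xs \<Gamma>b A2) + ((\<Sum>i<length us. H5 i) + seqs us \<Gamma>5 A5)"
    by (rule joined_snoc[OF c(2) js l(4)])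
  have n0: "A4 = D \<and> \<Gamma>4 = add_mset (y', C) \<Gamma>"
    by (rule focus_unique[OF nd, of y]) (subst eH, subst fH, simp, simp add: add_mset_commute)
  have n1: "\<forall>i<length xs. A2 i = B i \<and> \<Gamma>b i = \<Gamma>2 i"
    by (rule seqs_unique[OF nd]) (subst eH, subst fH, auto)
  have U: "seqs xs \<Gamma>b A2 = seqs xs \<Gamma>2 B" "fam xs A2 = fam xs B"
    using n1 by (auto intro: seqs_cong fam_cong)
  have H3: "H3 = H4 + ((\<Sum>i<length xs. H2 i) + seqs xs \<Gamma>2 B) + ((\<Sum>i<length us. H5 i) + seqs us \<Gamma>5 A5)"
    using fH m0 n0 U by (simp add: add_mset_commute)
  have \<Psi>0: "\<Psi>0 = H4 + (\<Sum>i<length xs. H2 i) + ((\<Sum>i<length us. H5 i) + seqs us \<Gamma>5 A5) + (\<Sum>i<length xs. H1 i)"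
    using H31 H3 l by (simp add: ac_simps)
  have \<Sigma>0: "\<Sigma>0 = S4 + (\<Sum>i<length xs. S2 i) + (\<Sum>i<length us. S5 i) + (\<Sum>i<length xs. S1 i)"
    using S fS l by (simp add: vs ac_simps)
  have fr: "z \<notin># edom \<Sigma>0" if "z \<in> set xs \<union> {y} \<union> set xs' \<union> {y'}" for z
  proof (cases "z \<in> set xs \<union> {y}")
    case True
    then show ?thesis by (intro session_fresh[OF wf]) auto
  next
    case False
    then have "z \<notin># edom (\<Sigma>0 + {#(mset xs + {#y#} + mset vs, H)#})"
      using that by (intro session_fresh[OF wfp]) auto
    then show ?thesis by simp
  qed
  have send: "S1 i + S2 i \<tturnstile> Send (xs ! i) (xs' ! i) (Ps ! i) (Qs ! i) \<Colon>
      add_mset (add_mset (xs ! i, Tensor (A i) (B i)) (\<Gamma>1 i + \<Gamma>2 i)) (H1 i + H2 i)" if i: "i < length xs" for i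
  proof (rule typed_Send)
    show "S1 i \<tturnstile> Ps ! i \<Colon> add_mset (add_mset (xs' ! i, A i) (\<Gamma>1 i)) (H1 i)"
      using c(1) m1 i l by fastforce
    show "S2 i \<tturnstile> Qs ! i \<Colon> add_mset (add_mset (xs ! i, B i) (\<Gamma>2 i)) (H2 i)"
      using d(1) n1 i by fastforce
    have "Qs ! i \<in> set Qs" using i l by simp
    then show "fv (Ps ! i) \<inter> fv (Qs ! i) = {}" using PQ[OF i] by (auto simp: fQ)
    have *: "z \<notin># edom (S1 i + S2 i)" if "z \<notin># edom \<Sigma>0" for z
      using that i unfolding \<Sigma>0 by simp
    then show "xs ! i \<notin># edom (S1 i + S2 i)" "xs' ! i \<notin># edom (S1 i + S2 i)"
      using i l by (auto intro!: * fr simp del: edom_simps)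
  qed
  have recv: "S4 \<tturnstile> Recv y y' R \<Colon> add_mset (add_mset (y, Parr C D) \<Gamma>) H4"
  proof (rule typed_Recv)
    show "S4 \<tturnstile> R \<Colon> add_mset (add_mset (y, D) (add_mset (y', C) \<Gamma>)) H4" using d(2) n0 by simp
    show "y \<notin># edom S4" "y' \<notin># edom S4" using fr[of y] fr[of y'] unfolding \<Sigma>0 by simp_all
  qed
  have coh: "GComm xs y G H \<Turnstile> add_mset (y, Parr C D) (fam xs (\<lambda>i. Tensor (A i) (B i)) + fam us A5)"
  proof -
    \<comment> \<open>Both sessions live in the premise at once, so their endpoints are distinct and
      the exchange can be undone, as needed for coherence of the original \<open>G\<close>.\<close>
    have "nodup (edom ?Sp)" using wfp by (simp only: wf_def)
    then have dis: "distinct (xs @ [y])" "distinct (xs' @ [y'])" "set (xs @ [y]) \<inter> set (xs' @ [y']) = {}"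
      by auto
    have inv: "map_gtype ?\<rho> (map_gtype ?\<rho> G) = G"
      using dis l by (simp add: gtype.map_comp comp_def exch_involutive gtype.map_ident)
    have "map ?\<rho> (xs' @ [y']) = xs @ [y]"
      by (rule map_exch_snd) (use dis l in auto)
    then have "map ?\<rho> xs' = xs" "?\<rho> y' = y" by simp_all
    moreover have "inj ?\<rho>" by (rule exch_inj) (use dis l in auto)
    ultimately have "G \<Turnstile> add_mset (y, C) (fam xs A)"
      using coherent_rename[OF c(3), of ?\<rho>] inv by (simp add: T m0)
    then show ?thesis
      using coh_comm[of G xs A y C H "fam us A5" B D] d(5) by (simp add: n0 U ac_simps)
  qed
  have "\<Sigma>0 + {#(mset xs + {#y#} + mset vs, GComm xs y G H)#} \<tturnstile> par Ks \<Colon> \<Psi>"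
    unfolding Ks
  proof (rule conn_snoc[OF _ lK recv d(3,4) coh wf])
    show "\<forall>i<length xs. S1 i + S2 i \<tturnstile> map (\<lambda>i. Send (xs ! i) (xs' ! i) (Ps ! i) (Qs ! i)) [0..<length xs] ! i \<Colon>
        add_mset (add_mset (xs ! i, Tensor (A i) (B i)) (\<Gamma>1 i + \<Gamma>2 i)) (H1 i + H2 i)"
      using send by simp
    show "\<Sigma>0 + {#(mset xs + {#y#} + mset vs, GComm xs y G H)#} =
        S4 + (\<Sum>i<length xs. S1 i + S2 i) + (\<Sum>i<length us. S5 i) + {#(mset xs + {#y#} + mset us, GComm xs y G H)#}"
      unfolding \<Sigma>0 by (simp add: vs sum.distrib ac_simps)
    show "\<Psi> = add_mset (add_mset (y, Parr C D) \<Gamma>) H4 +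
        ((\<Sum>i<length xs. H1 i + H2 i) + seqs xs (\<lambda>i. \<Gamma>1 i + \<Gamma>2 i) (\<lambda>i. Tensor (A i) (B i))) + ((\<Sum>i<length us. H5 i) + seqs us \<Gamma>5 A5)"
      unfolding H \<Psi>0 by (simp add: sum.distrib ac_simps)
  qed
  then show ?thesis using st typed_wf[OF t] by (auto intro: typed_stripped)
qed

section \<open>Preservation by a single transformation, in both directions\<close>

lemma typed_Link: "atomic A \<Longrightarrow> x \<noteq> y \<Longrightarrow> {#} \<tturnstile> Link x A y \<Colon> {#{#(x, A), (y, dual A)#}#}"
  using typed.intros[OF rule.Ax[of A x y], of "[]"] by (simp add: wf_def)

lemma transf_extr: "transf \<Sigma> es L R \<Longrightarrow> \<Sigma> \<tturnstile> L \<Colon> \<Psi> \<Longrightarrow> \<Sigma> \<tturnstile> R \<Colon> \<Psi>"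
proof (induction rule: transf.induct)
  case (tr_link1 \<Sigma> w X y P x)
  then show ?case using extr_link[of \<Sigma> P "Link x (TVar X) y" \<Psi> w "TVar X" y x] inv_Link by fastforce
next
  case (tr_link2 \<Sigma> w X y P x)
  \<comment> \<open>The reversed link has the sequent of a link of type \<open>TCoVar X\<close> from
    \<open>x\<close> to \<open>y\<close>, so one lemma covers both orientations.\<close>
  have L: "stripped S H {#} \<and> H = {#{#(x, TCoVar X), (y, dual (TCoVar X))#}#}" if "S \<tturnstile> Link y (TVar X) x \<Colon> H" for S H
    using inv_Link[OF that] by (auto simp: add_mset_commute)
  show ?case using extr_link[OF tr_link2(2,1) L] by simp
next
  case (tr_comm xs xs' Ps Qs Ks y y' R Ss \<Sigma> G H us)
  then show ?case by (intro extr_comm)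
next
  case (tr_close \<Sigma> xs y P)
  then show ?case by (intro extr_close)
next
  case (tr_inl Qs ys Rs Ks x P Ss \<Sigma> G H us)
  show ?case by (rule extr_inl[OF tr_inl(5,1-4)])
next
  case (tr_inr Qs ys Rs Ks x P Ss \<Sigma> G H us)
  show ?case by (rule extr_inr[OF tr_inr(5,1-4)])
next
  case (tr_sel Rs ys Ss Ks x P Q Ts \<Sigma> G H us)
  show ?case by (rule extr_sel[OF tr_sel(5,1-4)])
next
  case (tr_starts Qs ys \<Sigma> x G P)
  show ?case by (rule extr_starts[OF tr_starts(3,1) refl tr_starts(2)])
next
  case (tr_kills Qs ys \<Sigma> x G P)
  show ?case by (rule extr_kills[OF tr_kills(3,1) refl tr_kills(2)])
next
  case (tr_clones Qs ys ys' zs' zs Ks x x' P \<Sigma> G)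
  show ?case by (rule extr_clones[OF tr_clones(10,1-9)])
qed

lemma transf_proj: "transf \<Sigma> es L R \<Longrightarrow> typable L \<Longrightarrow> \<Sigma> \<tturnstile> R \<Colon> \<Psi> \<Longrightarrow> \<Sigma> \<tturnstile> L \<Colon> \<Psi>"
proof (induction rule: transf.induct)
  case (tr_link1 \<Sigma> w X y P x)
  then show ?case using proj_link[of \<Sigma> x y "TVar X" w P \<Psi> "Link x (TVar X) y"] typed_Link[of "TVar X" x y] by simp
next
  case (tr_link2 \<Sigma> w X y P x)
  then show ?case using proj_link[of \<Sigma> x y "TCoVar X" w P \<Psi> "Link y (TVar X) x"] typed_Link[of "TVar X" y x]
    by (simp add: add_mset_commute atomic_def)
next
  case (tr_comm xs xs' Ps Qs Ks y y' R Ss \<Sigma> G H us)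
  show ?case by (rule proj_comm[OF tr_comm(10,1-5,8,9)])
next
  case (tr_close \<Sigma> xs y P)
  then show ?case by (intro proj_close)
next
  case (tr_inl Qs ys Rs Ks x P Ss \<Sigma> G H us)
  show ?case by (rule proj_inl[OF tr_inl(6,1-5)])
next
  case (tr_inr Qs ys Rs Ks x P Ss \<Sigma> G H us)
  show ?case by (rule proj_inr[OF tr_inr(6,1-5)])
next
  case (tr_sel Rs ys Ss Ks x P Q Ts \<Sigma> G H us)
  show ?case by (rule proj_sel[OF tr_sel(6,1-5)])
next
  case (tr_starts Qs ys \<Sigma> x G P)
  show ?case by (rule proj_starts[OF tr_starts(4,1-3)])
next
  case (tr_kills Qs ys \<Sigma> x G P)
  then show ?case by (intro proj_kills)
next
  case (tr_clones Qs ys ys' zs' zs Ks x x' P \<Sigma> G)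
  show ?case unfolding tr_clones(4)
    by (rule proj_clones[OF tr_clones(11,1) _ tr_clones(9,10)[unfolded tr_clones(4)]]) (use tr_clones in simp)
qed

section \<open>Subterms\<close>

lemma infers_update:
  assumes "infers F J Ps \<Sigma> \<Psi>" "k < length J" "fst (J ! k) \<tturnstile> Q \<Colon> snd (J ! k)"
  shows "\<Sigma> \<tturnstile> F (Ps[k := Q]) \<Colon> \<Psi>"
proof (rule typed.intros)
  fix i assume "i < length J"
  then show "fst (J ! i) \<tturnstile> Ps[k := Q] ! i \<Colon> snd (J ! i)"
    using assms by (cases "i = k") (auto simp: infers_def)
qed (use assms in \<open>auto simp: infers_def\<close>)

text \<open>The derivation leading to the rewritten subterm is recorded step by step, so
  preservation at the subterm climbs up through the same rule instances.\<close>

lemma at_subterm_typed: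
  assumes "at_subterm T \<Sigma> \<Psi> P Q" "\<And>\<Sigma> \<Psi> P Q. T \<Sigma> P Q \<Longrightarrow> \<Sigma> \<tturnstile> P \<Colon> \<Psi> \<Longrightarrow> \<Sigma> \<tturnstile> Q \<Colon> \<Psi>"
  shows "\<Sigma> \<tturnstile> Q \<Colon> \<Psi>"
  using assms by (induction rule: at_subterm.induct) (auto intro: infers_update)

theorem theorem4:
  fixes \<Sigma> :: env and \<Psi> :: hyp and P Q :: "ep trm" and xs :: "ep list"
  shows "(extr \<Sigma> \<Psi> xs P Q \<and> \<Sigma> \<tturnstile> P \<Colon> \<Psi> \<longrightarrow> \<Sigma> \<tturnstile> Q \<Colon> \<Psi>)
       \<and> (proj \<Sigma> \<Psi> xs Q P \<and> \<Sigma> \<tturnstile> Q \<Colon> \<Psi> \<longrightarrow> \<Sigma> \<tturnstile> P \<Colon> \<Psi>)"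
  unfolding extr_def proj_def
  by (auto elim!: at_subterm_typed intro: transf_extr transf_proj)

end
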